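(* Let $(X,* )$ be a pointed fibrant bisimplicial set. For all $m\ge 0$, $n\ge 0$, the map $$\rho:\left(\pi^{\mathrm A}_{m+1,n+1}(X),\diamond\right)\to\left(\pi^{\mathrm{BC}}_{m,n}(\Omega X),\diamond\right)$$ is an isomorphism of groups, where the left-hand side carries the Aeppli product and the right-hand side carries the composition-of-loops operation.
   Context: **Notation.** A bisimplicial set $X$ has face and degeneracy maps $d_i,s_i$ in the first index and $\overline d_j,\overline s_j$ in the second. For simplicial sets $A,B$, $(A\boxtimes B)_{m,n}=A_m\times B_n$. $\Delta^{m,n}=\Delta^m\boxtimes\Delta^n$; elements of $X_{m,n}$ are identified with maps $\Delta^{m,n}\to X$, so faces and degeneracies of such maps make sense. $d_i\Delta^m$ is the $i$-th face of $\Delta^m$ and $\Lambda^m_k=\bigcup_{i\ne k}d_i\Delta^m$. Subobjects of $\Delta^{m,n}$: $\delta\Delta^{m,n}=\partial\Delta^m\boxtimes\Delta^n\cup\Delta^m\boxtimes\partial\Delta^n$; $\Lambda^{m,n}=\Lambda^m_m\boxtimes\Delta^n\cup\Delta^m\boxtimes\Lambda^n_n$; $\delta_{\mathrm A}\Delta^{m,n}=\Lambda^{m,n}\cup\partial\Delta^m\boxtimes\partial\Delta^n=\Lambda^{m,n}\cup d_m\overline d_n\Delta^{m,n}$. **Fibrancy.** Anodyne extensions are the monomorphisms in the saturated class generated by $\Lambda^m_k\boxtimes\Delta^n\cup\Delta^m\boxtimes\Lambda^n_l\to\Delta^m\boxtimes\Delta^n$ ($m,n\ge1$, $0\le k\le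 m$, $0\le l\le n$). Fibrations are the maps with the right lifting property against all anodyne extensions; $X$ is fibrant if $X\to\Delta^{0,0}$ is a fibration. A pointed bisimplicial set has a chosen vertex $*$; constant maps to it are also written $*$. **Homotopy.** For $h:K\times\Delta^{1,1}\to X$, operators in the $\Delta^{1,1}$-direction carry a hat. $h$ is a homotopy from $\alpha$ to $\beta$ if $\hat d_0h=\hat{\overline s}_0\alpha$, $\hat{\overline d}_0h=\hat s_0\alpha$ (i.e. $\alpha$ composed with the projection to $K$) and $\hat d_1\hat{\overline d}_1h=\beta$. A map $K\to X$ rel $L\subset K$ is one that is $*$ on $L$; a homotopy rel $L$ is one with $h|_{L\times\Delta^{1,1}}=*$. For fibrant $X$ this is an equivalence relation. $\pi^{\mathrm{BC}}_{m,n}(X)$ (resp. $\pi^{\mathrm A}_{m,n}(X)$) is the set of relative homotopy classes of maps $\Delta^{m,n}\to X$ rel $\delta\Delta^{m,n}$ (resp. rel $\delta_{\mathrm A}\Delta^{m,n}$). **Aeppli product** on $\pi^{\mathrm A}_{p,q}(X)$, $p,q\ge1$: for $\alpha,\beta:\Delta^{p,q}\to X$ rel $\delta_{\mathrm A}\Delta^{p,q}$ choose $\theta:\Delta^{p+1,q+1}\to X$ with $d_i\theta=*$ ($i<p-1$), $\overline d_j\theta=*$ ($j<q-1$), $d_{p-1}\theta=\overline s_{q-1}\alpha$, $\overline d_{q-1}\theta=s_{p-1}\alpha$, $d_{p+1}\overline d_{q+1}\theta=\beta$; then $[\alpha]\diamond[\beta]=[d_p\overline d_q\theta]$. This is well defined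 and a group operation. **Path and loop spaces.** $\mathbf{Hom}(K,X)_{m,n}=\mathrm{Hom}(K\times\Delta^{m,n},X)$. $PX$ (resp. $\Omega X$) is the fiber over the constant map of the restriction $\mathbf{Hom}(\Delta^{1,1},X)\to\mathbf{Hom}(\Lambda^{1,1},X)$ (resp. $\to\mathbf{Hom}(\delta_{\mathrm A}\Delta^{1,1},X)$). Both are pointed by the constant map, and are fibrant if $X$ is. $\mathrm{ev}:PX\to X$, evaluation at the vertex $d_1\overline d_1\Delta^{1,1}$, is a fibration for fibrant $X$ with fiber $\Omega X$ over $*$. **Composition of loops** on $\pi^{\mathrm{BC}}_{m,n}(\Omega X)$, $m,n\ge0$: maps $\Delta^{m,n}\to\Omega X$ rel $\delta\Delta^{m,n}$ correspond to maps $\Delta^{1,1}\to Z$ rel $\delta_{\mathrm A}\Delta^{1,1}$, where $Z=\mathbf{Hom}(\Delta^{m,n},X)\times_{\mathbf{Hom}(\delta\Delta^{m,n},X)}\mathbf{Hom}(\delta\Delta^{m,n},* )$, and $\diamond$ is the Aeppli product of $\pi^{\mathrm A}_{1,1}(Z)$ transported to $\pi^{\mathrm{BC}}_{m,n}(\Omega X)$. It is a group operation. **The map $\rho$.** For $\alpha:\Delta^{m+1,n+1}\to X$ rel $\delta_{\mathrm A}\Delta^{m+1,n+1}$, choose a lift $\widetilde\alpha:\Delta^{m+1,n+1}\to PX$ with $\mathrm{ev}\circ\widetilde\alpha=\alpha$ and $\widetilde\alpha|_{\Lambda^{m+1,n+1}}=*$. Then $d_{m+1}\overline d_{n+1}\widetilde\alpha$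 is a map $\Delta^{m,n}\to\Omega X$ rel $\delta\Delta^{m,n}$, and $\rho[\alpha]:=[d_{m+1}\overline d_{n+1}\widetilde\alpha]$ (well defined). *)

theory Defs
  imports "HOL-Algebra.Group" "HOL-Library.Infinite_Typeclass"
begin

section \<open>Bisimplicial sets\<close>

text \<open>A monotone map from \<open>{0..k}\<close> to \<open>{0..m}\<close> is the list of its \<open>k + 1\<close> values.
  \<open>opcomp f g\<close> is \<open>f\<close> after \<open>g\<close>.\<close>

definition ops :: "nat \<Rightarrow> nat \<Rightarrow> nat list set" where
  "ops k m = {f. length f = Suc k \<and> sorted f \<and> set f \<subseteq> {..m}}"

definition opcomp :: "nat list \<Rightarrow> nat list \<Rightarrow> nat list" where
  "opcomp f g = map (\<lambda>i. f ! i) g"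

definition opdim :: "nat list \<Rightarrow> nat" where
  "opdim f = length f - 1"

definition idop :: "nat \<Rightarrow> nat list" where
  "idop m = [0..<Suc m]"

definition zeroop :: "nat \<Rightarrow> nat list" where
  "zeroop m = replicate (Suc m) 0"

text \<open>The coface \<open>{0..m-1} \<rightarrow> {0..m}\<close> omitting \<open>i\<close>, and the codegeneracy
  \<open>{0..m+1} \<rightarrow> {0..m}\<close> repeating \<open>i\<close>.\<close>

definition coface :: "nat \<Rightarrow> nat \<Rightarrow> nat list" where
  "coface m i = map (\<lambda>j. if j < i then j else Suc j) [0..<m]"

definition codeg :: "nat \<Rightarrow> nat \<Rightarrow> nat list" where
  "codeg m i = map (\<lambda>j. if j \<le> i then j else j - 1) [0..<Suc (Suc m)]"

text \<open>A bisimplicial set is a contravariant functor on pairs of monotone maps: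
  \<open>act X m n f g\<close> sends \<open>X\<^sub>m\<^sub>,\<^sub>n\<close> to \<open>X\<^sub>m\<^sub>'\<^sub>,\<^sub>n\<^sub>'\<close> for \<open>f \<in> ops m' m\<close> and \<open>g \<in> ops n' n\<close>.  The index
  \<open>m n\<close> is an argument because the sets of simplices need not be disjoint.\<close>

record 'a bisset =
  cells :: "nat \<Rightarrow> nat \<Rightarrow> 'a set"
  act :: "nat \<Rightarrow> nat \<Rightarrow> nat list \<Rightarrow> nat list \<Rightarrow> 'a \<Rightarrow> 'a"

definition bisset :: "'a bisset \<Rightarrow> bool" where
  "bisset X \<longleftrightarrow>
     (\<forall>m n m' n'. \<forall>f\<in>ops m' m. \<forall>g\<in>ops n' n. \<forall>x\<in>cells X m n.
        act X m n f g x \<in> cells X m' n') \<and>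
     (\<forall>m n. \<forall>x\<in>cells X m n. act X m n (idop m) (idop n) x = x) \<and>
     (\<forall>m n m' n' m'' n''. \<forall>f\<in>ops m' m. \<forall>g\<in>ops n' n. \<forall>f'\<in>ops m'' m'. \<forall>g'\<in>ops n'' n'.
        \<forall>x\<in>cells X m n.
          act X m' n' f' g' (act X m n f g x) = act X m n (opcomp f f') (opcomp g g') x)"

text \<open>Maps are extensional in each bidegree, so that two maps are equal iff they agree on all
  simplices of their domain.\<close>

type_synonym ('a, 'b) bmap = "nat \<Rightarrow> nat \<Rightarrow> 'a \<Rightarrow> 'b"

definition bhom :: "'a bisset \<Rightarrow> 'b bisset \<Rightarrow> ('a, 'b) bmap set" where
  "bhom A B = {\<phi>. (\<forall>m n. \<phi> m n \<in> cells A m n \<rightarrow>\<^sub>E cells B m n) \<and>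
     (\<forall>m n m' n'. \<forall>f\<in>ops m' m. \<forall>g\<in>ops n' n. \<forall>x\<in>cells A m n.
        \<phi> m' n' (act A m n f g x) = act B m n f g (\<phi> m n x))}"

definition bcomp :: "'a bisset \<Rightarrow> ('b, 'c) bmap \<Rightarrow> ('a, 'b) bmap \<Rightarrow> ('a, 'c) bmap" where
  "bcomp A \<psi> \<phi> = (\<lambda>m n. compose (cells A m n) (\<psi> m n) (\<phi> m n))"

definition bincl :: "'a bisset \<Rightarrow> ('a, 'a) bmap" where
  "bincl A = (\<lambda>m n. \<lambda>x\<in>cells A m n. x)"

definition brestr :: "'a bisset \<Rightarrow> ('a, 'b) bmap \<Rightarrow> ('a, 'b) bmap" where
  "brestr L \<phi> = (\<lambda>m n. restrict (\<phi> m n) (cells L m n))"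

definition bmono :: "'a bisset \<Rightarrow> ('a, 'b) bmap \<Rightarrow> bool" where
  "bmono A \<phi> \<longleftrightarrow> (\<forall>m n. inj_on (\<phi> m n) (cells A m n))"

definition biso :: "'a bisset \<Rightarrow> 'b bisset \<Rightarrow> ('a, 'b) bmap set" where
  "biso A B = {\<phi> \<in> bhom A B. \<forall>m n. bij_betw (\<phi> m n) (cells A m n) (cells B m n)}"

text \<open>\<open>degen X m n v\<close> is the totally degenerate simplex of bidegree \<open>(m, n)\<close> on the vertex \<open>v\<close>.\<close>

definition degen :: "'a bisset \<Rightarrow> nat \<Rightarrow> nat \<Rightarrow> 'a \<Rightarrow> 'a" where
  "degen X m n v = act X 0 0 (zeroop m) (zeroop n) v"

definition bconst :: "'k bisset \<Rightarrow> 'a bisset \<Rightarrow> 'a \<Rightarrow> ('k, 'a) bmap" where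
  "bconst K X v = (\<lambda>m n. \<lambda>k\<in>cells K m n. degen X m n v)"

definition bprod :: "'a bisset \<Rightarrow> 'b bisset \<Rightarrow> ('a \<times> 'b) bisset" where
  "bprod X Y = \<lparr> cells = (\<lambda>m n. cells X m n \<times> cells Y m n),
                 act = (\<lambda>m n f g (x, y). (act X m n f g x, act Y m n f g y)) \<rparr>"

section \<open>The standard objects\<close>

text \<open>Simplicial subsets of \<open>\<Delta>\<^sup>m\<close> are given by their sets of \<open>k\<close>-simplices; the operators always act
  by composition.  The \<open>i\<close>-th face consists of the monotone maps that omit the value \<open>i\<close>.\<close>

type_synonym lpair = "nat list \<times> nat list"

definition bsub :: "(nat \<Rightarrow> nat \<Rightarrow> lpair set) \<Rightarrow> lpair bisset" where
  "bsub F = \<lparr> cells = F, act = (\<lambda>_ _ f g (u, v). (opcomp u f, opcomp v g)) \<rparr>"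

definition sx :: "nat \<Rightarrow> nat \<Rightarrow> nat list set" where
  "sx m k = ops k m"

definition sxface :: "nat \<Rightarrow> nat \<Rightarrow> nat \<Rightarrow> nat list set" where
  "sxface m i k = {u \<in> sx m k. i \<notin> set u}"

definition sxbd :: "nat \<Rightarrow> nat \<Rightarrow> nat list set" where
  "sxbd m k = (\<Union>i\<in>{..m}. sxface m i k)"

definition sxhorn :: "nat \<Rightarrow> nat \<Rightarrow> nat \<Rightarrow> nat list set" where
  "sxhorn m j k = (\<Union>i\<in>{..m} - {j}. sxface m i k)"

definition bD :: "nat \<Rightarrow> nat \<Rightarrow> lpair bisset" where
  "bD m n = bsub (\<lambda>a b. sx m a \<times> sx n b)"

definition bhorn :: "nat \<Rightarrow> nat \<Rightarrow> nat \<Rightarrow> nat \<Rightarrow> lpair bisset" where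
  "bhorn m n k l = bsub (\<lambda>a b. sxhorn m k a \<times> sx n b \<union> sx m a \<times> sxhorn n l b)"

definition bLam :: "nat \<Rightarrow> nat \<Rightarrow> lpair bisset" where
  "bLam m n = bhorn m n m n"

definition bdelta :: "nat \<Rightarrow> nat \<Rightarrow> lpair bisset" where
  "bdelta m n = bsub (\<lambda>a b. sxbd m a \<times> sx n b \<union> sx m a \<times> sxbd n b)"

definition bdeltaA :: "nat \<Rightarrow> nat \<Rightarrow> lpair bisset" where
  "bdeltaA m n = bsub (\<lambda>a b. cells (bLam m n) a b \<union> sxbd m a \<times> sxbd n b)"

section \<open>Anodyne extensions and fibrations\<close>

text \<open>Anodyne extensions are formed in the category of bisimplicial sets with simplices in an
  infinite type \<open>'u\<close>.  It contains copies of the generators and is closed under the colimits below,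
  for index sets contained in \<open>'u\<close>, so these agree with the colimits in all bisimplicial sets.
  The lifting property against the saturated class is equivalent to that against the generators;
  hence the resulting notion of fibration does not depend on \<open>'u\<close>.\<close>

type_synonym 'u arrow = "'u bisset \<times> 'u bisset \<times> ('u, 'u) bmap"

definition arrows :: "'u arrow set" where
  "arrows = {(A, B, f). bisset A \<and> bisset B \<and> f \<in> bhom A B}"

definition pushout ::
  "'u bisset \<Rightarrow> 'u bisset \<Rightarrow> 'u bisset \<Rightarrow> 'u bisset \<Rightarrow>
   ('u, 'u) bmap \<Rightarrow> ('u, 'u) bmap \<Rightarrow> ('u, 'u) bmap \<Rightarrow> ('u, 'u) bmap \<Rightarrow> bool" where
  "pushout A B C D f g i j \<longleftrightarrow>
     (A, B, f) \<in> arrows \<and> (A, C, g) \<in> arrows \<and> (B, D, i) \<in> arrows \<and> (C, D, j) \<in> arrows \<and>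
     bcomp A i f = bcomp A j g \<and>
     (\<forall>T s t. (B, T, s) \<in> arrows \<longrightarrow> (C, T, t) \<in> arrows \<longrightarrow> bcomp A s f = bcomp A t g \<longrightarrow>
        (\<exists>!w. w \<in> bhom D T \<and> bcomp B w i = s \<and> bcomp C w j = t))"

definition coproduct ::
  "'i set \<Rightarrow> ('i \<Rightarrow> 'u bisset) \<Rightarrow> 'u bisset \<Rightarrow> ('i \<Rightarrow> ('u, 'u) bmap) \<Rightarrow> bool" where
  "coproduct I A S i \<longleftrightarrow>
     bisset S \<and> (\<forall>x\<in>I. (A x, S, i x) \<in> arrows) \<and>
     (\<forall>(T :: 'u bisset) t. bisset T \<longrightarrow> (\<forall>x\<in>I. t x \<in> bhom (A x) T) \<longrightarrow>
        (\<exists>!w. w \<in> bhom S T \<and> (\<forall>x\<in>I. bcomp (A x) w (i x) = t x)))"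

definition seq_colimit ::
  "(nat \<Rightarrow> 'u bisset) \<Rightarrow> (nat \<Rightarrow> ('u, 'u) bmap) \<Rightarrow> 'u bisset \<Rightarrow> (nat \<Rightarrow> ('u, 'u) bmap) \<Rightarrow> bool" where
  "seq_colimit A f S i \<longleftrightarrow>
     (\<forall>k. (A k, A (Suc k), f k) \<in> arrows) \<and> (\<forall>k. (A k, S, i k) \<in> arrows) \<and>
     (\<forall>k. bcomp (A k) (i (Suc k)) (f k) = i k) \<and>
     (\<forall>(T :: 'u bisset) t. bisset T \<longrightarrow> (\<forall>k. t k \<in> bhom (A k) T) \<longrightarrow>
        (\<forall>k. bcomp (A k) (t (Suc k)) (f k) = t k) \<longrightarrow>
        (\<exists>!w. w \<in> bhom S T \<and> (\<forall>k. bcomp (A k) w (i k) = t k)))"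

definition retract_of :: "'u arrow \<Rightarrow> 'u arrow \<Rightarrow> bool" where
  "retract_of \<phi> \<psi> \<longleftrightarrow> (case (\<phi>, \<psi>) of ((A, B, f), (A', B', f')) \<Rightarrow>
     (\<exists>i r j q. (A, A', i) \<in> arrows \<and> (A', A, r) \<in> arrows \<and>
                (B, B', j) \<in> arrows \<and> (B', B, q) \<in> arrows \<and>
                bcomp A r i = bincl A \<and> bcomp B q j = bincl B \<and>
                bcomp A f' i = bcomp A j f \<and> bcomp A' f r = bcomp A' q f'))"

definition saturated :: "'u arrow set \<Rightarrow> bool" where
  "saturated C \<longleftrightarrow>
     C \<subseteq> arrows \<and>
     (\<forall>A B f. bisset A \<longrightarrow> bisset B \<longrightarrow> f \<in> biso A B \<longrightarrow> (A, B, f) \<in> C) \<and>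
     (\<forall>A B A' B' f g i j. pushout A B A' B' f g i j \<longrightarrow> (A, B, f) \<in> C \<longrightarrow> (A', B', j) \<in> C) \<and>
     (\<forall>\<phi>\<in>arrows. \<forall>\<psi>\<in>C. retract_of \<phi> \<psi> \<longrightarrow> \<phi> \<in> C) \<and>
     (\<forall>(I :: 'u set) A B f S i T j h. coproduct I A S i \<longrightarrow> coproduct I B T j \<longrightarrow>
        (\<forall>x\<in>I. (A x, B x, f x) \<in> C) \<longrightarrow> h \<in> bhom S T \<longrightarrow>
        (\<forall>x\<in>I. bcomp (A x) h (i x) = bcomp (A x) (j x) (f x)) \<longrightarrow> (S, T, h) \<in> C) \<and>
     (\<forall>A B D f g. (A, B, f) \<in> C \<longrightarrow> (B, D, g) \<in> C \<longrightarrow> (A, D, bcomp A g f) \<in> C) \<and>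
     (\<forall>A f S i. seq_colimit A f S i \<longrightarrow> (\<forall>k. (A k, A (Suc k), f k) \<in> C) \<longrightarrow> (A 0, S, i 0) \<in> C)"

definition anodyne_gen :: "'u arrow set" where
  "anodyne_gen = {(A, B, f) \<in> arrows.
     \<exists>m n k l \<phi> \<psi>. 1 \<le> m \<and> 1 \<le> n \<and> k \<le> m \<and> l \<le> n \<and>
       \<phi> \<in> biso A (bhorn m n k l) \<and> \<psi> \<in> biso B (bD m n) \<and>
       bcomp A \<psi> f = bcomp A (bincl (bhorn m n k l)) \<phi>}"

definition anodyne :: "'u arrow set" where
  "anodyne = {(A, B, f). bmono A f \<and> (A, B, f) \<in> \<Inter>{C. saturated C \<and> anodyne_gen \<subseteq> C}}"

definition fibration :: "'u itself \<Rightarrow> 'a bisset \<Rightarrow> 'b bisset \<Rightarrow> ('a, 'b) bmap \<Rightarrow> bool" where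
  "fibration (u :: 'u itself) X Y p \<longleftrightarrow>
     bisset X \<and> bisset Y \<and> p \<in> bhom X Y \<and>
     (\<forall>A B i. (A, B, i) \<in> (anodyne :: 'u arrow set) \<longrightarrow>
        (\<forall>s\<in>bhom A X. \<forall>t\<in>bhom B Y. bcomp A p s = bcomp A t i \<longrightarrow>
           (\<exists>l\<in>bhom B X. bcomp A l i = s \<and> bcomp B p l = t)))"

definition fibrant :: "'u itself \<Rightarrow> 'a bisset \<Rightarrow> bool" where
  "fibrant u X \<longleftrightarrow> fibration u X (bD 0 0) (bconst X (bD 0 0) (idop 0, idop 0))"

section \<open>Internal hom, fibers, path and loop spaces\<close>

definition iHom :: "'k bisset \<Rightarrow> 'a bisset \<Rightarrow> ('k \<times> lpair, 'a) bmap bisset" where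
  "iHom K X = \<lparr> cells = (\<lambda>m n. bhom (bprod K (bD m n)) X),
     act = (\<lambda>m n f g h a b. \<lambda>(k, u, v)\<in>cells (bprod K (bD (opdim f) (opdim g))) a b.
              h a b (k, opcomp f u, opcomp g v)) \<rparr>"

definition fiber :: "'a bisset \<Rightarrow> 'b bisset \<Rightarrow> ('a, 'b) bmap \<Rightarrow> 'b \<Rightarrow> 'a bisset" where
  "fiber E B p v = E\<lparr> cells := (\<lambda>m n. {x \<in> cells E m n. p m n x = degen B m n v}) \<rparr>"

definition res :: "'k bisset \<Rightarrow> 'k bisset \<Rightarrow> 'a bisset \<Rightarrow>
    (('k \<times> lpair, 'a) bmap, ('k \<times> lpair, 'a) bmap) bmap" where
  "res K L X = (\<lambda>m n. \<lambda>h\<in>cells (iHom K X) m n. brestr (bprod L (bD m n)) h)"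

text \<open>The vertex of \<open>iHom K X\<close> that is the constant map \<open>K \<rightarrow> X\<close>.\<close>

definition hpt :: "'k bisset \<Rightarrow> 'a bisset \<Rightarrow> 'a \<Rightarrow> ('k \<times> lpair, 'a) bmap" where
  "hpt K X pt = bconst (bprod K (bD 0 0)) X pt"

definition relHom :: "'k bisset \<Rightarrow> 'k bisset \<Rightarrow> 'a bisset \<Rightarrow> 'a \<Rightarrow> ('k \<times> lpair, 'a) bmap bisset" where
  "relHom K L X pt = fiber (iHom K X) (iHom L X) (res K L X) (hpt L X pt)"

definition pathsp :: "'a bisset \<Rightarrow> 'a \<Rightarrow> (lpair \<times> lpair, 'a) bmap bisset" where
  "pathsp X pt = relHom (bD 1 1) (bLam 1 1) X pt"

definition loopsp :: "'a bisset \<Rightarrow> 'a \<Rightarrow> (lpair \<times> lpair, 'a) bmap bisset" where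
  "loopsp X pt = relHom (bD 1 1) (bdeltaA 1 1) X pt"

abbreviation lpt :: "'a bisset \<Rightarrow> 'a \<Rightarrow> (lpair \<times> lpair, 'a) bmap" where
  "lpt X pt \<equiv> hpt (bD 1 1) X pt"

text \<open>A simplex \<open>h : \<Delta>\<^sup>1\<^sup>,\<^sup>1 \<times> \<Delta>\<^sup>m\<^sup>,\<^sup>n \<rightarrow> X\<close> is evaluated at the vertex \<open>(0, 0) = d\<^sub>1 d\<^sub>1 \<Delta>\<^sup>1\<^sup>,\<^sup>1\<close> by restricting it
  to \<open>{(0, 0)} \<times> \<Delta>\<^sup>m\<^sup>,\<^sup>n\<close>, which is a simplex of \<open>X\<close> by the Yoneda lemma.\<close>

definition ev :: "'a bisset \<Rightarrow> 'a \<Rightarrow> ((lpair \<times> lpair, 'a) bmap, 'a) bmap" where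
  "ev X pt = (\<lambda>m n. \<lambda>h\<in>cells (pathsp X pt) m n.
      h m n (degen (bD 1 1) m n (coface 1 1, coface 1 1), (idop m, idop n)))"

section \<open>Homotopy\<close>

text \<open>Faces in the two directions of a simplex of bidegree \<open>(m, n)\<close>; for \<open>h : K \<times> \<Delta>\<^sup>m\<^sup>,\<^sup>n \<rightarrow> X\<close> the
  operators with a hat are those of \<open>iHom K X\<close>.\<close>

definition fac1 :: "'a bisset \<Rightarrow> nat \<Rightarrow> nat \<Rightarrow> nat \<Rightarrow> 'a \<Rightarrow> 'a" where
  "fac1 X m n i x = act X m n (coface m i) (idop n) x"

definition fac2 :: "'a bisset \<Rightarrow> nat \<Rightarrow> nat \<Rightarrow> nat \<Rightarrow> 'a \<Rightarrow> 'a" where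
  "fac2 X m n j x = act X m n (idop m) (coface n j) x"

definition fstcomp :: "'k bisset \<Rightarrow> nat \<Rightarrow> nat \<Rightarrow> ('k, 'a) bmap \<Rightarrow> ('k \<times> lpair, 'a) bmap" where
  "fstcomp K m n \<alpha> = (\<lambda>a b. \<lambda>(k, u)\<in>cells (bprod K (bD m n)) a b. \<alpha> a b k)"

definition homotopy ::
  "'k bisset \<Rightarrow> 'a bisset \<Rightarrow> ('k, 'a) bmap \<Rightarrow> ('k, 'a) bmap \<Rightarrow> ('k \<times> lpair, 'a) bmap \<Rightarrow> bool" where
  "homotopy K X \<alpha> \<beta> h \<longleftrightarrow>
     h \<in> bhom (bprod K (bD 1 1)) X \<and>
     fac1 (iHom K X) 1 1 0 h = fstcomp K 0 1 \<alpha> \<and>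
     fac2 (iHom K X) 1 1 0 h = fstcomp K 1 0 \<alpha> \<and>
     fac1 (iHom K X) 1 0 1 (fac2 (iHom K X) 1 1 1 h) = fstcomp K 0 0 \<beta>"

definition relmaps :: "'k bisset \<Rightarrow> 'k bisset \<Rightarrow> 'a bisset \<Rightarrow> 'a \<Rightarrow> ('k, 'a) bmap set" where
  "relmaps K L X pt = {\<alpha> \<in> bhom K X. brestr L \<alpha> = bconst L X pt}"

definition htpy :: "'k bisset \<Rightarrow> 'k bisset \<Rightarrow> 'a bisset \<Rightarrow> 'a \<Rightarrow>
    (('k, 'a) bmap \<times> ('k, 'a) bmap) set" where
  "htpy K L X pt = {(\<alpha>, \<beta>). \<alpha> \<in> relmaps K L X pt \<and> \<beta> \<in> relmaps K L X pt \<and>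
     (\<exists>h. homotopy K X \<alpha> \<beta> h \<and>
          brestr (bprod L (bD 1 1)) h = bconst (bprod L (bD 1 1)) X pt)}"

definition piBC :: "nat \<Rightarrow> nat \<Rightarrow> 'a bisset \<Rightarrow> 'a \<Rightarrow> (lpair, 'a) bmap set set" where
  "piBC m n X pt = relmaps (bD m n) (bdelta m n) X pt // htpy (bD m n) (bdelta m n) X pt"

definition piA :: "nat \<Rightarrow> nat \<Rightarrow> 'a bisset \<Rightarrow> 'a \<Rightarrow> (lpair, 'a) bmap set set" where
  "piA m n X pt = relmaps (bD m n) (bdeltaA m n) X pt // htpy (bD m n) (bdeltaA m n) X pt"

abbreviation clBC :: "nat \<Rightarrow> nat \<Rightarrow> 'a bisset \<Rightarrow> 'a \<Rightarrow> (lpair, 'a) bmap \<Rightarrow> (lpair, 'a) bmap set" where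
  "clBC m n X pt \<alpha> \<equiv> htpy (bD m n) (bdelta m n) X pt `` {\<alpha>}"

abbreviation clA :: "nat \<Rightarrow> nat \<Rightarrow> 'a bisset \<Rightarrow> 'a \<Rightarrow> (lpair, 'a) bmap \<Rightarrow> (lpair, 'a) bmap set" where
  "clA m n X pt \<alpha> \<equiv> htpy (bD m n) (bdeltaA m n) X pt `` {\<alpha>}"

section \<open>Aeppli product and composition of loops\<close>

text \<open>Faces and degeneracies of maps \<open>\<Delta>\<^sup>m\<^sup>,\<^sup>n \<rightarrow> X\<close>, by precomposition.\<close>

definition pull :: "nat list \<Rightarrow> nat list \<Rightarrow> (lpair, 'a) bmap \<Rightarrow> (lpair, 'a) bmap" where
  "pull f g \<alpha> = (\<lambda>a b. \<lambda>(u, v)\<in>cells (bD (opdim f) (opdim g)) a b. \<alpha> a b (opcomp f u, opcomp g v))"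

definition md1 :: "nat \<Rightarrow> nat \<Rightarrow> nat \<Rightarrow> (lpair, 'a) bmap \<Rightarrow> (lpair, 'a) bmap" where
  "md1 m n i \<alpha> = pull (coface m i) (idop n) \<alpha>"

definition md2 :: "nat \<Rightarrow> nat \<Rightarrow> nat \<Rightarrow> (lpair, 'a) bmap \<Rightarrow> (lpair, 'a) bmap" where
  "md2 m n j \<alpha> = pull (idop m) (coface n j) \<alpha>"

definition ms1 :: "nat \<Rightarrow> nat \<Rightarrow> nat \<Rightarrow> (lpair, 'a) bmap \<Rightarrow> (lpair, 'a) bmap" where
  "ms1 m n i \<alpha> = pull (codeg m i) (idop n) \<alpha>"

definition ms2 :: "nat \<Rightarrow> nat \<Rightarrow> nat \<Rightarrow> (lpair, 'a) bmap \<Rightarrow> (lpair, 'a) bmap" where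
  "ms2 m n j \<alpha> = pull (idop m) (codeg n j) \<alpha>"

definition aeppli_filler :: "nat \<Rightarrow> nat \<Rightarrow> 'a bisset \<Rightarrow> 'a \<Rightarrow>
    (lpair, 'a) bmap \<Rightarrow> (lpair, 'a) bmap \<Rightarrow> (lpair, 'a) bmap \<Rightarrow> bool" where
  "aeppli_filler p q X pt \<alpha> \<beta> \<theta> \<longleftrightarrow>
     \<theta> \<in> bhom (bD (p + 1) (q + 1)) X \<and>
     (\<forall>i<p - 1. md1 (p + 1) (q + 1) i \<theta> = bconst (bD p (q + 1)) X pt) \<and>
     (\<forall>j<q - 1. md2 (p + 1) (q + 1) j \<theta> = bconst (bD (p + 1) q) X pt) \<and>
     md1 (p + 1) (q + 1) (p - 1) \<theta> = ms2 p q (q - 1) \<alpha> \<and>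
     md2 (p + 1) (q + 1) (q - 1) \<theta> = ms1 p q (p - 1) \<alpha> \<and>
     md1 (p + 1) q (p + 1) (md2 (p + 1) (q + 1) (q + 1) \<theta>) = \<beta>"

text \<open>Only meaningful for \<open>p, q \<ge> 1\<close>.\<close>

definition aeppli :: "nat \<Rightarrow> nat \<Rightarrow> 'a bisset \<Rightarrow> 'a \<Rightarrow>
    (lpair, 'a) bmap set \<Rightarrow> (lpair, 'a) bmap set \<Rightarrow> (lpair, 'a) bmap set" where
  "aeppli p q X pt a b = (THE c. \<exists>\<alpha>\<in>a. \<exists>\<beta>\<in>b. \<exists>\<theta>. aeppli_filler p q X pt \<alpha> \<beta> \<theta> \<and>
     c = clA p q X pt (md1 (p + 1) q p (md2 (p + 1) (q + 1) q \<theta>)))"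

definition piA_group :: "nat \<Rightarrow> nat \<Rightarrow> 'a bisset \<Rightarrow> 'a \<Rightarrow> (lpair, 'a) bmap set monoid" where
  "piA_group p q X pt = \<lparr> carrier = piA p q X pt, mult = aeppli p q X pt,
     one = clA p q X pt (bconst (bD p q) X pt) \<rparr>"

text \<open>\<open>loopZ m n X pt\<close> is the pullback \<open>Z\<close>; since \<open>Hom(\<delta>\<Delta>\<^sup>m\<^sup>,\<^sup>n, *)\<close> is a point, it is the fiber of the
  restriction map over the constant map.  \<open>adj\<close> sends \<open>\<alpha> : \<Delta>\<^sup>m\<^sup>,\<^sup>n \<rightarrow> \<Omega>X\<close> to the map \<open>\<Delta>\<^sup>1\<^sup>,\<^sup>1 \<rightarrow> Z\<close> with the same
  underlying map \<open>\<Delta>\<^sup>m\<^sup>,\<^sup>n \<times> \<Delta>\<^sup>1\<^sup>,\<^sup>1 \<rightarrow> X\<close>, namely \<open>(v, u) \<mapsto> \<alpha>(v)(u, id)\<close>.\<close>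

definition loopZ :: "nat \<Rightarrow> nat \<Rightarrow> 'a bisset \<Rightarrow> 'a \<Rightarrow> (lpair \<times> lpair, 'a) bmap bisset" where
  "loopZ m n X pt = relHom (bD m n) (bdelta m n) X pt"

definition adj :: "nat \<Rightarrow> nat \<Rightarrow>
    (lpair, (lpair \<times> lpair, 'a) bmap) bmap \<Rightarrow> (lpair, (lpair \<times> lpair, 'a) bmap) bmap" where
  "adj m n \<alpha> = (\<lambda>a b. \<lambda>u\<in>cells (bD 1 1) a b.
     (\<lambda>a' b'. \<lambda>(v, w)\<in>cells (bprod (bD m n) (bD a b)) a' b'.
        \<alpha> a' b' v a' b' (act (bD 1 1) a b (fst w) (snd w) u, (idop a', idop b'))))"

definition loopcomp :: "nat \<Rightarrow> nat \<Rightarrow> 'a bisset \<Rightarrow> 'a \<Rightarrow>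
    (lpair, (lpair \<times> lpair, 'a) bmap) bmap set \<Rightarrow> (lpair, (lpair \<times> lpair, 'a) bmap) bmap set \<Rightarrow>
    (lpair, (lpair \<times> lpair, 'a) bmap) bmap set" where
  "loopcomp m n X pt a b =
     the_inv_into (piBC m n (loopsp X pt) (lpt X pt)) (image (adj m n))
       (aeppli 1 1 (loopZ m n X pt) (hpt (bD m n) X pt) (adj m n ` a) (adj m n ` b))"

definition piBC_loop_group :: "nat \<Rightarrow> nat \<Rightarrow> 'a bisset \<Rightarrow> 'a \<Rightarrow>
    (lpair, (lpair \<times> lpair, 'a) bmap) bmap set monoid" where
  "piBC_loop_group m n X pt = \<lparr> carrier = piBC m n (loopsp X pt) (lpt X pt),
     mult = loopcomp m n X pt,
     one = clBC m n (loopsp X pt) (lpt X pt) (bconst (bD m n) (loopsp X pt) (lpt X pt)) \<rparr>"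

section \<open>The map rho\<close>

definition rho_lift :: "nat \<Rightarrow> nat \<Rightarrow> 'a bisset \<Rightarrow> 'a \<Rightarrow>
    (lpair, 'a) bmap \<Rightarrow> (lpair, (lpair \<times> lpair, 'a) bmap) bmap \<Rightarrow> bool" where
  "rho_lift m n X pt \<alpha> \<alpha>' \<longleftrightarrow>
     \<alpha>' \<in> bhom (bD (m + 1) (n + 1)) (pathsp X pt) \<and>
     bcomp (bD (m + 1) (n + 1)) (ev X pt) \<alpha>' = \<alpha> \<and>
     brestr (bLam (m + 1) (n + 1)) \<alpha>' = bconst (bLam (m + 1) (n + 1)) (pathsp X pt) (lpt X pt)"

definition rho :: "nat \<Rightarrow> nat \<Rightarrow> 'a bisset \<Rightarrow> 'a \<Rightarrow>
    (lpair, 'a) bmap set \<Rightarrow> (lpair, (lpair \<times> lpair, 'a) bmap) bmap set" where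
  "rho m n X pt a = (THE c. \<exists>\<alpha>\<in>a. \<exists>\<alpha>'. rho_lift m n X pt \<alpha> \<alpha>' \<and>
     c = clBC m n (loopsp X pt) (lpt X pt)
           (md1 (m + 1) n (m + 1) (md2 (m + 1) (n + 1) (n + 1) \<alpha>')))"

end

theory Submission
  imports Defs "HOL-Library.Product_Order" "HOL-Library.Countable"
begin

text \<open>Both groups are quotients of one set of loops: the maps \<open>x : \<Delta>\<^sup>m\<^sup>,\<^sup>n \<times> \<Delta>\<^sup>1\<^sup>,\<^sup>1 \<rightarrow> X\<close> that are \<open>*\<close> on
  \<open>\<delta>\<Delta>\<^sup>m\<^sup>,\<^sup>n \<times> \<Delta>\<^sup>1\<^sup>,\<^sup>1\<close> and on \<open>\<Delta>\<^sup>m\<^sup>,\<^sup>n \<times> \<delta>\<^sub>A\<Delta>\<^sup>1\<^sup>,\<^sup>1\<close>. Let \<open>T x y z\<close> say that some map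
  \<open>\<Delta>\<^sup>m\<^sup>,\<^sup>n \<times> \<Delta>\<^sup>2\<^sup>,\<^sup>2 \<rightarrow> X\<close> exhibits \<open>z\<close> as the composite of \<open>x\<close> and \<open>y\<close>. Filling the last face of
  \<open>\<Delta>\<^sup>m\<^sup>,\<^sup>n \<times> \<Delta>\<^sup>k\<^sup>,\<^sup>k\<close> for \<open>k = 2, 3\<close> gives left division and an associativity law for \<open>T\<close>, and these formally make
  the loops a group modulo the relation \<open>T * x y\<close>, which turns out to be homotopy. The fillers exist because
  the pairs of chains still missing are matched by toggling one vertex in either direction, and each matched
  block is attached along one of the generating horns.

  Maps \<open>\<Delta>\<^sup>m\<^sup>,\<^sup>n \<rightarrow> \<Omega>X\<close> and \<open>\<Delta>\<^sup>1\<^sup>,\<^sup>1 \<rightarrow> Z\<close> are loops by uncurrying. A simplex \<open>\<alpha>\<close> of bidegree \<open>(m + 1, n + 1)\<close>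
  becomes a loop by composition with the map \<open>\<Delta>\<^sup>m \<times> \<Delta>\<^sup>1 \<rightarrow> \<Delta>\<^sup>m\<^sup>+\<^sup>1\<close> that sends \<open>\<Delta>\<^sup>m \<times> {1}\<close> to the last vertex;
  extended to \<open>\<Delta>\<^sup>m\<^sup>+\<^sup>1 \<times> \<Delta>\<^sup>1\<close>, the same formula is a lift of \<open>\<alpha>\<close> to \<open>PX\<close>, so this loop represents \<open>\<rho>[\<alpha>]\<close>.\<close>

section \<open>Horn fillers\<close>

text \<open>No generating horn fills in one direction alone. A block attached by a horn is therefore
  the product of a matched pair of chains in the first direction with one in the second, and the
  pairs still missing must be closed under the toggles of each direction separately. This shapes the
  data: the initial face is prescribed as soon as either direction omits level 0, the other faces
  only at corners, where both directions omit the level. The Aeppli product has the same pattern.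

  In \<open>\<Delta>^{m,n} \<times> \<Delta>^{k,k}\<close> the toggled vertex has top level
  \<open>k\<close> and a base vertex that occurs anyway. Toggling changes nothing but the occurrence
  of level \<open>k\<close>, so any prescribed piece that does not mention this level is harmless,
  and the corner that comes out is the one opposite level \<open>k\<close>. Hence filling divides
  instead of multiplying, and products must be recovered from inverses. The filler of the Aeppli
  product in bidegree \<open>(m + 1, n + 1)\<close> comes from a cruder matching that toggles one
  fixed vertex in each direction.\<close>

lemma opsD:
  assumes "f \<in> ops k m"
  shows "length f = Suc k" "sorted f" "\<And>i. i \<in> set f \<Longrightarrow> i \<le> m" "set f \<subseteq> {..m}"
  using assms by (auto simp: ops_def)

lemma ops_nth_le: "f \<in> ops k m \<Longrightarrow> i \<le> k \<Longrightarrow> f ! i \<le> m"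
  using opsD(1,3) by (metis le_imp_less_Suc nth_mem)

lemma idop_ops [simp]: "idop m \<in> ops m m"
  by (auto simp: ops_def idop_def simp del: upt_Suc)

lemma zeroop_ops [simp]: "zeroop k \<in> ops k m"
  by (auto simp: ops_def zeroop_def)

lemma ops_comp:
  assumes "f \<in> ops k m" "g \<in> ops l k"
  shows "opcomp f g \<in> ops l m"
proof -
  have "sorted (map ((!) f) g)"
    unfolding sorted_map
  proof (rule sorted_wrt_mono_rel[where P = "(\<le>)"])
    show "f ! x \<le> f ! y" if "x \<in> set g" "y \<in> set g" "x \<le> y" for x y
      using that assms opsD(1,2,3) sorted_nth_mono by (metis le_imp_less_Suc)
    show "sorted g" using assms opsD(2) by blast
  qed
  then show ?thesis
    using assms opsD(1)[OF assms(2)] opsD(3)[OF assms(2)] ops_nth_le[OF assms(1)]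
    by (auto simp: ops_def opcomp_def)
qed

lemma opcomp_id_left: "f \<in> ops k m \<Longrightarrow> opcomp (idop m) f = f"
  unfolding opcomp_def idop_def
  by (rule map_idI) (use opsD(3) in \<open>fastforce simp del: upt_Suc\<close>)

lemma opcomp_id_right: "length f = Suc k \<Longrightarrow> opcomp f (idop k) = f"
  unfolding opcomp_def idop_def by (metis map_nth)

lemma opcomp_assoc:
  assumes "g \<in> ops l k" "h \<in> ops j l"
  shows "opcomp f (opcomp g h) = opcomp (opcomp f g) h"
  using assms opsD(1)[OF assms(1)] opsD(3)[OF assms(2)]
  by (auto simp: opcomp_def less_Suc_eq_le)

lemma set_opcomp:
  assumes "f \<in> ops k m" "g \<in> ops l k"
  shows "set (opcomp f g) \<subseteq> set f"
proof -
  have "f ! i \<in> set f" if "i \<in> set g" for i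
    using opsD(3)[OF assms(2) that] opsD(1)[OF assms(1)] by (simp add: less_Suc_eq_le)
  then show ?thesis by (auto simp: opcomp_def)
qed

lemma opcomp_zeroop:
  assumes "g \<in> ops l k"
  shows "opcomp (zeroop k) g = zeroop l"
proof -
  have "map ((!) (zeroop k)) g = map (\<lambda>_. 0) g"
    using opsD(3)[OF assms] by (auto simp: zeroop_def less_Suc_eq_le simp del: replicate_Suc)
  then show ?thesis
    using opsD(1)[OF assms] by (simp add: opcomp_def zeroop_def map_replicate_const)
qed

lemma bsub_simps [simp]: "cells (bsub F) = F" "act (bsub F) m n f g (u, v) = (opcomp u f, opcomp v g)"
  by (auto simp: bsub_def)

lemma bissetD:
  assumes "bisset X"
  shows "\<lbrakk>f \<in> ops m' m; g \<in> ops n' n; x \<in> cells X m n\<rbrakk> \<Longrightarrow> act X m n f g x \<in> cells X m' n'"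
    "x \<in> cells X m n \<Longrightarrow> act X m n (idop m) (idop n) x = x"
    "\<lbrakk>f \<in> ops m' m; g \<in> ops n' n; f' \<in> ops m'' m'; g' \<in> ops n'' n'; x \<in> cells X m n\<rbrakk> \<Longrightarrow>
      act X m' n' f' g' (act X m n f g x) = act X m n (opcomp f f') (opcomp g g') x"
  using assms unfolding bisset_def by (simp, simp, simp)

lemma bhomD:
  assumes "\<phi> \<in> bhom A B"
  shows "x \<in> cells A m n \<Longrightarrow> \<phi> m n x \<in> cells B m n"
    "x \<notin> cells A m n \<Longrightarrow> \<phi> m n x = undefined"
    "\<lbrakk>f \<in> ops m' m; g \<in> ops n' n; x \<in> cells A m n\<rbrakk> \<Longrightarrow>
       \<phi> m' n' (act A m n f g x) = act B m n f g (\<phi> m n x)"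
  using assms unfolding bhom_def PiE_def extensional_def by blast+

lemma bhomI:
  assumes "\<And>m n x. x \<in> cells A m n \<Longrightarrow> \<phi> m n x \<in> cells B m n"
    "\<And>m n x. x \<notin> cells A m n \<Longrightarrow> \<phi> m n x = undefined"
    "\<And>m n m' n' f g x. \<lbrakk>f \<in> ops m' m; g \<in> ops n' n; x \<in> cells A m n\<rbrakk> \<Longrightarrow>
       \<phi> m' n' (act A m n f g x) = act B m n f g (\<phi> m n x)"
  shows "\<phi> \<in> bhom A B"
  using assms unfolding bhom_def PiE_def extensional_def by blast

lemma bhom_eqI:
  assumes "\<phi> \<in> bhom A B" "\<psi> \<in> bhom A C" "\<And>m n x. x \<in> cells A m n \<Longrightarrow> \<phi> m n x = \<psi> m n x"
  shows "\<phi> = \<psi>"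
proof (intro ext)
  show "\<phi> m n x = \<psi> m n x" for m n x
    using assms(3) bhomD(2)[OF assms(1)] bhomD(2)[OF assms(2)] by (cases "x \<in> cells A m n") metis+
qed

lemma bisset_bD [simp]: "bisset (bD m n)"
  by (auto simp: bisset_def bD_def sx_def ops_comp opcomp_id_right opcomp_assoc dest: opsD(1))

lemma bisset_bsub:
  assumes "\<And>a b u v. (u, v) \<in> F a b \<Longrightarrow> u \<in> ops a m \<and> v \<in> ops b n"
    and "\<And>a b u v a' b' f g. \<lbrakk>(u, v) \<in> F a b; f \<in> ops a' a; g \<in> ops b' b\<rbrakk> \<Longrightarrow>
      (opcomp u f, opcomp v g) \<in> F a' b'"
  shows "bisset (bsub F)"
  unfolding bisset_def
proof (intro conjI allI ballI)
  show "act (bsub F) a b (idop a) (idop b) x = x" if "x \<in> cells (bsub F) a b" for a b x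
    using that assms(1) opcomp_id_right opsD(1) by (cases x) (simp, metis)
qed (use assms in \<open>auto simp: opcomp_assoc\<close>)

text \<open>An operator lies in the horn at \<open>k\<close> when it omits some vertex other than
  \<open>k\<close>. In this negated form the simplices outside the horn are those covering all other
  vertices in both directions, which is how \<open>extend_block\<close> recognizes the missing
  block.\<close>

lemma cells_bhorn:
  "(u, v) \<in> cells (bhorn m n k l) a b \<longleftrightarrow>
   u \<in> ops a m \<and> v \<in> ops b n \<and> \<not> ({..m} - {k} \<subseteq> set u \<and> {..n} - {l} \<subseteq> set v)"
  by (auto simp: bhorn_def sx_def sxhorn_def sxface_def)

lemma cells_bD: "(u, v) \<in> cells (bD m n) a b \<longleftrightarrow> u \<in> ops a m \<and> v \<in> ops b n"
  by (auto simp: bD_def sx_def)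

lemma act_bD [simp]: "act (bD m n) a b f g (u, v) = (opcomp u f, opcomp v g)"
  by (simp add: bD_def)

lemma act_bhorn [simp]: "act (bhorn m n k l) a b f g (u, v) = (opcomp u f, opcomp v g)"
  by (simp add: bhorn_def)

lemma bisset_bhorn [simp]: "bisset (bhorn m n k l)"
  unfolding bhorn_def
proof (rule bisset_bsub)
  fix a b u v a' b' f g
  assume "(u, v) \<in> sxhorn m k a \<times> sx n b \<union> sx m a \<times> sxhorn n l b" "f \<in> ops a' a" "g \<in> ops b' b"
  then have *: "(u, v) \<in> cells (bhorn m n k l) a b" by (simp add: bhorn_def)
  then have "(opcomp u f, opcomp v g) \<in> cells (bhorn m n k l) a' b'"
    using \<open>f \<in> ops a' a\<close> \<open>g \<in> ops b' b\<close> ops_comp set_opcomp unfolding cells_bhorn by (meson order_trans)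
  then show "(opcomp u f, opcomp v g) \<in> sxhorn m k a' \<times> sx n b' \<union> sx m a' \<times> sxhorn n l b'"
    by (simp add: bhorn_def)
qed (auto simp: sxhorn_def sxface_def sx_def)

lemma degen_cells: "bisset X \<Longrightarrow> pt \<in> cells X 0 0 \<Longrightarrow> degen X a b pt \<in> cells X a b"
  unfolding degen_def by (rule bissetD(1)) auto

lemma act_degen:
  "\<lbrakk>bisset X; pt \<in> cells X 0 0; f \<in> ops a' a; g \<in> ops b' b\<rbrakk> \<Longrightarrow>
   act X a b f g (degen X a b pt) = degen X a' b' pt"
  unfolding degen_def by (subst bissetD(3)) (auto simp: opcomp_zeroop)

text \<open>The anodyne class lives on the type \<open>'u\<close>, whereas the standard horns have
  simplices in \<open>lpair\<close>. Copies along an injection bring them into that class.\<close>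

definition btransp :: "('b \<Rightarrow> 'u) \<Rightarrow> 'b bisset \<Rightarrow> 'u bisset" where
  "btransp e B = \<lparr> cells = (\<lambda>m n. e ` cells B m n),
                  act = (\<lambda>m n f g x. e (act B m n f g (inv_into UNIV e x))) \<rparr>"

lemma btransp_simps [simp]:
  assumes "inj e"
  shows "cells (btransp e B) m n = e ` cells B m n"
    "act (btransp e B) m n f g (e x) = e (act B m n f g x)"
  using assms by (auto simp: btransp_def)

lemma bisset_btransp:
  assumes "inj e" "bisset B"
  shows "bisset (btransp e B)"
  unfolding bisset_def
proof (intro conjI allI ballI)
  show "act (btransp e B) m n f g x \<in> cells (btransp e B) m' n'"
    if "f \<in> ops m' m" "g \<in> ops n' n" "x \<in> cells (btransp e B) m n" for m n m' n' f g x
    using that bissetD(1)[OF assms(2) that(1,2)] assms(1) by auto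
  show "act (btransp e B) m n (idop m) (idop n) x = x" if "x \<in> cells (btransp e B) m n" for m n x
    using that bissetD(2)[OF assms(2)] assms(1) by auto
  show "act (btransp e B) m' n' f' g' (act (btransp e B) m n f g x) =
      act (btransp e B) m n (opcomp f f') (opcomp g g') x"
    if "f \<in> ops m' m" "g \<in> ops n' n" "f' \<in> ops m'' m'" "g' \<in> ops n'' n'"
      "x \<in> cells (btransp e B) m n" for m n m' n' m'' n'' f g f' g' x
    using that bissetD(3)[OF assms(2) that(1-4)] assms(1) by auto
qed

lemma bhom_btransp:
  assumes e: "inj e" and B: "bisset B" and \<phi>: "\<phi> \<in> bhom B Y"
  shows "(\<lambda>m n. \<lambda>x\<in>e ` cells B m n. \<phi> m n (inv_into UNIV e x)) \<in> bhom (btransp e B) Y"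
proof (rule bhomI)
  fix m n m' n' f g x
  assume *: "f \<in> ops m' m" "g \<in> ops n' n" "x \<in> cells (btransp e B) m n"
  then show "(\<lambda>x\<in>e ` cells B m' n'. \<phi> m' n' (inv_into UNIV e x)) (act (btransp e B) m n f g x) =
      act Y m n f g ((\<lambda>x\<in>e ` cells B m n. \<phi> m n (inv_into UNIV e x)) x)"
    using bissetD(1)[OF B *(1,2)] bhomD(3)[OF \<phi> *(1,2)] e by (auto simp: inj_eq)
qed (use e bhomD(1)[OF \<phi>] in auto)

lemma biso_btransp:
  assumes e: "inj e" and B: "bisset B"
  shows "(\<lambda>m n. \<lambda>x\<in>e ` cells B m n. inv_into UNIV e x) \<in> biso (btransp e B) B"
proof -
  have "(\<lambda>m n. \<lambda>x\<in>cells B m n. x) \<in> bhom B B"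
  proof (rule bhomI)
    fix m n m' n' f g x
    assume *: "f \<in> ops m' m" "g \<in> ops n' n" "x \<in> cells B m n"
    then show "(\<lambda>x\<in>cells B m' n'. x) (act B m n f g x) = act B m n f g ((\<lambda>x\<in>cells B m n. x) x)"
      using bissetD(1)[OF B *] by simp
  qed auto
  from bhom_btransp[OF e B this]
  have "(\<lambda>m n. \<lambda>x\<in>e ` cells B m n. (\<lambda>x\<in>cells B m n. x) (inv_into UNIV e x)) \<in> bhom (btransp e B) B" .
  also have "(\<lambda>m n. \<lambda>x\<in>e ` cells B m n. (\<lambda>x\<in>cells B m n. x) (inv_into UNIV e x)) =
      (\<lambda>m n. \<lambda>x\<in>e ` cells B m n. inv_into UNIV e x)"
    using e by (intro ext) (auto simp: restrict_def)
  finally have "(\<lambda>m n. \<lambda>x\<in>e ` cells B m n. inv_into UNIV e x) \<in> bhom (btransp e B) B" .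
  then show ?thesis
    unfolding biso_def using e
    by (simp add: bij_betw_def inj_on_def image_image cong: image_cong)
qed

text \<open>An injection of \<open>lpair\<close> into \<open>'u\<close> exists because
  \<open>lpair\<close> is countable and \<open>'u\<close> is infinite. The copy of the horn
  inclusion along it is a generator, hence anodyne, and lifting against it extends the copy of
  \<open>h\<close>.\<close>

lemma fibrant_horn_filler:
  fixes X :: "'a bisset"
  assumes fib: "fibrant TYPE('u::infinite) X"
    and mn: "1 \<le> m" "1 \<le> n" "k \<le> m" "l \<le> n" and h: "h \<in> bhom (bhorn m n k l) X"
  obtains H where "H \<in> bhom (bD m n) X"
    "\<And>a b x. x \<in> cells (bhorn m n k l) a b \<Longrightarrow> H a b x = h a b x"
proof -
  obtain e0 :: "nat \<Rightarrow> 'u" where "inj e0"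
    using infinite_UNIV infinite_countable_subset by blast
  then have "inj (e0 \<circ> to_nat :: lpair \<Rightarrow> 'u)" by (simp add: inj_compose)
  then obtain e :: "lpair \<Rightarrow> 'u" where e: "inj e" by blast
  let ?A0 = "bhorn m n k l" and ?B0 = "bD m n"
  have sub: "cells ?A0 a b \<subseteq> cells ?B0 a b" for a b
    using cells_bhorn cells_bD by auto
  define A B where "A = btransp e ?A0" and "B = btransp e ?B0"
  have cA: "cells A a b = e ` cells ?A0 a b" "cells B a b = e ` cells ?B0 a b" for a b
    by (simp_all add: A_def B_def e)
  define i :: "('u, 'u) bmap" where "i = (\<lambda>a b. \<lambda>x\<in>cells A a b. x)"
  have bA: "bisset A" "bisset B" by (simp_all add: A_def B_def e bisset_btransp)
  have act_eq: "act A a b f g (e x) = act B a b f g (e x)" if "x \<in> cells ?A0 a b" for a b f g x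
    using that by (cases x) (simp add: A_def B_def e)
  have i: "i \<in> bhom A B"
  proof (rule bhomI)
    fix a b a' b' f g x
    assume *: "f \<in> ops a' a" "g \<in> ops b' b" "x \<in> cells A a b"
    then obtain y where y: "x = e y" "y \<in> cells ?A0 a b" using cA by auto
    have "i a' b' (act A a b f g x) = act A a b f g x"
      unfolding i_def using bissetD(1)[OF bA(1) *] by (rule restrict_apply')
    also have "\<dots> = act B a b f g x" using act_eq y by simp
    also have "\<dots> = act B a b f g (i a b x)" unfolding i_def using *(3) by simp
    finally show "i a' b' (act A a b f g x) = act B a b f g (i a b x)" .
  qed (use sub in \<open>auto simp: i_def cA\<close>)
  have "(A, B, i) \<in> anodyne_gen"
  proof -
    let ?\<phi> = "\<lambda>a b. \<lambda>x\<in>e ` cells ?A0 a b. inv_into UNIV e x" and ?\<psi> = "\<lambda>a b. \<lambda>x\<in>e ` cells ?B0 a b. inv_into UNIV e x"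
    have "bcomp A ?\<psi> i = bcomp A (bincl ?A0) ?\<phi>"
      using sub by (auto simp: bcomp_def compose_def i_def bincl_def cA e fun_eq_iff restrict_def)
    moreover have "?\<phi> \<in> biso A ?A0" "?\<psi> \<in> biso B ?B0"
      unfolding A_def B_def by (rule biso_btransp; simp add: e)+
    ultimately show ?thesis
      unfolding anodyne_gen_def arrows_def using mn bA i by blast
  qed
  moreover have "bmono A i" by (auto simp: bmono_def i_def inj_on_def)
  ultimately have ano: "(A, B, i) \<in> (anodyne :: 'u arrow set)" by (auto simp: anodyne_def)
  define p where "p = bconst X (bD 0 0) (idop 0, idop 0)"
  define t where "t = bconst B (bD 0 0) (idop 0, idop 0)"
  define s where "s = (\<lambda>a b. \<lambda>x\<in>e ` cells ?A0 a b. h a b (inv_into UNIV e x))"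
  have s: "s \<in> bhom A X" unfolding s_def A_def by (rule bhom_btransp) (simp_all add: e h)
  have pt0: "(idop 0, idop 0) \<in> cells (bD 0 0) 0 0" by (simp add: cells_bD)
  have t: "t \<in> bhom B (bD 0 0)"
    by (rule bhomI)
      (auto simp: t_def bconst_def degen_cells pt0 act_degen[OF bisset_bD pt0] bissetD(1)[OF bA(2)])
  \<comment> \<open>Both composites are constant at the vertex of \<open>bD 0 0\<close>, so the
    square commutes whatever \<open>s\<close> is.\<close>
  have "bcomp A p s = bcomp A t i"
    using bhomD(1)[OF s] bhomD(1)[OF i]
    by (auto simp: bcomp_def compose_def p_def t_def bconst_def fun_eq_iff restrict_def)
  moreover have "\<forall>A B i. (A, B, i) \<in> (anodyne :: 'u arrow set) \<longrightarrow>
        (\<forall>s\<in>bhom A X. \<forall>t\<in>bhom B (bD 0 0). bcomp A p s = bcomp A t i \<longrightarrow>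
           (\<exists>l\<in>bhom B X. bcomp A l i = s \<and> bcomp B p l = t))"
    using fib by (simp add: fibrant_def fibration_def p_def)
  ultimately obtain L where L: "L \<in> bhom B X" "bcomp A L i = s"
    using ano s t by meson
  show thesis
  proof
    show "(\<lambda>a b. \<lambda>x\<in>cells ?B0 a b. L a b (e x)) \<in> bhom ?B0 X"
    proof (rule bhomI)
      fix a b a' b' f g x
      assume *: "f \<in> ops a' a" "g \<in> ops b' b" "x \<in> cells ?B0 a b"
      have "L a' b' (act B a b f g (e x)) = act X a b f g (L a b (e x))"
        by (rule bhomD(3)[OF L(1) *(1,2)]) (use *(3) cA in simp)
      then show "(\<lambda>x\<in>cells ?B0 a' b'. L a' b' (e x)) (act ?B0 a b f g x) =
          act X a b f g ((\<lambda>x\<in>cells ?B0 a b. L a b (e x)) x)"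
        using * bissetD(1)[OF bisset_bD *] by (simp add: B_def e)
    qed (use cA bhomD(1)[OF L(1)] in auto)
    fix a b x assume x: "x \<in> cells ?A0 a b"
    then have "s a b (e x) = L a b (e x)"
      unfolding L(2)[symmetric] by (simp add: bcomp_def compose_def cA i_def)
    then show "(\<lambda>x\<in>cells ?B0 a b. L a b (e x)) x = h a b x"
      using x sub by (auto simp: s_def e)
  qed
qed

section \<open>Maps given on chains of posets\<close>

text \<open>A map from (a bisimplicial subset of) the product of the nerves of two posets is given by its
  values on pairs of lists, sorted for the partial orders; \<open>bx X D \<phi>\<close> says that \<open>\<phi>\<close> is natural. The subset
  \<open>D\<close> is a predicate on the pairs of underlying vertex sets. In this description \<open>\<Delta>\<^sup>m \<times> \<Delta>\<^sup>1 \<times> \<Delta>\<^sup>1\<close> is no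
  more complicated than \<open>\<Delta>\<^sup>m\<close>, and restriction along monotone maps of posets is composition with \<open>map\<close>.\<close>

abbreviation dm :: "'p list \<Rightarrow> nat" where "dm s \<equiv> length s - 1"

abbreviation sel :: "'p list \<Rightarrow> nat list \<Rightarrow> 'p list" where "sel s f \<equiv> map ((!) s) f"

definition srt :: "'p::order list \<Rightarrow> bool" where "srt s \<longleftrightarrow> s \<noteq> [] \<and> sorted_wrt (\<le>) s"

definition bx :: "'a bisset \<Rightarrow> ('p::order set \<Rightarrow> 'q::order set \<Rightarrow> bool) \<Rightarrow> ('p list \<Rightarrow> 'q list \<Rightarrow> 'a) \<Rightarrow> bool"
  where "bx X D \<phi> \<longleftrightarrow> (\<forall>s t. srt s \<longrightarrow> srt t \<longrightarrow> D (set s) (set t) \<longrightarrow>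
     \<phi> s t \<in> cells X (dm s) (dm t) \<and>
     (\<forall>k l. \<forall>f\<in>ops k (dm s). \<forall>g\<in>ops l (dm t).
        \<phi> (sel s f) (sel t g) = act X (dm s) (dm t) f g (\<phi> s t)))"

text \<open>\<open>D\<close> sees only vertex sets, and a degeneracy keeps the vertex set; closure
  under subsets therefore already describes a bisimplicial subset.\<close>

definition down :: "('p set \<Rightarrow> 'q set \<Rightarrow> bool) \<Rightarrow> bool" where
  "down D \<longleftrightarrow> (\<forall>\<sigma> \<sigma>' \<tau> \<tau>'. D \<sigma> \<sigma>' \<longrightarrow> \<tau> \<subseteq> \<sigma> \<longrightarrow> \<tau>' \<subseteq> \<sigma>' \<longrightarrow> D \<tau> \<tau>')"

lemma downD: "down D \<Longrightarrow> D \<sigma> \<sigma>' \<Longrightarrow> \<tau> \<subseteq> \<sigma> \<Longrightarrow> \<tau>' \<subseteq> \<sigma>' \<Longrightarrow> D \<tau> \<tau>'"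
  unfolding down_def by blast

lemma bxD:
  assumes "bx X D \<phi>" "srt s" "srt t" "D (set s) (set t)"
  shows "\<phi> s t \<in> cells X (dm s) (dm t)"
    "f \<in> ops k (dm s) \<Longrightarrow> g \<in> ops l (dm t) \<Longrightarrow>
      \<phi> (sel s f) (sel t g) = act X (dm s) (dm t) f g (\<phi> s t)"
  using assms unfolding bx_def by blast+

lemma bxI:
  assumes "\<And>s t. srt s \<Longrightarrow> srt t \<Longrightarrow> D (set s) (set t) \<Longrightarrow> \<phi> s t \<in> cells X (dm s) (dm t)"
    "\<And>s t k l f g. \<lbrakk>srt s; srt t; D (set s) (set t); f \<in> ops k (dm s); g \<in> ops l (dm t)\<rbrakk> \<Longrightarrow>
      \<phi> (sel s f) (sel t g) = act X (dm s) (dm t) f g (\<phi> s t)"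
  shows "bx X D \<phi>"
  unfolding bx_def using assms by simp

lemma srt_sorted [simp]: "srt (s :: nat list) \<longleftrightarrow> s \<noteq> [] \<and> sorted s"
  by (simp add: srt_def)

lemma srt_nth_mono:
  assumes "srt s" "i \<le> j" "j < length s"
  shows "s ! i \<le> s ! j"
  using assms sorted_wrt_nth_less[of "(\<le>)" s i j] by (cases "i = j") (auto simp: srt_def)

lemma
  assumes s: "srt s" and f: "f \<in> ops k (dm s)"
  shows srt_sel: "srt (sel s f)"
    and set_sel: "set (sel s f) \<subseteq> set s"
proof -
  have lt: "i < length s" if "i \<in> set f" for i
    using opsD(3)[OF f that] s by (cases s) (auto simp: srt_def)
  have "f \<noteq> []" using opsD(1)[OF f] by auto
  moreover have "sorted_wrt (\<lambda>x y. s ! x \<le> s ! y) f"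
    by (rule sorted_wrt_mono_rel[OF _ opsD(2)[OF f]]) (use s lt srt_nth_mono in blast)
  ultimately show "srt (sel s f)" by (simp add: srt_def sorted_wrt_map)
  show "set (sel s f) \<subseteq> set s" using lt by auto
qed

lemma map_sel:
  assumes "s \<noteq> []" "f \<in> ops k (dm s)"
  shows "map c (sel s f) = sel (map c s) f"
proof -
  have "i < length s" if "i \<in> set f" for i
    using opsD(3)[OF assms(2) that] assms(1) by (cases s) auto
  then show ?thesis by simp
qed

lemma srt_map:
  assumes "srt s" "mono c"
  shows "srt (map c s)"
proof -
  have "sorted_wrt (\<lambda>x y. c x \<le> c y) s"
    by (rule sorted_wrt_mono_rel[of _ "(\<le>)"]) (use assms in \<open>auto simp: srt_def dest: monoD\<close>)
  then show ?thesis using assms(1) by (simp add: srt_def sorted_wrt_map)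
qed

lemma bx_mono: "bx X D \<phi> \<Longrightarrow> (\<And>\<sigma> \<sigma>'. E \<sigma> \<sigma>' \<Longrightarrow> D \<sigma> \<sigma>') \<Longrightarrow> bx X E \<phi>"
  unfolding bx_def by blast

text \<open>Naturality at \<open>s\<close>, \<open>t\<close> involves only lists on the vertices of
  \<open>s\<close> and \<open>t\<close>, so it can be borrowed from any natural
  \<open>\<chi>\<close> that agrees with \<open>\<phi>\<close> on a down-closed region containing
  them. This serves to glue maps given piecewise.\<close>

lemma bx_local:
  fixes \<phi> :: "'p::order list \<Rightarrow> 'q::order list \<Rightarrow> 'a"
  assumes local: "\<And>s t. \<lbrakk>srt s; srt t; D (set s) (set t)\<rbrakk> \<Longrightarrow> \<exists>E \<chi>. E (set s) (set t) \<and> down E \<and> bx X E \<chi> \<and>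
      (\<forall>s t. srt s \<longrightarrow> srt t \<longrightarrow> E (set s) (set t) \<longrightarrow> \<phi> s t = \<chi> s t)"
  shows "bx X D \<phi>"
proof (rule bxI)
  fix s :: "'p list" and t :: "'q list" assume st: "srt s" "srt t" "D (set s) (set t)"
  then obtain E \<chi> where E: "E (set s) (set t)" "down E" "bx X E \<chi>"
      "\<And>s t. srt s \<Longrightarrow> srt t \<Longrightarrow> E (set s) (set t) \<Longrightarrow> \<phi> s t = \<chi> s t"
    using local[OF st] by blast
  have eq: "\<phi> s t = \<chi> s t" by (rule E(4)[OF st(1,2) E(1)])
  show "\<phi> s t \<in> cells X (dm s) (dm t)" unfolding eq by (rule bxD(1)[OF E(3) st(1,2) E(1)])
  fix k l f g assume fg: "f \<in> ops k (dm s)" "g \<in> ops l (dm t)"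
  have "E (set (sel s f)) (set (sel t g))"
    by (rule downD[OF E(2,1) set_sel[OF st(1) fg(1)] set_sel[OF st(2) fg(2)]])
  then have "\<phi> (sel s f) (sel t g) = \<chi> (sel s f) (sel t g)"
    by (rule E(4)[OF srt_sel[OF st(1) fg(1)] srt_sel[OF st(2) fg(2)]])
  then show "\<phi> (sel s f) (sel t g) = act X (dm s) (dm t) f g (\<phi> s t)"
    unfolding eq using bxD(2)[OF E(3) st(1,2) E(1) fg] by (rule trans)
qed

lemma bx_pull:
  fixes c :: "'p::order \<Rightarrow> 'r::order" and c' :: "'q::order \<Rightarrow> 's::order"
  assumes "bx X E \<chi>" "mono c" "mono c'"
  shows "bx X (\<lambda>\<sigma> \<sigma>'. E (c ` \<sigma>) (c' ` \<sigma>')) (\<lambda>s t. \<chi> (map c s) (map c' t))"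
proof (rule bxI)
  fix s :: "'p list" and t :: "'q list" assume st: "srt s" "srt t" "E (c ` set s) (c' ` set t)"
  have E: "srt (map c s)" "srt (map c' t)" "E (set (map c s)) (set (map c' t))"
    using st by (auto intro: srt_map assms)
  show "\<chi> (map c s) (map c' t) \<in> cells X (dm s) (dm t)" using bxD(1)[OF assms(1) E] by simp
  fix k l f g assume fg: "f \<in> ops k (dm s)" "g \<in> ops l (dm t)"
  have "s \<noteq> []" "t \<noteq> []" using st by (auto simp: srt_def)
  then show "\<chi> (map c (sel s f)) (map c' (sel t g)) = act X (dm s) (dm t) f g (\<chi> (map c s) (map c' t))"
    using bxD(2)[OF assms(1) E, of f k g l] fg
    by (simp only: map_sel[OF _ fg(1)] map_sel[OF _ fg(2)] length_map not_False_eq_True)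
qed

locale ptd_bisset =
  fixes X :: "'a bisset" and pt :: 'a
  assumes bisset: "bisset X" and pt: "pt \<in> cells X 0 0"
begin

definition star :: "'p list \<Rightarrow> 'q list \<Rightarrow> 'a" where "star s t = degen X (dm s) (dm t) pt"

lemma bx_star: "bx X D star"
proof (rule bxI)
  fix s :: "'p::order list" and t :: "'q::order list" and k l f g
  assume "f \<in> ops k (dm s)" "g \<in> ops l (dm t)"
  then show "star (sel s f) (sel t g) = act X (dm s) (dm t) f g (star s t)"
    by (simp add: star_def act_degen[OF bisset pt] opsD(1))
qed (simp add: star_def degen_cells[OF bisset pt])

lemma star_map [simp]: "star (map c s) (map c' t) = star s t"
  by (simp add: star_def)

end

text \<open>From here to the final theorem this is all that is used of fibrancy; the type
  \<open>'u\<close> no longer occurs.\<close>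

locale kan_bisset = ptd_bisset +
  assumes horn_filler: "\<lbrakk>1 \<le> m; 1 \<le> n; k \<le> m; l \<le> n; h \<in> bhom (bhorn m n k l) X\<rbrakk> \<Longrightarrow>
    \<exists>H\<in>bhom (bD m n) X. \<forall>a b. \<forall>x\<in>cells (bhorn m n k l) a b. H a b x = h a b x"

section \<open>Extending over pairs of chains\<close>

definition chain :: "'p::order set \<Rightarrow> bool" where
  "chain \<sigma> \<longleftrightarrow> finite \<sigma> \<and> (\<forall>x\<in>\<sigma>. \<forall>y\<in>\<sigma>. x \<le> y \<or> y \<le> x)"

lemma chain_subset: "chain \<sigma> \<Longrightarrow> \<tau> \<subseteq> \<sigma> \<Longrightarrow> chain \<tau>"
  by (auto simp: chain_def intro: finite_subset)

lemma chain_set: "srt s \<Longrightarrow> chain (set s)"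
  unfolding chain_def by (auto simp: in_set_conv_nth) (meson nat_le_linear srt_nth_mono)

lemma chain_enum:
  assumes "chain \<sigma>"
  obtains e where "distinct e" "set e = \<sigma>" "sorted_wrt (<) e"
proof -
  have "finite \<sigma>" using assms by (simp add: chain_def)
  then have "chain \<sigma> \<Longrightarrow> \<exists>e. distinct e \<and> set e = \<sigma> \<and> sorted_wrt (<) e"
  proof (induction rule: finite_psubset_induct)
    case (psubset \<sigma>)
    show ?case
    proof (cases "\<sigma> = {}")
      case False
      then obtain x where x: "x \<in> \<sigma>" "\<And>y. y \<in> \<sigma> \<Longrightarrow> y \<le> x"
        using finite_has_maximal[OF psubset.hyps False] psubset.prems unfolding chain_def by metis
      obtain e where e: "distinct e" "set e = \<sigma> - {x}" "sorted_wrt (<) e"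
        using psubset.IH[of "\<sigma> - {x}"] x(1) chain_subset[OF psubset.prems, of "\<sigma> - {x}"] by auto
      have "distinct (e @ [x]) \<and> set (e @ [x]) = \<sigma> \<and> sorted_wrt (<) (e @ [x])"
        using e x by (auto simp: sorted_wrt_append order_less_le)
      then show ?thesis by blast
    qed auto
  qed
  then show thesis using assms that by blast
qed

text \<open>Replacing vertices by their positions in \<open>e\<close> exhibits every simplex on the
  chain as an operator applied to its one nondegenerate top simplex.\<close>

lemma chain_index:
  assumes e: "sorted_wrt (<) e" "distinct e" and s: "srt s" "set s \<subseteq> set e"
  obtains u where "u \<in> ops (dm s) (dm e)" "sel e u = s"
proof -
  define ix where "ix p = (THE i. i < length e \<and> e ! i = p)" for p
  have ix: "ix p < length e" "e ! ix p = p" if "p \<in> set e" for p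
  proof -
    have "\<exists>!i. i < length e \<and> e ! i = p"
      using that e(2) by (metis distinct_Ex1)
    from theI'[OF this] show "ix p < length e" "e ! ix p = p" by (simp_all add: ix_def)
  qed
  have le: "ix p \<le> ix q" if "p \<in> set e" "q \<in> set e" "p \<le> q" for p q
  proof (rule ccontr)
    assume "\<not> ix p \<le> ix q"
    then have "e ! ix q < e ! ix p"
      using e(1) ix(1)[OF that(1)] by (simp add: sorted_wrt_iff_nth_less)
    then show False using ix(2) that by auto
  qed
  have "sorted_wrt (\<lambda>x y. ix x \<le> ix y) s"
    by (rule sorted_wrt_mono_rel[of _ "(\<le>)"]) (use s le in \<open>auto simp: srt_def\<close>)
  then have "sorted (map ix s)" by (simp add: sorted_wrt_map)
  moreover have "ix p \<le> dm e" if "p \<in> set s" for p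
    using ix(1)[of p] s(2) that by fastforce
  ultimately have "map ix s \<in> ops (dm s) (dm e)"
    using s(1) by (auto simp: ops_def srt_def)
  moreover have "sel e (map ix s) = s"
    using ix(2) s(2) by (auto intro!: map_idI)
  ultimately show thesis by (rule that)
qed

lemma sel_sel: "u \<in> ops k m \<Longrightarrow> f \<in> ops l k \<Longrightarrow> sel (sel e u) f = sel e (opcomp u f)"
  unfolding opcomp_def by (rule map_sel[symmetric]) (auto dest: opsD(1))

lemma sel_inj:
  assumes "distinct e" "e \<noteq> []" "u \<in> ops k (dm e)" "v \<in> ops k (dm e)" "sel e u = sel e v"
  shows "u = v"
proof (rule nth_equalityI)
  show len: "length u = length v" using assms(3,4) by (simp add: opsD(1))
  fix i assume i: "i < length u"
  have "e ! (u ! i) = e ! (v ! i)"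
    using arg_cong[OF assms(5), of "\<lambda>l. l ! i"] i len by simp
  moreover have "u ! i < length e" "v ! i < length e"
    using opsD(3)[OF assms(3), of "u ! i"] opsD(3)[OF assms(4), of "v ! i"] i len assms(2)
    by (cases e; simp)+
  ultimately show "u ! i = v ! i" using assms(1) nth_eq_iff_index_eq by blast
qed

text \<open>Identifies the chain with a standard simplex in which \<open>x\<close> becomes the
  vertex \<open>k\<close>. The last clause turns the description of the horn at \<open>k\<close>
  into a statement about subsets of the chain.\<close>

lemma chain_position:
  assumes "chain \<sigma>" "x \<in> \<sigma>" "\<sigma> - {x} \<noteq> {}"
  obtains e m k where "distinct e" "set e = \<sigma>" "sorted_wrt (<) e" "srt e" "length e = Suc m"
    "1 \<le> m" "k \<le> m" "\<And>a u. u \<in> ops a m \<Longrightarrow> {..m} - {k} \<subseteq> set u \<longleftrightarrow> \<sigma> - {x} \<subseteq> set (sel e u)"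
proof -
  obtain e where e: "distinct e" "set e = \<sigma>" "sorted_wrt (<) e"
    using chain_enum assms(1) by blast
  obtain k where k: "k < length e" "e ! k = x" using assms(2) e(2) by (metis in_set_conv_nth)
  obtain y where y: "y \<in> \<sigma>" "y \<noteq> x" using assms(3) by auto
  \<comment> \<open>A second vertex makes the dimension at least 1, as the generating horns
    require.\<close>
  have "card {x, y} \<le> card \<sigma>"
    using y assms(1,2) by (intro card_mono) (auto simp: chain_def)
  then have len: "2 \<le> length e" using e(1,2) y(2) distinct_card by fastforce
  define m where "m = dm e"
  have lm: "length e = Suc m" using len by (simp add: m_def)
  have "srt e"
    using e(3) len by (auto simp: srt_def intro: sorted_wrt_mono_rel[rotated])
  moreover have "{..m} - {k} \<subseteq> set u \<longleftrightarrow> \<sigma> - {x} \<subseteq> set (sel e u)" if u: "u \<in> ops a m" for a u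
  proof
    assume sub: "{..m} - {k} \<subseteq> set u"
    show "\<sigma> - {x} \<subseteq> set (sel e u)"
    proof
      fix z assume z: "z \<in> \<sigma> - {x}"
      then obtain i where "i < length e" "e ! i = z" using e(2) by (metis DiffD1 in_set_conv_nth)
      moreover have "i \<noteq> k" using z k(2) calculation by auto
      ultimately have "i \<in> set u" using sub lm by auto
      then show "z \<in> set (sel e u)" using \<open>e ! i = z\<close> by auto
    qed
  next
    assume sub: "\<sigma> - {x} \<subseteq> set (sel e u)"
    show "{..m} - {k} \<subseteq> set u"
    proof
      fix i assume i: "i \<in> {..m} - {k}"
      then have "e ! i \<in> \<sigma> - {x}"
        using e(1,2) k lm nth_eq_iff_index_eq[OF e(1), of i k] by auto
      then obtain j where j: "j \<in> set u" "e ! i = e ! j" using sub by auto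
      then have "i = j" using nth_eq_iff_index_eq[OF e(1), of i j] i opsD(3)[OF u j(1)] lm by auto
      then show "i \<in> set u" using j by simp
    qed
  qed
  ultimately show thesis using that[OF e _ lm, of k] len lm k(1) by auto
qed

text \<open>The four pairs in \<open>{\<sigma>, \<sigma> - {x}} \<times> {\<sigma>', \<sigma>' -
  {x'}}\<close> are exactly the pairs of vertex sets that the horn at \<open>x\<close>,
  \<open>x'\<close> misses, so one filler adds all four. By \<open>new\<close> the smallest of them
  is not in \<open>D\<close>, hence none is; by \<open>old\<close> the whole horn is in
  \<open>D\<close>.\<close>

lemma (in kan_bisset) extend_block:
  fixes \<phi> :: "'p::order list \<Rightarrow> 'q::order list \<Rightarrow> 'a"
  assumes \<phi>: "bx X D \<phi>" and D: "down D" and \<sigma>: "chain \<sigma>" "x \<in> \<sigma>" "\<sigma> - {x} \<noteq> {}"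
    and \<sigma>': "chain \<sigma>'" "x' \<in> \<sigma>'" "\<sigma>' - {x'} \<noteq> {}"
    and new: "\<not> D (\<sigma> - {x}) (\<sigma>' - {x'})"
    and old: "\<And>\<tau> \<tau>'. \<lbrakk>\<tau> \<subseteq> \<sigma>; \<tau>' \<subseteq> \<sigma>'; \<not> (\<sigma> - {x} \<subseteq> \<tau> \<and> \<sigma>' - {x'} \<subseteq> \<tau>')\<rbrakk> \<Longrightarrow> D \<tau> \<tau>'"
  obtains \<psi> where "bx X (\<lambda>\<tau> \<tau>'. D \<tau> \<tau>' \<or> \<tau> \<in> {\<sigma>, \<sigma> - {x}} \<and> \<tau>' \<in> {\<sigma>', \<sigma>' - {x'}}) \<psi>"
    "\<And>s t. D (set s) (set t) \<Longrightarrow> \<psi> s t = \<phi> s t"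
proof -
  obtain e m k where e: "distinct e" "set e = \<sigma>" "sorted_wrt (<) e" "srt e" "length e = Suc m"
      "1 \<le> m" "k \<le> m" "\<And>a u. u \<in> ops a m \<Longrightarrow> {..m} - {k} \<subseteq> set u \<longleftrightarrow> \<sigma> - {x} \<subseteq> set (sel e u)"
    using chain_position[OF \<sigma>] by metis
  obtain e' n l where e': "distinct e'" "set e' = \<sigma>'" "sorted_wrt (<) e'" "srt e'" "length e' = Suc n"
      "1 \<le> n" "l \<le> n" "\<And>a u. u \<in> ops a n \<Longrightarrow> {..n} - {l} \<subseteq> set u \<longleftrightarrow> \<sigma>' - {x'} \<subseteq> set (sel e' u)"
    using chain_position[OF \<sigma>'] by metis
  have dm: "dm e = m" "dm e' = n" and ne: "e \<noteq> []" "e' \<noteq> []" using e(5) e'(5) by auto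
  have sub: "set (sel e u) \<subseteq> \<sigma>" if "u \<in> ops a m" for a u
    using set_sel[OF e(4), of u a] that dm e(2) by simp
  have sub': "set (sel e' u) \<subseteq> \<sigma>'" if "u \<in> ops a n" for a u
    using set_sel[OF e'(4), of u a] that dm e'(2) by simp
  let ?L = "bhorn m n k l"
  have inD: "D (set (sel e u)) (set (sel e' v))" if "(u, v) \<in> cells ?L a b" for u v a b
  proof -
    have uv: "u \<in> ops a m" "v \<in> ops b n" "\<not> ({..m} - {k} \<subseteq> set u \<and> {..n} - {l} \<subseteq> set v)"
      using that cells_bhorn by auto
    show ?thesis by (rule old[OF sub[OF uv(1)] sub'[OF uv(2)]]) (use uv(3) e(8)[OF uv(1)] e'(8)[OF uv(2)] in simp)
  qed
  define h where "h = (\<lambda>a b. \<lambda>(u, v)\<in>cells ?L a b. \<phi> (sel e u) (sel e' v))"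
  have hval: "\<phi> (sel e u) (sel e' v) \<in> cells X a b"
      "\<lbrakk>f \<in> ops a' a; g \<in> ops b' b\<rbrakk> \<Longrightarrow>
        \<phi> (sel e (opcomp u f)) (sel e' (opcomp v g)) = act X a b f g (\<phi> (sel e u) (sel e' v))"
    if uv: "(u, v) \<in> cells ?L a b" for u v a b f g a' b'
  proof -
    have o: "u \<in> ops a m" "v \<in> ops b n" using uv cells_bhorn by auto
    have s: "srt (sel e u)" "srt (sel e' v)" "dm (sel e u) = a" "dm (sel e' v) = b"
      using srt_sel[OF e(4)] srt_sel[OF e'(4)] o dm opsD(1) by auto
    show "\<phi> (sel e u) (sel e' v) \<in> cells X a b" using bxD(1)[OF \<phi> s(1,2) inD[OF uv]] s by simp
    assume fg: "f \<in> ops a' a" "g \<in> ops b' b"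
    show "\<phi> (sel e (opcomp u f)) (sel e' (opcomp v g)) = act X a b f g (\<phi> (sel e u) (sel e' v))"
      using bxD(2)[OF \<phi> s(1,2) inD[OF uv], of f a' g b'] fg s(3,4)
      unfolding sel_sel[OF o(1) fg(1)] sel_sel[OF o(2) fg(2)] by simp
  qed
  have "h \<in> bhom ?L X"
  proof (rule bhomI)
    fix a b a' b' f g z
    assume *: "f \<in> ops a' a" "g \<in> ops b' b" "z \<in> cells ?L a b"
    obtain u v where z: "z = (u, v)" by (cases z)
    have "(opcomp u f, opcomp v g) \<in> cells ?L a' b'"
      using bissetD(1)[OF bisset_bhorn *] by (simp add: z)
    then show "h a' b' (act ?L a b f g z) = act X a b f g (h a b z)"
      using hval(2)[OF _ *(1,2), of u v] *(3) by (simp add: h_def z)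
  qed (auto simp: h_def hval(1))
  then obtain H where H: "H \<in> bhom (bD m n) X"
      "\<And>a b z. z \<in> cells ?L a b \<Longrightarrow> H a b z = h a b z"
    using horn_filler[OF e(6) e'(6) e(7) e'(7)] by blast
  \<comment> \<open>The operator that selects \<open>s\<close> from \<open>e\<close>, unique by
    \<open>sel_inj\<close>. It allows the filler \<open>H\<close> to be evaluated at lists.\<close>
  define U where "U s = (SOME u. u \<in> ops (dm s) m \<and> sel e u = s)" for s
  define U' where "U' s = (SOME u. u \<in> ops (dm s) n \<and> sel e' u = s)" for s
  have U: "U s \<in> ops (dm s) m \<and> sel e (U s) = s" if "srt s" "set s \<subseteq> \<sigma>" for s
    unfolding U_def by (rule someI_ex) (use chain_index[OF e(3,1) that(1)] that(2) e(2) dm in metis)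
  have U': "U' s \<in> ops (dm s) n \<and> sel e' (U' s) = s" if "srt s" "set s \<subseteq> \<sigma>'" for s
    unfolding U'_def by (rule someI_ex) (use chain_index[OF e'(3,1) that(1)] that(2) e'(2) dm in metis)
  let ?B = "\<lambda>\<tau> \<tau>'. \<tau> \<in> {\<sigma>, \<sigma> - {x}} \<and> \<tau>' \<in> {\<sigma>', \<sigma>' - {x'}}"
  have BD: "\<not> D \<tau> \<tau>'" if "?B \<tau> \<tau>'" for \<tau> \<tau>'
    using new downD[OF D, of \<tau> \<tau>' "\<sigma> - {x}" "\<sigma>' - {x'}"] that by auto
  define \<psi> where "\<psi> s t = (if D (set s) (set t) then \<phi> s t else H (dm s) (dm t) (U s, U' t))" for s t
  \<comment> \<open>This holds on the horn too, where \<open>\<psi>\<close> is still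
    \<open>\<phi>\<close>, because the filler extends \<open>h\<close>. Naturality of
    \<open>\<psi>\<close> at a new pair thus reduces to that of \<open>H\<close>.\<close>
  have on_H: "\<psi> (sel e u) (sel e' v) = H a b (u, v)" if uv: "u \<in> ops a m" "v \<in> ops b n" for u v a b
  proof (cases "(u, v) \<in> cells ?L a b")
    case True
    then show ?thesis using inD[OF True] H(2)[OF True] by (simp add: \<psi>_def h_def)
  next
    case False
    then have "\<sigma> - {x} \<subseteq> set (sel e u)" "\<sigma>' - {x'} \<subseteq> set (sel e' v)"
      using e(8)[OF uv(1)] e'(8)[OF uv(2)] uv unfolding cells_bhorn by blast+
    then have "\<not> D (set (sel e u)) (set (sel e' v))" using new downD[OF D] by blast
    moreover have s: "srt (sel e u)" "srt (sel e' v)" "dm (sel e u) = a" "dm (sel e' v) = b"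
      using srt_sel[OF e(4)] srt_sel[OF e'(4)] uv dm opsD(1) by auto
    moreover have "U (sel e u) = u" "U' (sel e' v) = v"
      using sel_inj[OF e(1), of "U (sel e u)" a u] sel_inj[OF e'(1), of "U' (sel e' v)" b v]
        U[OF s(1) sub[OF uv(1)]] U'[OF s(2) sub'[OF uv(2)]] s uv dm ne by auto
    ultimately show ?thesis by (simp add: \<psi>_def)
  qed
  have "bx X (\<lambda>\<tau> \<tau>'. D \<tau> \<tau>' \<or> ?B \<tau> \<tau>') \<psi>"
  proof (rule bxI)
    fix s t assume st: "srt s" "srt t" "D (set s) (set t) \<or> ?B (set s) (set t)"
    show "\<psi> s t \<in> cells X (dm s) (dm t)"
    proof (cases "D (set s) (set t)")
      case True then show ?thesis using bxD(1)[OF \<phi> st(1,2) True] by (simp add: \<psi>_def)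
    next
      case False
      then have s: "set s \<subseteq> \<sigma>" "set t \<subseteq> \<sigma>'" using st(3) by auto
      show ?thesis
        using bhomD(1)[OF H(1)] U[OF st(1) s(1)] U'[OF st(2) s(2)] False by (simp add: \<psi>_def cells_bD)
    qed
    fix a b f g assume fg: "f \<in> ops a (dm s)" "g \<in> ops b (dm t)"
    show "\<psi> (sel s f) (sel t g) = act X (dm s) (dm t) f g (\<psi> s t)"
    proof (cases "D (set s) (set t)")
      case True
      then have "D (set (sel s f)) (set (sel t g))"
        by (rule downD[OF D _ set_sel[OF st(1) fg(1)] set_sel[OF st(2) fg(2)]])
      then show ?thesis using bxD(2)[OF \<phi> st(1,2) True fg] True by (simp add: \<psi>_def)
    next
      case False
      then have s: "set s \<subseteq> \<sigma>" "set t \<subseteq> \<sigma>'" using st(3) by auto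
      define u v where "u = U s" and "v = U' t"
      have u: "u \<in> ops (dm s) m" "sel e u = s" and v: "v \<in> ops (dm t) n" "sel e' v = t"
        using U[OF st(1) s(1)] U'[OF st(2) s(2)] by (auto simp: u_def v_def)
      have "sel s f = sel e (opcomp u f)" "sel t g = sel e' (opcomp v g)"
        using sel_sel[OF u(1) fg(1), of e] sel_sel[OF v(1) fg(2), of e'] u(2) v(2) by simp_all
      then have "\<psi> (sel s f) (sel t g) = H a b (opcomp u f, opcomp v g)"
        using on_H[OF ops_comp[OF u(1) fg(1)] ops_comp[OF v(1) fg(2)]] by simp
      also have "\<dots> = act X (dm s) (dm t) f g (H (dm s) (dm t) (u, v))"
        using bhomD(3)[OF H(1) fg, of "(u, v)"] u v by (simp add: cells_bD)
      also have "H (dm s) (dm t) (u, v) = \<psi> s t" using on_H[OF u(1) v(1)] u(2) v(2) by simp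
      finally show ?thesis .
    qed
  qed
  then show thesis by (rule that) (simp add: \<psi>_def)
qed

text \<open>An acyclic matching on chains: \<open>\<sigma>\<close> is matched with the chain obtained by adding or removing the
  vertex \<open>v \<sigma>\<close>; the rank \<open>r\<close> excludes cycles.\<close>

definition toggle :: "'p::order set set \<Rightarrow> ('p set \<Rightarrow> 'p) \<Rightarrow> ('p set \<Rightarrow> nat) \<Rightarrow> bool" where
  "toggle C v r \<longleftrightarrow> (\<forall>\<sigma>\<in>C.
     insert (v \<sigma>) \<sigma> \<in> C \<and> v (insert (v \<sigma>) \<sigma>) = v \<sigma> \<and> r (insert (v \<sigma>) \<sigma>) = r \<sigma> \<and>
     \<sigma> - {v \<sigma>} \<in> C \<and> v (\<sigma> - {v \<sigma>}) = v \<sigma> \<and> r (\<sigma> - {v \<sigma>}) = r \<sigma> \<and>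
     chain (insert (v \<sigma>) \<sigma>) \<and> \<sigma> - {v \<sigma>} \<noteq> {} \<and>
     (\<forall>y\<in>\<sigma>. y \<noteq> v \<sigma> \<longrightarrow> v \<sigma> \<in> \<sigma> \<longrightarrow> \<sigma> - {y} \<in> C \<longrightarrow> v (\<sigma> - {y}) \<notin> \<sigma> - {y} \<longrightarrow> r (\<sigma> - {y}) < r \<sigma>))"

lemma toggleD:
  assumes "toggle C v r" "\<sigma> \<in> C"
  shows "insert (v \<sigma>) \<sigma> \<in> C" "v (insert (v \<sigma>) \<sigma>) = v \<sigma>" "r (insert (v \<sigma>) \<sigma>) = r \<sigma>"
    "\<sigma> - {v \<sigma>} \<in> C" "v (\<sigma> - {v \<sigma>}) = v \<sigma>" "r (\<sigma> - {v \<sigma>}) = r \<sigma>"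
    "chain (insert (v \<sigma>) \<sigma>)" "\<sigma> - {v \<sigma>} \<noteq> {}"
    "\<lbrakk>y \<in> \<sigma>; y \<noteq> v \<sigma>; v \<sigma> \<in> \<sigma>; \<sigma> - {y} \<in> C; v (\<sigma> - {y}) \<notin> \<sigma> - {y}\<rbrakk> \<Longrightarrow> r (\<sigma> - {y}) < r \<sigma>"
  using bspec[OF assms(1)[unfolded toggle_def] assms(2)] by simp_all

text \<open>A block is a union of orbits of the toggle, so deleting it leaves a family that is still
  closed under toggling.\<close>

lemma toggle_block_iff:
  assumes t: "toggle C v r" and \<sigma>: "\<sigma> \<in> C" "v \<sigma> \<in> \<sigma>" and \<tau>: "\<tau> \<in> C"
  shows "insert (v \<tau>) \<tau> \<in> {\<sigma>, \<sigma> - {v \<sigma>}} \<longleftrightarrow> \<tau> \<in> {\<sigma>, \<sigma> - {v \<sigma>}}"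
    "\<tau> - {v \<tau>} \<in> {\<sigma>, \<sigma> - {v \<sigma>}} \<longleftrightarrow> \<tau> \<in> {\<sigma>, \<sigma> - {v \<sigma>}}"
proof -
  have v: "v \<tau> = v \<sigma>"
    if "insert (v \<tau>) \<tau> \<in> {\<sigma>, \<sigma> - {v \<sigma>}} \<or> \<tau> - {v \<tau>} \<in> {\<sigma>, \<sigma> - {v \<sigma>}} \<or> \<tau> \<in> {\<sigma>, \<sigma> - {v \<sigma>}}"
    using that toggleD(2,5)[OF t \<tau>] toggleD(5)[OF t \<sigma>(1)] by (metis insertE singletonD)
  show "insert (v \<tau>) \<tau> \<in> {\<sigma>, \<sigma> - {v \<sigma>}} \<longleftrightarrow> \<tau> \<in> {\<sigma>, \<sigma> - {v \<sigma>}}"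
    using v \<sigma>(2) by auto
  have "\<tau> - {v \<sigma>} \<in> {\<sigma>, \<sigma> - {v \<sigma>}} \<longleftrightarrow> \<tau> \<in> {\<sigma>, \<sigma> - {v \<sigma>}}"
    using \<sigma>(2) by (cases "v \<sigma> \<in> \<tau>") blast+
  then show "\<tau> - {v \<tau>} \<in> {\<sigma>, \<sigma> - {v \<sigma>}} \<longleftrightarrow> \<tau> \<in> {\<sigma>, \<sigma> - {v \<sigma>}}"
    using v by metis
qed

text \<open>A face outside the block has fewer vertices than \<open>\<sigma>\<close>, so its larger
  partner has at most as many. Equality occurs only for \<open>\<sigma> - {y}\<close> with its own
  toggle vertex absent, and then the rank drops by the last clause of \<open>toggle\<close>. Size of
  the larger partner, then rank, is thus the order in which blocks can be attached.\<close>

lemma toggle_face: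
  assumes t: "toggle C v r" and \<sigma>: "\<sigma> \<in> C" "v \<sigma> \<in> \<sigma>" and \<tau>: "\<tau> \<in> C" "\<tau> \<subseteq> \<sigma>"
  shows "\<tau> \<in> {\<sigma>, \<sigma> - {v \<sigma>}} \<and> card (insert (v \<tau>) \<tau>) = card \<sigma> \<and> r \<tau> = r \<sigma> \<or>
    \<tau> \<notin> {\<sigma>, \<sigma> - {v \<sigma>}} \<and>
    (card (insert (v \<tau>) \<tau>) < card \<sigma> \<or> card (insert (v \<tau>) \<tau>) = card \<sigma> \<and> r \<tau> < r \<sigma>)"
proof (cases "\<tau> \<in> {\<sigma>, \<sigma> - {v \<sigma>}}")
  case True
  then have "insert (v \<tau>) \<tau> = \<sigma>" "r \<tau> = r \<sigma>" using \<sigma>(2) toggleD(5,6)[OF t \<sigma>(1)] by auto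
  then show ?thesis using True by simp
next
  case False
  have fin: "finite \<sigma>" using toggleD(7)[OF t \<sigma>(1)] \<sigma>(2) by (simp add: chain_def insert_absorb)
  then have fin\<tau>: "finite \<tau>" using \<tau>(2) finite_subset by blast
  have lt: "card \<tau> < card \<sigma>" using \<tau>(2) False fin by (intro psubset_card_mono) auto
  have le: "card (insert (v \<tau>) \<tau>) \<le> Suc (card \<tau>)" by (simp add: card_insert_le_m1 fin\<tau> card_insert_if)
  show ?thesis
  proof (cases "card (insert (v \<tau>) \<tau>) = card \<sigma>")
    case True
    then have c: "Suc (card \<tau>) = card \<sigma>" and nv: "v \<tau> \<notin> \<tau>" using lt le by (auto simp: insert_absorb)
    have "card (\<sigma> - \<tau>) = 1" using c card_Diff_subset[OF fin\<tau> \<tau>(2)] by simp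
    then obtain y where "\<sigma> - \<tau> = {y}" by (auto simp: card_1_singleton_iff)
    then have y: "y \<in> \<sigma>" "\<tau> = \<sigma> - {y}" using \<tau>(2) by auto
    then have "y \<noteq> v \<sigma>" using False by auto
    then have "r \<tau> < r \<sigma>" using toggleD(9)[OF t \<sigma>(1) y(1)] \<sigma>(2) \<tau>(1) nv y(2) by simp
    then show ?thesis using True False by simp
  next
    case neq: False
    then show ?thesis using lt le False by simp
  qed
qed

text \<open>Induction on the set of missing pairs: a block of minimal measure has all its other
  faces in \<open>D\<close>, so \<open>extend_block\<close> applies, and the remaining pairs again
  satisfy the hypotheses.\<close>

lemma (in kan_bisset) extend_matching:
  fixes \<phi> :: "'p::order list \<Rightarrow> 'q::order list \<Rightarrow> 'a"
  assumes C: "toggle C v r" and C': "toggle C' v' r'"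
    and "finite N" "N \<subseteq> C \<times> C'"
    and "\<And>\<sigma> \<sigma>'. (\<sigma>, \<sigma>') \<in> N \<Longrightarrow> (insert (v \<sigma>) \<sigma>, \<sigma>') \<in> N \<and> (\<sigma> - {v \<sigma>}, \<sigma>') \<in> N \<and>
      (\<sigma>, insert (v' \<sigma>') \<sigma>') \<in> N \<and> (\<sigma>, \<sigma>' - {v' \<sigma>'}) \<in> N"
    and "bx X D \<phi>" "down D" "down (\<lambda>\<sigma> \<sigma>'. D \<sigma> \<sigma>' \<or> (\<sigma>, \<sigma>') \<in> N)"
    and "\<And>\<sigma> \<sigma>'. (\<sigma>, \<sigma>') \<in> N \<Longrightarrow> \<not> D \<sigma> \<sigma>'"
  shows "\<exists>\<psi>. bx X (\<lambda>\<sigma> \<sigma>'. D \<sigma> \<sigma>' \<or> (\<sigma>, \<sigma>') \<in> N) \<psi> \<and> (\<forall>s t. D (set s) (set t) \<longrightarrow> \<psi> s t = \<phi> s t)"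
  using assms(3-)
proof (induction N arbitrary: D \<phi> rule: finite_psubset_induct)
  case (psubset N)
  note NC = psubset.prems(1) and tog = psubset.prems(2) and \<phi> = psubset.prems(3)
    and dD = psubset.prems(4) and dDN = psubset.prems(5) and ND = psubset.prems(6)
  show ?case
  proof (cases "N = {}")
    case True
    then show ?thesis using \<phi> by auto
  next
    case False
    \<comment> \<open>Sizes of the larger partners come first, ranks second, each summed over the
      two directions. The measure is constant on blocks.\<close>
    define \<mu> where "\<mu> = (\<lambda>(\<sigma>, \<sigma>'). (card (insert (v \<sigma>) \<sigma>) + card (insert (v' \<sigma>') \<sigma>'), r \<sigma> + r' \<sigma>'))"
    have "wf (inv_image (less_than <*lex*> less_than) \<mu>)" by auto
    then obtain p where p: "p \<in> N" "\<And>q. (\<mu> q, \<mu> p) \<in> less_than <*lex*> less_than \<Longrightarrow> q \<notin> N"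
      using False unfolding wf_eq_minimal in_inv_image by (metis ex_in_conv)
    obtain \<sigma>0 \<sigma>0' where p0: "p = (\<sigma>0, \<sigma>0')" by (cases p)
    define \<sigma> \<sigma>' where "\<sigma> = insert (v \<sigma>0) \<sigma>0" and "\<sigma>' = insert (v' \<sigma>0') \<sigma>0'"
    have c0: "\<sigma>0 \<in> C" "\<sigma>0' \<in> C'" using p(1) NC p0 by auto
    note t0 = toggleD[OF C c0(1), folded \<sigma>_def] and t0' = toggleD[OF C' c0(2), folded \<sigma>'_def]
    have \<sigma>: "\<sigma> \<in> C" "v \<sigma> \<in> \<sigma>" "chain \<sigma>" "\<sigma> - {v \<sigma>} \<noteq> {}" "r \<sigma> = r \<sigma>0"
      using t0 toggleD(8)[OF C t0(1)] by (auto simp: \<sigma>_def)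
    have \<sigma>': "\<sigma>' \<in> C'" "v' \<sigma>' \<in> \<sigma>'" "chain \<sigma>'" "\<sigma>' - {v' \<sigma>'} \<noteq> {}" "r' \<sigma>' = r' \<sigma>0'"
      using t0' toggleD(8)[OF C' t0'(1)] by (auto simp: \<sigma>'_def)
    have topN: "(\<sigma>, \<sigma>') \<in> N" using tog p(1) p0 unfolding \<sigma>_def \<sigma>'_def by blast
    let ?B = "{\<sigma>, \<sigma> - {v \<sigma>}} \<times> {\<sigma>', \<sigma>' - {v' \<sigma>'}}"
    have BN: "?B \<subseteq> N" using tog topN by blast
    have \<mu>p: "\<mu> p = (card \<sigma> + card \<sigma>', r \<sigma> + r' \<sigma>')"
      by (simp add: \<mu>_def p0 \<sigma>(5) \<sigma>'(5) \<sigma>_def \<sigma>'_def) (simp add: \<sigma>_def[symmetric] \<sigma>'_def[symmetric] \<sigma>(5) \<sigma>'(5))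
    \<comment> \<open>A face of the block that is neither in \<open>D\<close> nor in the block would
      be a missing pair of smaller measure.\<close>
    have old: "D \<tau> \<tau>'" if \<tau>: "\<tau> \<subseteq> \<sigma>" "\<tau>' \<subseteq> \<sigma>'" "\<not> (\<sigma> - {v \<sigma>} \<subseteq> \<tau> \<and> \<sigma>' - {v' \<sigma>'} \<subseteq> \<tau>')" for \<tau> \<tau>'
    proof (rule ccontr)
      assume "\<not> D \<tau> \<tau>'"
      then have N: "(\<tau>, \<tau>') \<in> N" using downD[OF dDN _ \<tau>(1,2)] topN by blast
      then have CC: "\<tau> \<in> C" "\<tau>' \<in> C'" using NC by auto
      have "\<not> (\<tau> \<in> {\<sigma>, \<sigma> - {v \<sigma>}} \<and> \<tau>' \<in> {\<sigma>', \<sigma>' - {v' \<sigma>'}})" using \<tau>(3) by auto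
      with toggle_face[OF C \<sigma>(1,2) CC(1) \<tau>(1)] toggle_face[OF C' \<sigma>'(1,2) CC(2) \<tau>(2)]
      have "card (insert (v \<tau>) \<tau>) + card (insert (v' \<tau>') \<tau>') < card \<sigma> + card \<sigma>' \<or>
          card (insert (v \<tau>) \<tau>) + card (insert (v' \<tau>') \<tau>') = card \<sigma> + card \<sigma>' \<and>
          r \<tau> + r' \<tau>' < r \<sigma> + r' \<sigma>'"
        by (elim disjE conjE; (blast | linarith))
      then have "(\<mu> (\<tau>, \<tau>'), \<mu> p) \<in> less_than <*lex*> less_than"
        unfolding \<mu>p by (simp add: \<mu>_def)
      then show False using p(2) N by blast
    qed
    obtain \<psi> where \<psi>: "bx X (\<lambda>\<tau> \<tau>'. D \<tau> \<tau>' \<or> \<tau> \<in> {\<sigma>, \<sigma> - {v \<sigma>}} \<and> \<tau>' \<in> {\<sigma>', \<sigma>' - {v' \<sigma>'}}) \<psi>"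
        "\<And>s t. D (set s) (set t) \<Longrightarrow> \<psi> s t = \<phi> s t"
      using extend_block[OF \<phi> dD \<sigma>(3,2,4) \<sigma>'(3,2,4) _ old] ND BN by blast
    let ?D = "\<lambda>\<tau> \<tau>'. D \<tau> \<tau>' \<or> \<tau> \<in> {\<sigma>, \<sigma> - {v \<sigma>}} \<and> \<tau>' \<in> {\<sigma>', \<sigma>' - {v' \<sigma>'}}"
    have eq: "?D \<tau> \<tau>' \<or> (\<tau>, \<tau>') \<in> N - ?B \<longleftrightarrow> D \<tau> \<tau>' \<or> (\<tau>, \<tau>') \<in> N" for \<tau> \<tau>' using BN by auto
    have "down ?D"
      unfolding down_def
    proof (intro allI impI)
      fix \<tau> \<tau>' \<upsilon> \<upsilon>'
      assume *: "?D \<tau> \<tau>'" "\<upsilon> \<subseteq> \<tau>" "\<upsilon>' \<subseteq> \<tau>'"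
      show "?D \<upsilon> \<upsilon>'"
      proof (cases "D \<tau> \<tau>'")
        case True then show ?thesis using downD[OF dD] * by blast
      next
        case False
        then have sub: "\<upsilon> \<subseteq> \<sigma>" "\<upsilon>' \<subseteq> \<sigma>'" using * by auto
        show ?thesis
        proof (cases "\<sigma> - {v \<sigma>} \<subseteq> \<upsilon> \<and> \<sigma>' - {v' \<sigma>'} \<subseteq> \<upsilon>'")
          case True then show ?thesis using sub by blast
        qed (use old sub in blast)
      qed
    qed
    have B2: "(insert (v \<tau>) \<tau>, \<tau>') \<in> N - ?B \<and> (\<tau> - {v \<tau>}, \<tau>') \<in> N - ?B \<and>
        (\<tau>, insert (v' \<tau>') \<tau>') \<in> N - ?B \<and> (\<tau>, \<tau>' - {v' \<tau>'}) \<in> N - ?B" if *: "(\<tau>, \<tau>') \<in> N - ?B" for \<tau> \<tau>'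
    proof -
      have N: "(\<tau>, \<tau>') \<in> N" and nB: "\<not> (\<tau> \<in> {\<sigma>, \<sigma> - {v \<sigma>}} \<and> \<tau>' \<in> {\<sigma>', \<sigma>' - {v' \<sigma>'}})"
        using * unfolding Diff_iff mem_Sigma_iff by blast+
      have CC: "\<tau> \<in> C" "\<tau>' \<in> C'" using subsetD[OF NC N] by simp_all
      show ?thesis
        unfolding Diff_iff mem_Sigma_iff
          toggle_block_iff[OF C \<sigma>(1,2) CC(1)] toggle_block_iff[OF C' \<sigma>'(1,2) CC(2)]
        using tog[OF N] nB by simp
    qed
    have ps: "N - ?B \<subset> N" "N - ?B \<subseteq> C \<times> C'" using BN NC by blast+
    have dd: "down (\<lambda>\<tau> \<tau>'. ?D \<tau> \<tau>' \<or> (\<tau>, \<tau>') \<in> N - ?B)" unfolding eq by (rule dDN)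
    have nd: "\<not> ?D \<tau> \<tau>'" if "(\<tau>, \<tau>') \<in> N - ?B" for \<tau> \<tau>'
      using ND[of \<tau> \<tau>'] that unfolding Diff_iff mem_Sigma_iff by blast
    have "\<exists>\<psi>'. bx X (\<lambda>\<tau> \<tau>'. ?D \<tau> \<tau>' \<or> (\<tau>, \<tau>') \<in> N - ?B) \<psi>' \<and>
        (\<forall>s t. ?D (set s) (set t) \<longrightarrow> \<psi>' s t = \<psi> s t)"
      by (rule psubset.IH[OF ps B2 \<psi>(1) \<open>down ?D\<close> dd nd])
    then obtain \<psi>' where \<psi>': "bx X (\<lambda>\<tau> \<tau>'. ?D \<tau> \<tau>' \<or> (\<tau>, \<tau>') \<in> N - ?B) \<psi>'"
        "\<forall>s t. ?D (set s) (set t) \<longrightarrow> \<psi>' s t = \<psi> s t"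
      by (elim exE conjE) (rule that)
    have "\<forall>s t. D (set s) (set t) \<longrightarrow> \<psi>' s t = \<phi> s t"
      using \<psi>'(2) \<psi>(2) by simp
    then show ?thesis using \<psi>'(1) unfolding eq by blast
  qed
qed

text \<open>Adding the toggle vertex keeps a pair missing because \<open>D\<close> is closed under
  subsets, so only removal has to be assumed in \<open>tog\<close>.\<close>

lemma (in kan_bisset) extend_toggle:
  fixes \<phi> :: "'p::order list \<Rightarrow> 'q::order list \<Rightarrow> 'a"
  assumes C: "toggle C v r" "toggle C' v' r'" and fin: "finite P" "finite P'"
    and \<phi>: "bx X (\<lambda>\<sigma> \<sigma>'. \<sigma> \<subseteq> P \<and> \<sigma>' \<subseteq> P' \<and> D \<sigma> \<sigma>') \<phi>" and D: "down D"
    and in_C: "\<And>\<sigma> \<sigma>'. \<lbrakk>\<sigma> \<subseteq> P; \<sigma>' \<subseteq> P'; chain \<sigma>; chain \<sigma>'; \<not> D \<sigma> \<sigma>'\<rbrakk> \<Longrightarrow>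
      \<sigma> \<in> C \<and> \<sigma>' \<in> C' \<and> v \<sigma> \<in> P \<and> v' \<sigma>' \<in> P'"
    and tog: "\<And>\<sigma> \<sigma>'. \<lbrakk>\<sigma> \<subseteq> P; \<sigma>' \<subseteq> P'; chain \<sigma>; chain \<sigma>'; \<not> D \<sigma> \<sigma>'\<rbrakk> \<Longrightarrow>
      \<not> D (\<sigma> - {v \<sigma>}) \<sigma>' \<and> \<not> D \<sigma> (\<sigma>' - {v' \<sigma>'})"
  shows "\<exists>\<psi>. bx X (\<lambda>\<sigma> \<sigma>'. \<sigma> \<subseteq> P \<and> \<sigma>' \<subseteq> P') \<psi> \<and>
    (\<forall>s t. srt s \<longrightarrow> srt t \<longrightarrow> set s \<subseteq> P \<longrightarrow> set t \<subseteq> P' \<longrightarrow> D (set s) (set t) \<longrightarrow> \<psi> s t = \<phi> s t)"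
proof -
  define D1 where "D1 \<sigma> \<sigma>' \<longleftrightarrow> (\<sigma> \<subseteq> P \<and> \<sigma>' \<subseteq> P' \<and> chain \<sigma> \<and> chain \<sigma>') \<and> D \<sigma> \<sigma>'" for \<sigma> \<sigma>'
  define N where "N = {(\<sigma>, \<sigma>'). (\<sigma> \<subseteq> P \<and> \<sigma>' \<subseteq> P' \<and> chain \<sigma> \<and> chain \<sigma>') \<and> \<not> D \<sigma> \<sigma>'}"
  have eq: "D1 \<sigma> \<sigma>' \<or> (\<sigma>, \<sigma>') \<in> N \<longleftrightarrow> \<sigma> \<subseteq> P \<and> \<sigma>' \<subseteq> P' \<and> chain \<sigma> \<and> chain \<sigma>'" for \<sigma> \<sigma>'
    unfolding D1_def N_def by blast
  have dW: "down (\<lambda>\<sigma> \<sigma>'. \<sigma> \<subseteq> P \<and> \<sigma>' \<subseteq> P' \<and> chain \<sigma> \<and> chain \<sigma>')"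
    unfolding down_def by (meson chain_subset order_trans)
  have dd: "down (\<lambda>\<sigma> \<sigma>'. D1 \<sigma> \<sigma>' \<or> (\<sigma>, \<sigma>') \<in> N)" unfolding eq by (rule dW)
  have dD1: "down D1"
    unfolding down_def D1_def
  proof (intro allI impI, elim conjE)
    fix \<sigma> \<sigma>' \<tau> \<tau>' assume *: "\<sigma> \<subseteq> P" "\<sigma>' \<subseteq> P'" "chain \<sigma>" "chain \<sigma>'" "D \<sigma> \<sigma>'" "\<tau> \<subseteq> \<sigma>" "\<tau>' \<subseteq> \<sigma>'"
    show "(\<tau> \<subseteq> P \<and> \<tau>' \<subseteq> P' \<and> chain \<tau> \<and> chain \<tau>') \<and> D \<tau> \<tau>'"
      using downD[OF dW _ *(6,7)] downD[OF D *(5-7)] *(1-4) by blast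
  qed
  have NI: "(\<sigma>, \<sigma>') \<in> N \<longleftrightarrow> \<sigma> \<subseteq> P \<and> \<sigma>' \<subseteq> P' \<and> chain \<sigma> \<and> chain \<sigma>' \<and> \<not> D \<sigma> \<sigma>'" for \<sigma> \<sigma>'
    by (simp add: N_def)
  have "\<exists>\<psi>. bx X (\<lambda>\<sigma> \<sigma>'. D1 \<sigma> \<sigma>' \<or> (\<sigma>, \<sigma>') \<in> N) \<psi> \<and> (\<forall>s t. D1 (set s) (set t) \<longrightarrow> \<psi> s t = \<phi> s t)"
  proof (rule extend_matching[OF C])
    show "finite N"
      by (rule finite_subset[of _ "Pow P \<times> Pow P'"]) (auto simp: NI fin)
    show "N \<subseteq> C \<times> C'" using in_C NI by auto
    show "bx X D1 \<phi>" by (rule bx_mono[OF \<phi>]) (simp add: D1_def)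
    show "\<not> D1 \<sigma> \<sigma>'" if "(\<sigma>, \<sigma>') \<in> N" for \<sigma> \<sigma>' using that by (simp add: NI D1_def)
    fix \<sigma> \<sigma>' assume "(\<sigma>, \<sigma>') \<in> N"
    then have *: "\<sigma> \<subseteq> P" "\<sigma>' \<subseteq> P'" "chain \<sigma>" "chain \<sigma>'" "\<not> D \<sigma> \<sigma>'" by (simp_all add: NI)
    note c = in_C[OF *] and t = tog[OF *]
    have ch: "chain (insert (v \<sigma>) \<sigma>)" "chain (insert (v' \<sigma>') \<sigma>')"
      using toggleD(7)[OF C(1)] toggleD(7)[OF C(2)] c by blast+
    have "\<not> D (insert (v \<sigma>) \<sigma>) \<sigma>'" "\<not> D \<sigma> (insert (v' \<sigma>') \<sigma>')"
      using *(5) downD[OF D] by blast+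
    moreover have "chain (\<sigma> - {v \<sigma>})" "chain (\<sigma>' - {v' \<sigma>'})" using *(3,4) by (auto intro: chain_subset)
    ultimately show "(insert (v \<sigma>) \<sigma>, \<sigma>') \<in> N \<and> (\<sigma> - {v \<sigma>}, \<sigma>') \<in> N \<and>
        (\<sigma>, insert (v' \<sigma>') \<sigma>') \<in> N \<and> (\<sigma>, \<sigma>' - {v' \<sigma>'}) \<in> N"
      using * ch c t unfolding NI by blast
  qed (rule dd dD1)+
  then obtain \<psi> where \<psi>: "bx X (\<lambda>\<sigma> \<sigma>'. \<sigma> \<subseteq> P \<and> \<sigma>' \<subseteq> P' \<and> chain \<sigma> \<and> chain \<sigma>') \<psi>"
      "\<forall>s t. D1 (set s) (set t) \<longrightarrow> \<psi> s t = \<phi> s t"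
    unfolding eq by (elim exE conjE) (rule that)
  have "bx X (\<lambda>\<sigma> \<sigma>'. \<sigma> \<subseteq> P \<and> \<sigma>' \<subseteq> P') \<psi>"
  proof (rule bxI)
    fix s t assume *: "srt s" "srt t" "set s \<subseteq> P \<and> set t \<subseteq> P'"
    then have c: "set s \<subseteq> P \<and> set t \<subseteq> P' \<and> chain (set s) \<and> chain (set t)" by (simp add: chain_set)
    show "\<psi> s t \<in> cells X (dm s) (dm t)" by (rule bxD(1)[OF \<psi>(1) *(1,2) c])
    show "\<psi> (sel s f) (sel t g) = act X (dm s) (dm t) f g (\<psi> s t)"
      if "f \<in> ops k (dm s)" "g \<in> ops l (dm t)" for f g k l
      by (rule bxD(2)[OF \<psi>(1) *(1,2) c that])
  qed
  moreover have "\<psi> s t = \<phi> s t" if "srt s" "srt t" "set s \<subseteq> P" "set t \<subseteq> P'" "D (set s) (set t)" for s t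
    using \<psi>(2)[rule_format, of s t] chain_set[OF that(1)] chain_set[OF that(2)] that(3-5)
    by (simp add: D1_def)
  ultimately show ?thesis by blast
qed

text \<open>In a product with \<open>{..f}\<close>, toggle the vertex in the top row above the last vertex
  below that row.\<close>

lemma toggle_prod:
  fixes f :: nat
  defines "r \<equiv> \<lambda>\<sigma> :: (nat \<times> nat) set. Max (fst ` {p \<in> \<sigma>. snd p \<noteq> f})"
  shows "toggle {\<sigma>. chain \<sigma> \<and> \<sigma> \<subseteq> UNIV \<times> {..f} \<and> (\<exists>p\<in>\<sigma>. snd p \<noteq> f)} (\<lambda>\<sigma>. (r \<sigma>, f)) r"
    and "\<lbrakk>chain \<sigma>; \<exists>p\<in>\<sigma>. snd p \<noteq> f\<rbrakk> \<Longrightarrow> \<exists>p\<in>\<sigma>. snd p \<noteq> f \<and> fst p = r \<sigma>"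
proof -
  have mx: "\<exists>p\<in>\<sigma>. snd p \<noteq> f \<and> fst p = r \<sigma> \<and> (\<forall>q\<in>\<sigma>. snd q \<noteq> f \<longrightarrow> fst q \<le> fst p)"
    if "chain \<sigma>" "\<exists>p\<in>\<sigma>. snd p \<noteq> f" for \<sigma>
  proof -
    have "r \<sigma> \<in> fst ` {p \<in> \<sigma>. snd p \<noteq> f}"
      unfolding r_def
    proof (rule Max_in)
      show "finite (fst ` {p \<in> \<sigma>. snd p \<noteq> f})" using that(1) by (simp add: chain_def)
      show "fst ` {p \<in> \<sigma>. snd p \<noteq> f} \<noteq> {}" using that(2) by blast
    qed
    then obtain p where "p \<in> \<sigma>" "snd p \<noteq> f" "fst p = r \<sigma>" by (elim imageE CollectE conjE) simp
    moreover have "\<forall>q\<in>\<sigma>. snd q \<noteq> f \<longrightarrow> fst q \<le> r \<sigma>"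
      unfolding r_def using that(1) by (auto simp: chain_def intro!: Max_ge)
    ultimately show ?thesis by metis
  qed
  then show "\<lbrakk>chain \<sigma>; \<exists>p\<in>\<sigma>. snd p \<noteq> f\<rbrakk> \<Longrightarrow> \<exists>p\<in>\<sigma>. snd p \<noteq> f \<and> fst p = r \<sigma>" by blast
  show "toggle {\<sigma>. chain \<sigma> \<and> \<sigma> \<subseteq> UNIV \<times> {..f} \<and> (\<exists>p\<in>\<sigma>. snd p \<noteq> f)} (\<lambda>\<sigma>. (r \<sigma>, f)) r"
    unfolding toggle_def
  proof
    fix \<sigma> :: "(nat \<times> nat) set" assume "\<sigma> \<in> {\<sigma>. chain \<sigma> \<and> \<sigma> \<subseteq> UNIV \<times> {..f} \<and> (\<exists>p\<in>\<sigma>. snd p \<noteq> f)}"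
    then have ch: "chain \<sigma>" and le: "\<And>p. p \<in> \<sigma> \<Longrightarrow> snd p \<le> f" and ex: "\<exists>p\<in>\<sigma>. snd p \<noteq> f"
      by auto
    obtain q where q: "q \<in> \<sigma>" "snd q \<noteq> f" "fst q = r \<sigma>" "\<And>p. p \<in> \<sigma> \<Longrightarrow> snd p \<noteq> f \<Longrightarrow> fst p \<le> fst q"
      using mx[OF ch ex] by metis
    let ?w = "(r \<sigma>, f)"
    have req: "r (insert ?w \<sigma>) = r \<sigma>" "r (\<sigma> - {?w}) = r \<sigma>"
      unfolding r_def by (rule arg_cong[where f = Max]; auto)+
    \<comment> \<open>A vertex of the top row is comparable with \<open>q\<close>, hence above it,
      hence above \<open>?w\<close>. A vertex below the top row has first coordinate at most
      \<open>r \<sigma>\<close>, hence lies below \<open>?w\<close>.\<close>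
    have cmp: "?w \<le> p \<or> p \<le> ?w" if "p \<in> \<sigma>" for p
    proof (cases "snd p = f")
      case True
      have "q \<le> p \<or> p \<le> q" using ch that q(1) by (simp add: chain_def)
      then have "q \<le> p" using True q(2) le[OF q(1)] by (auto simp: less_eq_prod_def)
      then show ?thesis using True q(3) by (simp add: less_eq_prod_def)
    next
      case False
      then show ?thesis using q(3,4) le that by (simp add: less_eq_prod_def)
    qed
    have ins: "chain (insert ?w \<sigma>)" using ch cmp unfolding chain_def by auto
    have qw: "q \<in> \<sigma> - {?w}" using q(1,2) by auto
    \<comment> \<open>If the rank did not drop, the toggle vertex of \<open>\<sigma> - {y}\<close>
      would still be \<open>?w\<close>, which has not been removed.\<close>
    have last: "r (\<sigma> - {y}) < r \<sigma>"
      if y: "y \<in> \<sigma>" "y \<noteq> ?w" "?w \<in> \<sigma>" "\<exists>p\<in>\<sigma> - {y}. snd p \<noteq> f" "(r (\<sigma> - {y}), f) \<notin> \<sigma> - {y}" for y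
    proof -
      have "finite (fst ` {p \<in> \<sigma>. snd p \<noteq> f})" using ch by (simp add: chain_def)
      moreover have "fst ` {p \<in> \<sigma> - {y}. snd p \<noteq> f} \<noteq> {}" using y(4) by blast
      ultimately have "r (\<sigma> - {y}) \<le> r \<sigma>" unfolding r_def by (intro Max_mono) blast+
      moreover have "r (\<sigma> - {y}) \<noteq> r \<sigma>" using y by auto
      ultimately show ?thesis by simp
    qed
    show "insert ?w \<sigma> \<in> {\<sigma>. chain \<sigma> \<and> \<sigma> \<subseteq> UNIV \<times> {..f} \<and> (\<exists>p\<in>\<sigma>. snd p \<noteq> f)} \<and>
      (r (insert ?w \<sigma>), f) = ?w \<and> r (insert ?w \<sigma>) = r \<sigma> \<and>
      \<sigma> - {?w} \<in> {\<sigma>. chain \<sigma> \<and> \<sigma> \<subseteq> UNIV \<times> {..f} \<and> (\<exists>p\<in>\<sigma>. snd p \<noteq> f)} \<and>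
      (r (\<sigma> - {?w}), f) = ?w \<and> r (\<sigma> - {?w}) = r \<sigma> \<and> chain (insert ?w \<sigma>) \<and> \<sigma> - {?w} \<noteq> {} \<and>
      (\<forall>y\<in>\<sigma>. y \<noteq> ?w \<longrightarrow> ?w \<in> \<sigma> \<longrightarrow>
        \<sigma> - {y} \<in> {\<sigma>. chain \<sigma> \<and> \<sigma> \<subseteq> UNIV \<times> {..f} \<and> (\<exists>p\<in>\<sigma>. snd p \<noteq> f)} \<longrightarrow>
        (r (\<sigma> - {y}), f) \<notin> \<sigma> - {y} \<longrightarrow> r (\<sigma> - {y}) < r \<sigma>)"
    proof (intro conjI ballI impI)
      show "\<sigma> - {?w} \<in> {\<sigma>. chain \<sigma> \<and> \<sigma> \<subseteq> UNIV \<times> {..f} \<and> (\<exists>p\<in>\<sigma>. snd p \<noteq> f)}"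
        using qw q(2) le chain_subset[OF ch] by auto
      show "insert ?w \<sigma> \<in> {\<sigma>. chain \<sigma> \<and> \<sigma> \<subseteq> UNIV \<times> {..f} \<and> (\<exists>p\<in>\<sigma>. snd p \<noteq> f)}"
        using ins ex le by auto
    qed (use req ins qw last in blast)+
  qed
qed

text \<open>The toggle vertex \<open>(r \<sigma>, f)\<close> repeats a first coordinate that occurs
  below the top row, so toggling changes only whether level \<open>f\<close> occurs, and
  \<open>ins\<close> makes \<open>Q\<close> blind to that. By \<open>top\<close> a missing pair has
  vertices below the top row in both directions, so that the toggle is defined.\<close>

lemma (in kan_bisset) fill_prod:
  fixes \<phi> :: "(nat \<times> nat) list \<Rightarrow> (nat \<times> nat) list \<Rightarrow> 'a"
  assumes \<phi>: "bx X (\<lambda>\<sigma> \<sigma>'. \<sigma> \<subseteq> {..m} \<times> {..f} \<and> \<sigma>' \<subseteq> {..n} \<times> {..f} \<and>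
      Q (fst ` \<sigma>) (snd ` \<sigma>) (fst ` \<sigma>') (snd ` \<sigma>')) \<phi>"
    and anti: "\<And>A B A' B' A1 B1 A1' B1'. \<lbrakk>Q A B A' B'; A1 \<subseteq> A; B1 \<subseteq> B; A1' \<subseteq> A'; B1' \<subseteq> B'\<rbrakk> \<Longrightarrow> Q A1 B1 A1' B1'"
    and top: "\<And>A A' B'. Q A {f} A' B'" "\<And>A B A'. Q A B A' {f}"
    and ins: "\<And>A B A' B'. Q A B A' B' \<Longrightarrow> Q A (insert f B) A' (insert f B')"
  obtains \<psi> where "bx X (\<lambda>\<sigma> \<sigma>'. \<sigma> \<subseteq> {..m} \<times> {..f} \<and> \<sigma>' \<subseteq> {..n} \<times> {..f}) \<psi>"
    "\<And>s t. \<lbrakk>srt s; srt t; set s \<subseteq> {..m} \<times> {..f}; set t \<subseteq> {..n} \<times> {..f};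
      Q (fst ` set s) (snd ` set s) (fst ` set t) (snd ` set t)\<rbrakk> \<Longrightarrow> \<psi> s t = \<phi> s t"
proof -
  define r where "r \<sigma> = Max (fst ` {p \<in> \<sigma>. snd p \<noteq> f})" for \<sigma> :: "(nat \<times> nat) set"
  let ?C = "{\<sigma> :: (nat \<times> nat) set. chain \<sigma> \<and> \<sigma> \<subseteq> UNIV \<times> {..f} \<and> (\<exists>p\<in>\<sigma>. snd p \<noteq> f)}"
  let ?D = "\<lambda>\<sigma> \<sigma>'. Q (fst ` \<sigma>) (snd ` \<sigma>) (fst ` \<sigma>') (snd ` \<sigma>')"
  have tog: "toggle ?C (\<lambda>\<sigma>. (r \<sigma>, f)) r"
    unfolding r_def by (rule toggle_prod(1))
  have fr: "r \<sigma> \<in> fst ` (\<sigma> - {(r \<sigma>, f)})" if C: "\<sigma> \<in> ?C" for \<sigma>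
  proof -
    obtain p where "p \<in> \<sigma>" "snd p \<noteq> f" "fst p = r \<sigma>"
      using toggle_prod(2)[of \<sigma> f] C unfolding r_def mem_Collect_eq by blast
    moreover from this have "p \<in> \<sigma> - {(r \<sigma>, f)}" by auto
    ultimately show ?thesis by (metis image_eqI)
  qed
  have dD: "down ?D" unfolding down_def by (meson anti image_mono)
  have nD: "\<sigma> \<in> ?C \<and> \<sigma>' \<in> ?C" if "\<sigma> \<subseteq> {..m} \<times> {..f}" "\<sigma>' \<subseteq> {..n} \<times> {..f}" "chain \<sigma>" "chain \<sigma>'" "\<not> ?D \<sigma> \<sigma>'" for \<sigma> \<sigma>'
  proof -
    have "\<not> snd ` \<sigma> \<subseteq> {f}" "\<not> snd ` \<sigma>' \<subseteq> {f}" using that(5) anti top by (meson order_refl)+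
    then show ?thesis using that(1-4) by auto
  qed
  have "\<exists>\<psi>. bx X (\<lambda>\<sigma> \<sigma>'. \<sigma> \<subseteq> {..m} \<times> {..f} \<and> \<sigma>' \<subseteq> {..n} \<times> {..f}) \<psi> \<and>
      (\<forall>s t. srt s \<longrightarrow> srt t \<longrightarrow> set s \<subseteq> {..m} \<times> {..f} \<longrightarrow> set t \<subseteq> {..n} \<times> {..f} \<longrightarrow> ?D (set s) (set t) \<longrightarrow> \<psi> s t = \<phi> s t)"
  proof (rule extend_toggle[OF tog tog _ _ \<phi> dD])
    fix \<sigma> \<sigma>' assume *: "\<sigma> \<subseteq> {..m} \<times> {..f}" "\<sigma>' \<subseteq> {..n} \<times> {..f}" "chain \<sigma>" "chain \<sigma>'" "\<not> ?D \<sigma> \<sigma>'"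
    have C: "\<sigma> \<in> ?C" "\<sigma>' \<in> ?C" using nD[OF *] by auto
    have "r \<sigma> \<in> fst ` \<sigma>" "r \<sigma>' \<in> fst ` \<sigma>'" using fr[OF C(1)] fr[OF C(2)] by auto
    then show "\<sigma> \<in> ?C \<and> \<sigma>' \<in> ?C \<and> (r \<sigma>, f) \<in> {..m} \<times> {..f} \<and> (r \<sigma>', f) \<in> {..n} \<times> {..f}"
      using C *(1,2) by auto
    have sub: "fst ` \<tau> \<subseteq> fst ` (\<tau> - {(r \<tau>, f)})" "snd ` \<tau> \<subseteq> insert f (snd ` (\<tau> - {(r \<tau>, f)}))"
      if "\<tau> \<in> ?C" for \<tau>
    proof -
      have *: "\<tau> \<subseteq> insert (r \<tau>, f) (\<tau> - {(r \<tau>, f)})" by blast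
      show "fst ` \<tau> \<subseteq> fst ` (\<tau> - {(r \<tau>, f)})"
        using image_mono[OF *, of fst] fr[OF that] by (simp only: image_insert fst_conv insert_absorb)
      show "snd ` \<tau> \<subseteq> insert f (snd ` (\<tau> - {(r \<tau>, f)}))"
        using image_mono[OF *, of snd] by (simp only: image_insert snd_conv)
    qed
    show "\<not> ?D (\<sigma> - {(r \<sigma>, f)}) \<sigma>' \<and> \<not> ?D \<sigma> (\<sigma>' - {(r \<sigma>', f)})"
    proof (intro conjI notI)
      assume "?D (\<sigma> - {(r \<sigma>, f)}) \<sigma>'"
      from anti[OF ins[OF this] sub[OF C(1)] order_refl subset_insertI] show False using *(5) by contradiction
    next
      assume "?D \<sigma> (\<sigma>' - {(r \<sigma>', f)})"
      from anti[OF ins[OF this] order_refl subset_insertI sub[OF C(2)]] show False using *(5) by contradiction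
    qed
  qed auto
  then show thesis using that by blast
qed

text \<open>Here every missing chain is matched by toggling the same vertex. No face of a chain
  containing that vertex can have it absent unless it is the partner, so a constant rank
  suffices.\<close>

lemma (in kan_bisset) fill_vertex:
  fixes \<phi> :: "nat list \<Rightarrow> nat list \<Rightarrow> 'a"
  assumes \<phi>: "bx X (\<lambda>\<sigma> \<sigma>'. \<sigma> \<subseteq> {..M} \<and> \<sigma>' \<subseteq> {..M'} \<and> D \<sigma> \<sigma>') \<phi>" and D: "down D"
    and w: "w \<le> M" "w' \<le> M'"
    and nD: "\<And>\<sigma> \<sigma>'. \<not> D \<sigma> \<sigma>' \<Longrightarrow> \<sigma> - {w} \<noteq> {} \<and> \<sigma>' - {w'} \<noteq> {} \<and> \<not> D (\<sigma> - {w}) \<sigma>' \<and> \<not> D \<sigma> (\<sigma>' - {w'})"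
  obtains \<psi> where "bx X (\<lambda>\<sigma> \<sigma>'. \<sigma> \<subseteq> {..M} \<and> \<sigma>' \<subseteq> {..M'}) \<psi>"
    "\<And>s t. \<lbrakk>srt s; srt t; set s \<subseteq> {..M}; set t \<subseteq> {..M'}; D (set s) (set t)\<rbrakk> \<Longrightarrow> \<psi> s t = \<phi> s t"
proof -
  have tog: "toggle {\<sigma>. finite \<sigma> \<and> \<sigma> - {w} \<noteq> {}} (\<lambda>_. w) (\<lambda>_. 0)" for w :: nat
    unfolding toggle_def chain_def by auto
  have "\<exists>\<psi>. bx X (\<lambda>\<sigma> \<sigma>'. \<sigma> \<subseteq> {..M} \<and> \<sigma>' \<subseteq> {..M'}) \<psi> \<and>
      (\<forall>s t. srt s \<longrightarrow> srt t \<longrightarrow> set s \<subseteq> {..M} \<longrightarrow> set t \<subseteq> {..M'} \<longrightarrow> D (set s) (set t) \<longrightarrow> \<psi> s t = \<phi> s t)"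
  proof (rule extend_toggle[OF tog tog _ _ \<phi> D])
    fix \<sigma> \<sigma>' assume "\<sigma> \<subseteq> {..M}" "\<sigma>' \<subseteq> {..M'}" "chain \<sigma>" "chain \<sigma>'" "\<not> D \<sigma> \<sigma>'"
    note * = this(3,4) nD[OF this(5)]
    show "\<sigma> \<in> {\<sigma>. finite \<sigma> \<and> \<sigma> - {w} \<noteq> {}} \<and> \<sigma>' \<in> {\<sigma>. finite \<sigma> \<and> \<sigma> - {w'} \<noteq> {}} \<and> w \<in> {..M} \<and> w' \<in> {..M'}"
      using * w by (simp add: chain_def)
    show "\<not> D (\<sigma> - {w}) \<sigma>' \<and> \<not> D \<sigma> (\<sigma>' - {w'})" using * by simp
  qed auto
  then show thesis using that by blast
qed

section \<open>Groups from a composition relation\<close>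

text \<open>\<open>T x y z\<close> says that \<open>z\<close> is a composite of \<open>x\<close> and \<open>y\<close>. Filling the last face of a triangle, or of a
  tetrahedron, suffices for the composition to be a group operation up to the equivalence \<open>T e\<close>.\<close>

locale composition =
  fixes S :: "'s set" and T :: "'s \<Rightarrow> 's \<Rightarrow> 's \<Rightarrow> bool" and e :: 's
  assumes e: "e \<in> S"
    and T_S: "T x y z \<Longrightarrow> x \<in> S \<and> y \<in> S \<and> z \<in> S"
    and right_unit: "x \<in> S \<Longrightarrow> T x e x"
    and left_unit: "x \<in> S \<Longrightarrow> T e x x"
    and triangle: "\<lbrakk>x \<in> S; z \<in> S\<rbrakk> \<Longrightarrow> \<exists>y. T x y z"
    and tetrahedron: "\<lbrakk>T x y w; T w z u; T x v u\<rbrakk> \<Longrightarrow> T y z v"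
begin

abbreviation E :: "'s \<Rightarrow> 's \<Rightarrow> bool" where "E \<equiv> T e"

text \<open>This and the following laws are instances of \<open>tetrahedron\<close> with the unit
  inserted at one place. Here the unit is the first edge.\<close>

lemma T_cong3: "T y z u \<Longrightarrow> E v u \<Longrightarrow> T y z v"
  using tetrahedron[of e y y z u v] left_unit T_S by blast

lemma E_sym: "E u v \<Longrightarrow> E v u"
  using T_cong3[of e v v u] left_unit T_S by blast

lemma E_trans: "E u v \<Longrightarrow> E v w \<Longrightarrow> E u w"
  using T_cong3[of e u v w] E_sym by blast

lemma left_cancel: "T x z u \<Longrightarrow> T x v u \<Longrightarrow> E z v"
  using tetrahedron[of x e x z u v] right_unit T_S by blast

lemma T_cong1: "T x z u \<Longrightarrow> E x x' \<Longrightarrow> T x' z u"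
  using tetrahedron[of e x' x z u u] E_sym left_unit T_S by blast

text \<open>\<open>tetrahedron\<close> with the unit as composite of the first two edges: dividing
  by \<open>x\<close> is multiplying by its right inverse \<open>b\<close>.\<close>

lemma right_inverse_cancel:
  assumes "T x b e" "T x v z"
  shows "T b z v"
  using tetrahedron[OF assms(1) left_unit assms(2)] T_S assms(2) by blast

text \<open>Left division of \<open>e\<close> by \<open>x\<close> gives a right inverse, and
  cancelling it against \<open>x e = x\<close> shows that it is a left inverse as well.\<close>

lemma inverse:
  assumes "x \<in> S"
  obtains b where "T x b e" "T b x e"
  using triangle[OF assms e] right_inverse_cancel[OF _ right_unit[OF assms]] by blast

text \<open>Since only left division is available, the product of \<open>x\<close> and
  \<open>y\<close> is found by dividing \<open>y\<close> by an inverse of \<open>x\<close>.\<close>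

lemma T_ex:
  assumes "x \<in> S" "y \<in> S"
  obtains z where "T x y z"
proof -
  obtain b where b: "T b x e" using inverse[OF assms(1)] by blast
  then obtain v where "T b v y" using triangle T_S assms(2) by blast
  then show thesis using tetrahedron[OF b left_unit[OF assms(2)]] that by blast
qed

lemma T_cong2:
  assumes "T x z u" "E z z'"
  shows "T x z' u"
proof -
  obtain b where b: "T x b e" "T b x e" using inverse[of x] T_S[OF assms(1)] by blast
  show ?thesis
    by (rule tetrahedron[OF b(2) E_sym[OF assms(2)] right_inverse_cancel[OF b(1) assms(1)]])
qed

lemma T_unique:
  assumes "T x y z" "T x y z'"
  shows "E z z'"
proof -
  obtain b where b: "T x b e" using inverse[of x] T_S[OF assms(1)] by blast
  show ?thesis
    by (rule left_cancel[OF right_inverse_cancel[OF b assms(1)] right_inverse_cancel[OF b assms(2)]])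
qed

text \<open>The axiom assumes that \<open>v\<close> composes with \<open>x\<close> to
  \<open>u\<close>. A division provides some \<open>v'\<close> with this property, and uniqueness of
  composites identifies it with \<open>v\<close>.\<close>

lemma T_assoc:
  assumes "T x y w" "T w z u" "T y z v"
  shows "T x v u"
proof -
  obtain v' where v': "T x v' u" using triangle[of x u] T_S[OF assms(1)] T_S[OF assms(2)] by blast
  have "E v v'" using T_unique[OF assms(3) tetrahedron[OF assms(1,2) v']] .
  then show ?thesis using T_cong2[OF v'] E_sym by blast
qed

text \<open>Says that \<open>r\<close> induces an isomorphism of \<open>G\<close> onto
  \<open>S\<close> modulo \<open>E\<close>, without forming that quotient. Surjectivity is required
  only up to \<open>E\<close>, and the operation only on representatives.\<close>

definition presents :: "'b set \<Rightarrow> ('b \<times> 'b) set \<Rightarrow> ('b \<Rightarrow> 's) \<Rightarrow> 'b set monoid \<Rightarrow> bool" where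
  "presents A R r G \<longleftrightarrow> R = {(a, b). a \<in> A \<and> b \<in> A \<and> E (r a) (r b)} \<and>
     r ` A \<subseteq> S \<and> (\<forall>s\<in>S. \<exists>a\<in>A. E (r a) s) \<and> carrier G = A // R \<and>
     (\<exists>a\<in>A. E (r a) e \<and> \<one>\<^bsub>G\<^esub> = R `` {a}) \<and>
     (\<forall>a\<in>A. \<forall>b\<in>A. \<exists>c\<in>A. T (r a) (r b) (r c) \<and> R `` {a} \<otimes>\<^bsub>G\<^esub> R `` {b} = R `` {c})"

lemma presentsD:
  assumes "presents A R r G"
  shows "R = {(a, b). a \<in> A \<and> b \<in> A \<and> E (r a) (r b)}"
    "a \<in> A \<Longrightarrow> r a \<in> S" "s \<in> S \<Longrightarrow> \<exists>a\<in>A. E (r a) s" "carrier G = A // R"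
    "\<exists>a\<in>A. E (r a) e \<and> \<one>\<^bsub>G\<^esub> = R `` {a}"
    "a \<in> A \<Longrightarrow> b \<in> A \<Longrightarrow> \<exists>c\<in>A. T (r a) (r b) (r c) \<and> R `` {a} \<otimes>\<^bsub>G\<^esub> R `` {b} = R `` {c}"
  using assms unfolding presents_def by (elim conjE; simp; blast)+

lemma presents_eq_iff:
  assumes "presents A R r G" "a \<in> A" "b \<in> A"
  shows "R `` {a} = R `` {b} \<longleftrightarrow> E (r a) (r b)"
proof
  have R: "(x, y) \<in> R \<longleftrightarrow> x \<in> A \<and> y \<in> A \<and> E (r x) (r y)" for x y
    by (subst presentsD(1)[OF assms(1)]) simp
  show "E (r a) (r b)" if eq: "R `` {a} = R `` {b}"
  proof -
    have "b \<in> R `` {b}" using R assms(3) left_unit presentsD(2)[OF assms(1)] by blast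
    then show ?thesis using R unfolding eq[symmetric] by blast
  qed
  show "R `` {a} = R `` {b}" if "E (r a) (r b)"
  proof -
    have "(a, c) \<in> R \<longleftrightarrow> (b, c) \<in> R" for c
      using R E_trans E_sym that assms(2,3) by blast
    then show ?thesis by blast
  qed
qed

lemma presents_mult_eq:
  assumes G: "presents A R r G" and abc: "a \<in> A" "b \<in> A" "c \<in> A" "T (r a) (r b) (r c)"
  shows "R `` {a} \<otimes>\<^bsub>G\<^esub> R `` {b} = R `` {c}"
proof -
  obtain c' where c': "c' \<in> A" "T (r a) (r b) (r c')" "R `` {a} \<otimes>\<^bsub>G\<^esub> R `` {b} = R `` {c'}"
    using presentsD(6)[OF G abc(1,2)] by blast
  then show ?thesis using presents_eq_iff[OF G c'(1) abc(3)] T_unique[OF c'(2) abc(4)] by simp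
qed

lemma presents_group:
  assumes G: "presents A R r G"
  shows "group G"
proof (rule groupI)
  note P = presentsD[OF G]
  have car: "\<exists>a\<in>A. x = R `` {a}" if "x \<in> carrier G" for x
    using that unfolding P(4) by (auto elim: quotientE)
  have cl: "R `` {a} \<in> carrier G" if "a \<in> A" for a
    unfolding P(4) using that by (rule quotientI)
  obtain a0 where a0: "a0 \<in> A" "E (r a0) e" "\<one>\<^bsub>G\<^esub> = R `` {a0}" using P(5) by blast
  show "\<one>\<^bsub>G\<^esub> \<in> carrier G" unfolding a0(3) using cl a0(1) .
  have unit: "T (r a0) (r a) (r a)" if "a \<in> A" for a
    by (rule T_cong1[OF left_unit[OF P(2)[OF that]] E_sym[OF a0(2)]])
  show "x \<otimes>\<^bsub>G\<^esub> y \<in> carrier G" if xy: "x \<in> carrier G" "y \<in> carrier G" for x y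
  proof -
    obtain a b where "a \<in> A" "x = R `` {a}" "b \<in> A" "y = R `` {b}" using car[OF xy(1)] car[OF xy(2)] by blast
    then show ?thesis using P(6)[of a b] cl by auto
  qed
  show "\<one>\<^bsub>G\<^esub> \<otimes>\<^bsub>G\<^esub> x = x" if x: "x \<in> carrier G" for x
  proof -
    obtain a where a: "a \<in> A" "x = R `` {a}" using car[OF x] by blast
    show ?thesis unfolding a0(3) a(2) by (rule presents_mult_eq[OF G a0(1) a(1) a(1) unit[OF a(1)]])
  qed
  show "x \<otimes>\<^bsub>G\<^esub> y \<otimes>\<^bsub>G\<^esub> z = x \<otimes>\<^bsub>G\<^esub> (y \<otimes>\<^bsub>G\<^esub> z)"
    if xyz: "x \<in> carrier G" "y \<in> carrier G" "z \<in> carrier G" for x y z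
  proof -
    obtain a where a: "a \<in> A" "x = R `` {a}" using car[OF xyz(1)] by blast
    obtain b where b: "b \<in> A" "y = R `` {b}" using car[OF xyz(2)] by blast
    obtain c where c: "c \<in> A" "z = R `` {c}" using car[OF xyz(3)] by blast
    obtain p where p: "p \<in> A" "T (r a) (r b) (r p)" "R `` {a} \<otimes>\<^bsub>G\<^esub> R `` {b} = R `` {p}"
      using P(6)[OF a(1) b(1)] by blast
    obtain q where q: "q \<in> A" "T (r b) (r c) (r q)" "R `` {b} \<otimes>\<^bsub>G\<^esub> R `` {c} = R `` {q}"
      using P(6)[OF b(1) c(1)] by blast
    obtain u where u: "u \<in> A" "T (r p) (r c) (r u)" "R `` {p} \<otimes>\<^bsub>G\<^esub> R `` {c} = R `` {u}"
      using P(6)[OF p(1) c(1)] by blast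
    show ?thesis
      unfolding a(2) b(2) c(2) p(3) q(3) u(3)
      by (rule presents_mult_eq[OF G a(1) q(1) u(1) T_assoc[OF p(2) u(2) q(2)], symmetric])
  qed
  show "\<exists>y\<in>carrier G. y \<otimes>\<^bsub>G\<^esub> x = \<one>\<^bsub>G\<^esub>" if x: "x \<in> carrier G" for x
  proof -
    obtain a where a: "a \<in> A" "x = R `` {a}" using car[OF x] by blast
    obtain s where s: "T s (r a) e" using inverse[OF P(2)[OF a(1)]] by blast
    obtain b where b: "b \<in> A" "E (r b) s" using P(3) T_S s by blast
    have "T (r b) (r a) (r a0)"
      by (rule T_cong3[OF T_cong1[OF s E_sym[OF b(2)]] a0(2)])
    then have "R `` {b} \<otimes>\<^bsub>G\<^esub> x = \<one>\<^bsub>G\<^esub>"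
      unfolding a(2) a0(3) by (rule presents_mult_eq[OF G b(1) a(1) a0(1)])
    then show ?thesis using cl[OF b(1)] by blast
  qed
qed

text \<open>Both groups are copies of \<open>S\<close> modulo \<open>E\<close>. A map that matches
  representatives up to \<open>E\<close> is the composite of the two identifications.\<close>

lemma presents_iso:
  assumes G: "presents A R r G" and G': "presents A' R' r' G'"
    and F: "\<And>a. a \<in> A \<Longrightarrow> \<exists>b\<in>A'. E (r a) (r' b) \<and> F (R `` {a}) = R' `` {b}"
  shows "F \<in> iso G G'"
proof -
  note P = presentsD[OF G] and P' = presentsD[OF G']
  have car: "\<exists>a\<in>A. x = R `` {a}" if "x \<in> carrier G" for x
    using that unfolding P(4) by (auto elim: quotientE)
  have car': "\<exists>a\<in>A'. x = R' `` {a}" if "x \<in> carrier G'" for x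
    using that unfolding P'(4) by (auto elim: quotientE)
  have cl: "R `` {a} \<in> carrier G" if "a \<in> A" for a
    unfolding P(4) using that by (rule quotientI)
  have cl': "R' `` {a} \<in> carrier G'" if "a \<in> A'" for a
    unfolding P'(4) using that by (rule quotientI)
  have Feq: "F (R `` {a}) = R' `` {b}" if ab: "a \<in> A" "b \<in> A'" "E (r a) (r' b)" for a b
  proof -
    obtain b' where b': "b' \<in> A'" "E (r a) (r' b')" "F (R `` {a}) = R' `` {b'}" using F[OF ab(1)] by blast
    have "E (r' b') (r' b)" by (rule E_trans[OF E_sym[OF b'(2)] ab(3)])
    then show ?thesis using presents_eq_iff[OF G' b'(1) ab(2)] b'(3) by simp
  qed
  have "F \<in> hom G G'"
  proof (rule homI)
    show "F x \<in> carrier G'" if x: "x \<in> carrier G" for x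
    proof -
      obtain a where a: "a \<in> A" "x = R `` {a}" using car[OF x] by blast
      obtain b where "b \<in> A'" "F (R `` {a}) = R' `` {b}" using F[OF a(1)] by blast
      then show ?thesis using cl' a(2) by simp
    qed
    show "F (x \<otimes>\<^bsub>G\<^esub> y) = F x \<otimes>\<^bsub>G'\<^esub> F y" if xy: "x \<in> carrier G" "y \<in> carrier G" for x y
    proof -
      obtain a where a: "a \<in> A" "x = R `` {a}" using car[OF xy(1)] by blast
      obtain b where b: "b \<in> A" "y = R `` {b}" using car[OF xy(2)] by blast
      obtain a' where a': "a' \<in> A'" "E (r a) (r' a')" "F (R `` {a}) = R' `` {a'}" using F[OF a(1)] by blast
      obtain b' where b': "b' \<in> A'" "E (r b) (r' b')" "F (R `` {b}) = R' `` {b'}" using F[OF b(1)] by blast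
      obtain c where c: "c \<in> A" "T (r a) (r b) (r c)" "R `` {a} \<otimes>\<^bsub>G\<^esub> R `` {b} = R `` {c}"
        using P(6)[OF a(1) b(1)] by blast
      obtain c' where c': "c' \<in> A'" "T (r' a') (r' b') (r' c')" "R' `` {a'} \<otimes>\<^bsub>G'\<^esub> R' `` {b'} = R' `` {c'}"
        using P'(6)[OF a'(1) b'(1)] by blast
      have "T (r' a') (r' b') (r c)" by (rule T_cong2[OF T_cong1[OF c(2) a'(2)] b'(2)])
      then have "E (r c) (r' c')" using T_unique c'(2) by blast
      then show ?thesis unfolding a(2) b(2) c(3) a'(3) b'(3) c'(3) by (rule Feq[OF c(1) c'(1)])
    qed
  qed
  moreover have "inj_on F (carrier G)"
  proof (rule inj_onI)
    fix x y assume xy: "x \<in> carrier G" "y \<in> carrier G" "F x = F y"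
    obtain a where a: "a \<in> A" "x = R `` {a}" using car[OF xy(1)] by blast
    obtain b where b: "b \<in> A" "y = R `` {b}" using car[OF xy(2)] by blast
    obtain a' where a': "a' \<in> A'" "E (r a) (r' a')" "F (R `` {a}) = R' `` {a'}" using F[OF a(1)] by blast
    obtain b' where b': "b' \<in> A'" "E (r b) (r' b')" "F (R `` {b}) = R' `` {b'}" using F[OF b(1)] by blast
    have "E (r' a') (r' b')" using presents_eq_iff[OF G' a'(1) b'(1)] xy(3) a b a'(3) b'(3) by simp
    then have "E (r a) (r b)" using a'(2) b'(2) E_trans E_sym by blast
    then show "x = y" using presents_eq_iff[OF G a(1) b(1)] a(2) b(2) by simp
  qed
  moreover have "carrier G' \<subseteq> F ` carrier G"
  proof
    fix x assume "x \<in> carrier G'"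
    then obtain b where b: "b \<in> A'" "x = R' `` {b}" using car' by blast
    obtain a where a: "a \<in> A" "E (r a) (r' b)" using P(3)[OF P'(2)[OF b(1)]] by blast
    show "x \<in> F ` carrier G"
      by (rule image_eqI[OF _ cl[OF a(1)]]) (simp add: Feq[OF a(1) b(1) a(2)] b(2))
  qed
  ultimately show ?thesis
    unfolding iso_def bij_betw_def hom_def by blast
qed

end

section \<open>The composition of loops\<close>

definition inb :: "'p::order set \<Rightarrow> 'q::order set \<Rightarrow> 'p list \<Rightarrow> 'q list \<Rightarrow> bool" where
  "inb P P' s t \<longleftrightarrow> srt s \<and> srt t \<and> set s \<subseteq> P \<and> set t \<subseteq> P'"

lemma inb_map: "\<lbrakk>inb Q Q' s t; mono c; mono c'; c ` Q \<subseteq> P; c' ` Q' \<subseteq> P'\<rbrakk> \<Longrightarrow> inb P P' (map c s) (map c' t)"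
  by (simp add: inb_def srt_map) blast

lemma inb_mono: "inb P P' s t \<Longrightarrow> P \<subseteq> Q \<Longrightarrow> P' \<subseteq> Q' \<Longrightarrow> inb Q Q' s t"
  by (auto simp: inb_def)

abbreviation Bx where "Bx X P P' \<equiv> bx X (\<lambda>\<sigma> \<sigma>'. \<sigma> \<subseteq> P \<and> \<sigma>' \<subseteq> P')"

lemma Bx_pull:
  assumes "Bx X P P' \<chi>" "mono c" "mono c'" "c ` Q \<subseteq> P" "c' ` Q' \<subseteq> P'"
  shows "Bx X Q Q' (\<lambda>s t. \<chi> (map c s) (map c' t))"
  by (rule bx_mono[OF bx_pull[OF assms(1-3)]]) (use assms(4,5) in blast)

lemma Bx_mono: "Bx X P P' \<chi> \<Longrightarrow> Q \<subseteq> P \<Longrightarrow> Q' \<subseteq> P' \<Longrightarrow> Bx X Q Q' \<chi>"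
  by (erule bx_mono) blast

text \<open>The arguments are the base vertices and the levels that occur in the first direction,
  then those in the second.\<close>

type_synonym occ = "nat set \<Rightarrow> nat set \<Rightarrow> nat set \<Rightarrow> nat set \<Rightarrow> bool"

definition occ_of :: "occ \<Rightarrow> (nat \<times> nat) list \<Rightarrow> (nat \<times> nat) list \<Rightarrow> bool" where
  "occ_of Q s t = Q (fst ` set s) (snd ` set s) (fst ` set t) (snd ` set t)"

text \<open>What \<open>fill_prod\<close> needs of each piece: it is a bisimplicial subset, and the
  occurrence of level \<open>f\<close> does not matter.\<close>

definition admissible :: "nat \<Rightarrow> occ \<Rightarrow> bool" where
  "admissible f Q \<longleftrightarrow>
    (\<forall>A B A' B' A1 B1 A1' B1'. Q A B A' B' \<longrightarrow> A1 \<subseteq> A \<longrightarrow> B1 \<subseteq> B \<longrightarrow> A1' \<subseteq> A' \<longrightarrow> B1' \<subseteq> B' \<longrightarrow> Q A1 B1 A1' B1') \<and>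
    (\<forall>A B A' B'. Q A B A' B' \<longrightarrow> Q A (insert f B) A' (insert f B'))"

lemma admissibleD:
  assumes "admissible f Q" "Q A B A' B'"
  shows "\<lbrakk>A1 \<subseteq> A; B1 \<subseteq> B; A1' \<subseteq> A'; B1' \<subseteq> B'\<rbrakk> \<Longrightarrow> Q A1 B1 A1' B1'"
    "Q A (insert f B) A' (insert f B')"
proof -
  note * = assms(1)[unfolded admissible_def]
  show "Q A1 B1 A1' B1'" if "A1 \<subseteq> A" "B1 \<subseteq> B" "A1' \<subseteq> A'" "B1' \<subseteq> B'"
    by (rule *[THEN conjunct1, rule_format, OF assms(2) that])
  show "Q A (insert f B) A' (insert f B')"
    by (rule *[THEN conjunct2, rule_format, OF assms(2)])
qed

text \<open>Pieces that agree on overlaps glue to one natural map by \<open>bx_local\<close>, and a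
  union of admissible pieces is again of the form required by \<open>fill_prod\<close>.\<close>

lemma (in kan_bisset) fill_pieces:
  fixes L :: "(occ \<times> ((nat \<times> nat) list \<Rightarrow> (nat \<times> nat) list \<Rightarrow> 'a)) list"
  assumes bx: "\<And>Q \<chi>. (Q, \<chi>) \<in> set L \<Longrightarrow> Bx X ({..m} \<times> {..f}) ({..n} \<times> {..f}) \<chi>"
    and adm: "\<And>Q \<chi>. (Q, \<chi>) \<in> set L \<Longrightarrow> admissible f Q"
    and compat: "sorted_wrt (\<lambda>(Q, \<chi>) (Q', \<chi>'). \<forall>s t. inb ({..m} \<times> {..f}) ({..n} \<times> {..f}) s t \<longrightarrow>
      occ_of Q s t \<longrightarrow> occ_of Q' s t \<longrightarrow> \<chi> s t = \<chi>' s t) L"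
    and top: "\<And>A B A' B'. B = {f} \<or> B' = {f} \<Longrightarrow> \<exists>(Q, \<chi>)\<in>set L. Q A B A' B'"
  obtains \<psi> where "Bx X ({..m} \<times> {..f}) ({..n} \<times> {..f}) \<psi>"
    "\<And>Q \<chi> s t. \<lbrakk>(Q, \<chi>) \<in> set L; inb ({..m} \<times> {..f}) ({..n} \<times> {..f}) s t; occ_of Q s t\<rbrakk> \<Longrightarrow> \<psi> s t = \<chi> s t"
proof -
  let ?in = "inb ({..m} \<times> {..f}) ({..n} \<times> {..f})"
  have com: "\<chi> s t = \<chi>' s t"
    if com: "(Q, \<chi>) \<in> set L" "(Q', \<chi>') \<in> set L" "?in s t" "occ_of Q s t" "occ_of Q' s t" for Q \<chi> Q' \<chi>' s t
  proof -
    obtain i j where ij: "i < length L" "L ! i = (Q, \<chi>)" "j < length L" "L ! j = (Q', \<chi>')"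
      using com(1,2) by (metis in_set_conv_nth)
    consider "i < j" | "j < i" | "i = j" by linarith
    then show ?thesis
    proof cases
      case 1
      from sorted_wrt_nth_less[OF compat 1 ij(3)] show ?thesis using com(3-5) ij(2,4) by simp
    next
      case 2
      from sorted_wrt_nth_less[OF compat 2 ij(1)] show ?thesis using com(3-5) ij(2,4) by simp
    qed (use ij in simp)
  qed
  \<comment> \<open>Any piece containing the pair may be chosen, by compatibility.\<close>
  define \<phi> where "\<phi> s t = snd (SOME p. p \<in> set L \<and> occ_of (fst p) s t) s t" for s t
  have \<phi>: "\<phi> s t = \<chi> s t" if p: "(Q, \<chi>) \<in> set L" "?in s t" "occ_of Q s t" for Q \<chi> s t
  proof -
    let ?p = "SOME p. p \<in> set L \<and> occ_of (fst p) s t"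
    have "?p \<in> set L \<and> occ_of (fst ?p) s t"
      by (rule someI[of "\<lambda>p. p \<in> set L \<and> occ_of (fst p) s t" "(Q, \<chi>)"]) (use p in simp)
    then show ?thesis unfolding \<phi>_def using com[OF _ p(1,2) _ p(3), of "fst ?p" "snd ?p"] by simp
  qed
  define Q0 where "Q0 A B A' B' \<longleftrightarrow> (\<exists>(Q, \<chi>)\<in>set L. Q A B A' B')" for A B A' B'
  have "bx X (\<lambda>\<sigma> \<sigma>'. \<sigma> \<subseteq> {..m} \<times> {..f} \<and> \<sigma>' \<subseteq> {..n} \<times> {..f} \<and> Q0 (fst ` \<sigma>) (snd ` \<sigma>) (fst ` \<sigma>') (snd ` \<sigma>')) \<phi>"
  proof (rule bx_local)
    fix s t :: "(nat \<times> nat) list"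
    assume st: "srt s" "srt t" "set s \<subseteq> {..m} \<times> {..f} \<and> set t \<subseteq> {..n} \<times> {..f} \<and>
      Q0 (fst ` set s) (snd ` set s) (fst ` set t) (snd ` set t)"
    then obtain Q \<chi> where Q: "(Q, \<chi>) \<in> set L" "Q (fst ` set s) (snd ` set s) (fst ` set t) (snd ` set t)"
      unfolding Q0_def by blast
    let ?E = "\<lambda>\<sigma> \<sigma>'. \<sigma> \<subseteq> {..m} \<times> {..f} \<and> \<sigma>' \<subseteq> {..n} \<times> {..f} \<and> Q (fst ` \<sigma>) (snd ` \<sigma>) (fst ` \<sigma>') (snd ` \<sigma>')"
    have "down ?E"
      unfolding down_def
    proof (intro allI impI conjI; elim conjE)
      fix \<sigma> \<sigma>' \<tau> \<tau>' :: "(nat \<times> nat) set"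
      assume *: "Q (fst ` \<sigma>) (snd ` \<sigma>) (fst ` \<sigma>') (snd ` \<sigma>')" and sub: "\<tau> \<subseteq> \<sigma>" "\<tau>' \<subseteq> \<sigma>'"
      show "Q (fst ` \<tau>) (snd ` \<tau>) (fst ` \<tau>') (snd ` \<tau>')"
        by (rule admissibleD(1)[OF adm[OF Q(1)] *]) (simp_all add: image_mono sub)
    qed blast+
    moreover have "bx X ?E \<chi>" by (rule bx_mono[OF bx[OF Q(1)]]) blast
    moreover have "\<forall>s t. srt s \<longrightarrow> srt t \<longrightarrow> ?E (set s) (set t) \<longrightarrow> \<phi> s t = \<chi> s t"
      using \<phi>[OF Q(1)] by (simp add: inb_def occ_of_def)
    ultimately show "\<exists>E \<chi>. E (set s) (set t) \<and> down E \<and> bx X E \<chi> \<and>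
        (\<forall>s t. srt s \<longrightarrow> srt t \<longrightarrow> E (set s) (set t) \<longrightarrow> \<phi> s t = \<chi> s t)"
      using st(3) Q(2) by (intro exI[of _ ?E] exI[of _ \<chi>]) blast
  qed
  then obtain \<psi> where \<psi>: "Bx X ({..m} \<times> {..f}) ({..n} \<times> {..f}) \<psi>"
    "\<And>s t. \<lbrakk>srt s; srt t; set s \<subseteq> {..m} \<times> {..f}; set t \<subseteq> {..n} \<times> {..f};
      Q0 (fst ` set s) (snd ` set s) (fst ` set t) (snd ` set t)\<rbrakk> \<Longrightarrow> \<psi> s t = \<phi> s t"
  proof (rule fill_prod)
    fix A B A' B' A1 B1 A1' B1'
    assume "Q0 A B A' B'" and sub: "A1 \<subseteq> A" "B1 \<subseteq> B" "A1' \<subseteq> A'" "B1' \<subseteq> B'"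
    then obtain Q \<chi> where "(Q, \<chi>) \<in> set L" "Q A B A' B'" unfolding Q0_def by blast
    then show "Q0 A1 B1 A1' B1'" unfolding Q0_def using admissibleD(1)[OF adm _ sub] by blast
  next
    fix A B A' B' assume "Q0 A B A' B'"
    then obtain Q \<chi> where "(Q, \<chi>) \<in> set L" "Q A B A' B'" unfolding Q0_def by blast
    then show "Q0 A (insert f B) A' (insert f B')" unfolding Q0_def using admissibleD(2)[OF adm] by blast
  qed (simp_all add: Q0_def top)
  show thesis
  proof (rule that[OF \<psi>(1)])
    fix Q \<chi> s t assume *: "(Q, \<chi>) \<in> set L" "?in s t" "occ_of Q s t"
    then have "\<psi> s t = \<phi> s t" by (intro \<psi>(2)) (auto simp: inb_def occ_of_def Q0_def)
    then show "\<psi> s t = \<chi> s t" using \<phi>[OF *] by simp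
  qed
qed

text \<open>The shapes of all prescribed pieces: the part over the boundary of the base, a face in
  either direction, a corner in the levels, and a corner in the base. Only the level
  \<open>f\<close> to be filled must not be mentioned.\<close>

lemma admissibleI:
  "admissible f (\<lambda>A B A' B'. \<not> P \<subseteq> A \<or> \<not> P' \<subseteq> A')"
  "f \<noteq> j \<Longrightarrow> admissible f (\<lambda>A B A' B'. j \<notin> B \<or> j \<notin> B')"
  "f \<noteq> j \<Longrightarrow> admissible f (\<lambda>A B A' B'. j \<notin> B \<and> j \<notin> B')"
  "admissible f (\<lambda>A B A' B'. a \<notin> A \<and> a' \<notin> A')"
  unfolding admissible_def by blast+

text \<open>On levels this is the codegeneracy taking the value 0 twice. It inverts the cofaces
  omitting 0 and 1, so it reads off both of these faces. Where only one direction omits level 0, it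
  degenerates in the other one, as the prescribed faces of the Aeppli product do.\<close>

definition dec :: "nat \<times> nat \<Rightarrow> nat \<times> nat" where "dec p = (fst p, snd p - 1)"

text \<open>On levels up to \<open>k + 1\<close> this is the codegeneracy taking the value
  \<open>k\<close> twice; it inverts the cofaces omitting \<open>k\<close> and
  \<open>k + 1\<close>.\<close>

definition cap :: "nat \<Rightarrow> nat \<times> nat \<Rightarrow> nat \<times> nat" where "cap k p = (fst p, min k (snd p))"

lemma mono_dec [simp]: "mono dec" by (auto simp: mono_def dec_def less_eq_prod_def)

lemma mono_cap [simp]: "mono (cap k)" by (auto simp: mono_def cap_def less_eq_prod_def)

lemma fst_dec [simp]: "fst ` dec ` \<sigma> = fst ` \<sigma>" "fst ` cap k ` \<sigma> = fst ` \<sigma>"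
  by (auto simp: dec_def cap_def image_image)

lemma miss_map: "j \<notin> snd ` set (map c s) \<longleftrightarrow> (\<forall>p\<in>set s. snd (c p) \<noteq> j)"
  by auto

lemma miss: "j \<notin> snd ` set s \<longleftrightarrow> (\<forall>p\<in>set s. snd p \<noteq> j)"
  by auto

locale loops = kan_bisset X pt for X :: "'a bisset" and pt +
  fixes m n :: nat
begin

abbreviation gin :: "nat \<Rightarrow> (nat \<times> nat) list \<Rightarrow> (nat \<times> nat) list \<Rightarrow> bool" where
  "gin f \<equiv> inb ({..m} \<times> {..f}) ({..n} \<times> {..f})"

abbreviation gbx where "gbx f \<equiv> Bx X ({..m} \<times> {..f}) ({..n} \<times> {..f})"

text \<open>Not covering: over the base \<open>{..m}\<close>, \<open>{..n}\<close> this means lying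
  over \<open>bdelta m n\<close>. It is also used over \<open>{..Suc m}\<close>,
  \<open>{..Suc n}\<close>, where it means lying over the horn
  \<open>bLam (Suc m) (Suc n)\<close>.\<close>

definition nc :: "(nat \<times> 'p) list \<Rightarrow> (nat \<times> 'q) list \<Rightarrow> bool" where
  "nc s t \<longleftrightarrow> \<not> {..m} \<subseteq> fst ` set s \<or> \<not> {..n} \<subseteq> fst ` set t"

text \<open>\<open>loop\<close> describes the maps \<open>\<Delta>\<^sup>m\<^sup>,\<^sup>n \<times> \<Delta>\<^sup>1\<^sup>,\<^sup>1 \<rightarrow> X\<close> that correspond to maps \<open>\<Delta>\<^sup>m\<^sup>,\<^sup>n \<rightarrow> \<Omega>X\<close> relative
  to the boundary, and \<open>\<theta>\<close> in \<open>comp_by\<close> a map \<open>\<Delta>\<^sup>m\<^sup>,\<^sup>n \<times> \<Delta>\<^sup>2\<^sup>,\<^sup>2 \<rightarrow> X\<close> that defines a composite.\<close>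

definition loop :: "((nat \<times> nat) list \<Rightarrow> (nat \<times> nat) list \<Rightarrow> 'a) \<Rightarrow> bool" where
  "loop x \<longleftrightarrow> gbx 1 x \<and> (\<forall>s t. gin 1 s t \<longrightarrow>
     nc s t \<or> 0 \<notin> snd ` set s \<or> 0 \<notin> snd ` set t \<or> 1 \<notin> snd ` set s \<and> 1 \<notin> snd ` set t \<longrightarrow>
     x s t = star s t)"

definition comp_by where
  "comp_by \<theta> x y z \<longleftrightarrow> gbx 2 \<theta> \<and> (\<forall>s t. gin 2 s t \<longrightarrow>
     (nc s t \<longrightarrow> \<theta> s t = star s t) \<and>
     (0 \<notin> snd ` set s \<or> 0 \<notin> snd ` set t \<longrightarrow> \<theta> s t = x (map dec s) (map dec t)) \<and>
     (2 \<notin> snd ` set s \<and> 2 \<notin> snd ` set t \<longrightarrow> \<theta> s t = y s t) \<and>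
     (1 \<notin> snd ` set s \<and> 1 \<notin> snd ` set t \<longrightarrow> \<theta> s t = z (map dec s) (map dec t)))"

definition T where "T x y z \<longleftrightarrow> loop x \<and> loop y \<and> loop z \<and> (\<exists>\<theta>. comp_by \<theta> x y z)"

lemma loop_star:
  assumes "loop x" "gin 1 s t"
    "nc s t \<or> 0 \<notin> snd ` set s \<or> 0 \<notin> snd ` set t \<or> 1 \<notin> snd ` set s \<and> 1 \<notin> snd ` set t"
  shows "x s t = star s t"
  using assms unfolding loop_def by blast

lemma loop_bx: "loop x \<Longrightarrow> gbx 1 x"
  unfolding loop_def by blast

lemma comp_byD:
  assumes "comp_by \<theta> x y z"
  shows "gbx 2 \<theta>" "gin 2 s t \<Longrightarrow> nc s t \<Longrightarrow> \<theta> s t = star s t"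
    "gin 2 s t \<Longrightarrow> 0 \<notin> snd ` set s \<or> 0 \<notin> snd ` set t \<Longrightarrow> \<theta> s t = x (map dec s) (map dec t)"
    "gin 2 s t \<Longrightarrow> 2 \<notin> snd ` set s \<Longrightarrow> 2 \<notin> snd ` set t \<Longrightarrow> \<theta> s t = y s t"
    "gin 2 s t \<Longrightarrow> 1 \<notin> snd ` set s \<Longrightarrow> 1 \<notin> snd ` set t \<Longrightarrow> \<theta> s t = z (map dec s) (map dec t)"
  using assms unfolding comp_by_def by blast+

lemma gin_dec: "gin (Suc f) s t \<Longrightarrow> gin f (map dec s) (map dec t)"
  by (erule inb_map) (auto simp: dec_def)

lemma gin_cap: "gin g s t \<Longrightarrow> gin f (map (cap f) s) (map (cap f) t)"
  by (erule inb_map) (auto simp: cap_def)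

lemma gbx_dec: "gbx f x \<Longrightarrow> gbx (Suc f) (\<lambda>s t. x (map dec s) (map dec t))"
  by (erule Bx_pull) (auto simp: dec_def)

lemma gbx_cap: "gbx f x \<Longrightarrow> gbx g (\<lambda>s t. x (map (cap f) s) (map (cap f) t))"
  by (erule Bx_pull) (auto simp: cap_def)

lemma gin_mono: "gin f s t \<Longrightarrow> f \<le> g \<Longrightarrow> gin g s t"
  by (erule inb_mono) auto

lemma gbx_mono: "gbx g x \<Longrightarrow> f \<le> g \<Longrightarrow> gbx f x"
  by (erule Bx_mono) auto

lemma gin_le: "gin f s t \<Longrightarrow> (\<forall>p\<in>set s. snd p \<le> f) \<and> (\<forall>p\<in>set t. snd p \<le> f)"
  by (auto simp: inb_def)

lemma nc_map [simp]:
  "nc (map dec s) (map dec t) = nc s t" "nc (map (cap f) s) (map (cap f) t) = nc s t"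
  by (simp_all add: nc_def)

section \<open>Units, left division and the tetrahedron law for loops\<close>

lemma loop_star_const: "loop star"
  by (simp add: loop_def bx_star)

text \<open>The degeneracy of \<open>x\<close> along \<open>dec\<close> is the filler: without level
  2 only level 0 remains after \<open>dec\<close>, where a loop is trivial.\<close>

lemma T_right_unit:
  assumes x: "loop x" shows "T x star x"
proof -
  have "comp_by (\<lambda>s t. x (map dec s) (map dec t)) x star x"
    unfolding comp_by_def
  proof (intro conjI allI impI)
    show "gbx 2 (\<lambda>s t. x (map dec s) (map dec t))" using gbx_dec[OF loop_bx[OF x]] by (simp add: numeral_2_eq_2)
    fix s t assume "gin 2 s t"
    then have g: "gin 1 (map dec s) (map dec t)"
      and le: "\<forall>p\<in>set s. snd p \<le> 2" "\<forall>p\<in>set t. snd p \<le> 2"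
      using gin_dec[of 1 s t] gin_le[of 2 s t] by (simp_all add: numeral_2_eq_2)
    show "x (map dec s) (map dec t) = star s t" if "nc s t"
      using loop_star[OF x g] that by simp
    show "x (map dec s) (map dec t) = star s t" if "2 \<notin> snd ` set s \<and> 2 \<notin> snd ` set t"
    proof -
      have "1 \<notin> snd ` set (map dec s)" "1 \<notin> snd ` set (map dec t)"
        using that le unfolding miss_map miss by (force simp: dec_def)+
      then show ?thesis using loop_star[OF x g] by simp
    qed
  qed auto
  then show ?thesis using x loop_star_const unfolding T_def by blast
qed

end

context loops
begin

lemma gin_dec2: "gin 2 s t \<Longrightarrow> gin 1 (map dec s) (map dec t)"
  and gin_dec3: "gin 3 s t \<Longrightarrow> gin 2 (map dec s) (map dec t)"
  using gin_dec[of 1 s t] gin_dec[of 2 s t] by (simp_all add: numeral_2_eq_2 numeral_3_eq_3)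

lemma gbx_dec2: "gbx 1 x \<Longrightarrow> gbx 2 (\<lambda>s t. x (map dec s) (map dec t))"
  and gbx_dec3: "gbx 2 x \<Longrightarrow> gbx 3 (\<lambda>s t. x (map dec s) (map dec t))"
  using gbx_dec[of 1 x] gbx_dec[of 2 x] by (simp_all add: numeral_2_eq_2 numeral_3_eq_3)

text \<open>The other degeneracy, along \<open>cap 1\<close>: without level 0 in one direction only
  level 1 remains there, where a loop is trivial.\<close>

lemma T_left_unit:
  assumes x: "loop x" shows "T star x x"
proof -
  have "comp_by (\<lambda>s t. x (map (cap 1) s) (map (cap 1) t)) star x x"
    unfolding comp_by_def
  proof (intro conjI allI impI)
    show "gbx 2 (\<lambda>s t. x (map (cap 1) s) (map (cap 1) t))" by (rule gbx_cap[OF loop_bx[OF x]])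
    fix s t assume gin: "gin 2 s t"
    have g: "gin 1 (map (cap 1) s) (map (cap 1) t)" by (rule gin_cap[OF gin])
    have le: "\<forall>p\<in>set s. snd p \<le> 2" "\<forall>p\<in>set t. snd p \<le> 2" using gin_le[OF gin] by simp_all
    show "x (map (cap 1) s) (map (cap 1) t) = star s t" if "nc s t"
      using loop_star[OF x g] that by simp
    show "x (map (cap 1) s) (map (cap 1) t) = star (map dec s) (map dec t)"
      if "0 \<notin> snd ` set s \<or> 0 \<notin> snd ` set t"
    proof -
      have "0 \<notin> snd ` set (map (cap 1) s) \<or> 0 \<notin> snd ` set (map (cap 1) t)"
        using that unfolding miss_map miss by (auto simp: cap_def)
      then have "x (map (cap 1) s) (map (cap 1) t) = star (map (cap 1) s) (map (cap 1) t)"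
        using loop_star[OF x g] by blast
      then show ?thesis by simp
    qed
    show "x (map (cap 1) s) (map (cap 1) t) = x s t" if "2 \<notin> snd ` set s \<and> 2 \<notin> snd ` set t"
    proof -
      have "map (cap 1) s = s" "map (cap 1) t = t"
        using that le unfolding miss by (force simp: cap_def intro!: map_idI)+
      then show ?thesis by simp
    qed
    show "x (map (cap 1) s) (map (cap 1) t) = x (map dec s) (map dec t)"
      if "1 \<notin> snd ` set s \<and> 1 \<notin> snd ` set t"
    proof -
      have "map (cap 1) s = map dec s" "map (cap 1) t = map dec t"
        using that le unfolding miss by (force simp: cap_def dec_def)+
      then show ?thesis by (simp only:)
    qed
  qed
  then show ?thesis using x loop_star_const unfolding T_def by blast
qed

text \<open>Without level 2 in both directions, only level 0 remains after \<open>dec\<close>;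
  without levels 0 and 1 in one direction, only level 1 remains there. Hence loops prescribed on
  different faces agree on overlaps, being trivial.\<close>

lemma dec_star:
  assumes "loop x" "gin 2 s t" "nc s t \<or> (2 \<notin> snd ` set s \<and> 2 \<notin> snd ` set t) \<or>
    (1 \<notin> snd ` set s \<and> 1 \<notin> snd ` set t \<and> (0 \<notin> snd ` set s \<or> 0 \<notin> snd ` set t))"
  shows "x (map dec s) (map dec t) = star s t"
proof -
  have le: "\<forall>p\<in>set s. snd p \<le> 2" "\<forall>p\<in>set t. snd p \<le> 2" using gin_le[OF assms(2)] by simp_all
  consider "nc s t" | "2 \<notin> snd ` set s" "2 \<notin> snd ` set t" | "1 \<notin> snd ` set s" "0 \<notin> snd ` set s"
    | "1 \<notin> snd ` set t" "0 \<notin> snd ` set t"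
    using assms(3) by blast
  then have "nc (map dec s) (map dec t) \<or> 0 \<notin> snd ` set (map dec s) \<or> 0 \<notin> snd ` set (map dec t) \<or>
      1 \<notin> snd ` set (map dec s) \<and> 1 \<notin> snd ` set (map dec t)"
  proof cases
    case 2
    then have "1 \<notin> snd ` set (map dec s) \<and> 1 \<notin> snd ` set (map dec t)"
      using le unfolding miss_map miss by (force simp: dec_def)
    then show ?thesis by blast
  next
    case 3
    then have "0 \<notin> snd ` set (map dec s)"
      unfolding miss_map miss by (force simp: dec_def)
    then show ?thesis by blast
  next
    case 4
    then have "0 \<notin> snd ` set (map dec t)"
      unfolding miss_map miss by (force simp: dec_def)
    then show ?thesis by blast
  qed simp
  then show ?thesis using loop_star[OF assms(1) gin_dec2[OF assms(2)]] by simp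
qed

text \<open>Prescribed are the face opposite level 0, read from \<open>x\<close>, the corner
  opposite level 1, read from \<open>z\<close>, and the part over the boundary. Filling toggles
  level 2 and supplies the corner opposite it.\<close>

lemma T_triangle:
  assumes x: "loop x" and z: "loop z"
  shows "\<exists>y. T x y z"
proof -
  let ?x = "\<lambda>s t. x (map dec s) (map dec t)" and ?z = "\<lambda>s t. z (map dec s) (map dec t)"
  let ?Qn = "\<lambda>A B A' B'. \<not> {..m} \<subseteq> A \<or> \<not> {..n} \<subseteq> A'" and ?Qa = "\<lambda>A B A' B'. 0 \<notin> B \<or> 0 \<notin> B'"
    and ?Qb = "\<lambda>A B A' B'. 1 \<notin> B \<and> 1 \<notin> B'"
  let ?L = "[(?Qn, star), (?Qa, ?x), (?Qb, ?z)] :: (occ \<times> ((nat \<times> nat) list \<Rightarrow> (nat \<times> nat) list \<Rightarrow> 'a)) list"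
  have "gbx 2 ?x" "gbx 2 ?z" by (rule gbx_dec2[OF loop_bx[OF x]] gbx_dec2[OF loop_bx[OF z]])+
  then have bx: "gbx 2 \<chi>" if "(Q, \<chi>) \<in> set ?L" for Q \<chi>
    using that by (auto simp: bx_star)
  have adm: "admissible 2 Q" if "(Q, \<chi>) \<in> set ?L" for Q and \<chi> :: "(nat \<times> nat) list \<Rightarrow> (nat \<times> nat) list \<Rightarrow> 'a"
    using that by (auto intro: admissibleI simp del: de_Morgan_conj de_Morgan_disj imp_conv_disj disj_not1 disj_not2)
  have com: "sorted_wrt (\<lambda>(Q, \<chi>) (Q', \<chi>'). \<forall>s t. gin 2 s t \<longrightarrow>
      occ_of Q s t \<longrightarrow> occ_of Q' s t \<longrightarrow> \<chi> s t = \<chi>' s t) ?L"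
  proof -
    have "star s t = ?x s t" "star s t = ?z s t" if "gin 2 s t" "nc s t" for s t
      using dec_star[OF x that(1)] dec_star[OF z that(1)] that(2) by simp_all
    moreover have "?x s t = ?z s t"
      if "gin 2 s t" "0 \<notin> snd ` set s \<or> 0 \<notin> snd ` set t" "1 \<notin> snd ` set s \<and> 1 \<notin> snd ` set t" for s t
      using dec_star[OF x that(1)] dec_star[OF z that(1)] that(2,3) by simp
    ultimately show ?thesis by (simp add: occ_of_def nc_def)
  qed
  obtain \<psi> where \<psi>: "gbx 2 \<psi>"
      "\<And>Q \<chi> s t. \<lbrakk>(Q, \<chi>) \<in> set ?L; gin 2 s t; occ_of Q s t\<rbrakk> \<Longrightarrow> \<psi> s t = \<chi> s t"
    by (rule fill_pieces[OF bx adm com]) auto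
  have v: "\<psi> s t = star s t" if "gin 2 s t" "nc s t" for s t
    by (rule \<psi>(2)[of ?Qn]) (use that in \<open>simp_all add: occ_of_def nc_def\<close>)
  have v0: "\<psi> s t = ?x s t" if "gin 2 s t" "0 \<notin> snd ` set s \<or> 0 \<notin> snd ` set t" for s t
    by (rule \<psi>(2)[of ?Qa]) (use that in \<open>simp_all add: occ_of_def\<close>)
  have v1: "\<psi> s t = ?z s t" if "gin 2 s t" "1 \<notin> snd ` set s \<and> 1 \<notin> snd ` set t" for s t
    by (rule \<psi>(2)[of ?Qb]) (use that in \<open>simp_all add: occ_of_def\<close>)
  have "loop \<psi>"
    unfolding loop_def
  proof (intro conjI allI impI)
    show "gbx 1 \<psi>" by (rule gbx_mono[OF \<psi>(1)]) simp
    fix s t assume g1: "gin 1 s t"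
      and c: "nc s t \<or> 0 \<notin> snd ` set s \<or> 0 \<notin> snd ` set t \<or> 1 \<notin> snd ` set s \<and> 1 \<notin> snd ` set t"
    have g: "gin 2 s t" by (rule gin_mono[OF g1]) simp
    have two: "2 \<notin> snd ` set s \<and> 2 \<notin> snd ` set t" using gin_le[OF g1] by fastforce
    show "\<psi> s t = star s t"
      using c v[OF g] v0[OF g] v1[OF g] dec_star[OF x g] dec_star[OF z g] two by metis
  qed
  \<comment> \<open>The corner opposite level 2 needs no renumbering: on levels 0 and 1 the filler
    itself is the quotient sought.\<close>
  moreover have "comp_by \<psi> x \<psi> z"
    unfolding comp_by_def using \<psi>(1) v v0 v1 by simp
  ultimately show ?thesis unfolding T_def using x z by blast
qed

end

context loops
begin

text \<open>Levels 0 to 3 form a tetrahedron with \<open>a\<close>, \<open>c\<close>,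
  \<open>b\<close> opposite 0, 1, 2. They match along the shared edges: \<open>a\<close> and
  \<open>b\<close> along \<open>w\<close>, \<open>a\<close> and \<open>c\<close> along
  \<open>x\<close>, \<open>b\<close> and \<open>c\<close> along \<open>u\<close>. The face that
  comes out opposite 3 has the remaining edges \<open>y\<close>, \<open>z\<close>,
  \<open>v\<close>.\<close>

lemma T_tetrahedron:
  assumes T: "T x y w" "T w z u" "T x v u"
  shows "T y z v"
proof -
  obtain a b c where a: "comp_by a x y w" and b: "comp_by b w z u" and c: "comp_by c x v u"
    using T unfolding T_def by blast
  have lp: "loop x" "loop y" "loop z" "loop v" "loop w" "loop u" using T unfolding T_def by blast+
  note A = comp_byD[OF a] and B = comp_byD[OF b] and C = comp_byD[OF c]
  let ?a = "\<lambda>s t. a (map dec s) (map dec t)" and ?b = "\<lambda>s t. b (map (cap 2) s) (map (cap 2) t)"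
    and ?c = "\<lambda>s t. c (map dec s) (map dec t)"
  let ?Qn = "\<lambda>A B A' B'. \<not> {..m} \<subseteq> A \<or> \<not> {..n} \<subseteq> A'" and ?Qa = "\<lambda>A B A' B'. 0 \<notin> B \<or> 0 \<notin> B'"
    and ?Qb = "\<lambda>A B A' B'. 2 \<notin> B \<and> 2 \<notin> B'" and ?Qc = "\<lambda>A B A' B'. 1 \<notin> B \<and> 1 \<notin> B'"
  let ?L = "[(?Qn, star), (?Qa, ?a), (?Qb, ?b), (?Qc, ?c)] :: (occ \<times> ((nat \<times> nat) list \<Rightarrow> (nat \<times> nat) list \<Rightarrow> 'a)) list"
  have "gbx 3 ?a" "gbx 3 ?b" "gbx 3 ?c"
    by (rule gbx_dec3[OF A(1)] gbx_cap[OF B(1)] gbx_dec3[OF C(1)])+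
  then have bx: "gbx 3 \<chi>" if "(Q, \<chi>) \<in> set ?L" for Q \<chi>
    using that by (auto simp: bx_star)
  have adm: "admissible 3 Q" if "(Q, \<chi>) \<in> set ?L" for Q and \<chi> :: "(nat \<times> nat) list \<Rightarrow> (nat \<times> nat) list \<Rightarrow> 'a"
    using that by (auto intro: admissibleI simp del: de_Morgan_conj de_Morgan_disj imp_conv_disj disj_not1 disj_not2)
  \<comment> \<open>A simplicial identity: both composites send levels 0, 1, 3 to 0, 0, 1.\<close>
  have dd: "map dec (map dec r) = map dec (map (cap 2) r)"
    if "\<forall>p\<in>set r. snd p \<le> 3" "2 \<notin> snd ` set r" for r
    using that unfolding miss by (force simp: dec_def cap_def)
  have n: "?a s t = star s t" "?b s t = star s t" "?c s t = star s t" if "gin 3 s t" "nc s t" for s t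
    using A(2)[OF gin_dec3[OF that(1)]] B(2)[OF gin_cap[OF that(1)]] C(2)[OF gin_dec3[OF that(1)]] that(2)
    by simp_all
  have ab: "?a s t = ?b s t" if g: "gin 3 s t" and h: "0 \<notin> snd ` set s \<or> 0 \<notin> snd ` set t" "2 \<notin> snd ` set s \<and> 2 \<notin> snd ` set t" for s t
  proof -
    have "1 \<notin> snd ` set (map dec s)" "1 \<notin> snd ` set (map dec t)"
      using h(2) unfolding miss_map miss by (force simp: dec_def)+
    then have "?a s t = w (map dec (map dec s)) (map dec (map dec t))" by (rule A(5)[OF gin_dec3[OF g]])
    also have "\<dots> = w (map dec (map (cap 2) s)) (map dec (map (cap 2) t))"
      using dd[of s] dd[of t] gin_le[OF g] h(2) by presburger
    also have "0 \<notin> snd ` set (map (cap 2) s) \<or> 0 \<notin> snd ` set (map (cap 2) t)"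
      using h(1) unfolding miss_map miss by (auto simp: cap_def)
    then have "w (map dec (map (cap 2) s)) (map dec (map (cap 2) t)) = ?b s t"
      by (rule B(3)[OF gin_cap[OF g], symmetric])
    finally show ?thesis .
  qed
  have ac: "?a s t = ?c s t" if g: "gin 3 s t" and h: "0 \<notin> snd ` set s \<or> 0 \<notin> snd ` set t" "1 \<notin> snd ` set s \<and> 1 \<notin> snd ` set t" for s t
  proof -
    have z: "0 \<notin> snd ` set (map dec s) \<or> 0 \<notin> snd ` set (map dec t)"
      using h unfolding miss_map miss by (force simp: dec_def)
    show ?thesis using A(3)[OF gin_dec3[OF g] z] C(3)[OF gin_dec3[OF g] z] by simp
  qed
  have bc: "?b s t = ?c s t" if g: "gin 3 s t" and h: "2 \<notin> snd ` set s \<and> 2 \<notin> snd ` set t" "1 \<notin> snd ` set s \<and> 1 \<notin> snd ` set t" for s t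
  proof -
    have c1: "1 \<notin> snd ` set (map dec s)" "1 \<notin> snd ` set (map dec t)"
      using h(1) unfolding miss_map miss by (force simp: dec_def)+
    have b1: "1 \<notin> snd ` set (map (cap 2) s)" "1 \<notin> snd ` set (map (cap 2) t)"
      using h(2) unfolding miss_map miss by (force simp: cap_def)+
    have "?c s t = u (map dec (map dec s)) (map dec (map dec t))" by (rule C(5)[OF gin_dec3[OF g] c1])
    also have "\<dots> = u (map dec (map (cap 2) s)) (map dec (map (cap 2) t))"
      using dd[of s] dd[of t] gin_le[OF g] h(1) by presburger
    also have "\<dots> = ?b s t" by (rule B(5)[OF gin_cap[OF g] b1, symmetric])
    finally show ?thesis by simp
  qed
  have com: "sorted_wrt (\<lambda>(Q, \<chi>) (Q', \<chi>'). \<forall>s t. gin 3 s t \<longrightarrow>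
      occ_of Q s t \<longrightarrow> occ_of Q' s t \<longrightarrow> \<chi> s t = \<chi>' s t) ?L"
    using n ab ac bc by (simp add: occ_of_def nc_def)
  obtain \<psi> where \<psi>: "gbx 3 \<psi>"
      "\<And>Q \<chi> s t. \<lbrakk>(Q, \<chi>) \<in> set ?L; gin 3 s t; occ_of Q s t\<rbrakk> \<Longrightarrow> \<psi> s t = \<chi> s t"
    by (rule fill_pieces[OF bx adm com]) auto
  have "comp_by \<psi> y z v"
    unfolding comp_by_def
  proof (intro conjI allI impI)
    show "gbx 2 \<psi>" by (rule gbx_mono[OF \<psi>(1)]) simp
    fix s t assume g2: "gin 2 s t"
    have g: "gin 3 s t" by (rule gin_mono[OF g2]) simp
    have le: "\<forall>p\<in>set s. snd p \<le> 2" "\<forall>p\<in>set t. snd p \<le> 2" using gin_le[OF g2] by simp_all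
    have d2: "2 \<notin> snd ` set (map dec s)" "2 \<notin> snd ` set (map dec t)"
      using le unfolding miss_map miss by (force simp: dec_def)+
    have id: "map (cap 2) s = s" "map (cap 2) t = t"
      using le by (force simp: cap_def intro!: map_idI)+
    show "\<psi> s t = star s t" if "nc s t"
      by (rule \<psi>(2)[OF _ g, of ?Qn]) (use that in \<open>simp_all add: occ_of_def nc_def\<close>)
    show "\<psi> s t = y (map dec s) (map dec t)" if "0 \<notin> snd ` set s \<or> 0 \<notin> snd ` set t"
    proof -
      have "\<psi> s t = ?a s t"
        by (rule \<psi>(2)[OF _ g, of ?Qa]) (use that in \<open>simp_all add: occ_of_def\<close>)
      then show ?thesis using A(4)[OF gin_dec3[OF g] d2] by simp
    qed
    show "\<psi> s t = z s t" if h: "2 \<notin> snd ` set s \<and> 2 \<notin> snd ` set t"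
    proof -
      have "\<psi> s t = ?b s t"
        by (rule \<psi>(2)[OF _ g, of ?Qb]) (use that in \<open>simp_all add: occ_of_def\<close>)
      then show ?thesis using B(4)[OF g2] h unfolding id by simp
    qed
    show "\<psi> s t = v (map dec s) (map dec t)" if "1 \<notin> snd ` set s \<and> 1 \<notin> snd ` set t"
    proof -
      have "\<psi> s t = ?c s t"
        by (rule \<psi>(2)[OF _ g, of ?Qc]) (use that in \<open>simp_all add: occ_of_def\<close>)
      then show ?thesis using C(4)[OF gin_dec3[OF g] d2] by simp
    qed
  qed
  then show ?thesis unfolding T_def using lp by blast
qed

end

sublocale loops \<subseteq> composition "{x. loop x}" T star
proof
  show "T x y z \<Longrightarrow> x \<in> {x. loop x} \<and> y \<in> {x. loop x} \<and> z \<in> {x. loop x}" for x y z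
    unfolding T_def by blast
qed (use loop_star_const T_right_unit T_left_unit T_triangle T_tetrahedron in \<open>blast+\<close>)

section \<open>Squares and homotopies of loops\<close>

context loops
begin

text \<open>Vertices of squares are triples of a base vertex, a loop level and a homotopy
  level.\<close>

abbreviation loop_dir :: "nat \<times> nat \<times> nat \<Rightarrow> nat \<times> nat" where "loop_dir p \<equiv> (fst p, fst (snd p))"
abbreviation htpy_dir :: "nat \<times> nat \<times> nat \<Rightarrow> nat \<times> nat" where "htpy_dir p \<equiv> (fst p, snd (snd p))"

abbreviation "sqin \<equiv> inb ({..m} \<times> {..1 :: nat} \<times> {..1 :: nat}) ({..n} \<times> {..1 :: nat} \<times> {..1 :: nat})"
abbreviation "sqbx \<equiv> Bx X ({..m} \<times> {..1 :: nat} \<times> {..1 :: nat}) ({..n} \<times> {..1 :: nat} \<times> {..1 :: nat})"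

text \<open>The two triangles of a square in \<open>X\<close> have the diagonal as a common composite.\<close>

lemma square:
  assumes h: "sqbx h" and lp: "loop p" "loop q" "loop r" "loop w"
    and nc: "\<And>s t. sqin s t \<Longrightarrow> nc s t \<Longrightarrow> h s t = star s t"
    and p: "\<And>s t. \<lbrakk>sqin s t; 0 \<notin> snd ` snd ` set s \<or> 0 \<notin> snd ` snd ` set t\<rbrakk> \<Longrightarrow>
      h s t = p (map loop_dir s) (map loop_dir t)"
    and q: "\<And>s t. \<lbrakk>sqin s t; 1 \<notin> snd ` snd ` set s \<and> 1 \<notin> snd ` snd ` set t\<rbrakk> \<Longrightarrow>
      h s t = q (map loop_dir s) (map loop_dir t)"
    and r: "\<And>s t. \<lbrakk>sqin s t; 0 \<notin> fst ` snd ` set s \<or> 0 \<notin> fst ` snd ` set t\<rbrakk> \<Longrightarrow>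
      h s t = r (map htpy_dir s) (map htpy_dir t)"
    and w: "\<And>s t. \<lbrakk>sqin s t; 1 \<notin> fst ` snd ` set s \<and> 1 \<notin> fst ` snd ` set t\<rbrakk> \<Longrightarrow>
      h s t = w (map htpy_dir s) (map htpy_dir t)"
  obtains g where "T p w g" "T r q g"
proof -
  let ?d = "\<lambda>p :: nat \<times> nat. (fst p, snd p, snd p)"
  define g where "g s t = h (map ?d s) (map ?d t)" for s t
  have md: "mono ?d" by (auto simp: mono_def less_eq_prod_def)
  have g: "gbx 1 g"
    unfolding g_def by (rule Bx_pull[OF h md md]) auto
  have din: "sqin (map ?d s) (map ?d t)" if "gin 1 s t" for s t
    by (rule inb_map[OF that md md]) auto
  have "loop g"
    unfolding loop_def
  proof (intro conjI allI impI)
    fix s t assume gin: "gin 1 s t"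
      and "nc s t \<or> 0 \<notin> snd ` set s \<or> 0 \<notin> snd ` set t \<or> 1 \<notin> snd ` set s \<and> 1 \<notin> snd ` set t"
    then consider "nc s t" | "0 \<notin> snd ` set s \<or> 0 \<notin> snd ` set t" | "1 \<notin> snd ` set s \<and> 1 \<notin> snd ` set t"
      by blast
    then show "g s t = star s t"
    proof cases
      case 1
      then have "nc (map ?d s) (map ?d t)" by (simp add: nc_def image_image)
      then show ?thesis unfolding g_def using nc[OF din[OF gin]] by simp
    next
      case 2
      then have "0 \<notin> snd ` snd ` set (map ?d s) \<or> 0 \<notin> snd ` snd ` set (map ?d t)"
        by (simp add: image_image)
      then have "g s t = p s t" unfolding g_def using p[OF din[OF gin]] by (simp add: comp_def)
      also have "p s t = star s t" by (rule loop_star[OF lp(1) gin]) (use 2 in blast)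
      finally show ?thesis .
    next
      case 3
      then have "1 \<notin> snd ` snd ` set (map ?d s) \<and> 1 \<notin> snd ` snd ` set (map ?d t)"
        by (simp add: image_image)
      then have "g s t = q s t" unfolding g_def using q[OF din[OF gin]] by (simp add: comp_def)
      also have "q s t = star s t" by (rule loop_star[OF lp(2) gin]) (use 3 in blast)
      finally show ?thesis .
    qed
  qed (rule g)
  \<comment> \<open>A monotone path of levels from \<open>(0, 0)\<close> to \<open>(1, 1)\<close>
    cuts a triangle out of the square. Its edge opposite the middle vertex is the diagonal
    \<open>g\<close>.\<close>
  have tri: "comp_by (\<lambda>s t. h (map c s) (map c t)) x y g"
    if c: "c = (\<lambda>p. (fst p, c1 (snd p), c2 (snd p)))" "mono c" "c ` (UNIV \<times> {..2}) \<subseteq> UNIV \<times> {..1} \<times> {..1}"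
      and c02: "c1 0 = 0" "c2 0 = 0" "c1 2 = 1" "c2 2 = 1"
      and x: "\<And>s t. gin 2 s t \<Longrightarrow> 0 \<notin> snd ` set s \<or> 0 \<notin> snd ` set t \<Longrightarrow>
        h (map c s) (map c t) = x (map dec s) (map dec t)"
      and y: "\<And>s t. gin 2 s t \<Longrightarrow> 2 \<notin> snd ` set s \<and> 2 \<notin> snd ` set t \<Longrightarrow>
        h (map c s) (map c t) = y s t" for c c1 c2 x y
    unfolding comp_by_def
  proof (intro conjI allI impI)
    have sub: "c ` ({..k} \<times> {..2}) \<subseteq> {..k} \<times> {..1} \<times> {..1}" for k
      using c(3) by (fastforce simp: c(1))
    show "gbx 2 (\<lambda>s t. h (map c s) (map c t))" by (rule Bx_pull[OF h c(2,2) sub sub])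
    fix s t assume gin: "gin 2 s t"
    have le: "\<forall>p\<in>set s. snd p \<le> 2" "\<forall>p\<in>set t. snd p \<le> 2" using gin_le[OF gin] by simp_all
    have sq: "sqin (map c s) (map c t)" by (rule inb_map[OF gin c(2,2) sub sub])
    show "h (map c s) (map c t) = star s t" if "nc s t"
      using nc[OF sq] that by (simp add: nc_def image_image c(1))
    show "h (map c s) (map c t) = g (map dec s) (map dec t)" if "1 \<notin> snd ` set s \<and> 1 \<notin> snd ` set t"
    proof -
      have "c p = ?d (dec p)" if "snd p \<le> 2" "snd p \<noteq> 1" for p
      proof -
        from that have "snd p = 0 \<or> snd p = 2" by linarith
        then show ?thesis using c02 by (auto simp: c(1) dec_def)
      qed
      then have "map c s = map ?d (map dec s)" "map c t = map ?d (map dec t)"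
        using le that unfolding miss by auto
      then show ?thesis unfolding g_def by (simp only:)
    qed
  qed (use x y in blast)+
  have "\<exists>\<theta>. comp_by \<theta> p w g"
  \<comment> \<open>The path through \<open>(0, 1)\<close>: first along \<open>w\<close> at loop
    level 0, then along \<open>p\<close> at homotopy level 1.\<close>
  proof (rule exI, rule tri[OF refl])
    let ?c1 = "\<lambda>j. j - Suc 0" and ?c2 = "\<lambda>j. min 1 j"
    let ?c = "\<lambda>p :: nat \<times> nat. (fst p, ?c1 (snd p), ?c2 (snd p))"
    show mc: "mono ?c" by (auto simp: mono_def less_eq_prod_def)
    have sub: "?c ` ({..k} \<times> {..2}) \<subseteq> {..k} \<times> {..1} \<times> {..1}" for k by auto
    show "h (map ?c s) (map ?c t) = p (map dec s) (map dec t)"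
      if gin: "gin 2 s t" and z: "0 \<notin> snd ` set s \<or> 0 \<notin> snd ` set t" for s t
    proof -
      have "0 \<notin> snd ` snd ` set (map ?c s) \<or> 0 \<notin> snd ` snd ` set (map ?c t)"
        using z by (auto simp: image_iff min_def split: if_splits)
      from p[OF inb_map[OF gin mc mc sub sub] this] show ?thesis by (simp add: comp_def dec_def[abs_def])
    qed
    show "h (map ?c s) (map ?c t) = w s t"
      if gin: "gin 2 s t" and z: "2 \<notin> snd ` set s \<and> 2 \<notin> snd ` set t" for s t
    proof -
      have le: "\<forall>p\<in>set s. snd p \<le> 1" "\<forall>p\<in>set t. snd p \<le> 1"
        using gin_le[OF gin] z unfolding miss by force+
      then have "1 \<notin> fst ` snd ` set (map ?c s) \<and> 1 \<notin> fst ` snd ` set (map ?c t)"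
        by (force simp: image_image)
      from w[OF inb_map[OF gin mc mc sub sub] this]
      have "h (map ?c s) (map ?c t) = w (map (htpy_dir \<circ> ?c) s) (map (htpy_dir \<circ> ?c) t)" by simp
      moreover have "map (htpy_dir \<circ> ?c) s = s" "map (htpy_dir \<circ> ?c) t = t"
        using le by (auto intro!: map_idI simp: min_def)
      ultimately show ?thesis by (simp only:)
    qed
  qed auto
  moreover have "\<exists>\<theta>. comp_by \<theta> r q g"
  \<comment> \<open>The path through \<open>(1, 0)\<close>: first along \<open>q\<close> at homotopy
    level 0, then along \<open>r\<close> at loop level 1.\<close>
  proof (rule exI, rule tri[OF refl])
    let ?c2 = "\<lambda>j. j - Suc 0" and ?c1 = "\<lambda>j. min 1 j"
    let ?c = "\<lambda>p :: nat \<times> nat. (fst p, ?c1 (snd p), ?c2 (snd p))"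
    show mc: "mono ?c" by (auto simp: mono_def less_eq_prod_def)
    have sub: "?c ` ({..k} \<times> {..2}) \<subseteq> {..k} \<times> {..1} \<times> {..1}" for k by auto
    show "h (map ?c s) (map ?c t) = r (map dec s) (map dec t)"
      if gin: "gin 2 s t" and z: "0 \<notin> snd ` set s \<or> 0 \<notin> snd ` set t" for s t
    proof -
      have "0 \<notin> fst ` snd ` set (map ?c s) \<or> 0 \<notin> fst ` snd ` set (map ?c t)"
        using z by (auto simp: image_iff min_def split: if_splits)
      from r[OF inb_map[OF gin mc mc sub sub] this] show ?thesis by (simp add: comp_def dec_def[abs_def])
    qed
    show "h (map ?c s) (map ?c t) = q s t"
      if gin: "gin 2 s t" and z: "2 \<notin> snd ` set s \<and> 2 \<notin> snd ` set t" for s t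
    proof -
      have le: "\<forall>p\<in>set s. snd p \<le> 1" "\<forall>p\<in>set t. snd p \<le> 1"
        using gin_le[OF gin] z unfolding miss by force+
      then have "1 \<notin> snd ` snd ` set (map ?c s) \<and> 1 \<notin> snd ` snd ` set (map ?c t)"
        by (force simp: image_image)
      from q[OF inb_map[OF gin mc mc sub sub] this]
      have "h (map ?c s) (map ?c t) = q (map (loop_dir \<circ> ?c) s) (map (loop_dir \<circ> ?c) t)" by simp
      moreover have "map (loop_dir \<circ> ?c) s = s" "map (loop_dir \<circ> ?c) t = t"
        using le by (auto intro!: map_idI simp: min_def)
      ultimately show ?thesis by (simp only:)
    qed
  qed auto
  ultimately show thesis using that lp \<open>loop g\<close> unfolding T_def by blast
qed

end

context loops
begin

text \<open>As in \<open>homotopy\<close>, the source \<open>x\<close> sits where either direction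
  has homotopy level 1 only, and the target \<open>y\<close> at the corner where both have homotopy
  level 0 only.\<close>

definition loop_htpy where
  "loop_htpy x y h \<longleftrightarrow> sqbx h \<and> (\<forall>s t. sqin s t \<longrightarrow>
     (nc s t \<or> 0 \<notin> fst ` snd ` set s \<or> 0 \<notin> fst ` snd ` set t \<or>
       1 \<notin> fst ` snd ` set s \<and> 1 \<notin> fst ` snd ` set t \<longrightarrow> h s t = star s t) \<and>
     (0 \<notin> snd ` snd ` set s \<or> 0 \<notin> snd ` snd ` set t \<longrightarrow> h s t = x (map loop_dir s) (map loop_dir t)) \<and>
     (1 \<notin> snd ` snd ` set s \<and> 1 \<notin> snd ` snd ` set t \<longrightarrow> h s t = y (map loop_dir s) (map loop_dir t)))"

lemma loop_htpyD:
  assumes "loop_htpy x y h"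
  shows "sqbx h"
    "sqin s t \<Longrightarrow> nc s t \<or> 0 \<notin> fst ` snd ` set s \<or> 0 \<notin> fst ` snd ` set t \<or>
       1 \<notin> fst ` snd ` set s \<and> 1 \<notin> fst ` snd ` set t \<Longrightarrow> h s t = star s t"
    "sqin s t \<Longrightarrow> 0 \<notin> snd ` snd ` set s \<or> 0 \<notin> snd ` snd ` set t \<Longrightarrow>
       h s t = x (map loop_dir s) (map loop_dir t)"
    "sqin s t \<Longrightarrow> 1 \<notin> snd ` snd ` set s \<and> 1 \<notin> snd ` snd ` set t \<Longrightarrow>
       h s t = y (map loop_dir s) (map loop_dir t)"
  using assms unfolding loop_htpy_def by blast+

lemma T_iff_E:
  assumes "loop x" shows "T x star y \<longleftrightarrow> E x y"
proof
  have u: "T x star x" using right_unit assms by simp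
  show "E x y" if "T x star y" by (rule T_unique[OF u that])
  show "T x star y" if "E x y" by (rule T_cong3[OF u E_sym[OF that]])
qed

text \<open>In the square of the homotopy the two sides of constant loop level are trivial, so the
  diagonal is a composite both of \<open>x\<close> with \<open>star\<close> and of
  \<open>star\<close> with \<open>y\<close>.\<close>

lemma loop_htpy_imp_E:
  assumes "loop x" "loop y" "loop_htpy x y h"
  shows "E x y"
proof -
  note h = loop_htpyD[OF assms(3)]
  obtain g where g: "T x star g" "T star y g"
  proof (rule square[OF h(1) assms(1,2) loop_star_const loop_star_const])
    show "h s t = star s t" if "sqin s t" "nc s t" for s t using h(2) that by blast
    show "h s t = x (map loop_dir s) (map loop_dir t)"
      if "sqin s t" "0 \<notin> snd ` snd ` set s \<or> 0 \<notin> snd ` snd ` set t" for s t by (rule h(3)[OF that])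
    show "h s t = y (map loop_dir s) (map loop_dir t)"
      if "sqin s t" "1 \<notin> snd ` snd ` set s \<and> 1 \<notin> snd ` snd ` set t" for s t by (rule h(4)[OF that])
    show "h s t = star (map htpy_dir s) (map htpy_dir t)"
      if "sqin s t" "0 \<notin> fst ` snd ` set s \<or> 0 \<notin> fst ` snd ` set t" for s t
    proof -
      have "h s t = star s t" by (rule h(2)[OF that(1)]) (use that(2) in blast)
      then show ?thesis by simp
    qed
    show "h s t = star (map htpy_dir s) (map htpy_dir t)"
      if "sqin s t" "1 \<notin> fst ` snd ` set s \<and> 1 \<notin> fst ` snd ` set t" for s t
    proof -
      have "h s t = star s t" by (rule h(2)[OF that(1)]) (use that(2) in blast)
      then show ?thesis by simp
    qed
  qed blast
  show ?thesis using E_trans[OF _ E_sym[OF g(2)]] g(1) T_iff_E[OF assms(1)] by blast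
qed

text \<open>\<open>E\<close> also yields a triangle with edges \<open>x\<close>, \<open>star\<close>
  and composite \<open>y\<close>; a homotopy is this triangle pulled back to a square with one side
  collapsed.\<close>

lemma E_imp_loop_htpy:
  assumes "E x y"
  shows "\<exists>h. loop_htpy x y h"
proof -
  have lp: "loop x" "loop y" using assms unfolding T_def by blast+
  then obtain \<theta> where \<theta>: "comp_by \<theta> x star y" using T_iff_E assms unfolding T_def by blast
  note C = comp_byD[OF \<theta>]
  \<comment> \<open>Loop level 1 goes to vertex 2, loop level 0 to vertex 0 or 1 according to the
    homotopy level. So homotopy level 1 becomes the edge of \<open>x\<close>, homotopy level 0 that
    of \<open>y\<close>, and loop level 0 the trivial edge.\<close>
  let ?c = "\<lambda>p :: nat \<times> nat \<times> nat. (fst p, if 0 < fst (snd p) then 2 else min 1 (snd (snd p)))"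
  have mc: "mono ?c" by (auto simp: mono_def less_eq_prod_def)
  have sub: "?c ` ({..k} \<times> {..1} \<times> {..1}) \<subseteq> {..k} \<times> {..2}" for k by auto
  have "loop_htpy x y (\<lambda>s t. \<theta> (map ?c s) (map ?c t))"
    unfolding loop_htpy_def
  proof (intro conjI allI impI)
    show "sqbx (\<lambda>s t. \<theta> (map ?c s) (map ?c t))" by (rule Bx_pull[OF C(1) mc mc sub sub])
    fix s t assume sq: "sqin s t"
    have gin: "gin 2 (map ?c s) (map ?c t)" by (rule inb_map[OF sq mc mc sub sub])
    have le: "\<forall>p\<in>set s. fst (snd p) \<le> 1 \<and> snd (snd p) \<le> 1" "\<forall>p\<in>set t. fst (snd p) \<le> 1 \<and> snd (snd p) \<le> 1"
      using sq by (auto simp: inb_def)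
    have st: "x (map dec (map ?c s)) (map dec (map ?c t)) = star s t"
      if "0 \<notin> fst ` snd ` set s \<or> 0 \<notin> fst ` snd ` set t"
    proof -
      have d: "0 \<notin> snd ` set (map dec (map ?c r))" if "0 \<notin> fst ` snd ` set r" for r
      proof -
        have "\<forall>p\<in>set r. fst (snd p) \<noteq> 0" using that by force
        then show ?thesis by (auto simp: dec_def)
      qed
      have "x (map dec (map ?c s)) (map dec (map ?c t)) = star (map dec (map ?c s)) (map dec (map ?c t))"
        by (rule loop_star[OF lp(1) gin_dec2[OF gin]]) (use d that in blast)
      then show ?thesis by simp
    qed
    show "\<theta> (map ?c s) (map ?c t) = star s t"
      if "nc s t \<or> 0 \<notin> fst ` snd ` set s \<or> 0 \<notin> fst ` snd ` set t \<or>
        1 \<notin> fst ` snd ` set s \<and> 1 \<notin> fst ` snd ` set t"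
    proof -
      consider "nc s t" | "0 \<notin> fst ` snd ` set s \<or> 0 \<notin> fst ` snd ` set t"
        | "1 \<notin> fst ` snd ` set s \<and> 1 \<notin> fst ` snd ` set t" using \<open>_ \<or> _\<close> by blast
      then show ?thesis
      proof cases
        case 1
        then have "nc (map ?c s) (map ?c t)" by (simp add: nc_def image_image)
        then show ?thesis using C(2)[OF gin] by simp
      next
        case 2
        have d: "0 \<notin> snd ` set (map ?c r)" if "0 \<notin> fst ` snd ` set r" for r
          using that by (force simp: image_iff)
        have "\<theta> (map ?c s) (map ?c t) = x (map dec (map ?c s)) (map dec (map ?c t))"
          by (rule C(3)[OF gin]) (use d 2 in blast)
        then show ?thesis using st[OF 2] by simp
      next
        case 3
        have d: "2 \<notin> snd ` set (map ?c r)" if "\<forall>p\<in>set r. fst (snd p) \<le> 1 \<and> snd (snd p) \<le> 1" "1 \<notin> fst ` snd ` set r" for r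
          using that by (force simp: image_iff)
        have "2 \<notin> snd ` set (map ?c s)" "2 \<notin> snd ` set (map ?c t)" using d le 3 by blast+
        from C(4)[OF gin this] show ?thesis by simp
      qed
    qed
    show "\<theta> (map ?c s) (map ?c t) = x (map loop_dir s) (map loop_dir t)"
      if h: "0 \<notin> snd ` snd ` set s \<or> 0 \<notin> snd ` snd ` set t"
    proof -
      have d: "0 \<notin> snd ` set (map ?c r)" if "0 \<notin> snd ` snd ` set r" for r
      proof -
        have "\<forall>p\<in>set r. snd (snd p) \<noteq> 0" using that by force
        then show ?thesis by (auto simp: min_def split: if_splits)
      qed
      have e: "map dec (map ?c r) = map loop_dir r" if "\<forall>p\<in>set r. fst (snd p) \<le> 1 \<and> snd (snd p) \<le> 1" for r
        using that by (force simp: dec_def)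
      have "\<theta> (map ?c s) (map ?c t) = x (map dec (map ?c s)) (map dec (map ?c t))"
        by (rule C(3)[OF gin]) (use d h in blast)
      then show ?thesis unfolding e[OF le(1)] e[OF le(2)] .
    qed
    show "\<theta> (map ?c s) (map ?c t) = y (map loop_dir s) (map loop_dir t)"
      if h: "1 \<notin> snd ` snd ` set s \<and> 1 \<notin> snd ` snd ` set t"
    proof -
      have d: "1 \<notin> snd ` set (map ?c r)" if "\<forall>p\<in>set r. fst (snd p) \<le> 1 \<and> snd (snd p) \<le> 1" "1 \<notin> snd ` snd ` set r" for r
      proof -
        have "snd (snd p) = 0" if p: "p \<in> set r" for p
        proof -
          have "snd (snd p) \<noteq> 1" using \<open>1 \<notin> snd ` snd ` set r\<close> p by (metis image_eqI)
          then show ?thesis using \<open>\<forall>p\<in>set r. _ p\<close> p by fastforce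
        qed
        then show ?thesis by (force split: if_splits)
      qed
      have e: "map dec (map ?c r) = map loop_dir r" if "\<forall>p\<in>set r. fst (snd p) \<le> 1 \<and> snd (snd p) \<le> 1" for r
        using that by (force simp: dec_def)
      have "1 \<notin> snd ` set (map ?c s)" "1 \<notin> snd ` set (map ?c t)" using d le h by blast+
      from C(5)[OF gin this] show ?thesis unfolding e[OF le(1)] e[OF le(2)] .
    qed
  qed
  then show ?thesis by blast
qed

lemma loop_htpy_iff: "loop x \<Longrightarrow> loop y \<Longrightarrow> (\<exists>h. loop_htpy x y h) \<longleftrightarrow> E x y"
  using loop_htpy_imp_E E_imp_loop_htpy by blast

text \<open>Values outside \<open>gin 1\<close> are arbitrary, so loops that are the same map may
  differ as functions; they are identified only through \<open>E\<close>.\<close>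

lemma E_eqI:
  assumes x: "loop x" and y: "loop y" and eq: "\<And>s t. gin 1 s t \<Longrightarrow> x s t = y s t"
  shows "E x y"
proof -
  have "T star x x" using left_unit x by simp
  then obtain \<theta> where "comp_by \<theta> star x x" unfolding T_def by blast
  then have "comp_by \<theta> star x y"
    unfolding comp_by_def using eq gin_dec2 by simp
  then show ?thesis unfolding T_def using x y loop_star_const by blast
qed

section \<open>Simplices relative to the Aeppli boundary\<close>

abbreviation "rin \<equiv> inb {..Suc m} {..Suc n}"

text \<open>Failing to contain \<open>{..m}\<close> means lying in the horn at the last vertex; the
  last alternative is the corner opposite the last vertices. Together these are
  \<open>bdeltaA (Suc m) (Suc n)\<close>.\<close>

definition rel :: "(nat list \<Rightarrow> nat list \<Rightarrow> 'a) \<Rightarrow> bool" where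
  "rel \<alpha> \<longleftrightarrow> Bx X {..Suc m} {..Suc n} \<alpha> \<and> (\<forall>s t. rin s t \<longrightarrow>
     \<not> {..m} \<subseteq> set s \<or> \<not> {..n} \<subseteq> set t \<or> Suc m \<notin> set s \<and> Suc n \<notin> set t \<longrightarrow> \<alpha> s t = star s t)"

lemma relD:
  assumes "rel \<alpha>"
  shows "Bx X {..Suc m} {..Suc n} \<alpha>"
    "rin s t \<Longrightarrow> \<not> {..m} \<subseteq> set s \<or> \<not> {..n} \<subseteq> set t \<or> Suc m \<notin> set s \<and> Suc n \<notin> set t \<Longrightarrow> \<alpha> s t = star s t"
  using assms unfolding rel_def by blast+

text \<open>The map \<open>\<Delta>\<^sup>k \<times> \<Delta>\<^sup>1 \<rightarrow> \<Delta>\<^sup>k\<^sup>+\<^sup>1\<close> that contracts the face opposite to the last vertex to that vertex.\<close>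

definition contr :: "nat \<Rightarrow> nat \<times> nat \<Rightarrow> nat" where
  "contr k p = (if snd p = 0 then min (fst p) (Suc k) else Suc k)"

lemma mono_contr [simp]: "mono (contr k)"
  by (auto simp: mono_def contr_def less_eq_prod_def)

lemma contr_le: "contr k ` S \<subseteq> {..Suc k}"
  by (auto simp: contr_def)

text \<open>Everything at nonzero level is sent to \<open>Suc k\<close>, so the vertices up to
  \<open>k\<close> can be hit only from level 0.\<close>

lemma contr_cover: "{..k} \<subseteq> contr k ` S \<Longrightarrow> {..k} \<subseteq> fst ` {p \<in> S. snd p = 0}"
proof
  fix i assume "{..k} \<subseteq> contr k ` S" "i \<in> {..k}"
  then obtain p where p: "p \<in> S" "i = contr k p" by blast
  then have "p \<in> {p \<in> S. snd p = 0}" "i = fst p"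
    using \<open>i \<in> {..k}\<close> by (auto simp: contr_def min_def split: if_splits)
  then show "i \<in> fst ` {p \<in> S. snd p = 0}" by (metis image_eqI)
qed

definition rr :: "(nat list \<Rightarrow> nat list \<Rightarrow> 'a) \<Rightarrow> (nat \<times> nat) list \<Rightarrow> (nat \<times> nat) list \<Rightarrow> 'a" where
  "rr \<alpha> s t = \<alpha> (map (contr m) s) (map (contr n) t)"

lemma contr_nc:
  assumes "nc s t \<or> 0 \<notin> snd ` set s \<or> 0 \<notin> snd ` set t"
  shows "\<not> {..m} \<subseteq> contr m ` set s \<or> \<not> {..n} \<subseteq> contr n ` set t"
proof (rule ccontr)
  assume "\<not> ?thesis"
  then have c: "{..m} \<subseteq> fst ` {p \<in> set s. snd p = 0}" "{..n} \<subseteq> fst ` {p \<in> set t. snd p = 0}"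
    using contr_cover by blast+
  then have "{..m} \<subseteq> fst ` set s" "{..n} \<subseteq> fst ` set t" by blast+
  moreover have "0 \<in> snd ` set s" "0 \<in> snd ` set t" using c by (force simp: image_iff)+
  ultimately show False using assms unfolding nc_def by blast
qed

lemma rr_loop:
  assumes \<alpha>: "rel \<alpha>" shows "loop (rr \<alpha>)"
  unfolding loop_def
proof (intro conjI allI impI)
  show "gbx 1 (rr \<alpha>)"
    unfolding rr_def by (rule Bx_pull[OF relD(1)[OF \<alpha>]]) (simp_all add: contr_le)
  fix s t assume gin: "gin 1 s t"
    and c: "nc s t \<or> 0 \<notin> snd ` set s \<or> 0 \<notin> snd ` set t \<or> 1 \<notin> snd ` set s \<and> 1 \<notin> snd ` set t"
  have rin: "rin (map (contr m) s) (map (contr n) t)"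
    by (rule inb_map[OF gin]) (simp_all add: contr_le)
  have d: "Suc k \<notin> contr k ` S" if "S \<subseteq> {..k} \<times> {..1}" "1 \<notin> snd ` S" for k S
    using that by (force simp: contr_def split: if_splits)
  have "\<not> {..m} \<subseteq> contr m ` set s \<or> \<not> {..n} \<subseteq> contr n ` set t \<or>
      Suc m \<notin> contr m ` set s \<and> Suc n \<notin> contr n ` set t"
    using c contr_nc[of s t] d[of "set s" m] d[of "set t" n] gin unfolding inb_def by blast
  then have "\<alpha> (map (contr m) s) (map (contr n) t) = star (map (contr m) s) (map (contr n) t)"
    using relD(2)[OF \<alpha> rin] by simp
  then show "rr \<alpha> s t = star s t" by (simp add: rr_def)
qed

section \<open>Lifts to the path space, in coordinates\<close>

abbreviation "lin \<equiv> inb ({..Suc m} \<times> {..1 :: nat}) ({..Suc n} \<times> {..1 :: nat})"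
abbreviation "lbx \<equiv> Bx X ({..Suc m} \<times> {..1 :: nat}) ({..Suc n} \<times> {..1 :: nat})"

text \<open>The uncurried form of a lift to \<open>PX\<close>: trivial over the horn of the base,
  trivial where a direction omits level 0 because the values are paths, and equal to
  \<open>\<alpha>\<close> at the vertex \<open>(0, 0)\<close> of the loop direction.\<close>

definition lift where
  "lift w \<alpha> \<longleftrightarrow> lbx w \<and> (\<forall>s t. lin s t \<longrightarrow>
     (nc s t \<or> 0 \<notin> snd ` set s \<or> 0 \<notin> snd ` set t \<longrightarrow> w s t = star s t) \<and>
     (1 \<notin> snd ` set s \<and> 1 \<notin> snd ` set t \<longrightarrow> w s t = \<alpha> (map fst s) (map fst t)))"

lemma liftD:
  assumes "lift w \<alpha>"
  shows "lbx w" "lin s t \<Longrightarrow> nc s t \<or> 0 \<notin> snd ` set s \<or> 0 \<notin> snd ` set t \<Longrightarrow> w s t = star s t"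
    "lin s t \<Longrightarrow> 1 \<notin> snd ` set s \<and> 1 \<notin> snd ` set t \<Longrightarrow> w s t = \<alpha> (map fst s) (map fst t)"
  using assms unfolding lift_def by blast+

lemma map_contr_fst:
  assumes "set s \<subseteq> {..Suc k} \<times> {..1}" "1 \<notin> snd ` set s"
  shows "map (contr k) s = map fst s"
  using assms by (force simp: contr_def)

lemma lift_rr:
  assumes \<alpha>: "rel \<alpha>" shows "lift (rr \<alpha>) \<alpha>"
  unfolding lift_def
proof (intro conjI allI impI)
  show "lbx (rr \<alpha>)"
    unfolding rr_def by (rule Bx_pull[OF relD(1)[OF \<alpha>]]) (simp_all add: contr_le)
  fix s t assume lin: "lin s t"
  have rin: "rin (map (contr m) s) (map (contr n) t)"
    by (rule inb_map[OF lin]) (simp_all add: contr_le)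
  show "rr \<alpha> s t = star s t" if "nc s t \<or> 0 \<notin> snd ` set s \<or> 0 \<notin> snd ` set t"
    using relD(2)[OF \<alpha> rin] contr_nc[OF that] by (auto simp: rr_def)
  show "rr \<alpha> s t = \<alpha> (map fst s) (map fst t)" if "1 \<notin> snd ` set s \<and> 1 \<notin> snd ` set t"
  proof -
    have "map (contr m) s = map fst s" "map (contr n) t = map fst t"
      using lin that unfolding inb_def by (blast intro: map_contr_fst)+
    then show ?thesis by (simp only: rr_def)
  qed
qed

lemma gin_lin: "gin 1 s t \<Longrightarrow> lin s t"
  by (erule inb_mono) auto

text \<open>Over the base \<open>{..m}\<close>, \<open>{..n}\<close> the value at level 0 is the
  last corner of \<open>\<alpha>\<close>, which is trivial; there the paths are loops.\<close>

lemma lift_loop: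
  assumes \<alpha>: "rel \<alpha>" and w: "lift w \<alpha>"
  shows "loop w"
  unfolding loop_def
proof (intro conjI allI impI)
  show "gbx 1 w" by (rule Bx_mono[OF liftD(1)[OF w]]) auto
  fix s t assume gin: "gin 1 s t"
    and c: "nc s t \<or> 0 \<notin> snd ` set s \<or> 0 \<notin> snd ` set t \<or> 1 \<notin> snd ` set s \<and> 1 \<notin> snd ` set t"
  note lin = gin_lin[OF gin]
  show "w s t = star s t"
  proof (cases "1 \<notin> snd ` set s \<and> 1 \<notin> snd ` set t")
    case True
    have "rin (map fst s) (map fst t)" by (rule inb_map[OF lin]) (auto simp: mono_def less_eq_prod_def)
    moreover have "Suc m \<notin> set (map fst s) \<and> Suc n \<notin> set (map fst t)"
      using gin by (auto simp: inb_def)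
    ultimately have "\<alpha> (map fst s) (map fst t) = star (map fst s) (map fst t)"
      using relD(2)[OF \<alpha>] by blast
    then show ?thesis using liftD(3)[OF w lin True] by simp
  next
    case False
    show ?thesis by (rule liftD(2)[OF w lin]) (use c False in blast)
  qed
qed

text \<open>All lifts give the same class. Contracting the base of \<open>w\<close> to its last
  vertex along a homotopy level gives a square: at homotopy level 0 it is \<open>w\<close>, at level
  1 it is trivial because the base lies in the horn, at loop level 1 it is trivial, and at loop
  level 0 it is \<open>\<alpha>\<close> contracted, that is \<open>rr \<alpha>\<close>.\<close>

lemma lift_E:
  assumes \<alpha>: "rel \<alpha>" and w: "lift w \<alpha>"
  shows "E (rr \<alpha>) w"
proof -
  note W = liftD[OF w]
  let ?c = "\<lambda>k (p :: nat \<times> nat \<times> nat). (contr k (htpy_dir p), fst (snd p))"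
  have mc: "mono (?c k)" for k
    using monoD[OF mono_contr[of k]] by (auto simp: mono_def less_eq_prod_def)
  have sub: "?c k ` ({..k} \<times> {..1} \<times> {..1}) \<subseteq> {..Suc k} \<times> {..1}" for k by (auto simp: contr_def)
  define h where "h s t = w (map (?c m) s) (map (?c n) t)" for s t
  have lin: "lin (map (?c m) s) (map (?c n) t)" if "sqin s t" for s t
    by (rule inb_map[OF that mc mc sub sub])
  have f: "fst ` set (map (?c k) s) = contr k ` set (map htpy_dir s)" for k and s :: "(nat \<times> nat \<times> nat) list"
    by (simp add: image_image)
  have sn: "snd ` set (map (?c k) s) = fst ` snd ` set s" for k and s :: "(nat \<times> nat \<times> nat) list"
    by (simp add: image_image)
  have star': "h s t = star s t"
    if "sqin s t" "nc s t \<or> 0 \<notin> snd ` snd ` set s \<or> 0 \<notin> snd ` snd ` set t \<or> 0 \<notin> fst ` snd ` set s \<or> 0 \<notin> fst ` snd ` set t" for s t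
  proof -
    have "nc (map (?c m) s) (map (?c n) t) \<or> 0 \<notin> snd ` set (map (?c m) s) \<or> 0 \<notin> snd ` set (map (?c n) t)"
    proof (cases "0 \<notin> fst ` snd ` set s \<or> 0 \<notin> fst ` snd ` set t")
      case False
      then have "nc (map htpy_dir s) (map htpy_dir t) \<or> 0 \<notin> snd ` set (map htpy_dir s) \<or> 0 \<notin> snd ` set (map htpy_dir t)"
        using that(2) by (simp add: nc_def image_image)
      from contr_nc[OF this] show ?thesis unfolding nc_def f by simp
    qed (unfold sn, blast)
    from W(2)[OF lin[OF that(1)] this] show ?thesis by (simp add: h_def)
  qed
  obtain g where g: "T star (rr \<alpha>) g" "T star w g"
  proof (rule square[OF _ loop_star_const lift_loop[OF \<alpha> w] loop_star_const rr_loop[OF \<alpha>]])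
    show "sqbx h" unfolding h_def by (rule Bx_pull[OF W(1) mc mc sub sub])
    show "h s t = star s t" if "sqin s t" "nc s t" for s t using star' that by blast
    show "h s t = star (map loop_dir s) (map loop_dir t)"
      if "sqin s t" "0 \<notin> snd ` snd ` set s \<or> 0 \<notin> snd ` snd ` set t" for s t
    proof -
      have "h s t = star s t" by (rule star'[OF that(1)]) (use that(2) in blast)
      then show ?thesis by simp
    qed
    show "h s t = star (map htpy_dir s) (map htpy_dir t)"
      if "sqin s t" "0 \<notin> fst ` snd ` set s \<or> 0 \<notin> fst ` snd ` set t" for s t
    proof -
      have "h s t = star s t" by (rule star'[OF that(1)]) (use that(2) in blast)
      then show ?thesis by simp
    qed
    show "h s t = w (map loop_dir s) (map loop_dir t)"
      if "sqin s t" "1 \<notin> snd ` snd ` set s \<and> 1 \<notin> snd ` snd ` set t" for s t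
    proof -
      have d: "map (?c k) r = map loop_dir r"
        if "set r \<subseteq> {..k} \<times> {..1} \<times> {..1}" "1 \<notin> snd ` snd ` set r" for k r
        using that by (force simp: contr_def)
      have "map (?c m) s = map loop_dir s" "map (?c n) t = map loop_dir t"
        using that unfolding inb_def by (blast intro: d)+
      then show ?thesis by (simp only: h_def)
    qed
    show "h s t = rr \<alpha> (map htpy_dir s) (map htpy_dir t)"
      if "sqin s t" "1 \<notin> fst ` snd ` set s \<and> 1 \<notin> fst ` snd ` set t" for s t
    proof -
      have "h s t = \<alpha> (map fst (map (?c m) s)) (map fst (map (?c n) t))"
        unfolding h_def by (rule W(3)[OF lin[OF that(1)]]) (use that(2) in \<open>unfold sn, blast\<close>)
      then show ?thesis by (simp add: rr_def comp_def)
    qed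
  qed blast
  show ?thesis by (rule E_trans[OF g(1) E_sym[OF g(2)]])
qed

end

section \<open>Relative simplices and loops correspond up to homotopy\<close>

context loops
begin

definition rel_htpy where
  "rel_htpy \<alpha> \<beta> h \<longleftrightarrow> lbx h \<and> (\<forall>s t. lin s t \<longrightarrow>
     (nc s t \<or> Suc m \<notin> fst ` set s \<and> Suc n \<notin> fst ` set t \<longrightarrow> h s t = star s t) \<and>
     (0 \<notin> snd ` set s \<or> 0 \<notin> snd ` set t \<longrightarrow> h s t = \<alpha> (map fst s) (map fst t)) \<and>
     (1 \<notin> snd ` set s \<and> 1 \<notin> snd ` set t \<longrightarrow> h s t = \<beta> (map fst s) (map fst t)))"

lemma rel_htpyD:
  assumes "rel_htpy \<alpha> \<beta> h"
  shows "lbx h" "lin s t \<Longrightarrow> nc s t \<or> Suc m \<notin> fst ` set s \<and> Suc n \<notin> fst ` set t \<Longrightarrow> h s t = star s t"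
    "lin s t \<Longrightarrow> 0 \<notin> snd ` set s \<or> 0 \<notin> snd ` set t \<Longrightarrow> h s t = \<alpha> (map fst s) (map fst t)"
    "lin s t \<Longrightarrow> 1 \<notin> snd ` set s \<and> 1 \<notin> snd ` set t \<Longrightarrow> h s t = \<beta> (map fst s) (map fst t)"
  using assms unfolding rel_htpy_def by blast+

text \<open>Applying \<open>contr\<close> to base and loop level, with the homotopy level as
  parameter, turns a homotopy of simplices into one of loops.\<close>

lemma rel_htpy_imp_E:
  assumes "rel \<alpha>" "rel \<beta>" "rel_htpy \<alpha> \<beta> h"
  shows "E (rr \<alpha>) (rr \<beta>)"
proof -
  note H = rel_htpyD[OF assms(3)]
  let ?c = "\<lambda>k (p :: nat \<times> nat \<times> nat). (contr k (loop_dir p), snd (snd p))"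
  have mc: "mono (?c k)" for k
    using monoD[OF mono_contr[of k]] by (auto simp: mono_def less_eq_prod_def)
  have sub: "?c k ` ({..k} \<times> {..1} \<times> {..1}) \<subseteq> {..Suc k} \<times> {..1}" for k by (auto simp: contr_def)
  have f: "fst ` set (map (?c k) s) = contr k ` set (map loop_dir s)" for k and s :: "(nat \<times> nat \<times> nat) list"
    by (simp add: image_image)
  have sn: "snd ` set (map (?c k) s) = snd ` snd ` set s" for k and s :: "(nat \<times> nat \<times> nat) list"
    by (simp add: image_image)
  have "loop_htpy (rr \<alpha>) (rr \<beta>) (\<lambda>s t. h (map (?c m) s) (map (?c n) t))"
    unfolding loop_htpy_def
  proof (intro conjI allI impI)
    show "sqbx (\<lambda>s t. h (map (?c m) s) (map (?c n) t))" by (rule Bx_pull[OF H(1) mc mc sub sub])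
    fix s t assume sq: "sqin s t"
    have lin: "lin (map (?c m) s) (map (?c n) t)" by (rule inb_map[OF sq mc mc sub sub])
    show "h (map (?c m) s) (map (?c n) t) = star s t"
      if c: "nc s t \<or> 0 \<notin> fst ` snd ` set s \<or> 0 \<notin> fst ` snd ` set t \<or>
        1 \<notin> fst ` snd ` set s \<and> 1 \<notin> fst ` snd ` set t"
    proof -
      have "nc (map (?c m) s) (map (?c n) t) \<or>
          Suc m \<notin> fst ` set (map (?c m) s) \<and> Suc n \<notin> fst ` set (map (?c n) t)"
      proof (cases "nc s t \<or> 0 \<notin> fst ` snd ` set s \<or> 0 \<notin> fst ` snd ` set t")
        case True
        then have "nc (map loop_dir s) (map loop_dir t) \<or> 0 \<notin> snd ` set (map loop_dir s) \<or> 0 \<notin> snd ` set (map loop_dir t)"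
          by (simp add: nc_def image_image)
        from contr_nc[OF this] show ?thesis unfolding nc_def f by blast
      next
        case False
        have "Suc k \<notin> contr k ` set (map loop_dir r)"
          if "set r \<subseteq> {..k} \<times> {..1} \<times> {..1}" "1 \<notin> fst ` snd ` set r" for k and r :: "(nat \<times> nat \<times> nat) list"
          using that by (force simp: contr_def split: if_splits)
        then show ?thesis unfolding f using c False sq unfolding inb_def by blast
      qed
      from H(2)[OF lin this] show ?thesis by simp
    qed
    show "h (map (?c m) s) (map (?c n) t) = rr \<alpha> (map loop_dir s) (map loop_dir t)"
      if "0 \<notin> snd ` snd ` set s \<or> 0 \<notin> snd ` snd ` set t"
      using H(3)[OF lin, unfolded sn, OF that] by (simp add: rr_def comp_def)
    show "h (map (?c m) s) (map (?c n) t) = rr \<beta> (map loop_dir s) (map loop_dir t)"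
      if "1 \<notin> snd ` snd ` set s \<and> 1 \<notin> snd ` snd ` set t"
      using H(4)[OF lin, unfolded sn, OF that] by (simp add: rr_def comp_def)
  qed
  then show ?thesis using loop_htpy_imp_E rr_loop assms by blast
qed

text \<open>A monotone retraction that makes a map on the base \<open>{..k}\<close> into one on
  \<open>{..Suc k}\<close>, as a piece for \<open>fill_pieces\<close> must be. Its values matter
  only where the last vertex is absent and it is the identity.\<close>

abbreviation low :: "nat \<Rightarrow> nat \<times> nat \<Rightarrow> nat \<times> nat" where "low k p \<equiv> (min (fst p) k, snd p)"

lemma mono_low: "mono (low k)"
  by (auto simp: mono_def less_eq_prod_def)

lemma low_id: "set s \<subseteq> {..Suc k} \<times> S \<Longrightarrow> Suc k \<notin> fst ` set s \<Longrightarrow> map (low k) s = s"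
  by (force intro!: map_idI simp: le_Suc_eq)

lemma below: "set s \<subseteq> {..Suc k} \<times> S \<Longrightarrow> Suc k \<notin> fst ` set s \<Longrightarrow> set s \<subseteq> {..k} \<times> S"
  by (force simp: le_Suc_eq)

lemma low_eq:
  assumes "inb ({..Suc m} \<times> S) ({..Suc n} \<times> S) s t" "Suc m \<notin> fst ` set s \<and> Suc n \<notin> fst ` set t"
  shows "map (low m) s = s \<and> map (low n) t = t \<and> inb ({..m} \<times> S) ({..n} \<times> S) s t"
  using assms low_id[of s m] low_id[of t n] below[of s m] below[of t n] unfolding inb_def by blast

text \<open>Put \<open>w\<close> on the last corner of the base, the trivial map over the horn and
  where a direction omits level 0, and fill. The filler is a lift of its own restriction
  \<open>\<alpha>\<close> to level 0, and \<open>w\<close> is the loop that this lift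
  determines.\<close>

lemma rel_surj:
  assumes w: "loop w"
  shows "\<exists>\<alpha>. rel \<alpha> \<and> E (rr \<alpha>) w"
proof -
  let ?w = "\<lambda>s t. w (map (low m) s) (map (low n) t)"
  let ?Qn = "\<lambda>A B A' B'. \<not> {..m} \<subseteq> A \<or> \<not> {..n} \<subseteq> A'" and ?Qa = "\<lambda>A B A' B'. 0 \<notin> B \<or> 0 \<notin> B'"
    and ?Qc = "\<lambda>A B A' B'. Suc m \<notin> A \<and> Suc n \<notin> A'"
  let ?L = "[(?Qn, star), (?Qa, star), (?Qc, ?w)] :: (occ \<times> ((nat \<times> nat) list \<Rightarrow> (nat \<times> nat) list \<Rightarrow> 'a)) list"
  have "lbx ?w" by (rule Bx_pull[OF loop_bx[OF w] mono_low mono_low]) auto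
  then have bx: "lbx \<chi>" if "(Q, \<chi>) \<in> set ?L" for Q \<chi>
    using that by (auto simp: bx_star)
  have adm: "admissible 1 Q" if "(Q, \<chi>) \<in> set ?L" for Q and \<chi> :: "(nat \<times> nat) list \<Rightarrow> (nat \<times> nat) list \<Rightarrow> 'a"
    using that by (auto intro: admissibleI simp del: de_Morgan_conj de_Morgan_disj imp_conv_disj disj_not1 disj_not2)
  have w_eq: "gin 1 s t \<and> ?w s t = w s t" if "lin s t" "Suc m \<notin> fst ` set s \<and> Suc n \<notin> fst ` set t" for s t
    using low_eq[OF that] by presburger
  have w_star: "?w s t = star s t" if "lin s t" "Suc m \<notin> fst ` set s \<and> Suc n \<notin> fst ` set t"
    "nc s t \<or> 0 \<notin> snd ` set s \<or> 0 \<notin> snd ` set t \<or> 1 \<notin> snd ` set s \<and> 1 \<notin> snd ` set t" for s t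
    using w_eq[OF that(1,2)] loop_star[OF w _ that(3)] by presburger
  have ws: "star s t = ?w s t" if "lin s t" "nc s t" "Suc m \<notin> fst ` set s \<and> Suc n \<notin> fst ` set t" for s t
    by (rule w_star[OF that(1,3), symmetric]) (use that(2) in blast)
  have ws0: "star s t = ?w s t"
    if "lin s t" "0 \<notin> snd ` set s \<or> 0 \<notin> snd ` set t" "Suc m \<notin> fst ` set s \<and> Suc n \<notin> fst ` set t" for s t
    by (rule w_star[OF that(1,3), symmetric]) (use that(2) in blast)
  have com: "sorted_wrt (\<lambda>(Q, \<chi>) (Q', \<chi>'). \<forall>s t. lin s t \<longrightarrow>
      occ_of Q s t \<longrightarrow> occ_of Q' s t \<longrightarrow> \<chi> s t = \<chi>' s t) ?L"
    using ws ws0 by (simp add: occ_of_def nc_def)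
  obtain \<psi> where \<psi>: "lbx \<psi>"
      "\<And>Q \<chi> s t. \<lbrakk>(Q, \<chi>) \<in> set ?L; lin s t; occ_of Q s t\<rbrakk> \<Longrightarrow> \<psi> s t = \<chi> s t"
    by (rule fill_pieces[OF bx adm com]) auto
  have vn: "\<psi> s t = star s t" if "lin s t" "nc s t" for s t
    by (rule \<psi>(2)[of ?Qn]) (use that in \<open>simp_all add: occ_of_def nc_def\<close>)
  have va: "\<psi> s t = star s t" if "lin s t" "0 \<notin> snd ` set s \<or> 0 \<notin> snd ` set t" for s t
    by (rule \<psi>(2)[of ?Qa]) (use that in \<open>simp_all add: occ_of_def\<close>)
  have vc: "\<psi> s t = ?w s t" if "lin s t" "Suc m \<notin> fst ` set s \<and> Suc n \<notin> fst ` set t" for s t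
    by (rule \<psi>(2)[of ?Qc]) (use that in \<open>simp_all add: occ_of_def\<close>)
  let ?i = "\<lambda>i :: nat. (i, 0 :: nat)"
  define \<alpha> where "\<alpha> s t = \<psi> (map ?i s) (map ?i t)" for s t
  have mi: "mono ?i" by (auto simp: mono_def less_eq_prod_def)
  have "rel \<alpha>"
    unfolding rel_def
  proof (intro conjI allI impI)
    show "Bx X {..Suc m} {..Suc n} \<alpha>" unfolding \<alpha>_def by (rule Bx_pull[OF \<psi>(1) mi mi]) auto
    fix s t assume r: "rin s t" and c: "\<not> {..m} \<subseteq> set s \<or> \<not> {..n} \<subseteq> set t \<or> Suc m \<notin> set s \<and> Suc n \<notin> set t"
    have lin: "lin (map ?i s) (map ?i t)" by (rule inb_map[OF r mi mi]) auto
    have one: "1 \<notin> snd ` set (map ?i s)" "1 \<notin> snd ` set (map ?i t)" by auto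
    have "\<psi> (map ?i s) (map ?i t) = star (map ?i s) (map ?i t)"
    proof (cases "nc (map ?i s) (map ?i t)")
      case True then show ?thesis by (rule vn[OF lin])
    next
      case False
      then have "Suc m \<notin> fst ` set (map ?i s) \<and> Suc n \<notin> fst ` set (map ?i t)"
        using c by (simp add: nc_def image_image)
      then show ?thesis using vc[OF lin] w_star[OF lin] one by presburger
    qed
    then show "\<alpha> s t = star s t" by (simp add: \<alpha>_def)
  qed
  have lift: "lift \<psi> \<alpha>"
    unfolding lift_def
  proof (intro conjI allI impI)
    show "lbx \<psi>" by (rule \<psi>(1))
    fix s t assume lin: "lin s t"
    show "\<psi> s t = star s t" if "nc s t \<or> 0 \<notin> snd ` set s \<or> 0 \<notin> snd ` set t"
      using vn[OF lin] va[OF lin] that by blast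
    show "\<psi> s t = \<alpha> (map fst s) (map fst t)" if "1 \<notin> snd ` set s \<and> 1 \<notin> snd ` set t"
    proof -
      have d: "map ?i (map fst r) = r" if "set r \<subseteq> S \<times> {..1}" "1 \<notin> snd ` set r" for r :: "(nat \<times> nat) list" and S
        using that by (force intro!: map_idI simp: le_Suc_eq)
      have "map ?i (map fst s) = s" "map ?i (map fst t) = t"
        using that lin unfolding inb_def by (blast intro: d)+
      then show ?thesis by (simp only: \<alpha>_def)
    qed
  qed
  have "E \<psi> w"
  proof (rule E_eqI[OF lift_loop[OF \<open>rel \<alpha>\<close> lift] w])
    fix s t assume gin: "gin 1 s t"
    have nm: "Suc m \<notin> fst ` set s \<and> Suc n \<notin> fst ` set t" using gin by (force simp: inb_def)
    show "\<psi> s t = w s t" using vc[OF gin_lin[OF gin] nm] w_eq[OF gin_lin[OF gin] nm] by presburger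
  qed
  then show ?thesis using \<open>rel \<alpha>\<close> E_trans[OF lift_E[OF \<open>rel \<alpha>\<close> lift]] by blast
qed

text \<open>The triangle witnessing \<open>E\<close> is put on the last corner of the base, the
  canonical lifts of \<open>\<alpha>\<close> and \<open>\<beta>\<close> on the faces opposite levels
  0 and 1. After filling, levels 0 and 1 carry a homotopy from \<open>\<alpha>\<close> to
  \<open>\<beta>\<close>; it is trivial on the last corner because the edge of the triangle there is
  \<open>star\<close>.\<close>

lemma E_imp_rel_htpy:
  assumes \<alpha>: "rel \<alpha>" and \<beta>: "rel \<beta>" and E: "E (rr \<alpha>) (rr \<beta>)"
  shows "\<exists>h. rel_htpy \<alpha> \<beta> h"
proof -
  have "T (rr \<alpha>) star (rr \<beta>)" using E T_iff_E[OF rr_loop[OF \<alpha>]] by simp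
  then obtain \<theta> where \<theta>: "comp_by \<theta> (rr \<alpha>) star (rr \<beta>)" unfolding T_def by blast
  note C = comp_byD[OF \<theta>]
  let ?P = "{..Suc m} \<times> {..2 :: nat}" and ?P' = "{..Suc n} \<times> {..2 :: nat}"
  let ?\<theta> = "\<lambda>s t. \<theta> (map (low m) s) (map (low n) t)"
  let ?a = "\<lambda>s t. rr \<alpha> (map dec s) (map dec t)" and ?b = "\<lambda>s t. rr \<beta> (map dec s) (map dec t)"
  let ?Qn = "\<lambda>A B A' B'. \<not> {..m} \<subseteq> A \<or> \<not> {..n} \<subseteq> A'" and ?Qa = "\<lambda>A B A' B'. 0 \<notin> B \<or> 0 \<notin> B'"
    and ?Qb = "\<lambda>A B A' B'. 1 \<notin> B \<and> 1 \<notin> B'" and ?Qc = "\<lambda>A B A' B'. Suc m \<notin> A \<and> Suc n \<notin> A'"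
  let ?L = "[(?Qn, star), (?Qa, ?a), (?Qb, ?b), (?Qc, ?\<theta>)] :: (occ \<times> ((nat \<times> nat) list \<Rightarrow> (nat \<times> nat) list \<Rightarrow> 'a)) list"
  have ld: "lin (map dec s) (map dec t)" if "inb ?P ?P' s t" for s t
    by (rule inb_map[OF that]) (auto simp: dec_def)
  have "Bx X ?P ?P' ?a" "Bx X ?P ?P' ?b"
    by (rule Bx_pull[OF liftD(1)[OF lift_rr[OF \<alpha>]]] Bx_pull[OF liftD(1)[OF lift_rr[OF \<beta>]]]; auto simp: dec_def)+
  moreover have "Bx X ?P ?P' ?\<theta>" by (rule Bx_pull[OF C(1) mono_low mono_low]) auto
  ultimately have bx: "Bx X ?P ?P' \<chi>" if "(Q, \<chi>) \<in> set ?L" for Q \<chi>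
    using that by (auto simp: bx_star)
  have adm: "admissible 2 Q" if "(Q, \<chi>) \<in> set ?L" for Q and \<chi> :: "(nat \<times> nat) list \<Rightarrow> (nat \<times> nat) list \<Rightarrow> 'a"
    using that by (auto intro: admissibleI simp del: de_Morgan_conj de_Morgan_disj imp_conv_disj disj_not1 disj_not2)
  have \<theta>_eq: "gin 2 s t \<and> ?\<theta> s t = \<theta> s t" if "inb ?P ?P' s t" "Suc m \<notin> fst ` set s \<and> Suc n \<notin> fst ` set t" for s t
    using low_eq[OF that] by presburger
  have rs: "rr \<gamma> (map dec s) (map dec t) = star s t"
    if \<gamma>: "rel \<gamma>" and i: "inb ?P ?P' s t"
      and c: "nc s t \<or> (0 \<notin> snd ` set s \<or> 0 \<notin> snd ` set t) \<and> (1 \<notin> snd ` set s \<and> 1 \<notin> snd ` set t)" for s t \<gamma>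
  proof -
    have d: "0 \<notin> snd ` set (map dec r)" if "0 \<notin> snd ` set r" "1 \<notin> snd ` set r" for r
      using that by (force simp: dec_def)
    have "rr \<gamma> (map dec s) (map dec t) = star (map dec s) (map dec t)"
      by (rule liftD(2)[OF lift_rr[OF \<gamma>] ld[OF i]]) (use c d nc_map(1) in blast)
    then show ?thesis by simp
  qed
  have nc: "star s t = ?\<theta> s t" if "inb ?P ?P' s t" "nc s t" "Suc m \<notin> fst ` set s \<and> Suc n \<notin> fst ` set t" for s t
    using \<theta>_eq[OF that(1,3)] C(2)[OF _ that(2)] by presburger
  have ac: "?a s t = ?\<theta> s t" if "inb ?P ?P' s t" "0 \<notin> snd ` set s \<or> 0 \<notin> snd ` set t" "Suc m \<notin> fst ` set s \<and> Suc n \<notin> fst ` set t" for s t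
    using \<theta>_eq[OF that(1,3)] C(3)[OF _ that(2)] by presburger
  have bc: "?b s t = ?\<theta> s t" if "inb ?P ?P' s t" "1 \<notin> snd ` set s \<and> 1 \<notin> snd ` set t" "Suc m \<notin> fst ` set s \<and> Suc n \<notin> fst ` set t" for s t
    using \<theta>_eq[OF that(1,3)] C(5)[of s t] that(2) by presburger
  have com: "sorted_wrt (\<lambda>(Q, \<chi>) (Q', \<chi>'). \<forall>s t. inb ?P ?P' s t \<longrightarrow>
      occ_of Q s t \<longrightarrow> occ_of Q' s t \<longrightarrow> \<chi> s t = \<chi>' s t) ?L"
    using rs[OF \<alpha>] rs[OF \<beta>] nc ac bc by (simp add: occ_of_def nc_def)
  obtain \<psi> where \<psi>: "Bx X ?P ?P' \<psi>"
      "\<And>Q \<chi> s t. \<lbrakk>(Q, \<chi>) \<in> set ?L; inb ?P ?P' s t; occ_of Q s t\<rbrakk> \<Longrightarrow> \<psi> s t = \<chi> s t"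
    by (rule fill_pieces[OF bx adm com]) auto
  have "rel_htpy \<alpha> \<beta> \<psi>"
    unfolding rel_htpy_def
  proof (intro conjI allI impI)
    show "lbx \<psi>" by (rule Bx_mono[OF \<psi>(1)]) auto
    fix s t assume lin: "lin s t"
    have i: "inb ?P ?P' s t" by (rule inb_mono[OF lin]) auto
    have le: "\<forall>p\<in>set s. snd p \<le> 1" "\<forall>p\<in>set t. snd p \<le> 1" using lin by (auto simp: inb_def)
    \<comment> \<open>From levels 0 and 1 \<open>dec\<close> leaves only level 0, where
      \<open>contr\<close> is the projection. So the two lifts restrict to \<open>\<alpha>\<close>
      and \<open>\<beta>\<close>.\<close>
    have cd: "map (contr k) (map dec r) = map fst r" if "\<forall>p\<in>set r. snd p \<le> 1" "set r \<subseteq> {..Suc k} \<times> S" for k r S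
      using that by (force simp: contr_def dec_def)
    have sub: "set s \<subseteq> {..Suc m} \<times> {..1}" "set t \<subseteq> {..Suc n} \<times> {..1}" using lin by (auto simp: inb_def)
    have vn: "\<psi> s t = star s t" if "nc s t"
      by (rule \<psi>(2)[OF _ i, of ?Qn]) (use that in \<open>simp_all add: occ_of_def nc_def\<close>)
    have vc: "\<psi> s t = star s t" if h: "Suc m \<notin> fst ` set s \<and> Suc n \<notin> fst ` set t"
    proof -
      have "\<psi> s t = ?\<theta> s t"
        by (rule \<psi>(2)[OF _ i, of ?Qc]) (use h in \<open>simp_all add: occ_of_def\<close>)
      moreover have "2 \<notin> snd ` set s" "2 \<notin> snd ` set t" using le by force+
      ultimately show ?thesis using \<theta>_eq[OF i h] C(4)[of s t] by presburger
    qed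
    show "\<psi> s t = star s t" if "nc s t \<or> Suc m \<notin> fst ` set s \<and> Suc n \<notin> fst ` set t"
      using vn vc that by blast
    show "\<psi> s t = \<alpha> (map fst s) (map fst t)" if h: "0 \<notin> snd ` set s \<or> 0 \<notin> snd ` set t"
    proof -
      have "\<psi> s t = ?a s t"
        by (rule \<psi>(2)[OF _ i, of ?Qa]) (use h in \<open>simp_all add: occ_of_def\<close>)
      then show ?thesis unfolding rr_def cd[OF le(1) sub(1)] cd[OF le(2) sub(2)] .
    qed
    show "\<psi> s t = \<beta> (map fst s) (map fst t)" if h: "1 \<notin> snd ` set s \<and> 1 \<notin> snd ` set t"
    proof -
      have "\<psi> s t = ?b s t"
        by (rule \<psi>(2)[OF _ i, of ?Qb]) (use h in \<open>simp_all add: occ_of_def\<close>)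
      then show ?thesis unfolding rr_def cd[OF le(1) sub(1)] cd[OF le(2) sub(2)] .
    qed
  qed
  then show ?thesis by blast
qed

lemma rel_htpy_iff: "rel \<alpha> \<Longrightarrow> rel \<beta> \<Longrightarrow> (\<exists>h. rel_htpy \<alpha> \<beta> h) \<longleftrightarrow> E (rr \<alpha>) (rr \<beta>)"
  using rel_htpy_imp_E E_imp_rel_htpy by blast

end

section \<open>The Aeppli product\<close>

definition cd :: "nat \<Rightarrow> nat \<Rightarrow> nat" where "cd k j = (if j \<le> k then j else j - 1)"
definition cf :: "nat \<Rightarrow> nat \<Rightarrow> nat" where "cf k j = (if j < k then j else Suc j)"

lemma mono_cd [simp]: "mono (cd k)" and mono_cf [simp]: "mono (cf k)"
  by (auto simp: mono_def cd_def cf_def)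

lemma cd_cf [simp]: "cd k (cf k j) = j"
  by (auto simp: cd_def cf_def)

lemma cd_miss:
  "i < k \<Longrightarrow> i \<notin> S \<Longrightarrow> i \<notin> cd k ` S" "k \<notin> S \<Longrightarrow> Suc k \<notin> S \<Longrightarrow> k \<notin> cd k ` S"
  by (auto simp: cd_def split: if_splits)

context loops
begin

abbreviation "ain \<equiv> inb {..Suc (Suc m)} {..Suc (Suc n)}"

text \<open>This is \<open>aeppli_filler\<close> for \<open>p = m + 1\<close>,
  \<open>q = n + 1\<close>, whence \<open>p - 1 = m\<close>. The two conditions on the faces
  \<open>p - 1\<close> and \<open>q - 1\<close> become one clause: \<open>cd\<close> renumbers in a
  direction that omits the vertex and degenerates in the other.\<close>

definition afill where
  "afill \<alpha> \<beta> \<theta> \<longleftrightarrow> Bx X {..Suc (Suc m)} {..Suc (Suc n)} \<theta> \<and> (\<forall>s t. ain s t \<longrightarrow>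
     (\<not> {..<m} \<subseteq> set s \<or> \<not> {..<n} \<subseteq> set t \<longrightarrow> \<theta> s t = star s t) \<and>
     (m \<notin> set s \<or> n \<notin> set t \<longrightarrow> \<theta> s t = \<alpha> (map (cd m) s) (map (cd n) t)) \<and>
     (Suc (Suc m) \<notin> set s \<and> Suc (Suc n) \<notin> set t \<longrightarrow> \<theta> s t = \<beta> s t))"

lemma afillD:
  assumes "afill \<alpha> \<beta> \<theta>"
  shows "Bx X {..Suc (Suc m)} {..Suc (Suc n)} \<theta>"
    "ain s t \<Longrightarrow> \<not> {..<m} \<subseteq> set s \<or> \<not> {..<n} \<subseteq> set t \<Longrightarrow> \<theta> s t = star s t"
    "ain s t \<Longrightarrow> m \<notin> set s \<or> n \<notin> set t \<Longrightarrow> \<theta> s t = \<alpha> (map (cd m) s) (map (cd n) t)"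
    "ain s t \<Longrightarrow> Suc (Suc m) \<notin> set s \<and> Suc (Suc n) \<notin> set t \<Longrightarrow> \<theta> s t = \<beta> s t"
  using assms unfolding afill_def by blast+

definition aprod :: "(nat list \<Rightarrow> nat list \<Rightarrow> 'a) \<Rightarrow> nat list \<Rightarrow> nat list \<Rightarrow> 'a" where
  "aprod \<theta> s t = \<theta> (map (cf (Suc m)) s) (map (cf (Suc n)) t)"

lemma rin_cd: "ain s t \<Longrightarrow> rin (map (cd k) s) (map (cd l) t)" if "k \<le> Suc m" "l \<le> Suc n"
  by (erule inb_map) (use that in \<open>auto simp: cd_def\<close>)

lemma ain_cf: "rin s t \<Longrightarrow> ain (map (cf k) s) (map (cf l) t)"
  by (erule inb_map) (auto simp: cf_def)

text \<open>Under \<open>cd m\<close> a missing vertex below \<open>m\<close> stays missing, the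
  loss of \<open>m\<close> and \<open>Suc m\<close> loses \<open>m\<close>, and the loss of the last
  vertex loses \<open>Suc m\<close>. In each case the image meets the Aeppli boundary
  condition.\<close>

lemma rel_cd_star:
  assumes \<alpha>: "rel \<alpha>" and a: "ain s t"
    and c: "\<not> {..<m} \<subseteq> set s \<or> \<not> {..<n} \<subseteq> set t \<or> (m \<notin> set s \<and> Suc m \<notin> set s) \<or> (n \<notin> set t \<and> Suc n \<notin> set t) \<or>
      Suc (Suc m) \<notin> set s \<and> Suc (Suc n) \<notin> set t"
  shows "\<alpha> (map (cd m) s) (map (cd n) t) = star s t"
proof -
  have d1: "\<not> {..k} \<subseteq> cd k ` S" if h: "\<not> {..<k} \<subseteq> S \<or> k \<notin> S \<and> Suc k \<notin> S" for k S
  proof (cases "k \<notin> S \<and> Suc k \<notin> S")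
    case True
    then have "k \<notin> cd k ` S" using cd_miss(2) by blast
    then show ?thesis by (metis atMost_iff order_refl subsetD)
  next
    case False
    then obtain i where i: "i < k" "i \<notin> S" using h by blast
    then show ?thesis using cd_miss(1)[OF i] by (metis atMost_iff less_imp_le subsetD)
  qed
  have d2: "Suc k \<notin> cd k ` S" if "S \<subseteq> {..Suc (Suc k)}" "Suc (Suc k) \<notin> S" for k S
    using that by (force simp: cd_def split: if_splits)
  have "\<not> {..m} \<subseteq> set (map (cd m) s) \<or> \<not> {..n} \<subseteq> set (map (cd n) t) \<or>
      Suc m \<notin> set (map (cd m) s) \<and> Suc n \<notin> set (map (cd n) t)"
    using c d1[of m "set s"] d1[of n "set t"] d2[of "set s" m] d2[of "set t" n] a
    unfolding inb_def set_map by blast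
  moreover have "rin (map (cd m) s) (map (cd n) t)" by (rule rin_cd[OF _ _ a]) auto
  ultimately have "\<alpha> (map (cd m) s) (map (cd n) t) = star (map (cd m) s) (map (cd n) t)"
    using relD(2)[OF \<alpha>] by blast
  then show ?thesis by simp
qed

text \<open>In contrast to \<open>T_triangle\<close> this produces a product rather than a quotient:
  the free corner is opposite the inner vertices \<open>Suc m\<close> and
  \<open>Suc n\<close>.\<close>

lemma afill_ex:
  assumes \<alpha>: "rel \<alpha>" and \<beta>: "rel \<beta>"
  shows "\<exists>\<theta>. afill \<alpha> \<beta> \<theta>"
proof -
  let ?P = "{..Suc (Suc m)}" and ?P' = "{..Suc (Suc n)}"
  let ?D = "\<lambda>\<sigma> \<sigma>'. \<not> {..m} \<subseteq> \<sigma> \<or> \<not> {..n} \<subseteq> \<sigma>' \<or> Suc (Suc m) \<notin> \<sigma> \<and> Suc (Suc n) \<notin> \<sigma>'"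
  let ?D1 = "\<lambda>\<sigma> \<sigma>'. \<not> {..<m} \<subseteq> \<sigma> \<or> \<not> {..<n} \<subseteq> \<sigma>'" and ?D2 = "\<lambda>\<sigma> \<sigma>'. m \<notin> \<sigma> \<or> n \<notin> \<sigma>'"
    and ?D3 = "\<lambda>\<sigma> \<sigma>'. Suc (Suc m) \<notin> \<sigma> \<and> Suc (Suc n) \<notin> \<sigma>'"
  let ?a = "\<lambda>s t. \<alpha> (map (cd m) s) (map (cd n) t)"
  \<comment> \<open>The prescriptions overlap. By \<open>\<phi>2\<close> and \<open>\<phi>3\<close>
    the order of the cases is immaterial, as all values on overlaps are trivial.\<close>
  define \<phi> where "\<phi> s t = (if ?D1 (set s) (set t) then star s t else if ?D2 (set s) (set t) then ?a s t else \<beta> s t)" for s t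
  have \<phi>2: "\<phi> s t = ?a s t" if "ain s t" "?D2 (set s) (set t)" for s t
  proof (cases "?D1 (set s) (set t)")
    case True
    have "?a s t = star s t" by (rule rel_cd_star[OF \<alpha> that(1)]) (use True in blast)
    then show ?thesis by (simp only: \<phi>_def if_P[OF True])
  next
    case False
    show ?thesis by (simp only: \<phi>_def if_not_P[OF False] if_P[OF that(2)])
  qed
  have \<phi>3: "\<phi> s t = \<beta> s t" if a: "ain s t" and d: "?D3 (set s) (set t)" for s t
  proof -
    have rin: "rin s t" using a d unfolding inb_def by (auto simp: le_Suc_eq)
    have lt: "{..<k} \<subseteq> S \<and> k \<in> S \<longleftrightarrow> {..k} \<subseteq> S" for k :: nat and S
      by (metis insert_subset lessThan_Suc lessThan_Suc_atMost)
    have "\<beta> s t = star s t" if "?D1 (set s) (set t) \<or> ?D2 (set s) (set t)"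
      by (rule relD(2)[OF \<beta> rin]) (use that lt in blast)
    moreover have "?a s t = star s t" by (rule rel_cd_star[OF \<alpha> a]) (use d in blast)
    ultimately show ?thesis unfolding \<phi>_def by presburger
  qed
  have "bx X (\<lambda>\<sigma> \<sigma>'. \<sigma> \<subseteq> ?P \<and> \<sigma>' \<subseteq> ?P' \<and> ?D \<sigma> \<sigma>') \<phi>"
  proof (rule bx_local)
    fix s t :: "nat list" assume st: "srt s" "srt t" "set s \<subseteq> ?P \<and> set t \<subseteq> ?P' \<and> ?D (set s) (set t)"
    have lt: "{..<k} \<subseteq> S \<and> k \<in> S \<longleftrightarrow> {..k} \<subseteq> S" for k :: nat and S
      by (metis insert_subset lessThan_Suc lessThan_Suc_atMost)
    consider "?D1 (set s) (set t)" | "?D2 (set s) (set t)" | "?D3 (set s) (set t)"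
      using st(3) lt by blast
    then show "\<exists>E \<chi>. E (set s) (set t) \<and> down E \<and> bx X E \<chi> \<and>
        (\<forall>s t. srt s \<longrightarrow> srt t \<longrightarrow> E (set s) (set t) \<longrightarrow> \<phi> s t = \<chi> s t)"
    proof cases
      case 1
      have "down ?D1" unfolding down_def by blast
      then show ?thesis using 1 bx_star by (intro exI[of _ ?D1] exI[of _ star]) (simp add: \<phi>_def)
    next
      case 2
      let ?E = "\<lambda>\<sigma> \<sigma>'. \<sigma> \<subseteq> ?P \<and> \<sigma>' \<subseteq> ?P' \<and> ?D2 \<sigma> \<sigma>'"
      have "down ?E" unfolding down_def by blast
      moreover have "Bx X ?P ?P' ?a" by (rule Bx_pull[OF relD(1)[OF \<alpha>]]) (auto simp: cd_def)
      then have "bx X ?E ?a" by (rule bx_mono) blast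
      moreover have "\<forall>s t. srt s \<longrightarrow> srt t \<longrightarrow> ?E (set s) (set t) \<longrightarrow> \<phi> s t = ?a s t"
        using \<phi>2 by (simp add: inb_def)
      ultimately show ?thesis using 2 st(3) by (intro exI[of _ ?E] exI[of _ ?a]) blast
    next
      case 3
      let ?E = "\<lambda>\<sigma> \<sigma>'. \<sigma> \<subseteq> {..Suc m} \<and> \<sigma>' \<subseteq> {..Suc n}"
      have "down ?E" unfolding down_def by blast
      moreover have "?E (set s) (set t)" using 3 st(3) by (auto simp: le_Suc_eq)
      moreover have "\<forall>s t. srt s \<longrightarrow> srt t \<longrightarrow> ?E (set s) (set t) \<longrightarrow> \<phi> s t = \<beta> s t"
      proof (intro allI impI)
        fix s t assume "srt s" "srt t" and s: "?E (set s) (set t)"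
        moreover have "set s \<subseteq> ?P" "set t \<subseteq> ?P'" using s by auto
        moreover have "?D3 (set s) (set t)" using s by auto
        ultimately show "\<phi> s t = \<beta> s t" using \<phi>3[of s t] by (simp only: inb_def simp_thms)
      qed
      ultimately show ?thesis using relD(1)[OF \<beta>] by (intro exI[of _ ?E] exI[of _ \<beta>]) blast
    qed
  qed
  moreover have "down ?D" unfolding down_def by blast
  ultimately obtain \<theta> where \<theta>: "Bx X ?P ?P' \<theta>"
      "\<And>s t. \<lbrakk>srt s; srt t; set s \<subseteq> ?P; set t \<subseteq> ?P'; ?D (set s) (set t)\<rbrakk> \<Longrightarrow> \<theta> s t = \<phi> s t"
  \<comment> \<open>The prescribed part does not mention these vertices, so missing pairs stay
    missing when they are toggled.\<close>
  proof (rule fill_vertex[where w = "Suc m" and w' = "Suc n"])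
    fix \<sigma> \<sigma>' assume d: "\<not> ?D \<sigma> \<sigma>'"
    have "0 \<in> \<sigma> - {Suc m}" "0 \<in> \<sigma>' - {Suc n}" using d by auto
    moreover have "{..m} \<subseteq> \<sigma> - {Suc m}" "{..n} \<subseteq> \<sigma>' - {Suc n}" using d by auto
    ultimately show "\<sigma> - {Suc m} \<noteq> {} \<and> \<sigma>' - {Suc n} \<noteq> {} \<and> \<not> ?D (\<sigma> - {Suc m}) \<sigma>' \<and> \<not> ?D \<sigma> (\<sigma>' - {Suc n})"
      using d by auto
  qed auto
  have \<theta>': "\<theta> s t = \<phi> s t" if "ain s t" "?D (set s) (set t)" for s t
    using \<theta>(2)[of s t] that by (simp only: inb_def simp_thms)
  have "afill \<alpha> \<beta> \<theta>"
    unfolding afill_def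
  proof (intro conjI allI impI)
    show "Bx X ?P ?P' \<theta>" by (rule \<theta>(1))
    fix s t assume a: "ain s t"
    show "\<theta> s t = star s t" if h: "?D1 (set s) (set t)"
    proof -
      have "?D (set s) (set t)" using h by (meson lessThan_iff atMost_iff less_imp_le subset_iff)
      then show ?thesis using \<theta>'[OF a] h by (simp add: \<phi>_def)
    qed
    show "\<theta> s t = ?a s t" if "?D2 (set s) (set t)"
    proof -
      have "?D (set s) (set t)" using that by blast
      then show ?thesis using \<theta>'[OF a] \<phi>2[OF a that] by simp
    qed
    show "\<theta> s t = \<beta> s t" if "?D3 (set s) (set t)"
      using \<theta>'[OF a] \<phi>3[OF a that] that by simp
  qed
  then show ?thesis by blast
qed

lemma aprod_rel:
  assumes \<alpha>: "rel \<alpha>" and \<beta>: "rel \<beta>" and \<theta>: "afill \<alpha> \<beta> \<theta>"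
  shows "rel (aprod \<theta>)"
  unfolding rel_def
proof (intro conjI allI impI)
  note F = afillD[OF \<theta>]
  show "Bx X {..Suc m} {..Suc n} (aprod \<theta>)"
    unfolding aprod_def by (rule Bx_pull[OF F(1)]) (auto simp: cf_def)
  fix s t assume r: "rin s t" and c: "\<not> {..m} \<subseteq> set s \<or> \<not> {..n} \<subseteq> set t \<or> Suc m \<notin> set s \<and> Suc n \<notin> set t"
  let ?s = "map (cf (Suc m)) s" and ?t = "map (cf (Suc n)) t"
  have a: "ain ?s ?t" by (rule ain_cf[OF r])
  have lt: "{..<k} \<subseteq> S \<and> k \<in> S \<longleftrightarrow> {..k} \<subseteq> S" for k :: nat and S
    by (metis insert_subset lessThan_Suc lessThan_Suc_atMost)
  have i: "i \<in> cf (Suc k) ` S \<longleftrightarrow> i \<in> S" if "i \<le> k" for i k S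
    using that by (force simp: cf_def image_iff)
  have sk: "Suc k \<notin> cf (Suc k) ` S" for k S by (auto simp: cf_def)
  have sub: "{..<k} \<subseteq> cf (Suc k) ` S \<longleftrightarrow> {..<k} \<subseteq> S" for k S using i[of _ k S] by (auto simp: subset_iff)
  consider "\<not> {..<m} \<subseteq> set ?s \<or> \<not> {..<n} \<subseteq> set ?t"
    | "m \<notin> set ?s \<and> Suc m \<notin> set ?s \<or> n \<notin> set ?t \<and> Suc n \<notin> set ?t" | "Suc m \<notin> set s \<and> Suc n \<notin> set t"
    unfolding set_map sub i[OF order_refl]
    using c sk[of m "set s"] sk[of n "set t"] unfolding lt[symmetric] by blast
  then have "\<theta> ?s ?t = star ?s ?t"
  proof cases
    case 1
    then show ?thesis by (rule F(2)[OF a])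
  next
    case 2
    then show ?thesis using F(3)[OF a] rel_cd_star[OF \<alpha> a] by metis
  next
    case 3
    have "cf (Suc k) j = j" if "j \<le> Suc k" "j \<noteq> Suc k" for j k using that by (simp add: cf_def)
    then have eq: "?s = s" "?t = t"
      using r 3 unfolding inb_def by (auto intro!: map_idI)
    have "Suc (Suc m) \<notin> set s \<and> Suc (Suc n) \<notin> set t" using r by (auto simp: inb_def)
    then show ?thesis using F(4)[OF a] relD(2)[OF \<beta> r] 3 unfolding eq by metis
  qed
  then show "aprod \<theta> s t = star s t" by (simp add: aprod_def)
qed

text \<open>Collapses the first \<open>k\<close> vertices of the middle copy of \<open>\<Delta>\<^sup>k\<close> in \<open>\<Delta>\<^sup>k \<times> \<Delta>\<^sup>2\<close> onto the initial copy
  and the terminal copy to a point.\<close>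

definition prism :: "nat \<Rightarrow> nat \<times> nat \<Rightarrow> nat" where
  "prism k p = (if snd p = 0 then min (fst p) k
     else if snd p = 1 then if fst p < k then fst p else Suc k else Suc (Suc k))"

lemma mono_prism [simp]: "mono (prism k)"
  by (auto simp: mono_def prism_def less_eq_prod_def)

lemma prism_miss:
  "i < k \<Longrightarrow> i \<notin> fst ` S \<Longrightarrow> i \<notin> prism k ` S"
  "S \<subseteq> {..k} \<times> U \<Longrightarrow> k \<notin> fst ` S \<Longrightarrow> k \<notin> prism k ` S"
  "S \<subseteq> {..k} \<times> U \<Longrightarrow> k \<notin> fst ` S \<Longrightarrow> Suc k \<notin> prism k ` S"
  "0 \<notin> snd ` S \<Longrightarrow> k \<notin> prism k ` S"
  "1 \<notin> snd ` S \<Longrightarrow> Suc k \<notin> prism k ` S"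
  "S \<subseteq> {..k} \<times> {..2} \<Longrightarrow> 2 \<notin> snd ` S \<Longrightarrow> Suc (Suc k) \<notin> prism k ` S"
  by (force simp: prism_def split: if_splits)+

text \<open>The loop that \<open>prism\<close> makes of \<open>\<beta>\<close> on levels 0 and 1.
  Only the last base vertex moves, whereas \<open>rr \<beta>\<close> moves the whole base to the
  last vertex.\<close>

definition rh :: "(nat list \<Rightarrow> nat list \<Rightarrow> 'a) \<Rightarrow> (nat \<times> nat) list \<Rightarrow> (nat \<times> nat) list \<Rightarrow> 'a" where
  "rh \<beta> s t = \<beta> (map (prism m) s) (map (prism n) t)"

text \<open>A base vertex below \<open>k\<close> is the only source of its own value under
  \<open>prism k\<close>, and the base vertex \<open>k\<close> is the only source of both
  \<open>k\<close> and \<open>Suc k\<close>. A lost base vertex is therefore visible in the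
  image.\<close>

lemma nc_prism:
  assumes "gin f s t" "nc s t"
  shows "\<not> {..<m} \<subseteq> prism m ` set s \<or> \<not> {..<n} \<subseteq> prism n ` set t \<or>
    m \<notin> prism m ` set s \<and> Suc m \<notin> prism m ` set s \<or> n \<notin> prism n ` set t \<and> Suc n \<notin> prism n ` set t"
proof -
  have d: "\<not> {..<k} \<subseteq> prism k ` S \<or> k \<notin> prism k ` S \<and> Suc k \<notin> prism k ` S"
    if h: "S \<subseteq> {..k} \<times> {..f}" "\<not> {..k} \<subseteq> fst ` S" for k S
  proof (cases "k \<in> fst ` S")
    case True
    then obtain i where "i < k" "i \<notin> fst ` S" using h(2) by (metis atMost_iff le_neq_implies_less subsetI)
    then show ?thesis using prism_miss(1) by blast
  next
    case False
    then show ?thesis using prism_miss(2)[OF h(1)] prism_miss(3)[OF h(1)] by blast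
  qed
  show ?thesis
    using assms d[of "set s" m] d[of "set t" n] unfolding inb_def nc_def by blast
qed

lemma rh_loop:
  assumes \<beta>: "rel \<beta>" shows "loop (rh \<beta>)"
  unfolding loop_def
proof (intro conjI allI impI)
  show "gbx 1 (rh \<beta>)"
    unfolding rh_def by (rule Bx_pull[OF relD(1)[OF \<beta>]]) (auto simp: prism_def)
  fix s t assume gin: "gin 1 s t"
    and c: "nc s t \<or> 0 \<notin> snd ` set s \<or> 0 \<notin> snd ` set t \<or> 1 \<notin> snd ` set s \<and> 1 \<notin> snd ` set t"
  have r: "rin (map (prism m) s) (map (prism n) t)"
    by (rule inb_map[OF gin]) (auto simp: prism_def)
  have le: "k \<in> {..k}" "{..<k} \<subseteq> {..k}" for k :: nat by auto
  have "\<not> {..m} \<subseteq> prism m ` set s \<or> \<not> {..n} \<subseteq> prism n ` set t \<or>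
      Suc m \<notin> prism m ` set s \<and> Suc n \<notin> prism n ` set t"
    using c nc_prism[OF gin] prism_miss(4)[of "set s" m] prism_miss(4)[of "set t" n]
      prism_miss(5)[of "set s" m] prism_miss(5)[of "set t" n] le by blast
  then have "\<beta> (map (prism m) s) (map (prism n) t) = star (map (prism m) s) (map (prism n) t)"
    using relD(2)[OF \<beta> r] by simp
  then show "rh \<beta> s t = star s t" by (simp add: rh_def)
qed

text \<open>Pulling the filler back along \<open>prism\<close> gives a triangle of loops, because
  \<open>cd k\<close> after \<open>prism k\<close> is \<open>contr k\<close> after
  \<open>dec\<close>, and off level 1 \<open>prism k\<close> is \<open>cf (Suc k)\<close> after
  \<open>contr k\<close> after \<open>dec\<close>.\<close>

lemma afill_T_rh:
  assumes \<alpha>: "rel \<alpha>" and \<beta>: "rel \<beta>" and \<theta>: "afill \<alpha> \<beta> \<theta>"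
  shows "T (rr \<alpha>) (rh \<beta>) (rr (aprod \<theta>))"
proof -
  note F = afillD[OF \<theta>]
  have "comp_by (\<lambda>s t. \<theta> (map (prism m) s) (map (prism n) t)) (rr \<alpha>) (rh \<beta>) (rr (aprod \<theta>))"
    unfolding comp_by_def
  proof (intro conjI allI impI)
    show "gbx 2 (\<lambda>s t. \<theta> (map (prism m) s) (map (prism n) t))"
      by (rule Bx_pull[OF F(1)]) (auto simp: prism_def)
    fix s t assume gin: "gin 2 s t"
    let ?s = "map (prism m) s" and ?t = "map (prism n) t"
    have a: "ain ?s ?t" by (rule inb_map[OF gin]) (auto simp: prism_def)
    have sub: "set s \<subseteq> {..m} \<times> {..2}" "set t \<subseteq> {..n} \<times> {..2}" using gin by (auto simp: inb_def)
    show "\<theta> ?s ?t = star s t" if "nc s t"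
    proof -
      have c: "\<not> {..<m} \<subseteq> set ?s \<or> \<not> {..<n} \<subseteq> set ?t \<or>
        m \<notin> set ?s \<and> Suc m \<notin> set ?s \<or> n \<notin> set ?t \<and> Suc n \<notin> set ?t"
        using nc_prism[OF gin that] by simp
      have "\<theta> ?s ?t = star ?s ?t"
      proof (cases "\<not> {..<m} \<subseteq> set ?s \<or> \<not> {..<n} \<subseteq> set ?t")
        case True then show ?thesis by (rule F(2)[OF a])
      next
        case False
        then have "\<theta> ?s ?t = \<alpha> (map (cd m) ?s) (map (cd n) ?t)" using c by (intro F(3)[OF a]) blast
        also have "\<dots> = star ?s ?t" by (rule rel_cd_star[OF \<alpha> a]) (use c False in blast)
        finally show ?thesis .
      qed
      then show ?thesis by simp
    qed
    show "\<theta> ?s ?t = rr \<alpha> (map dec s) (map dec t)" if "0 \<notin> snd ` set s \<or> 0 \<notin> snd ` set t"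
    proof -
      have "m \<notin> set ?s \<or> n \<notin> set ?t" using that prism_miss(4) unfolding set_map by blast
      then have e: "\<theta> ?s ?t = \<alpha> (map (cd m) ?s) (map (cd n) ?t)" by (rule F(3)[OF a])
      have pt: "cd k (prism k p) = contr k (dec p)" if "fst p \<le> k" "snd p \<le> 2" for k p
      proof -
        from that consider "snd p = 0" | "snd p = 1" | "snd p = 2" by linarith
        then show ?thesis by cases (use that in \<open>auto simp: cd_def prism_def contr_def dec_def\<close>)
      qed
      have "map (cd k) (map (prism k) r) = map (contr k) (map dec r)" if "set r \<subseteq> {..k} \<times> {..2}" for k r
        using that pt by auto
      then show ?thesis using e sub unfolding rr_def by metis
    qed
    show "\<theta> ?s ?t = rh \<beta> s t" if "2 \<notin> snd ` set s \<and> 2 \<notin> snd ` set t"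
    proof -
      have "Suc (Suc m) \<notin> set ?s \<and> Suc (Suc n) \<notin> set ?t"
        using that prism_miss(6)[OF sub(1)] prism_miss(6)[OF sub(2)] unfolding set_map by blast
      then show ?thesis unfolding rh_def by (rule F(4)[OF a])
    qed
    show "\<theta> ?s ?t = rr (aprod \<theta>) (map dec s) (map dec t)" if h: "1 \<notin> snd ` set s \<and> 1 \<notin> snd ` set t"
    proof -
      have pt: "prism k p = cf (Suc k) (contr k (dec p))" if "fst p \<le> k" "snd p \<le> 2" "snd p \<noteq> 1" for k p
      proof -
        from that consider "snd p = 0" | "snd p = 2" by linarith
        then show ?thesis by cases (use that in \<open>auto simp: cf_def prism_def contr_def dec_def\<close>)
      qed
      have "map (prism k) r = map (cf (Suc k)) (map (contr k) (map dec r))"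
        if r: "set r \<subseteq> {..k} \<times> {..2}" "1 \<notin> snd ` set r" for k r
      proof -
        have "prism k p = cf (Suc k) (contr k (dec p))" if "p \<in> set r" for p
          by (rule pt) (use r that in force)+
        then show ?thesis by simp
      qed
      then have "map (prism m) s = map (cf (Suc m)) (map (contr m) (map dec s))"
        "map (prism n) t = map (cf (Suc n)) (map (contr n) (map dec t))" using sub h by blast+
      then show ?thesis unfolding rr_def aprod_def by (simp only:)
    qed
  qed
  then show ?thesis
    unfolding T_def using rr_loop[OF \<alpha>] rh_loop[OF \<beta>] rr_loop[OF aprod_rel[OF \<alpha> \<beta> \<theta>]] by blast
qed

lemma rel_star: "rel star"
  by (simp add: rel_def bx_star)

text \<open>The degenerate filler for \<open>* \<diamond> \<beta> = \<beta>\<close> identifies \<open>rh \<beta>\<close> with \<open>rr \<beta>\<close>.\<close>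

lemma E_rh_rr:
  assumes \<beta>: "rel \<beta>"
  shows "E (rh \<beta>) (rr \<beta>)"
proof -
  let ?\<theta> = "\<lambda>s t. \<beta> (map (cd (Suc m)) s) (map (cd (Suc n)) t)"
  have fill: "afill star \<beta> ?\<theta>"
    unfolding afill_def
  proof (intro conjI allI impI)
    show "Bx X {..Suc (Suc m)} {..Suc (Suc n)} ?\<theta>"
      by (rule Bx_pull[OF relD(1)[OF \<beta>]]) (auto simp: cd_def)
    fix s t assume a: "ain s t"
    have r: "rin (map (cd (Suc m)) s) (map (cd (Suc n)) t)" by (rule rin_cd[OF _ _ a]) auto
    have ms: "i \<notin> set (map (cd (Suc k)) l)" if "i \<le> k" "i \<notin> set l" for i k l
      using cd_miss(1)[of i "Suc k" "set l"] that by simp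
    show "?\<theta> s t = star s t" if "\<not> {..<m} \<subseteq> set s \<or> \<not> {..<n} \<subseteq> set t"
    proof -
      have "\<not> {..k} \<subseteq> set (map (cd (Suc k)) l)" if "\<not> {..<k} \<subseteq> set l" for k l
        using that ms by (meson atMost_iff lessThan_iff less_imp_le subset_iff)
      then have "?\<theta> s t = star (map (cd (Suc m)) s) (map (cd (Suc n)) t)"
        using that by (intro relD(2)[OF \<beta> r]) blast
      then show ?thesis by simp
    qed
    show "?\<theta> s t = star (map (cd m) s) (map (cd n) t)" if "m \<notin> set s \<or> n \<notin> set t"
    proof -
      have "?\<theta> s t = star (map (cd (Suc m)) s) (map (cd (Suc n)) t)"
        using that ms by (intro relD(2)[OF \<beta> r]) blast
      then show ?thesis by simp
    qed
    show "?\<theta> s t = \<beta> s t" if "Suc (Suc m) \<notin> set s \<and> Suc (Suc n) \<notin> set t"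
    proof -
      have "map (cd (Suc k)) l = l" if "set l \<subseteq> {..Suc (Suc k)}" "Suc (Suc k) \<notin> set l" for k l
        using that by (intro map_idI) (force simp: cd_def le_Suc_eq)
      then show ?thesis using that a unfolding inb_def by metis
    qed
  qed
  have "T star (rh \<beta>) (rr (aprod ?\<theta>))"
  proof -
    have "rr star = star" by (intro ext) (simp add: rr_def)
    then show ?thesis using afill_T_rh[OF rel_star \<beta> fill] by simp
  qed
  moreover have "aprod ?\<theta> = \<beta>" by (intro ext) (simp add: aprod_def comp_def)
  ultimately show ?thesis by simp
qed

lemma afill_T:
  assumes "rel \<alpha>" "rel \<beta>" "afill \<alpha> \<beta> \<theta>"
  shows "T (rr \<alpha>) (rr \<beta>) (rr (aprod \<theta>))"
  by (rule T_cong2[OF afill_T_rh[OF assms] E_rh_rr[OF assms(2)]])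

end

section \<open>Coordinates on products of standard objects\<close>

text \<open>Unlike \<open>bhom\<close> this leaves the values off the cells free, so that maps can
  be built by formulas and restricted afterwards.\<close>

definition nt :: "'b bisset \<Rightarrow> 'a bisset \<Rightarrow> ('b, 'a) bmap \<Rightarrow> bool" where
  "nt Y X \<Psi> \<longleftrightarrow> (\<forall>a b. \<forall>y\<in>cells Y a b. \<Psi> a b y \<in> cells X a b \<and>
     (\<forall>a' b'. \<forall>f\<in>ops a' a. \<forall>g\<in>ops b' b. \<Psi> a' b' (act Y a b f g y) = act X a b f g (\<Psi> a b y)))"

lemma ntD:
  assumes "nt Y X \<Psi>" "y \<in> cells Y a b"
  shows "\<Psi> a b y \<in> cells X a b"
    "f \<in> ops a' a \<Longrightarrow> g \<in> ops b' b \<Longrightarrow> \<Psi> a' b' (act Y a b f g y) = act X a b f g (\<Psi> a b y)"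
  using assms unfolding nt_def by blast+

lemma bhom_nt: "\<Psi> \<in> bhom Y X \<Longrightarrow> nt Y X \<Psi>"
  unfolding nt_def by (simp add: bhomD)

lemma nt_bhom:
  assumes Y: "bisset Y" and \<Psi>: "nt Y X \<Psi>"
  shows "(\<lambda>a b. \<lambda>y\<in>cells Y a b. \<Psi> a b y) \<in> bhom Y X"
proof (rule bhomI)
  fix a b a' b' f g y assume *: "f \<in> ops a' a" "g \<in> ops b' b" "y \<in> cells Y a b"
  show "(\<lambda>y\<in>cells Y a' b'. \<Psi> a' b' y) (act Y a b f g y) = act X a b f g ((\<lambda>y\<in>cells Y a b. \<Psi> a b y) y)"
    using bissetD(1)[OF Y *] ntD(2)[OF \<Psi> *(3,1,2)] *(3) by simp
qed (use ntD(1)[OF \<Psi>] in auto)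

text \<open>\<open>crd Y P Q e\<close>: \<open>e\<close> identifies \<open>Y\<close> with the product of the nerves of \<open>P\<close> and \<open>Q\<close>.\<close>

definition crd :: "'b bisset \<Rightarrow> 'p::order set \<Rightarrow> 'q::order set \<Rightarrow> ('p list \<Rightarrow> 'q list \<Rightarrow> 'b) \<Rightarrow> bool" where
  "crd Y P Q e \<longleftrightarrow>
     (\<forall>s t. inb P Q s t \<longrightarrow> e s t \<in> cells Y (dm s) (dm t) \<and>
       (\<forall>k l. \<forall>f\<in>ops k (dm s). \<forall>g\<in>ops l (dm t). e (sel s f) (sel t g) = act Y (dm s) (dm t) f g (e s t))) \<and>
     (\<forall>a b. \<forall>y\<in>cells Y a b. \<exists>s t. inb P Q s t \<and> length s = Suc a \<and> length t = Suc b \<and> e s t = y) \<and>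
     (\<forall>s t s' t'. inb P Q s t \<longrightarrow> inb P Q s' t' \<longrightarrow> e s t = e s' t' \<longrightarrow> s = s' \<and> t = t')"

lemma crdD:
  assumes "crd Y P Q e"
  shows "inb P Q s t \<Longrightarrow> e s t \<in> cells Y (dm s) (dm t)"
    "\<lbrakk>inb P Q s t; f \<in> ops k (dm s); g \<in> ops l (dm t)\<rbrakk> \<Longrightarrow>
       e (sel s f) (sel t g) = act Y (dm s) (dm t) f g (e s t)"
    "y \<in> cells Y a b \<Longrightarrow> \<exists>s t. inb P Q s t \<and> length s = Suc a \<and> length t = Suc b \<and> e s t = y"
    "\<lbrakk>inb P Q s t; inb P Q s' t'; e s t = e s' t'\<rbrakk> \<Longrightarrow> s = s' \<and> t = t'"
  using assms unfolding crd_def by (elim conjE; simp)+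

lemma inb_sel:
  assumes "inb P Q s t" "f \<in> ops k (dm s)" "g \<in> ops l (dm t)"
  shows "inb P Q (sel s f) (sel t g)"
  using assms srt_sel set_sel unfolding inb_def by (meson order_trans)

lemma inb_len: "inb P Q s t \<Longrightarrow> length s = Suc (dm s) \<and> length t = Suc (dm t)"
  unfolding inb_def srt_def by (cases s; cases t; simp)

lemma crd_nt:
  assumes e: "crd Y P Q e" and \<Psi>: "nt Y X \<Psi>"
  shows "Bx X P Q (\<lambda>s t. \<Psi> (dm s) (dm t) (e s t))"
proof (rule bxI)
  fix s t assume "srt s" "srt t" "set s \<subseteq> P \<and> set t \<subseteq> Q"
  then have i: "inb P Q s t" by (simp add: inb_def)
  show "\<Psi> (dm s) (dm t) (e s t) \<in> cells X (dm s) (dm t)" by (rule ntD(1)[OF \<Psi> crdD(1)[OF e i]])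
  fix k l f g assume fg: "f \<in> ops k (dm s)" "g \<in> ops l (dm t)"
  have "dm (sel s f) = k" "dm (sel t g) = l" using opsD(1)[OF fg(1)] opsD(1)[OF fg(2)] by simp_all
  then show "\<Psi> (dm (sel s f)) (dm (sel t g)) (e (sel s f) (sel t g)) = act X (dm s) (dm t) f g (\<Psi> (dm s) (dm t) (e s t))"
    using ntD(2)[OF \<Psi> crdD(1)[OF e i] fg] crdD(2)[OF e i fg] by simp
qed

text \<open>Together with \<open>crd_nt\<close> this makes natural maps on \<open>Y\<close> and
  natural functions of lists interchangeable; \<open>c\<close> inverts the coordinates.\<close>

lemma crd_ex:
  assumes e: "crd Y P Q e" and \<phi>: "Bx X P Q \<phi>"
  shows "\<exists>\<Psi>. nt Y X \<Psi> \<and> (\<forall>s t. inb P Q s t \<longrightarrow> \<Psi> (dm s) (dm t) (e s t) = \<phi> s t)"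
proof -
  define c where "c y = (SOME p. inb P Q (fst p) (snd p) \<and> e (fst p) (snd p) = y)" for y
  have c: "c (e s t) = (s, t)" if "inb P Q s t" for s t
  proof -
    let ?p = "c (e s t)"
    have "inb P Q (fst ?p) (snd ?p) \<and> e (fst ?p) (snd ?p) = e s t"
      unfolding c_def by (rule someI[of _ "(s, t)"]) (simp add: that)
    then show ?thesis using crdD(4)[OF e _ that, of "fst ?p" "snd ?p"] by (simp add: prod_eq_iff)
  qed
  define \<Psi> where "\<Psi> a b y = \<phi> (fst (c y)) (snd (c y))" for a b :: nat and y
  have "nt Y X \<Psi>"
    unfolding nt_def
  proof (intro allI ballI conjI)
    fix a b y assume "y \<in> cells Y a b"
    then obtain s t where st: "inb P Q s t" "length s = Suc a" "length t = Suc b" "e s t = y"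
      using crdD(3)[OF e] by blast
    have dm: "dm s = a" "dm t = b" using st by simp_all
    have i: "srt s" "srt t" "set s \<subseteq> P \<and> set t \<subseteq> Q" using st(1) by (simp_all add: inb_def)
    have cy: "c y = (s, t)" using c[OF st(1)] st(4) by simp
    show "\<Psi> a b y \<in> cells X a b" using bxD(1)[OF \<phi> i] dm by (simp add: \<Psi>_def cy)
    fix a' b' f g assume fg: "f \<in> ops a' a" "g \<in> ops b' b"
    have "act Y a b f g y = e (sel s f) (sel t g)" using crdD(2)[OF e st(1), of f a' g b'] fg dm st(4) by simp
    then have "c (act Y a b f g y) = (sel s f, sel t g)"
      using c[OF inb_sel[OF st(1), of f a' g b']] fg dm by simp
    then show "\<Psi> a' b' (act Y a b f g y) = act X a b f g (\<Psi> a b y)"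
      using bxD(2)[OF \<phi> i, of f a' g b'] fg dm by (simp add: \<Psi>_def cy)
  qed
  moreover have "\<Psi> (dm s) (dm t) (e s t) = \<phi> s t" if "inb P Q s t" for s t
    using c[OF that] by (simp add: \<Psi>_def)
  ultimately show ?thesis by blast
qed

lemma crd_bD: "crd (bD p q) {..p} {..q} (\<lambda>s t. (s, t))"
  unfolding crd_def
proof (intro conjI allI ballI impI)
  fix s t :: "nat list" assume i: "inb {..p} {..q} s t"
  show "(s, t) \<in> cells (bD p q) (dm s) (dm t)"
    using i inb_len[OF i] by (simp add: cells_bD ops_def inb_def)
next
  fix a b y assume "y \<in> cells (bD p q) a b"
  moreover obtain u v where "y = (u, v)" by (cases y)
  ultimately have "inb {..p} {..q} u v \<and> length u = Suc a \<and> length v = Suc b \<and> (u, v) = y"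
    by (auto simp: cells_bD ops_def inb_def)
  then show "\<exists>s t. inb {..p} {..q} s t \<and> length s = Suc a \<and> length t = Suc b \<and> (s, t) = y" by blast
qed (simp_all add: opcomp_def)

lemma srt_zip:
  assumes "srt s" "srt t" "length s = length t"
  shows "srt (zip s t)"
proof -
  have "zip s t \<noteq> []" using assms by (cases s; cases t; simp add: srt_def)
  moreover have "(zip s t) ! i \<le> (zip s t) ! j" if "i < j" "j < length (zip s t)" for i j
    using that srt_nth_mono[OF assms(1), of i j] srt_nth_mono[OF assms(2), of i j] assms(3)
    by (simp add: less_eq_prod_def)
  ultimately show ?thesis by (simp add: srt_def sorted_wrt_iff_nth_less)
qed

text \<open>Nerves preserve products: a chain in a product poset is a pair of chains of the same
  length, joined by \<open>zip\<close>.\<close>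

lemma crd_prod:
  assumes e: "crd Y P Q e" and e': "crd Y' P' Q' e'"
  shows "crd (bprod Y Y') (P \<times> P') (Q \<times> Q') (\<lambda>s t. (e (map fst s) (map fst t), e' (map snd s) (map snd t)))"
proof -
  have m: "mono fst" "mono snd" by (auto simp: mono_def less_eq_prod_def)
  have i1: "inb P Q (map fst s) (map fst t)" if "inb (P \<times> P') (Q \<times> Q') s t" for s t
    by (rule inb_map[OF that m(1) m(1)]) auto
  have i2: "inb P' Q' (map snd s) (map snd t)" if "inb (P \<times> P') (Q \<times> Q') s t" for s t
    by (rule inb_map[OF that m(2) m(2)]) auto
  show ?thesis
    unfolding crd_def
  proof (intro conjI allI ballI impI)
    fix s t assume i: "inb (P \<times> P') (Q \<times> Q') s t"
    show "(e (map fst s) (map fst t), e' (map snd s) (map snd t)) \<in> cells (bprod Y Y') (dm s) (dm t)"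
      using crdD(1)[OF e i1[OF i]] crdD(1)[OF e' i2[OF i]] by (simp add: bprod_def)
    fix k l f g assume fg: "f \<in> ops k (dm s)" "g \<in> ops l (dm t)"
    have ne: "s \<noteq> []" "t \<noteq> []" using i by (auto simp: inb_def srt_def)
    show "(e (map fst (sel s f)) (map fst (sel t g)), e' (map snd (sel s f)) (map snd (sel t g))) =
        act (bprod Y Y') (dm s) (dm t) f g (e (map fst s) (map fst t), e' (map snd s) (map snd t))"
      using crdD(2)[OF e i1[OF i], of f k g l] crdD(2)[OF e' i2[OF i], of f k g l] fg
      by (simp only: map_sel[OF ne(1) fg(1)] map_sel[OF ne(2) fg(2)] length_map) (simp add: bprod_def)
  next
    fix a b y assume "y \<in> cells (bprod Y Y') a b"
    then obtain y1 y2 where y: "y = (y1, y2)" "y1 \<in> cells Y a b" "y2 \<in> cells Y' a b"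
      by (auto simp: bprod_def)
    obtain s t where st: "inb P Q s t" "length s = Suc a" "length t = Suc b" "e s t = y1"
      using crdD(3)[OF e y(2)] by blast
    obtain s' t' where st': "inb P' Q' s' t'" "length s' = Suc a" "length t' = Suc b" "e' s' t' = y2"
      using crdD(3)[OF e' y(3)] by blast
    have "inb (P \<times> P') (Q \<times> Q') (zip s s') (zip t t')"
    proof -
      have "set (zip s s') \<subseteq> set s \<times> set s'" "set (zip t t') \<subseteq> set t \<times> set t'"
        by (auto dest: set_zip_leftD set_zip_rightD)
      moreover have "srt (zip s s')" "srt (zip t t')" using st st' srt_zip[of s s'] srt_zip[of t t'] unfolding inb_def by simp_all
      ultimately show ?thesis using st(1) st'(1) unfolding inb_def by blast
    qed
    then show "\<exists>s t. inb (P \<times> P') (Q \<times> Q') s t \<and> length s = Suc a \<and> length t = Suc b \<and>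
        (e (map fst s) (map fst t), e' (map snd s) (map snd t)) = y"
      using st st' y(1) by (intro exI[of _ "zip s s'"] exI[of _ "zip t t'"]) simp
  next
    fix s t s' t'
    assume i: "inb (P \<times> P') (Q \<times> Q') s t" "inb (P \<times> P') (Q \<times> Q') s' t'"
      and eq: "(e (map fst s) (map fst t), e' (map snd s) (map snd t)) =
        (e (map fst s') (map fst t'), e' (map snd s') (map snd t'))"
    have "map fst s = map fst s'" "map fst t = map fst t'" "map snd s = map snd s'" "map snd t = map snd t'"
      using eq crdD(4)[OF e i1[OF i(1)] i1[OF i(2)]] crdD(4)[OF e' i2[OF i(1)] i2[OF i(2)]] by simp_all
    then show "s = s'" "t = t'" by (metis zip_map_fst_snd)+
  qed
qed

lemma crd_reindex:
  assumes e: "crd Y P Q e" and c: "mono c" "mono d" "\<And>x. d (c x) = x" "\<And>x. c (d x) = x"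
    and c': "mono c'" "mono d'" "\<And>x. d' (c' x) = x" "\<And>x. c' (d' x) = x"
    and R: "c ` R = P" "c' ` R' = Q"
  shows "crd Y R R' (\<lambda>s t. e (map c s) (map c' t))"
proof -
  have i: "inb P Q (map c s) (map c' t)" if "inb R R' s t" for s t
    by (rule inb_map[OF that c(1) c'(1)]) (simp_all add: R)
  show ?thesis
    unfolding crd_def
  proof (intro conjI allI ballI impI)
    fix s t assume st: "inb R R' s t"
    show "e (map c s) (map c' t) \<in> cells Y (dm s) (dm t)" using crdD(1)[OF e i[OF st]] by simp
    fix k l f g assume fg: "f \<in> ops k (dm s)" "g \<in> ops l (dm t)"
    have ne: "s \<noteq> []" "t \<noteq> []" using st by (auto simp: inb_def srt_def)
    show "e (map c (sel s f)) (map c' (sel t g)) = act Y (dm s) (dm t) f g (e (map c s) (map c' t))"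
      using crdD(2)[OF e i[OF st], of f k g l] fg
      by (simp only: map_sel[OF ne(1) fg(1)] map_sel[OF ne(2) fg(2)] length_map)
  next
    fix a b y assume "y \<in> cells Y a b"
    then obtain s t where st: "inb P Q s t" "length s = Suc a" "length t = Suc b" "e s t = y"
      using crdD(3)[OF e] by blast
    have "inb R R' (map d s) (map d' t)"
      by (rule inb_map[OF st(1) c(2) c'(2)]) (use R c(3) c'(3) in auto)
    then show "\<exists>s t. inb R R' s t \<and> length s = Suc a \<and> length t = Suc b \<and> e (map c s) (map c' t) = y"
      using st by (intro exI[of _ "map d s"] exI[of _ "map d' t"]) (simp add: c(4) c'(4) comp_def)
  next
    fix s t s' t' assume *: "inb R R' s t" "inb R R' s' t'" "e (map c s) (map c' t) = e (map c s') (map c' t')"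
    have "map c s = map c s'" "map c' t = map c' t'" using crdD(4)[OF e i[OF *(1)] i[OF *(2)] *(3)] by simp_all
    then have "map d (map c s) = map d (map c s')" "map d' (map c' t) = map d' (map c' t')" by (simp_all only:)
    then show "s = s'" "t = t'" by (simp_all add: comp_def c(3) c'(3))
  qed
qed

section \<open>Uncurrying\<close>

lemma bprod_simps [simp]:
  "(y, k) \<in> cells (bprod Y K) a b \<longleftrightarrow> y \<in> cells Y a b \<and> k \<in> cells K a b"
  "act (bprod Y K) a b f g (y, k) = (act Y a b f g y, act K a b f g k)"
  by (simp_all add: bprod_def)

lemma bisset_bprod: "bisset Y \<Longrightarrow> bisset K \<Longrightarrow> bisset (bprod Y K)"
  unfolding bisset_def by (simp add: bprod_def split: prod.splits)

lemma fun2_restrict_eq: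
  "(\<lambda>a b. restrict (F a b) (C a b)) = (\<lambda>a b. restrict (G a b) (C a b)) \<longleftrightarrow>
    (\<forall>a b. \<forall>x\<in>C a b. F a b x = G a b x)"
  by (auto simp: fun_eq_iff restrict_def)

lemma opdim_ops: "f \<in> ops k m \<Longrightarrow> opdim f = k"
  by (simp add: opdim_def opsD(1))

lemma act_relHom: "act (relHom K L X pt) = act (iHom K X)"
  by (simp add: relHom_def fiber_def iHom_def)

lemma act_iHom:
  assumes "f \<in> ops a' a" "g \<in> ops b' b"
  shows "act (iHom K X) a b f g h = (\<lambda>i j. \<lambda>(k, u, v)\<in>cells (bprod K (bD a' b')) i j. h i j (k, opcomp f u, opcomp g v))"
  using opdim_ops[OF assms(1)] opdim_ops[OF assms(2)] by (simp add: iHom_def)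

lemma degen_iHom:
  "degen (iHom K X) a b (hpt K X pt) = bconst (bprod K (bD a b)) X pt"
proof -
  have "degen (iHom K X) a b (hpt K X pt) =
      (\<lambda>i j. \<lambda>(k, u, v)\<in>cells (bprod K (bD a b)) i j. hpt K X pt i j (k, opcomp (zeroop a) u, opcomp (zeroop b) v))"
    unfolding degen_def by (rule act_iHom) simp_all
  also have "\<dots> = bconst (bprod K (bD a b)) X pt"
    unfolding bconst_def fun2_restrict_eq
    by (auto simp: hpt_def bconst_def cells_bD opcomp_zeroop)
  finally show ?thesis .
qed

lemma cells_relHom:
  "h \<in> cells (relHom K L X pt) a b \<longleftrightarrow> h \<in> bhom (bprod K (bD a b)) X \<and>
    (\<forall>i j k f g. k \<in> cells L i j \<longrightarrow> f \<in> ops i a \<longrightarrow> g \<in> ops j b \<longrightarrow> h i j (k, f, g) = degen X i j pt)"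
proof -
  have "h \<in> cells (relHom K L X pt) a b \<longleftrightarrow> h \<in> bhom (bprod K (bD a b)) X \<and>
      brestr (bprod L (bD a b)) h = bconst (bprod L (bD a b)) X pt"
    by (auto simp: relHom_def fiber_def iHom_def res_def degen_iHom[unfolded iHom_def])
  also have "brestr (bprod L (bD a b)) h = bconst (bprod L (bD a b)) X pt \<longleftrightarrow>
      (\<forall>i j k f g. k \<in> cells L i j \<longrightarrow> f \<in> ops i a \<longrightarrow> g \<in> ops j b \<longrightarrow> h i j (k, f, g) = degen X i j pt)"
    unfolding brestr_def bconst_def fun2_restrict_eq by (auto simp: bprod_def cells_bD)
  finally show ?thesis .
qed

text \<open>The adjoint map on the product. Only the values at identity operators are kept; by
  naturality (\<open>unc_eval\<close>) they determine \<open>\<Phi>\<close>.\<close>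

definition unc :: "('y, ('k \<times> lpair, 'a) bmap) bmap \<Rightarrow> ('y \<times> 'k, 'a) bmap" where
  "unc \<Phi> a b = (\<lambda>(y, k). \<Phi> a b y a b (k, idop a, idop b))"

lemma unc_eval:
  assumes \<Phi>: "\<Phi> \<in> bhom Y (relHom K L X pt)" and y: "y \<in> cells Y a b" and k: "k \<in> cells K i j"
    and fg: "f \<in> ops i a" "g \<in> ops j b"
  shows "\<Phi> a b y i j (k, f, g) = unc \<Phi> i j (act Y a b f g y, k)"
  unfolding unc_def case_prod_conv bhomD(3)[OF \<Phi> fg y] act_relHom act_iHom[OF fg]
  using k fg by (simp add: cells_bD opcomp_id_right opsD(1))

lemma nt_unc:
  assumes K: "bisset K" and \<Phi>: "\<Phi> \<in> bhom Y (relHom K L X pt)"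
  shows "nt (bprod Y K) X (unc \<Phi>)"
    and "y \<in> cells Y a b \<Longrightarrow> k \<in> cells L a b \<Longrightarrow> unc \<Phi> a b (y, k) = degen X a b pt"
proof -
  show "nt (bprod Y K) X (unc \<Phi>)"
    unfolding nt_def
  proof (intro allI ballI conjI)
    fix a b z assume "z \<in> cells (bprod Y K) a b"
    then obtain y k where z: "z = (y, k)" "y \<in> cells Y a b" "k \<in> cells K a b" by (cases z) auto
    have h: "\<Phi> a b y \<in> bhom (bprod K (bD a b)) X" using bhomD(1)[OF \<Phi> z(2)] by (simp add: cells_relHom)
    have in': "(k, idop a, idop b) \<in> cells (bprod K (bD a b)) a b" using z(3) by (simp add: cells_bD)
    show "unc \<Phi> a b z \<in> cells X a b" using bhomD(1)[OF h in'] by (simp add: unc_def z(1))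
    fix a' b' f g assume fg: "f \<in> ops a' a" "g \<in> ops b' b"
    have "unc \<Phi> a' b' (act (bprod Y K) a b f g z) = \<Phi> a b y a' b' (act K a b f g k, f, g)"
      using unc_eval[OF \<Phi> z(2) bissetD(1)[OF K fg z(3)] fg] by (simp add: z(1))
    also have "\<dots> = \<Phi> a b y a' b' (act (bprod K (bD a b)) a b f g (k, idop a, idop b))"
      by (simp add: opcomp_id_left[OF fg(1)] opcomp_id_left[OF fg(2)])
    also have "\<dots> = act X a b f g (unc \<Phi> a b z)"
      using bhomD(3)[OF h fg in'] by (simp add: unc_def z(1))
    finally show "unc \<Phi> a' b' (act (bprod Y K) a b f g z) = act X a b f g (unc \<Phi> a b z)" .
  qed
  show "unc \<Phi> a b (y, k) = degen X a b pt" if "y \<in> cells Y a b" "k \<in> cells L a b"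
    using bhomD(1)[OF \<Phi> that(1)] that(2) by (simp add: cells_relHom unc_def)
qed

text \<open>The sources and the subobjects \<open>L\<close>, \<open>L'\<close> may differ. Thus a
  face of a map is comparable with a map on the smaller standard object, and a map to a path space
  with one to a loop space.\<close>

lemma unc_inj:
  assumes \<Phi>: "\<Phi> \<in> bhom Y (relHom K L X pt)" and \<Phi>': "\<Phi>' \<in> bhom Y' (relHom K L' X pt')"
    and Y: "y \<in> cells Y a b" "y' \<in> cells Y' a b"
    and eq: "\<And>i j k f g. \<lbrakk>k \<in> cells K i j; f \<in> ops i a; g \<in> ops j b\<rbrakk> \<Longrightarrow>
      unc \<Phi> i j (act Y a b f g y, k) = unc \<Phi>' i j (act Y' a b f g y', k)"
  shows "\<Phi> a b y = \<Phi>' a b y'"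
proof (rule bhom_eqI)
  show "\<Phi> a b y \<in> bhom (bprod K (bD a b)) X" "\<Phi>' a b y' \<in> bhom (bprod K (bD a b)) X"
    using bhomD(1)[OF \<Phi> Y(1)] bhomD(1)[OF \<Phi>' Y(2)] by (simp_all add: cells_relHom)
  fix i j x assume "x \<in> cells (bprod K (bD a b)) i j"
  then obtain k f g where "x = (k, f, g)" "k \<in> cells K i j" "f \<in> ops i a" "g \<in> ops j b"
    by (cases x) (auto simp: cells_bD)
  then show "\<Phi> a b y i j x = \<Phi>' a b y' i j x"
    using unc_eval[OF \<Phi> Y(1)] unc_eval[OF \<Phi>' Y(2)] eq by simp
qed

text \<open>Existence with prescribed adjoint is enough, because equality of maps is tested through
  \<open>unc\<close>.\<close>

lemma curry_ex:
  assumes Y: "bisset Y" and K: "bisset K" and \<Psi>: "nt (bprod Y K) X \<Psi>"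
    and LK: "\<And>a b. cells L a b \<subseteq> cells K a b"
    and star: "\<And>a b y k. y \<in> cells Y a b \<Longrightarrow> k \<in> cells L a b \<Longrightarrow> \<Psi> a b (y, k) = degen X a b pt"
  shows "\<exists>\<Phi>\<in>bhom Y (relHom K L X pt). \<forall>a b y k. y \<in> cells Y a b \<longrightarrow> k \<in> cells K a b \<longrightarrow>
    unc \<Phi> a b (y, k) = \<Psi> a b (y, k)"
proof -
  define \<Phi> where "\<Phi> = (\<lambda>a b. \<lambda>y\<in>cells Y a b. \<lambda>i j. \<lambda>(k, f, g)\<in>cells (bprod K (bD a b)) i j. \<Psi> i j (act Y a b f g y, k))"
  have \<Phi>: "\<Phi> \<in> bhom Y (relHom K L X pt)"
  proof (rule bhomI)
    fix a b y assume y: "y \<in> cells Y a b"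
    have ay: "act Y a b f g y \<in> cells Y i j" if "f \<in> ops i a" "g \<in> ops j b" for f g i j
      by (rule bissetD(1)[OF Y that y])
    have "\<Phi> a b y \<in> bhom (bprod K (bD a b)) X"
    proof (rule bhomI)
      fix i j x assume "x \<in> cells (bprod K (bD a b)) i j"
      then show "\<Phi> a b y i j x \<in> cells X i j"
        using ntD(1)[OF \<Psi>, of "(act Y a b (fst (snd x)) (snd (snd x)) y, fst x)" i j] ay y
        by (cases x) (auto simp: \<Phi>_def cells_bD)
    next
      fix i j x i' j' f g assume fg: "f \<in> ops i' i" "g \<in> ops j' j" and x: "x \<in> cells (bprod K (bD a b)) i j"
      obtain k u v where [simp]: "x = (k, u, v)" by (cases x)
      have uv: "k \<in> cells K i j" "u \<in> ops i a" "v \<in> ops j b" using x by (simp_all add: cells_bD)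
      have "\<Phi> a b y i' j' (act (bprod K (bD a b)) i j f g x) =
          \<Psi> i' j' (act Y a b (opcomp u f) (opcomp v g) y, act K i j f g k)"
        using y uv fg bissetD(1)[OF K fg uv(1)] by (simp add: \<Phi>_def cells_bD ops_comp)
      also have "act Y a b (opcomp u f) (opcomp v g) y = act Y i j f g (act Y a b u v y)"
        by (rule bissetD(3)[OF Y uv(2,3) fg y, symmetric])
      also have "\<Psi> i' j' (act Y i j f g (act Y a b u v y), act K i j f g k) =
          act X i j f g (\<Psi> i j (act Y a b u v y, k))"
        using ntD(2)[OF \<Psi>, of "(act Y a b u v y, k)" i j, OF _ fg] ay uv by simp
      finally show "\<Phi> a b y i' j' (act (bprod K (bD a b)) i j f g x) = act X i j f g (\<Phi> a b y i j x)"
        using y uv by (simp add: \<Phi>_def cells_bD)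
    qed (simp add: \<Phi>_def y)
    moreover have "\<Phi> a b y i j (k, f, g) = degen X i j pt"
      if "k \<in> cells L i j" "f \<in> ops i a" "g \<in> ops j b" for i j k f g
      using that LK star[OF ay[OF that(2,3)] that(1)] y by (auto simp: \<Phi>_def cells_bD)
    ultimately show "\<Phi> a b y \<in> cells (relHom K L X pt) a b" by (simp add: cells_relHom)
  next
    fix a b a' b' f g y assume fg: "f \<in> ops a' a" "g \<in> ops b' b" and y: "y \<in> cells Y a b"
    have ay: "act Y a b f g y \<in> cells Y a' b'" by (rule bissetD(1)[OF Y fg y])
    have "\<Phi> a' b' (act Y a b f g y) =
        (\<lambda>i j. \<lambda>(k, u, v)\<in>cells (bprod K (bD a' b')) i j. \<Psi> i j (act Y a' b' u v (act Y a b f g y), k))"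
      using ay by (simp add: \<Phi>_def)
    also have "\<dots> = (\<lambda>i j. \<lambda>(k, u, v)\<in>cells (bprod K (bD a' b')) i j. \<Phi> a b y i j (k, opcomp f u, opcomp g v))"
      unfolding fun2_restrict_eq
    proof (intro allI ballI)
      fix i j x assume "x \<in> cells (bprod K (bD a' b')) i j"
      then obtain k u v where x: "x = (k, u, v)" "k \<in> cells K i j" "u \<in> ops i a'" "v \<in> ops j b'"
        by (cases x) (auto simp: cells_bD)
      show "(case x of (k, u, v) \<Rightarrow> \<Psi> i j (act Y a' b' u v (act Y a b f g y), k)) =
          (case x of (k, u, v) \<Rightarrow> \<Phi> a b y i j (k, opcomp f u, opcomp g v))"
        using x y ops_comp[OF fg(1) x(3)] ops_comp[OF fg(2) x(4)] bissetD(3)[OF Y fg x(3,4) y]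
        by (simp add: \<Phi>_def cells_bD)
    qed
    finally show "\<Phi> a' b' (act Y a b f g y) = act (relHom K L X pt) a b f g (\<Phi> a b y)"
      by (simp add: act_relHom act_iHom[OF fg])
  qed (simp add: \<Phi>_def)
  moreover have "unc \<Phi> a b (y, k) = \<Psi> a b (y, k)" if "y \<in> cells Y a b" "k \<in> cells K a b" for a b y k
    using that by (simp add: unc_def \<Phi>_def cells_bD bissetD(2)[OF Y])
  ultimately show ?thesis by blast
qed

section \<open>Homotopies\<close>

lemma ops_1: "u \<in> ops a (Suc 0) \<longleftrightarrow> length u = Suc a \<and> sorted u \<and> (\<forall>j\<in>set u. j = 0 \<or> j = 1)"
  by (auto simp: ops_def)

lemma coface_1: "coface 1 0 = [1]" "coface 1 1 = [0]"
  by (simp_all add: coface_def)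

lemma ops_0: "u \<in> ops a 0 \<longleftrightarrow> u = zeroop a"
proof
  assume "u \<in> ops a 0"
  then have "length u = Suc a" "\<forall>j\<in>set u. j = 0" by (auto simp: ops_def)
  then show "u = zeroop a" unfolding zeroop_def by (metis replicate_eqI)
qed simp

lemma coface_1_ops: "coface 1 0 \<in> ops 0 1" "coface 1 1 \<in> ops 0 1"
  by (auto simp: coface_def ops_def)

lemma opcomp_const: "opcomp [j] (zeroop a) = replicate (Suc a) j"
  by (simp add: opcomp_def zeroop_def del: replicate_Suc)

lemma const_iff: "u \<in> ops a 1 \<Longrightarrow> 0 \<notin> set u \<longleftrightarrow> u = replicate (Suc a) 1"
  "u \<in> ops a 1 \<Longrightarrow> 1 \<notin> set u \<longleftrightarrow> u = replicate (Suc a) 0"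
  by (auto simp: ops_1 simp del: replicate_Suc intro!: replicate_eqI)

lemma replicate_ops: "j \<le> m \<Longrightarrow> replicate (Suc a) j \<in> ops a m"
  by (auto simp: ops_def simp del: replicate_Suc)

lemma ball_bprod_bD:
  "(\<forall>z\<in>cells (bprod K (bD p q)) a b. P z) \<longleftrightarrow>
    (\<forall>k u v. k \<in> cells K a b \<longrightarrow> u \<in> ops a p \<longrightarrow> v \<in> ops b q \<longrightarrow> P (k, u, v))"
  by (auto simp: bprod_def cells_bD)

text \<open>A simplex of \<open>\<Delta>^1\<close> omitting a vertex is constant at the other one.
  So the conditions on faces with a hat become conditions on the vertices that occur.\<close>

lemma homotopy_iff:
  "homotopy K X \<alpha> \<beta> h \<longleftrightarrow> h \<in> bhom (bprod K (bD 1 1)) X \<and>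
    (\<forall>a b k u v. k \<in> cells K a b \<longrightarrow> u \<in> ops a 1 \<longrightarrow> v \<in> ops b 1 \<longrightarrow>
      (0 \<notin> set u \<or> 0 \<notin> set v \<longrightarrow> h a b (k, u, v) = \<alpha> a b k) \<and>
      (1 \<notin> set u \<and> 1 \<notin> set v \<longrightarrow> h a b (k, u, v) = \<beta> a b k))"
proof -
  have 1: "fac1 (iHom K X) 1 1 0 h = fstcomp K 0 1 \<alpha> \<longleftrightarrow>
      (\<forall>a b k v. k \<in> cells K a b \<longrightarrow> v \<in> ops b 1 \<longrightarrow> h a b (k, replicate (Suc a) 1, v) = \<alpha> a b k)"
    unfolding fac1_def act_iHom[OF coface_1_ops(1) idop_ops] fstcomp_def fun2_restrict_eq
    unfolding coface_1 ball_bprod_bD prod.case ops_0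
    by (simp add: opcomp_const opcomp_id_left cong: imp_cong del: replicate_Suc One_nat_def)
  have 2: "fac2 (iHom K X) 1 1 0 h = fstcomp K 1 0 \<alpha> \<longleftrightarrow>
      (\<forall>a b k u. k \<in> cells K a b \<longrightarrow> u \<in> ops a 1 \<longrightarrow> h a b (k, u, replicate (Suc b) 1) = \<alpha> a b k)"
    unfolding fac2_def act_iHom[OF idop_ops coface_1_ops(1)] fstcomp_def fun2_restrict_eq
    unfolding coface_1 ball_bprod_bD prod.case ops_0
    by (simp add: opcomp_const opcomp_id_left cong: imp_cong del: replicate_Suc One_nat_def)
  have 3: "fac1 (iHom K X) 1 0 1 (fac2 (iHom K X) 1 1 1 h) = fstcomp K 0 0 \<beta> \<longleftrightarrow>
      (\<forall>a b k. k \<in> cells K a b \<longrightarrow> h a b (k, replicate (Suc a) 0, replicate (Suc b) 0) = \<beta> a b k)"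
    unfolding fac1_def fac2_def act_iHom[OF coface_1_ops(2) idop_ops] act_iHom[OF idop_ops coface_1_ops(2)]
      fstcomp_def fun2_restrict_eq
    unfolding coface_1 ball_bprod_bD prod.case ops_0
    by (simp add: cells_bD opcomp_const opcomp_id_left[OF zeroop_ops] opcomp_id_left[OF replicate_ops[of 0]]
        replicate_ops[OF zero_le]
        cong: imp_cong del: replicate_Suc One_nat_def)
  show ?thesis
    unfolding homotopy_def 1 2 3 using const_iff replicate_ops[of 1 1] replicate_ops[of 0 1]
    by (smt (verit, best) order_refl zero_le)
qed

lemma brestr_bconst:
  "brestr L \<alpha> = bconst L X pt \<longleftrightarrow> (\<forall>a b. \<forall>y\<in>cells L a b. \<alpha> a b y = degen X a b pt)"
  unfolding brestr_def bconst_def fun2_restrict_eq ..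

lemma relmaps_iff:
  "\<alpha> \<in> relmaps K L X pt \<longleftrightarrow> \<alpha> \<in> bhom K X \<and> (\<forall>a b. \<forall>y\<in>cells L a b. \<alpha> a b y = degen X a b pt)"
  by (simp add: relmaps_def brestr_bconst)

lemma htpy_iff:
  "(\<alpha>, \<beta>) \<in> htpy K L X pt \<longleftrightarrow> \<alpha> \<in> relmaps K L X pt \<and> \<beta> \<in> relmaps K L X pt \<and>
    (\<exists>h. homotopy K X \<alpha> \<beta> h \<and> (\<forall>a b k u v. k \<in> cells L a b \<longrightarrow> u \<in> ops a 1 \<longrightarrow> v \<in> ops b 1 \<longrightarrow>
      h a b (k, u, v) = degen X a b pt))"
  by (auto simp: htpy_def brestr_bconst cells_bD bprod_def[of L])

definition ho_cond :: "'k bisset \<Rightarrow> 'k bisset \<Rightarrow> 'a bisset \<Rightarrow> 'a \<Rightarrow> ('k, 'a) bmap \<Rightarrow> ('k, 'a) bmap \<Rightarrow>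
    ('k \<times> lpair, 'a) bmap \<Rightarrow> bool" where
  "ho_cond M N X pt \<alpha> \<beta> H \<longleftrightarrow> nt (bprod M (bD 1 1)) X H \<and>
    (\<forall>a b y u v. y \<in> cells M a b \<longrightarrow> u \<in> ops a 1 \<longrightarrow> v \<in> ops b 1 \<longrightarrow>
      (0 \<notin> set u \<or> 0 \<notin> set v \<longrightarrow> H a b (y, u, v) = \<alpha> a b y) \<and>
      (1 \<notin> set u \<and> 1 \<notin> set v \<longrightarrow> H a b (y, u, v) = \<beta> a b y) \<and>
      (y \<in> cells N a b \<longrightarrow> H a b (y, u, v) = degen X a b pt))"

lemma ho_condD:
  assumes "ho_cond M N X pt \<alpha> \<beta> H"
  shows "nt (bprod M (bD 1 1)) X H"
    "\<lbrakk>y \<in> cells M a b; u \<in> ops a 1; v \<in> ops b 1; 0 \<notin> set u \<or> 0 \<notin> set v\<rbrakk> \<Longrightarrow> H a b (y, u, v) = \<alpha> a b y"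
    "\<lbrakk>y \<in> cells M a b; u \<in> ops a 1; v \<in> ops b 1; 1 \<notin> set u \<and> 1 \<notin> set v\<rbrakk> \<Longrightarrow> H a b (y, u, v) = \<beta> a b y"
    "\<lbrakk>y \<in> cells M a b; y \<in> cells N a b; u \<in> ops a 1; v \<in> ops b 1\<rbrakk> \<Longrightarrow> H a b (y, u, v) = degen X a b pt"
  using assms unfolding ho_cond_def by blast+

lemma htpy_ho_cond:
  assumes M: "bisset M" and N: "\<And>a b. cells N a b \<subseteq> cells M a b"
  shows "(\<alpha>, \<beta>) \<in> htpy M N X pt \<longleftrightarrow> \<alpha> \<in> relmaps M N X pt \<and> \<beta> \<in> relmaps M N X pt \<and>
    (\<exists>H. ho_cond M N X pt \<alpha> \<beta> H)"
proof -
  have "(\<exists>h. homotopy M X \<alpha> \<beta> h \<and> (\<forall>a b k u v. k \<in> cells N a b \<longrightarrow> u \<in> ops a 1 \<longrightarrow> v \<in> ops b 1 \<longrightarrow>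
      h a b (k, u, v) = degen X a b pt)) \<longleftrightarrow> (\<exists>H. ho_cond M N X pt \<alpha> \<beta> H)" (is "?l \<longleftrightarrow> ?r")
  proof
    assume ?l
    then obtain h where h: "homotopy M X \<alpha> \<beta> h" "\<forall>a b k u v. k \<in> cells N a b \<longrightarrow> u \<in> ops a 1 \<longrightarrow> v \<in> ops b 1 \<longrightarrow>
      h a b (k, u, v) = degen X a b pt" by blast
    then have "ho_cond M N X pt \<alpha> \<beta> h"
      unfolding homotopy_iff ho_cond_def using bhom_nt by blast
    then show ?r by blast
  next
    assume ?r
    then obtain H where H: "ho_cond M N X pt \<alpha> \<beta> H" ..
    let ?h = "\<lambda>a b. \<lambda>z\<in>cells (bprod M (bD 1 1)) a b. H a b z"
    have "?h \<in> bhom (bprod M (bD 1 1)) X"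
      by (rule nt_bhom[OF bisset_bprod[OF M bisset_bD]]) (use H in \<open>simp add: ho_cond_def\<close>)
    moreover have v: "?h a b (y, u, v) = H a b (y, u, v)" if "y \<in> cells M a b" "u \<in> ops a 1" "v \<in> ops b 1" for a b y u v
      using that by (simp add: cells_bD)
    ultimately have "homotopy M X \<alpha> \<beta> ?h"
      unfolding homotopy_iff using ho_condD(2,3)[OF H] by (metis (no_types, lifting))
    moreover have "?h a b (y, u, v) = degen X a b pt" if "y \<in> cells N a b" "u \<in> ops a 1" "v \<in> ops b 1" for a b y u v
      using v[OF subsetD[OF N that(1)] that(2,3)] ho_condD(4)[OF H subsetD[OF N that(1)] that] by (rule trans)
    ultimately show ?l by blast
  qed
  then show ?thesis unfolding htpy_iff by blast
qed

lemma relHom_degen_iff: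
  assumes \<Phi>: "\<Phi> \<in> bhom Y (relHom K L X pt)" and X: "bisset X" "pt \<in> cells X 0 0" and y: "y \<in> cells Y a b"
  shows "\<Phi> a b y = degen (relHom K L X pt) a b (hpt K X pt) \<longleftrightarrow>
    (\<forall>i j k f g. k \<in> cells K i j \<longrightarrow> f \<in> ops i a \<longrightarrow> g \<in> ops j b \<longrightarrow> unc \<Phi> i j (act Y a b f g y, k) = degen X i j pt)"
proof -
  have d: "degen (relHom K L X pt) a b (hpt K X pt) = bconst (bprod K (bD a b)) X pt"
    using degen_iHom by (simp add: degen_def act_relHom)
  have h: "\<Phi> a b y \<in> bhom (bprod K (bD a b)) X" using bhomD(1)[OF \<Phi> y] by (simp add: cells_relHom)
  have ext: "\<Phi> a b y i j z = undefined" if "z \<notin> cells (bprod K (bD a b)) i j" for i j z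
    by (rule bhomD(2)[OF h that])
  have "\<Phi> a b y = bconst (bprod K (bD a b)) X pt \<longleftrightarrow>
      (\<forall>i j. \<forall>z\<in>cells (bprod K (bD a b)) i j. \<Phi> a b y i j z = degen X i j pt)"
    unfolding bconst_def fun_eq_iff restrict_def using ext by metis
  also have "\<dots> \<longleftrightarrow> (\<forall>i j k f g. k \<in> cells K i j \<longrightarrow> f \<in> ops i a \<longrightarrow> g \<in> ops j b \<longrightarrow> \<Phi> a b y i j (k, f, g) = degen X i j pt)"
    by (auto simp: bprod_def cells_bD)
  also have "\<dots> \<longleftrightarrow> (\<forall>i j k f g. k \<in> cells K i j \<longrightarrow> f \<in> ops i a \<longrightarrow> g \<in> ops j b \<longrightarrow> unc \<Phi> i j (act Y a b f g y, k) = degen X i j pt)"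
    using unc_eval[OF \<Phi> y] by metis
  finally show ?thesis unfolding d .
qed

lemma set_opcomp': "u \<in> ops i a \<Longrightarrow> f \<in> ops k i \<Longrightarrow> j \<notin> set u \<Longrightarrow> j \<notin> set (opcomp u f)"
  using set_opcomp by blast

text \<open>After currying, the pairs \<open>(M, N)\<close> and \<open>(K, L)\<close> enter the
  vanishing condition symmetrically. This is what lets one argument serve both for maps to the loop
  space and for maps from \<open>bD 1 1\<close> to \<open>Z\<close>.\<close>

lemma htpy_relHom:
  assumes bis: "bisset M" "bisset K" "bisset X" "pt \<in> cells X 0 0"
    and N: "\<And>a b. cells N a b \<subseteq> cells M a b" and LK: "\<And>a b. cells L a b \<subseteq> cells K a b"
    and Nact: "\<And>a b a' b' f g y. \<lbrakk>y \<in> cells N a b; f \<in> ops a' a; g \<in> ops b' b\<rbrakk> \<Longrightarrow> act M a b f g y \<in> cells N a' b'"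
  shows "(\<alpha>, \<beta>) \<in> htpy M N (relHom K L X pt) (hpt K X pt) \<longleftrightarrow>
    \<alpha> \<in> relmaps M N (relHom K L X pt) (hpt K X pt) \<and> \<beta> \<in> relmaps M N (relHom K L X pt) (hpt K X pt) \<and>
    (\<exists>H. nt (bprod (bprod M (bD 1 1)) K) X H \<and>
      (\<forall>a b y u v k. y \<in> cells M a b \<longrightarrow> u \<in> ops a 1 \<longrightarrow> v \<in> ops b 1 \<longrightarrow> k \<in> cells K a b \<longrightarrow>
        (0 \<notin> set u \<or> 0 \<notin> set v \<longrightarrow> H a b ((y, u, v), k) = unc \<alpha> a b (y, k)) \<and>
        (1 \<notin> set u \<and> 1 \<notin> set v \<longrightarrow> H a b ((y, u, v), k) = unc \<beta> a b (y, k)) \<and>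
        (y \<in> cells N a b \<or> k \<in> cells L a b \<longrightarrow> H a b ((y, u, v), k) = degen X a b pt)))"
    (is "_ \<longleftrightarrow> _ \<and> _ \<and> (\<exists>H. ?P H)")
proof -
  let ?W = "relHom K L X pt" and ?p = "hpt K X pt"
  let ?Y = "bprod M (bD 1 1)"
  have Y: "bisset ?Y" by (rule bisset_bprod[OF bis(1) bisset_bD])
  let ?Q = "\<lambda>h. homotopy M ?W \<alpha> \<beta> h \<and> (\<forall>a b k u v. k \<in> cells N a b \<longrightarrow> u \<in> ops a 1 \<longrightarrow> v \<in> ops b 1 \<longrightarrow>
      h a b (k, u, v) = degen ?W a b ?p)"
  have "(\<exists>h. ?Q h) \<longleftrightarrow> (\<exists>H. ?P H)" if \<alpha>\<beta>: "\<alpha> \<in> relmaps M N ?W ?p" "\<beta> \<in> relmaps M N ?W ?p"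
  proof
    assume "\<exists>h. ?Q h"
    then obtain h where h: "homotopy M ?W \<alpha> \<beta> h" and hN: "\<And>a b k u v. \<lbrakk>k \<in> cells N a b; u \<in> ops a 1; v \<in> ops b 1\<rbrakk> \<Longrightarrow>
      h a b (k, u, v) = degen ?W a b ?p" by blast
    have hb: "h \<in> bhom ?Y ?W" and h0: "\<And>a b k u v. \<lbrakk>k \<in> cells M a b; u \<in> ops a 1; v \<in> ops b 1; 0 \<notin> set u \<or> 0 \<notin> set v\<rbrakk> \<Longrightarrow>
        h a b (k, u, v) = \<alpha> a b k"
      and h1: "\<And>a b k u v. \<lbrakk>k \<in> cells M a b; u \<in> ops a 1; v \<in> ops b 1; 1 \<notin> set u \<and> 1 \<notin> set v\<rbrakk> \<Longrightarrow> h a b (k, u, v) = \<beta> a b k"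
      using h unfolding homotopy_iff by blast+
    have "?P (unc h)"
    proof (intro conjI allI impI)
      show "nt (bprod ?Y K) X (unc h)" by (rule nt_unc(1)[OF bis(2) hb])
      fix a b y u v k assume *: "y \<in> cells M a b" "u \<in> ops a 1" "v \<in> ops b 1" and k: "k \<in> cells K a b"
      have yuv: "(y, u, v) \<in> cells ?Y a b" using * by (simp add: cells_bD)
      show "unc h a b ((y, u, v), k) = unc \<alpha> a b (y, k)" if "0 \<notin> set u \<or> 0 \<notin> set v"
        using h0[OF * that] by (simp add: unc_def)
      show "unc h a b ((y, u, v), k) = unc \<beta> a b (y, k)" if "1 \<notin> set u \<and> 1 \<notin> set v"
        using h1[OF * that] by (simp add: unc_def)
      show "unc h a b ((y, u, v), k) = degen X a b pt" if "y \<in> cells N a b \<or> k \<in> cells L a b"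
      proof (cases "k \<in> cells L a b")
        case True then show ?thesis by (rule nt_unc(2)[OF bis(2) hb yuv])
      next
        case False
        then have "h a b (y, u, v) = degen ?W a b ?p" using hN that *(2,3) by blast
        then have "unc h a b (act ?Y a b (idop a) (idop b) (y, u, v), k) = degen X a b pt"
          using relHom_degen_iff[OF hb bis(3,4) yuv] k idop_ops by blast
        then show ?thesis unfolding bissetD(2)[OF Y yuv] .
      qed
    qed
    then show "\<exists>H. ?P H" by blast
  next
    assume "\<exists>H. ?P H"
    then obtain H where nt: "nt (bprod ?Y K) X H"
      and H0: "\<And>a b y u v k. \<lbrakk>y \<in> cells M a b; u \<in> ops a 1; v \<in> ops b 1; k \<in> cells K a b; 0 \<notin> set u \<or> 0 \<notin> set v\<rbrakk> \<Longrightarrow>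
        H a b ((y, u, v), k) = unc \<alpha> a b (y, k)"
      and H1: "\<And>a b y u v k. \<lbrakk>y \<in> cells M a b; u \<in> ops a 1; v \<in> ops b 1; k \<in> cells K a b; 1 \<notin> set u \<and> 1 \<notin> set v\<rbrakk> \<Longrightarrow>
        H a b ((y, u, v), k) = unc \<beta> a b (y, k)"
      and HN: "\<And>a b y u v k. \<lbrakk>y \<in> cells M a b; u \<in> ops a 1; v \<in> ops b 1; k \<in> cells K a b; y \<in> cells N a b \<or> k \<in> cells L a b\<rbrakk> \<Longrightarrow>
        H a b ((y, u, v), k) = degen X a b pt" by blast
    have st: "H a b (z, k) = degen X a b pt" if "z \<in> cells ?Y a b" "k \<in> cells L a b" for a b z k
      using HN[of "fst z" a b "fst (snd z)" "snd (snd z)" k] that LK[of a b] by (cases z) (auto simp: cells_bD)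
    have "\<exists>h\<in>bhom ?Y ?W. \<forall>a b z k. z \<in> cells ?Y a b \<longrightarrow> k \<in> cells K a b \<longrightarrow> unc h a b (z, k) = H a b (z, k)"
      by (rule curry_ex[OF Y bis(2) nt LK st])
    then obtain h where h: "h \<in> bhom ?Y ?W"
      and hH: "\<And>a b z k. \<lbrakk>z \<in> cells ?Y a b; k \<in> cells K a b\<rbrakk> \<Longrightarrow> unc h a b (z, k) = H a b (z, k)" by blast
    have ev: "unc h i j (act ?Y a b f g (y, u, v), k) = H i j ((act M a b f g y, opcomp u f, opcomp v g), k) \<and>
        act M a b f g y \<in> cells M i j \<and> opcomp u f \<in> ops i 1 \<and> opcomp v g \<in> ops j 1"
      if "y \<in> cells M a b" "u \<in> ops a 1" "v \<in> ops b 1" "k \<in> cells K i j" "f \<in> ops i a" "g \<in> ops j b" for a b y u v k f g i j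
    proof -
      have c: "act M a b f g y \<in> cells M i j" "opcomp u f \<in> ops i 1" "opcomp v g \<in> ops j 1"
        by (rule bissetD(1)[OF bis(1) that(5,6,1)] ops_comp[OF that(2,5)] ops_comp[OF that(3,6)])+
      then have "unc h i j ((act M a b f g y, opcomp u f, opcomp v g), k) = H i j ((act M a b f g y, opcomp u f, opcomp v g), k)"
        by (intro hH) (simp_all add: cells_bD that(4))
      then show ?thesis using c by simp
    qed
    have yuv: "(y, u, v) \<in> cells ?Y a b" if "y \<in> cells M a b" "u \<in> ops a 1" "v \<in> ops b 1" for a b y u v
      using that by (simp add: cells_bD)
    have ab: "\<alpha> \<in> bhom M ?W" "\<beta> \<in> bhom M ?W" using \<alpha>\<beta> by (simp_all add: relmaps_iff)
    have "homotopy M ?W \<alpha> \<beta> h"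
      unfolding homotopy_iff
    proof (intro conjI allI impI)
      show "h \<in> bhom ?Y ?W" by (rule h)
      fix a b y u v assume *: "y \<in> cells M a b" "u \<in> ops a 1" "v \<in> ops b 1"
      show "h a b (y, u, v) = \<alpha> a b y" if c: "0 \<notin> set u \<or> 0 \<notin> set v"
      proof (rule unc_inj[OF h ab(1) yuv[OF *] *(1)])
        fix i j k f g assume k: "k \<in> cells K i j" "f \<in> ops i a" "g \<in> ops j b"
        have "0 \<notin> set (opcomp u f) \<or> 0 \<notin> set (opcomp v g)"
          using c set_opcomp'[OF *(2) k(2)] set_opcomp'[OF *(3) k(3)] by blast
        then show "unc h i j (act ?Y a b f g (y, u, v), k) = unc \<alpha> i j (act M a b f g y, k)"
          using ev[OF * k] H0[OF _ _ _ k(1)] by metis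
      qed
      show "h a b (y, u, v) = \<beta> a b y" if c: "1 \<notin> set u \<and> 1 \<notin> set v"
      proof (rule unc_inj[OF h ab(2) yuv[OF *] *(1)])
        fix i j k f g assume k: "k \<in> cells K i j" "f \<in> ops i a" "g \<in> ops j b"
        have "1 \<notin> set (opcomp u f) \<and> 1 \<notin> set (opcomp v g)"
          using c set_opcomp'[OF *(2) k(2)] set_opcomp'[OF *(3) k(3)] by blast
        then show "unc h i j (act ?Y a b f g (y, u, v), k) = unc \<beta> i j (act M a b f g y, k)"
          using ev[OF * k] H1[OF _ _ _ k(1)] by metis
      qed
    qed
    moreover have "h a b (y, u, v) = degen ?W a b ?p" if y: "y \<in> cells N a b" and uv: "u \<in> ops a 1" "v \<in> ops b 1" for a b y u v
    proof -
      have yM: "y \<in> cells M a b" using N y by blast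
      have "unc h i j (act ?Y a b f g (y, u, v), k) = degen X i j pt"
        if k: "k \<in> cells K i j" "f \<in> ops i a" "g \<in> ops j b" for i j k f g
        using ev[OF yM uv k] HN[OF _ _ _ k(1)] Nact[OF y k(2,3)] by metis
      then show ?thesis using relHom_degen_iff[OF h bis(3,4) yuv[OF yM uv]] by blast
    qed
    ultimately show "\<exists>h. ?Q h" by blast
  qed
  then show ?thesis unfolding htpy_iff by blast
qed

text \<open>Instantiated twice, with \<open>(M, K)\<close> equal to
  \<open>(\<Delta>^{m,n}, \<Delta>^{1,1})\<close> and with the factors exchanged. By
  \<open>bd\<close> the subobjects \<open>N\<close> and \<open>L\<close> together give the vanishing
  locus of \<open>loop\<close>; \<open>crd3\<close> adds the homotopy level in the place where
  \<open>htpy_relHom\<close> has it.\<close>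

locale loop_model = loops X pt m n for X :: "'a bisset" and pt and m n :: nat +
  fixes M N K L :: "lpair bisset" and e :: "(nat \<times> nat) list \<Rightarrow> (nat \<times> nat) list \<Rightarrow> lpair \<times> lpair"
  assumes bis: "bisset M" "bisset K"
    and NM: "\<And>a b. cells N a b \<subseteq> cells M a b" and LK: "\<And>a b. cells L a b \<subseteq> cells K a b"
    and Nact: "\<And>a b a' b' f g y. \<lbrakk>y \<in> cells N a b; f \<in> ops a' a; g \<in> ops b' b\<rbrakk> \<Longrightarrow> act M a b f g y \<in> cells N a' b'"
    and crd: "crd (bprod M K) ({..m} \<times> {..1}) ({..n} \<times> {..1}) e"
    and bd: "gin 1 s t \<Longrightarrow> fst (e s t) \<in> cells N (dm s) (dm t) \<or> snd (e s t) \<in> cells L (dm s) (dm t) \<longleftrightarrow>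
      nc s t \<or> 0 \<notin> snd ` set s \<or> 0 \<notin> snd ` set t \<or> 1 \<notin> snd ` set s \<and> 1 \<notin> snd ` set t"
    and crd3: "crd (bprod (bprod M (bD 1 1)) K) ({..m} \<times> {..1} \<times> {..1}) ({..n} \<times> {..1} \<times> {..1})
      (\<lambda>s t. ((fst (e (map loop_dir s) (map loop_dir t)), map (\<lambda>p. snd (snd p)) s, map (\<lambda>p. snd (snd p)) t),
        snd (e (map loop_dir s) (map loop_dir t))))"
begin

abbreviation "W \<equiv> relHom K L X pt"
abbreviation "ctr \<equiv> hpt K X pt"
abbreviation "A \<equiv> relmaps M N W ctr"
abbreviation "R \<equiv> htpy M N W ctr"

definition r where "r \<omega> s t = unc \<omega> (dm s) (dm t) (e s t)"

lemma A_bhom: "\<omega> \<in> A \<Longrightarrow> \<omega> \<in> bhom M W"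
  by (simp add: relmaps_iff)

lemma A_star:
  assumes \<omega>: "\<omega> \<in> A" and y: "y \<in> cells M a b" and k: "k \<in> cells K a b"
    and c: "y \<in> cells N a b \<or> k \<in> cells L a b"
  shows "unc \<omega> a b (y, k) = degen X a b pt"
proof (cases "k \<in> cells L a b")
  case True then show ?thesis by (rule nt_unc(2)[OF bis(2) A_bhom[OF \<omega>] y])
next
  case False
  then have "\<omega> a b y = degen W a b ctr" using c \<omega> by (simp add: relmaps_iff)
  then have "unc \<omega> a b (act M a b (idop a) (idop b) y, k) = degen X a b pt"
    using relHom_degen_iff[OF A_bhom[OF \<omega>] bisset pt y] k idop_ops by blast
  then show ?thesis unfolding bissetD(2)[OF bis(1) y] .
qed

lemma e_cell: "gin 1 s t \<Longrightarrow> fst (e s t) \<in> cells M (dm s) (dm t) \<and> snd (e s t) \<in> cells K (dm s) (dm t)"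
  using crdD(1)[OF crd, of s t] by (cases "e s t") simp

lemma r_loop:
  assumes \<omega>: "\<omega> \<in> A" shows "loop (r \<omega>)"
  unfolding loop_def
proof (intro conjI allI impI)
  show "gbx 1 (r \<omega>)" unfolding r_def by (rule crd_nt[OF crd nt_unc(1)[OF bis(2) A_bhom[OF \<omega>]]])
  fix s t assume gin: "gin 1 s t"
    and c: "nc s t \<or> 0 \<notin> snd ` set s \<or> 0 \<notin> snd ` set t \<or> 1 \<notin> snd ` set s \<and> 1 \<notin> snd ` set t"
  show "r \<omega> s t = star s t"
    using A_star[OF \<omega>, of "fst (e s t)" "dm s" "dm t" "snd (e s t)"] e_cell[OF gin] bd[OF gin] c
    unfolding r_def star_def prod.collapse by blast
qed

lemma unc_ex:
  assumes \<Psi>: "nt (bprod M K) X \<Psi>"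
    and star: "\<And>a b y k. \<lbrakk>y \<in> cells M a b; k \<in> cells K a b; y \<in> cells N a b \<or> k \<in> cells L a b\<rbrakk> \<Longrightarrow> \<Psi> a b (y, k) = degen X a b pt"
  obtains \<omega> where "\<omega> \<in> A" "\<And>a b y k. \<lbrakk>y \<in> cells M a b; k \<in> cells K a b\<rbrakk> \<Longrightarrow> unc \<omega> a b (y, k) = \<Psi> a b (y, k)"
proof -
  have "\<exists>\<Phi>\<in>bhom M W. \<forall>a b y k. y \<in> cells M a b \<longrightarrow> k \<in> cells K a b \<longrightarrow> unc \<Phi> a b (y, k) = \<Psi> a b (y, k)"
    by (rule curry_ex[OF bis \<Psi> LK]) (use star LK in blast)
  then obtain \<omega> where \<omega>: "\<omega> \<in> bhom M W"
    and v: "\<And>a b y k. \<lbrakk>y \<in> cells M a b; k \<in> cells K a b\<rbrakk> \<Longrightarrow> unc \<omega> a b (y, k) = \<Psi> a b (y, k)" by blast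
  have "\<omega> a b y = degen W a b ctr" if y: "y \<in> cells N a b" for a b y
  proof -
    have yM: "y \<in> cells M a b" using NM y by blast
    have "unc \<omega> i j (act M a b f g y, k) = degen X i j pt" if "k \<in> cells K i j" "f \<in> ops i a" "g \<in> ops j b" for i j k f g
    proof -
      have c: "act M a b f g y \<in> cells M i j" by (rule bissetD(1)[OF bis(1) that(2,3) yM])
      show ?thesis using v[OF c that(1)] star[OF c that(1) disjI1[OF Nact[OF y that(2,3)]]] by (rule trans)
    qed
    then show ?thesis using relHom_degen_iff[OF \<omega> bisset pt yM] by blast
  qed
  then have "\<omega> \<in> A" using \<omega> by (simp add: relmaps_iff)
  then show thesis using that v by blast
qed

lemma r_surj:
  assumes x: "loop x"
  obtains \<omega> where "\<omega> \<in> A" "\<And>s t. gin 1 s t \<Longrightarrow> r \<omega> s t = x s t"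
proof -
  obtain \<Psi> where \<Psi>: "nt (bprod M K) X \<Psi>" "\<And>s t. gin 1 s t \<Longrightarrow> \<Psi> (dm s) (dm t) (e s t) = x s t"
    using crd_ex[OF crd loop_bx[OF x]] by blast
  have st: "\<Psi> a b (y, k) = degen X a b pt"
    if "y \<in> cells M a b" "k \<in> cells K a b" "y \<in> cells N a b \<or> k \<in> cells L a b" for a b y k
  proof -
    obtain s t where s: "gin 1 s t" "length s = Suc a" "length t = Suc b" "e s t = (y, k)"
      using crdD(3)[OF crd, of "(y, k)" a b] \<open>y \<in> cells M a b\<close> \<open>k \<in> cells K a b\<close> by auto
    have "x s t = star s t" using loop_star[OF x s(1)] bd[OF s(1)] that(3) s by simp
    then show ?thesis using \<Psi>(2)[OF s(1)] s by (simp add: star_def)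
  qed
  obtain \<omega> where \<omega>: "\<omega> \<in> A" "\<And>a b y k. \<lbrakk>y \<in> cells M a b; k \<in> cells K a b\<rbrakk> \<Longrightarrow> unc \<omega> a b (y, k) = \<Psi> a b (y, k)"
    using unc_ex[OF \<Psi>(1) st] by blast
  have "r \<omega> s t = x s t" if g: "gin 1 s t" for s t
    using \<omega>(2)[of "fst (e s t)" "dm s" "dm t" "snd (e s t)"] e_cell[OF g] \<Psi>(2)[OF g] by (simp add: r_def)
  then show thesis using that \<omega>(1) by blast
qed

text \<open>In the coordinates \<open>crd3\<close> the homotopies of \<open>htpy_relHom\<close> are
  those of \<open>loop_htpy\<close>, which characterize \<open>E\<close>.\<close>

lemma htpy_r_iff:
  assumes \<omega>: "\<omega> \<in> A" "\<omega>' \<in> A"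
  shows "(\<omega>, \<omega>') \<in> R \<longleftrightarrow> E (r \<omega>) (r \<omega>')"
proof -
  let ?e = "\<lambda>s t. e (map loop_dir s) (map loop_dir t)"
  let ?u = "\<lambda>s :: (nat \<times> nat \<times> nat) list. map (\<lambda>p. snd (snd p)) s"
  let ?e3 = "\<lambda>s t. ((fst (?e s t), ?u s, ?u t), snd (?e s t))"
  let ?Y = "bprod (bprod M (bD 1 1)) K"
  let ?P = "\<lambda>H. nt ?Y X H \<and>
      (\<forall>a b y u v k. y \<in> cells M a b \<longrightarrow> u \<in> ops a 1 \<longrightarrow> v \<in> ops b 1 \<longrightarrow> k \<in> cells K a b \<longrightarrow>
        (0 \<notin> set u \<or> 0 \<notin> set v \<longrightarrow> H a b ((y, u, v), k) = unc \<omega> a b (y, k)) \<and>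
        (1 \<notin> set u \<and> 1 \<notin> set v \<longrightarrow> H a b ((y, u, v), k) = unc \<omega>' a b (y, k)) \<and>
        (y \<in> cells N a b \<or> k \<in> cells L a b \<longrightarrow> H a b ((y, u, v), k) = degen X a b pt))"
  have md: "mono loop_dir" by (auto simp: mono_def less_eq_prod_def)
  have gin: "gin 1 (map loop_dir s) (map loop_dir t)" if "sqin s t" for s t
    by (rule inb_map[OF that md md]) auto
  have su: "set (?u s) = snd ` snd ` set s" for s by (simp add: image_image)
  have bd3: "fst (?e s t) \<in> cells N (dm s) (dm t) \<or> snd (?e s t) \<in> cells L (dm s) (dm t) \<longleftrightarrow>
      nc s t \<or> 0 \<notin> fst ` snd ` set s \<or> 0 \<notin> fst ` snd ` set t \<or> 1 \<notin> fst ` snd ` set s \<and> 1 \<notin> fst ` snd ` set t"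
    if "sqin s t" for s t
    using bd[OF gin[OF that]] by (simp add: nc_def image_image)
  have cl: "fst (?e s t) \<in> cells M (dm s) (dm t) \<and> ?u s \<in> ops (dm s) 1 \<and> ?u t \<in> ops (dm t) 1 \<and>
      snd (?e s t) \<in> cells K (dm s) (dm t)" if "sqin s t" for s t
    using crdD(1)[OF crd3 that] by (simp add: cells_bD)
  have rv: "r \<omega> (map loop_dir s) (map loop_dir t) = unc \<omega> (dm s) (dm t) (fst (?e s t), snd (?e s t))" for \<omega> s t
    by (simp add: r_def)
  have "(\<exists>H. ?P H) \<longleftrightarrow> (\<exists>h. loop_htpy (r \<omega>) (r \<omega>') h)"
  proof
    assume "\<exists>H. ?P H"
    then obtain H where nt: "nt ?Y X H" and H: "\<And>a b y u v k. \<lbrakk>y \<in> cells M a b; u \<in> ops a 1; v \<in> ops b 1; k \<in> cells K a b\<rbrakk> \<Longrightarrow>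
        (0 \<notin> set u \<or> 0 \<notin> set v \<longrightarrow> H a b ((y, u, v), k) = unc \<omega> a b (y, k)) \<and>
        (1 \<notin> set u \<and> 1 \<notin> set v \<longrightarrow> H a b ((y, u, v), k) = unc \<omega>' a b (y, k)) \<and>
        (y \<in> cells N a b \<or> k \<in> cells L a b \<longrightarrow> H a b ((y, u, v), k) = degen X a b pt)" by blast
    have "loop_htpy (r \<omega>) (r \<omega>') (\<lambda>s t. H (dm s) (dm t) (?e3 s t))"
      unfolding loop_htpy_def rv star_def bd3[symmetric] su[symmetric]
    proof (intro conjI allI)
      show "sqbx (\<lambda>s t. H (dm s) (dm t) (?e3 s t))" by (rule crd_nt[OF crd3 nt])
      fix s t
      show "sqin s t \<longrightarrow>
         (nc s t \<or> 0 \<notin> fst ` snd ` set s \<or> 0 \<notin> fst ` snd ` set t \<or> 1 \<notin> fst ` snd ` set s \<and> 1 \<notin> fst ` snd ` set t \<longrightarrow>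
           H (dm s) (dm t) (?e3 s t) = degen X (dm s) (dm t) pt) \<and>
         (0 \<notin> set (?u s) \<or> 0 \<notin> set (?u t) \<longrightarrow>
           H (dm s) (dm t) (?e3 s t) = unc \<omega> (dm s) (dm t) (fst (?e s t), snd (?e s t))) \<and>
         (1 \<notin> set (?u s) \<and> 1 \<notin> set (?u t) \<longrightarrow>
           H (dm s) (dm t) (?e3 s t) = unc \<omega>' (dm s) (dm t) (fst (?e s t), snd (?e s t)))"
      proof
        assume sq: "sqin s t"
        note c = cl[OF sq]
        from H[of "fst (?e s t)" "dm s" "dm t" "?u s" "?u t" "snd (?e s t)"] c
        show "(nc s t \<or> 0 \<notin> fst ` snd ` set s \<or> 0 \<notin> fst ` snd ` set t \<or> 1 \<notin> fst ` snd ` set s \<and> 1 \<notin> fst ` snd ` set t \<longrightarrow>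
           H (dm s) (dm t) (?e3 s t) = degen X (dm s) (dm t) pt) \<and>
         (0 \<notin> set (?u s) \<or> 0 \<notin> set (?u t) \<longrightarrow>
           H (dm s) (dm t) (?e3 s t) = unc \<omega> (dm s) (dm t) (fst (?e s t), snd (?e s t))) \<and>
         (1 \<notin> set (?u s) \<and> 1 \<notin> set (?u t) \<longrightarrow>
           H (dm s) (dm t) (?e3 s t) = unc \<omega>' (dm s) (dm t) (fst (?e s t), snd (?e s t)))"
          unfolding bd3[OF sq, symmetric] by blast
      qed
    qed
    then show "\<exists>h. loop_htpy (r \<omega>) (r \<omega>') h"
      by (rule exI[of "\<lambda>h. loop_htpy (r \<omega>) (r \<omega>') h" "\<lambda>s t. H (dm s) (dm t) (?e3 s t)"])
  next
    assume "\<exists>h. loop_htpy (r \<omega>) (r \<omega>') h"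
    then obtain h where h: "loop_htpy (r \<omega>) (r \<omega>') h" by blast
    note h' = loop_htpyD[OF h]
    obtain H where H: "nt ?Y X H" "\<And>s t. sqin s t \<Longrightarrow> H (dm s) (dm t) (?e3 s t) = h s t"
      using crd_ex[OF crd3 h'(1)] by blast
    have "?P H"
    proof (intro conjI[OF H(1)] allI impI)
      fix a b y u v k assume *: "y \<in> cells M a b" "u \<in> ops a 1" "v \<in> ops b 1" "k \<in> cells K a b"
      obtain s t where st: "sqin s t" "length s = Suc a" "length t = Suc b" "?e3 s t = ((y, u, v), k)"
        using crdD(3)[OF crd3, of "((y, u, v), k)" a b] * by (auto simp: cells_bD)
      have eqs: "fst (?e s t) = y" "snd (?e s t) = k" "?u s = u" "?u t = v" "dm s = a" "dm t = b" using st by simp_all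
      have Hh: "H a b ((y, u, v), k) = h s t" using H(2)[OF st(1)] unfolding eqs .
      have c: "(0 \<notin> set u \<or> 0 \<notin> set v \<longrightarrow> h s t = unc \<omega> a b (y, k))"
        using h'(3)[OF st(1)] unfolding rv eqs su[symmetric] by blast
      have d: "1 \<notin> set u \<and> 1 \<notin> set v \<longrightarrow> h s t = unc \<omega>' a b (y, k)"
        using h'(4)[OF st(1)] unfolding rv eqs su[symmetric] by blast
      have f: "y \<in> cells N a b \<or> k \<in> cells L a b \<longrightarrow> h s t = degen X a b pt"
        using h'(2)[OF st(1)] bd3[OF st(1)] unfolding eqs star_def by blast
      show "(0 \<notin> set u \<or> 0 \<notin> set v \<longrightarrow> H a b ((y, u, v), k) = unc \<omega> a b (y, k)) \<and>
        (1 \<notin> set u \<and> 1 \<notin> set v \<longrightarrow> H a b ((y, u, v), k) = unc \<omega>' a b (y, k)) \<and>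
        (y \<in> cells N a b \<or> k \<in> cells L a b \<longrightarrow> H a b ((y, u, v), k) = degen X a b pt)"
        unfolding Hh by (intro conjI c d f)
    qed
    then show "\<exists>H. ?P H" by (rule exI[of ?P H])
  qed
  moreover have "(\<omega>, \<omega>') \<in> R \<longleftrightarrow> \<omega> \<in> A \<and> \<omega>' \<in> A \<and> (\<exists>H. ?P H)"
    by (rule htpy_relHom[OF bis bisset pt NM LK]) (rule Nact)
  ultimately show ?thesis
    using loop_htpy_iff[OF r_loop[OF \<omega>(1)] r_loop[OF \<omega>(2)]] \<omega> by (simp only: simp_thms)
qed

lemma R_eq: "R = {(a, b). a \<in> A \<and> b \<in> A \<and> E (r a) (r b)}"
proof -
  have *: "(a, b) \<in> R \<longleftrightarrow> a \<in> A \<and> b \<in> A \<and> E (r a) (r b)" for a b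
  proof (cases "a \<in> A \<and> b \<in> A")
    case True then show ?thesis using htpy_r_iff[of a b] by (simp only: simp_thms)
  next
    case False then show ?thesis unfolding htpy_iff by blast
  qed
  show ?thesis by (rule Set.set_eqI) (simp only: split_paired_all mem_Collect_eq prod.case *)
qed

lemma eq_const:
  assumes \<omega>: "\<omega> \<in> bhom M W" and c: "\<And>a b y k. \<lbrakk>y \<in> cells M a b; k \<in> cells K a b\<rbrakk> \<Longrightarrow> unc \<omega> a b (y, k) = degen X a b pt"
  shows "\<omega> = bconst M W ctr"
proof (rule ext, rule ext, rule ext)
  fix a b y
  show "\<omega> a b y = bconst M W ctr a b y"
  proof (cases "y \<in> cells M a b")
    case True
    have "\<omega> a b y = degen W a b ctr"
      unfolding relHom_degen_iff[OF \<omega> bisset pt True] using c bissetD(1)[OF bis(1) _ _ True] by blast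
    then show ?thesis using True by (simp add: bconst_def)
  next
    case False then show ?thesis using bhomD(2)[OF \<omega>] by (simp add: bconst_def)
  qed
qed

lemma r_const: "bconst M W ctr \<in> A" "E (r (bconst M W ctr)) star"
proof -
  have nt: "nt (bprod M K) X (\<lambda>a b _. degen X a b pt)"
    by (simp add: nt_def degen_cells[OF bisset pt] act_degen[OF bisset pt])
  obtain \<omega> where \<omega>: "\<omega> \<in> A" "\<And>a b y k. \<lbrakk>y \<in> cells M a b; k \<in> cells K a b\<rbrakk> \<Longrightarrow> unc \<omega> a b (y, k) = degen X a b pt"
    using unc_ex[OF nt refl] by blast
  have eq: "\<omega> = bconst M W ctr" by (rule eq_const[OF A_bhom[OF \<omega>(1)] \<omega>(2)])
  show A: "bconst M W ctr \<in> A" using \<omega>(1) eq by simp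
  show "E (r (bconst M W ctr)) star"
  proof (rule E_eqI[OF r_loop[OF A] loop_star_const])
    fix s t assume g: "gin 1 s t"
    show "r (bconst M W ctr) s t = star s t"
      using \<omega>(2)[of "fst (e s t)" "dm s" "dm t" "snd (e s t)"] e_cell[OF g] unfolding eq[symmetric]
      by (simp add: r_def star_def)
  qed
qed

end

section \<open>The two models of loops\<close>

lemma cells_bdelta: "(u, v) \<in> cells (bdelta m n) a b \<longleftrightarrow>
   u \<in> ops a m \<and> v \<in> ops b n \<and> (\<not> {..m} \<subseteq> set u \<or> \<not> {..n} \<subseteq> set v)"
  by (auto simp: bdelta_def sx_def sxbd_def sxface_def)

lemma cells_bLam: "(u, v) \<in> cells (bLam (Suc m) (Suc n)) a b \<longleftrightarrow>
   u \<in> ops a (Suc m) \<and> v \<in> ops b (Suc n) \<and> (\<not> {..m} \<subseteq> set u \<or> \<not> {..n} \<subseteq> set v)"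
proof -
  have "{..Suc k} - {Suc k} = {..k}" for k by auto
  then show ?thesis unfolding bLam_def cells_bhorn by auto
qed

lemma cells_bdeltaA: "(u, v) \<in> cells (bdeltaA (Suc m) (Suc n)) a b \<longleftrightarrow>
   u \<in> ops a (Suc m) \<and> v \<in> ops b (Suc n) \<and>
   (\<not> {..m} \<subseteq> set u \<or> \<not> {..n} \<subseteq> set v \<or> Suc m \<notin> set u \<and> Suc n \<notin> set v)"
proof -
  have bd: "u \<in> sxbd (Suc k) a \<longleftrightarrow> u \<in> ops a (Suc k) \<and> (\<not> {..k} \<subseteq> set u \<or> Suc k \<notin> set u)" for k u a
    by (auto simp: sxbd_def sxface_def sx_def le_Suc_eq)
  have "(u, v) \<in> cells (bdeltaA (Suc m) (Suc n)) a b \<longleftrightarrow>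
      (u, v) \<in> cells (bLam (Suc m) (Suc n)) a b \<or> u \<in> sxbd (Suc m) a \<and> v \<in> sxbd (Suc n) b"
    by (simp add: bdeltaA_def)
  then show ?thesis unfolding cells_bLam bd by blast
qed

lemma bdelta_props:
  "cells (bdelta m n) a b \<subseteq> cells (bD m n) a b"
  "\<lbrakk>y \<in> cells (bdelta m n) a b; f \<in> ops a' a; g \<in> ops b' b\<rbrakk> \<Longrightarrow> act (bD m n) a b f g y \<in> cells (bdelta m n) a' b'"
proof -
  show "cells (bdelta m n) a b \<subseteq> cells (bD m n) a b" by (auto simp: cells_bdelta cells_bD)
  assume *: "y \<in> cells (bdelta m n) a b" "f \<in> ops a' a" "g \<in> ops b' b"
  obtain u v where y: "y = (u, v)" by (cases y)
  have uv: "u \<in> ops a m" "v \<in> ops b n" "\<not> {..m} \<subseteq> set u \<or> \<not> {..n} \<subseteq> set v"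
    using *(1) unfolding y cells_bdelta by blast+
  show "act (bD m n) a b f g y \<in> cells (bdelta m n) a' b'"
    unfolding y act_bD cells_bdelta
    using ops_comp[OF uv(1) *(2)] ops_comp[OF uv(2) *(3)] set_opcomp[OF uv(1) *(2)] set_opcomp[OF uv(2) *(3)] uv(3)
    by blast
qed

lemma bdeltaA_props:
  "cells (bdeltaA (Suc m) (Suc n)) a b \<subseteq> cells (bD (Suc m) (Suc n)) a b"
  "\<lbrakk>y \<in> cells (bdeltaA (Suc m) (Suc n)) a b; f \<in> ops a' a; g \<in> ops b' b\<rbrakk> \<Longrightarrow>
    act (bD (Suc m) (Suc n)) a b f g y \<in> cells (bdeltaA (Suc m) (Suc n)) a' b'"
proof -
  show "cells (bdeltaA (Suc m) (Suc n)) a b \<subseteq> cells (bD (Suc m) (Suc n)) a b" by (auto simp: cells_bdeltaA cells_bD)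
  assume *: "y \<in> cells (bdeltaA (Suc m) (Suc n)) a b" "f \<in> ops a' a" "g \<in> ops b' b"
  obtain u v where y: "y = (u, v)" by (cases y)
  have uv: "u \<in> ops a (Suc m)" "v \<in> ops b (Suc n)"
    "\<not> {..m} \<subseteq> set u \<or> \<not> {..n} \<subseteq> set v \<or> Suc m \<notin> set u \<and> Suc n \<notin> set v"
    using *(1) unfolding y cells_bdeltaA by blast+
  show "act (bD (Suc m) (Suc n)) a b f g y \<in> cells (bdeltaA (Suc m) (Suc n)) a' b'"
    unfolding y act_bD cells_bdeltaA
    using ops_comp[OF uv(1) *(2)] ops_comp[OF uv(2) *(3)] set_opcomp[OF uv(1) *(2)] set_opcomp[OF uv(2) *(3)] uv(3)
    by blast
qed

abbreviation e12 :: "('p \<times> 'q) list \<Rightarrow> ('p \<times> 'q) list \<Rightarrow> ('p list \<times> 'p list) \<times> 'q list \<times> 'q list" where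
  "e12 s t \<equiv> ((map fst s, map fst t), map snd s, map snd t)"

abbreviation e21 :: "('p \<times> 'q) list \<Rightarrow> ('p \<times> 'q) list \<Rightarrow> ('q list \<times> 'q list) \<times> 'p list \<times> 'p list" where
  "e21 s t \<equiv> ((map snd s, map snd t), map fst s, map fst t)"

lemma crd_e12: "crd (bprod (bD p q) (bD p' q')) ({..p} \<times> {..p'}) ({..q} \<times> {..q'}) e12"
  by (rule crd_prod[OF crd_bD crd_bD])

lemma crd_e21: "crd (bprod (bD p' q') (bD p q)) ({..p} \<times> {..p'}) ({..q} \<times> {..q'}) e21"
proof -
  have m: "mono (prod.swap :: nat \<times> nat \<Rightarrow> _)" by (auto simp: mono_def less_eq_prod_def)
  have "crd (bprod (bD p' q') (bD p q)) ({..p} \<times> {..p'}) ({..q} \<times> {..q'})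
      (\<lambda>s t. e12 (map prod.swap s) (map prod.swap t))"
    by (rule crd_reindex[OF crd_e12 m m _ _ m m]) (auto simp: product_swap)
  then show ?thesis by (simp add: comp_def)
qed

context loops
begin

lemma BC_model: "loop_model X pt m n (bD m n) (bdelta m n) (bD 1 1) (bdeltaA 1 1) e12"
proof unfold_locales
  have One: "1 = Suc 0" by simp
  show "cells (bdeltaA 1 1) a b \<subseteq> cells (bD 1 1) a b" for a b unfolding One by (rule bdeltaA_props(1))
  show "crd (bprod (bD m n) (bD 1 1)) ({..m} \<times> {..1}) ({..n} \<times> {..1}) e12" by (rule crd_e12)
  show "fst (e12 s t) \<in> cells (bdelta m n) (dm s) (dm t) \<or> snd (e12 s t) \<in> cells (bdeltaA 1 1) (dm s) (dm t) \<longleftrightarrow>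
      nc s t \<or> 0 \<notin> snd ` set s \<or> 0 \<notin> snd ` set t \<or> 1 \<notin> snd ` set s \<and> 1 \<notin> snd ` set t" if g: "gin 1 s t" for s t
    using crdD(1)[OF crd_e12 g] unfolding One fst_conv snd_conv cells_bdeltaA cells_bdelta
    by (auto simp: nc_def cells_bD)
  \<comment> \<open>The vertices list base, loop and homotopy coordinate, whereas the product is
    formed in the order base, homotopy, loop.\<close>
  let ?c = "\<lambda>p :: nat \<times> nat \<times> nat. ((fst p, snd (snd p)), fst (snd p))"
    and ?d = "\<lambda>p :: (nat \<times> nat) \<times> nat. (fst (fst p), snd p, snd (fst p))"
  have mc: "mono ?c" "mono ?d" by (auto simp: mono_def less_eq_prod_def)
  have im: "?c ` ({..k} \<times> {..1} \<times> {..1}) = ({..k} \<times> {..1}) \<times> {..1}" for k by (force simp: image_iff)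
  have "crd (bprod (bprod (bD m n) (bD 1 1)) (bD 1 1)) ({..m} \<times> {..1} \<times> {..1}) ({..n} \<times> {..1} \<times> {..1})
      (\<lambda>s t. (e12 (map fst (map ?c s)) (map fst (map ?c t)), (map snd (map ?c s), map snd (map ?c t))))"
    by (rule crd_reindex[OF crd_prod[OF crd_e12 crd_bD] mc _ _ mc _ _ im im]) simp_all
  then show "crd (bprod (bprod (bD m n) (bD 1 1)) (bD 1 1)) ({..m} \<times> {..1} \<times> {..1}) ({..n} \<times> {..1} \<times> {..1})
      (\<lambda>s t. ((fst (e12 (map loop_dir s) (map loop_dir t)), map (\<lambda>p. snd (snd p)) s, map (\<lambda>p. snd (snd p)) t),
        snd (e12 (map loop_dir s) (map loop_dir t))))"
    by (simp add: comp_def)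
qed (simp_all add: bdelta_props)

lemma Z_model: "loop_model X pt m n (bD 1 1) (bdeltaA 1 1) (bD m n) (bdelta m n) e21"
proof unfold_locales
  have One: "1 = Suc 0" by simp
  show "cells (bdeltaA 1 1) a b \<subseteq> cells (bD 1 1) a b" for a b unfolding One by (rule bdeltaA_props(1))
  show "act (bD 1 1) a b f g y \<in> cells (bdeltaA 1 1) a' b'"
    if "y \<in> cells (bdeltaA 1 1) a b" "f \<in> ops a' a" "g \<in> ops b' b" for a b a' b' f g y
    using that unfolding One by (rule bdeltaA_props(2))
  show "crd (bprod (bD 1 1) (bD m n)) ({..m} \<times> {..1}) ({..n} \<times> {..1}) e21" by (rule crd_e21)
  show "fst (e21 s t) \<in> cells (bdeltaA 1 1) (dm s) (dm t) \<or> snd (e21 s t) \<in> cells (bdelta m n) (dm s) (dm t) \<longleftrightarrow>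
      nc s t \<or> 0 \<notin> snd ` set s \<or> 0 \<notin> snd ` set t \<or> 1 \<notin> snd ` set s \<and> 1 \<notin> snd ` set t" if g: "gin 1 s t" for s t
    using crdD(1)[OF crd_e21 g] unfolding One fst_conv snd_conv cells_bdeltaA cells_bdelta
    by (auto simp: nc_def cells_bD)
  \<comment> \<open>Now the base is the last factor of the product.\<close>
  let ?c = "\<lambda>p :: nat \<times> nat \<times> nat. (snd p, fst p)" and ?d = "\<lambda>p :: (nat \<times> nat) \<times> nat. (snd p, fst p)"
  have mc: "mono ?c" "mono ?d" by (auto simp: mono_def less_eq_prod_def)
  have im: "?c ` ({..k} \<times> {..1} \<times> {..1}) = ({..1} \<times> {..1}) \<times> {..k}" for k by (force simp: image_iff)
  have "crd (bprod (bprod (bD 1 1) (bD 1 1)) (bD m n)) ({..m} \<times> {..1} \<times> {..1}) ({..n} \<times> {..1} \<times> {..1})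
      (\<lambda>s t. (e12 (map fst (map ?c s)) (map fst (map ?c t)), (map snd (map ?c s), map snd (map ?c t))))"
    by (rule crd_reindex[OF crd_prod[OF crd_e12 crd_bD] mc _ _ mc _ _ im im]) simp_all
  then show "crd (bprod (bprod (bD 1 1) (bD 1 1)) (bD m n)) ({..m} \<times> {..1} \<times> {..1}) ({..n} \<times> {..1} \<times> {..1})
      (\<lambda>s t. ((fst (e21 (map loop_dir s) (map loop_dir t)), map (\<lambda>p. snd (snd p)) s, map (\<lambda>p. snd (snd p)) t),
        snd (e21 (map loop_dir s) (map loop_dir t))))"
    by (simp add: comp_def)
qed (simp_all, rule bdelta_props(1))

end

section \<open>Faces and degeneracies of maps\<close>

lemma coface_eq: "u \<in> ops a p \<Longrightarrow> opcomp (coface (Suc p) i) u = map (cf i) u"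
  unfolding opcomp_def by (rule map_cong[OF refl]) (auto simp: coface_def cf_def nth_append le_Suc_eq dest!: opsD(3) simp del: upt_Suc)

lemma codeg_eq: "u \<in> ops a (Suc p) \<Longrightarrow> opcomp (codeg p i) u = map (cd i) u"
  unfolding opcomp_def by (rule map_cong[OF refl]) (auto simp: codeg_def cd_def dest!: opsD(3) simp del: upt_Suc)

lemma opdim_simps: "opdim (coface (Suc p) i) = p" "opdim (codeg p i) = Suc p" "opdim (idop p) = p"
  by (simp_all add: opdim_def coface_def codeg_def idop_def)

lemma map_cf_ops: "u \<in> ops a p \<Longrightarrow> map (cf i) u \<in> ops a (Suc p)"
  using srt_map[of u "cf i"] by (cases "u = []") (auto simp: ops_def srt_def cf_def)

lemma map_cd_ops: "u \<in> ops a (Suc p) \<Longrightarrow> i \<le> p \<Longrightarrow> map (cd i) u \<in> ops a p"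
  using srt_map[of u "cd i"] by (cases "u = []") (auto simp: ops_def srt_def cd_def)

lemma cf_cd: "i \<notin> set u \<Longrightarrow> map (cf i) (map (cd i) u) = u"
  by (auto simp: cf_def cd_def intro!: map_idI)

lemma map_cd_top: "u \<in> ops a (Suc p) \<Longrightarrow> Suc p \<notin> set u \<Longrightarrow> u \<in> ops a p"
  by (auto simp: ops_def subset_iff le_Suc_eq)

lemma ops_Suc: "u \<in> ops a p \<Longrightarrow> u \<in> ops a (Suc p)"
  by (auto simp: ops_def)

lemma map_cf_top: "u \<in> ops a p \<Longrightarrow> map (cf (Suc p)) u = u"
  by (auto simp: cf_def dest!: opsD(3) intro!: map_idI)

text \<open>\<open>cf i\<close> is a bijection onto the operators omitting \<open>i\<close>, with
  inverse \<open>cd i\<close>. \<open>P\<close> takes both sides of it because degenerate faces also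
  mention the renumbered operator.\<close>

lemma face_all:
  assumes "i \<le> p"
  shows "(\<forall>u. u \<in> ops a p \<longrightarrow> P (map (cf i) u) u) \<longleftrightarrow> (\<forall>u. u \<in> ops a (Suc p) \<longrightarrow> i \<notin> set u \<longrightarrow> P u (map (cd i) u))"
proof
  assume l: "\<forall>u. u \<in> ops a p \<longrightarrow> P (map (cf i) u) u"
  show "\<forall>u. u \<in> ops a (Suc p) \<longrightarrow> i \<notin> set u \<longrightarrow> P u (map (cd i) u)"
  proof (intro allI impI)
    fix u assume "u \<in> ops a (Suc p)" "i \<notin> set u"
    then show "P u (map (cd i) u)" using l[rule_format, OF map_cd_ops[OF _ assms], of u] cf_cd[of i u] by metis
  qed
next
  assume r: "\<forall>u. u \<in> ops a (Suc p) \<longrightarrow> i \<notin> set u \<longrightarrow> P u (map (cd i) u)"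
  show "\<forall>u. u \<in> ops a p \<longrightarrow> P (map (cf i) u) u"
  proof (intro allI impI)
    fix u assume "u \<in> ops a p"
    moreover have "i \<notin> set (map (cf i) u)" by (auto simp: cf_def)
    moreover have "map (cd i) (map (cf i) u) = u" by (simp add: comp_def)
    ultimately show "P (map (cf i) u) u" using r map_cf_ops by metis
  qed
qed

lemma ball_bD: "(\<forall>x\<in>cells (bD p q) a b. P x) \<longleftrightarrow> (\<forall>u. u \<in> ops a p \<longrightarrow> (\<forall>v. v \<in> ops b q \<longrightarrow> P (u, v)))"
  by (auto simp: bD_def sx_def)

lemma eq_bhom_iff:
  assumes "\<beta> \<in> bhom K Y"
  shows "(\<lambda>a b. restrict (F a b) (cells K a b)) = \<beta> \<longleftrightarrow> (\<forall>a b. \<forall>x\<in>cells K a b. F a b x = \<beta> a b x)"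
  using bhomD(2)[OF assms] by (simp add: fun_eq_iff restrict_def) metis

text \<open>A regrouping of quantifiers: the conditions of \<open>aeppli_filler\<close>, each
  translated on its own, are collected in one clause per pair of operators.\<close>

lemma all_conj_split:
  "(\<forall>a b u v. U a u \<longrightarrow> V b v \<longrightarrow> P u \<longrightarrow> A a b u v) \<and> (\<forall>a b u v. U a u \<longrightarrow> V b v \<longrightarrow> Q v \<longrightarrow> A a b u v) \<and>
    (\<forall>a b u. U a u \<longrightarrow> P' u \<longrightarrow> (\<forall>v. V b v \<longrightarrow> B a b u v)) \<and>
    (\<forall>a b u. U a u \<longrightarrow> (\<forall>v. V b v \<longrightarrow> Q' v \<longrightarrow> B a b u v)) \<and>
    (\<forall>a b u v. U a u \<longrightarrow> V b v \<longrightarrow> C u v \<longrightarrow> D a b u v) \<longleftrightarrow>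
   (\<forall>a b u v. U a u \<longrightarrow> V b v \<longrightarrow> (P u \<or> Q v \<longrightarrow> A a b u v) \<and> (P' u \<or> Q' v \<longrightarrow> B a b u v) \<and>
     (C u v \<longrightarrow> D a b u v))"
  by blast

text \<open>The target is arbitrary, as the product is needed both in \<open>X\<close> and in
  \<open>Z\<close>. Since \<open>\<beta>\<close> is extensional, the equation for the last corner
  can be tested on cells.\<close>

lemma aeppli_filler_iff:
  assumes \<beta>: "\<beta> \<in> bhom (bD (Suc m) (Suc n)) Y"
  shows "aeppli_filler (Suc m) (Suc n) Y pt \<alpha> \<beta> \<theta> \<longleftrightarrow> \<theta> \<in> bhom (bD (Suc (Suc m)) (Suc (Suc n))) Y \<and>
    (\<forall>a b u v. u \<in> ops a (Suc (Suc m)) \<longrightarrow> v \<in> ops b (Suc (Suc n)) \<longrightarrow>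
      (\<not> {..<m} \<subseteq> set u \<or> \<not> {..<n} \<subseteq> set v \<longrightarrow> \<theta> a b (u, v) = degen Y a b pt) \<and>
      (m \<notin> set u \<or> n \<notin> set v \<longrightarrow> \<theta> a b (u, v) = \<alpha> a b (map (cd m) u, map (cd n) v)) \<and>
      (Suc (Suc m) \<notin> set u \<and> Suc (Suc n) \<notin> set v \<longrightarrow> \<theta> a b (u, v) = \<beta> a b (u, v)))"
proof -
  let ?M = "Suc (Suc m)" and ?N = "Suc (Suc n)"
  note P = pull_def opdim_simps fun2_restrict_eq ball_bD prod.case
  note S = coface_eq codeg_eq opcomp_id_left
  have 1: "md1 ?M ?N i \<theta> = bconst (bD (Suc m) ?N) Y pt \<longleftrightarrow>
      (\<forall>a b u. u \<in> ops a ?M \<longrightarrow> i \<notin> set u \<longrightarrow> (\<forall>v. v \<in> ops b ?N \<longrightarrow> \<theta> a b (u, v) = degen Y a b pt))"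
    if "i \<le> Suc m" for i
  proof -
    have f: "(\<forall>u. u \<in> ops a (Suc m) \<longrightarrow> (\<forall>v. v \<in> ops b ?N \<longrightarrow> \<theta> a b (map (cf i) u, v) = degen Y a b pt)) \<longleftrightarrow>
        (\<forall>u. u \<in> ops a ?M \<longrightarrow> i \<notin> set u \<longrightarrow> (\<forall>v. v \<in> ops b ?N \<longrightarrow> \<theta> a b (u, v) = degen Y a b pt))" for a b
      by (rule face_all[OF that, where P = "\<lambda>u u'. \<forall>v. v \<in> ops b ?N \<longrightarrow> \<theta> a b (u, v) = degen Y a b pt"])
    show ?thesis unfolding md1_def bconst_def P f[symmetric] by (simp add: S cong: imp_cong)
  qed
  have 2: "md2 ?M ?N j \<theta> = bconst (bD ?M (Suc n)) Y pt \<longleftrightarrow>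
      (\<forall>a b u. u \<in> ops a ?M \<longrightarrow> (\<forall>v. v \<in> ops b ?N \<longrightarrow> j \<notin> set v \<longrightarrow> \<theta> a b (u, v) = degen Y a b pt))"
    if "j \<le> Suc n" for j
  proof -
    have f: "(\<forall>v. v \<in> ops b (Suc n) \<longrightarrow> \<theta> a b (u, map (cf j) v) = degen Y a b pt) \<longleftrightarrow>
        (\<forall>v. v \<in> ops b ?N \<longrightarrow> j \<notin> set v \<longrightarrow> \<theta> a b (u, v) = degen Y a b pt)" for a b u
      by (rule face_all[OF that, where P = "\<lambda>v v'. \<theta> a b (u, v) = degen Y a b pt"])
    show ?thesis unfolding md2_def bconst_def P f[symmetric] by (simp add: S cong: imp_cong)
  qed
  have 3: "md1 ?M ?N m \<theta> = ms2 (Suc m) (Suc n) n \<alpha> \<longleftrightarrow>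
      (\<forall>a b u. u \<in> ops a ?M \<longrightarrow> m \<notin> set u \<longrightarrow>
        (\<forall>v. v \<in> ops b ?N \<longrightarrow> \<theta> a b (u, v) = \<alpha> a b (map (cd m) u, map (cd n) v)))"
  proof -
    have f: "(\<forall>u. u \<in> ops a (Suc m) \<longrightarrow> (\<forall>v. v \<in> ops b ?N \<longrightarrow> \<theta> a b (map (cf m) u, v) = \<alpha> a b (u, map (cd n) v))) \<longleftrightarrow>
        (\<forall>u. u \<in> ops a ?M \<longrightarrow> m \<notin> set u \<longrightarrow>
          (\<forall>v. v \<in> ops b ?N \<longrightarrow> \<theta> a b (u, v) = \<alpha> a b (map (cd m) u, map (cd n) v)))" for a b
      by (rule face_all[OF le_SucI[OF order_refl],
          where P = "\<lambda>u u'. \<forall>v. v \<in> ops b ?N \<longrightarrow> \<theta> a b (u, v) = \<alpha> a b (u', map (cd n) v)"])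
    show ?thesis unfolding md1_def ms2_def P f[symmetric] by (simp add: S cong: imp_cong)
  qed
  have 4: "md2 ?M ?N n \<theta> = ms1 (Suc m) (Suc n) m \<alpha> \<longleftrightarrow>
      (\<forall>a b u. u \<in> ops a ?M \<longrightarrow>
        (\<forall>v. v \<in> ops b ?N \<longrightarrow> n \<notin> set v \<longrightarrow> \<theta> a b (u, v) = \<alpha> a b (map (cd m) u, map (cd n) v)))"
  proof -
    have f: "(\<forall>v. v \<in> ops b (Suc n) \<longrightarrow> \<theta> a b (u, map (cf n) v) = \<alpha> a b (map (cd m) u, v)) \<longleftrightarrow>
        (\<forall>v. v \<in> ops b ?N \<longrightarrow> n \<notin> set v \<longrightarrow> \<theta> a b (u, v) = \<alpha> a b (map (cd m) u, map (cd n) v))" for a b u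
      by (rule face_all[OF le_SucI[OF order_refl], where P = "\<lambda>v v'. \<theta> a b (u, v) = \<alpha> a b (map (cd m) u, v')"])
    show ?thesis unfolding md2_def ms1_def P f[symmetric] by (simp add: S cong: imp_cong)
  qed
  have "md1 ?M (Suc n) ?M (md2 ?M ?N ?N \<theta>) = (\<lambda>a b. \<lambda>(u, v)\<in>cells (bD (Suc m) (Suc n)) a b. \<theta> a b (u, v))"
    unfolding md1_def md2_def P
    by (simp add: coface_eq opcomp_id_left map_cf_top cells_bD map_cf_ops[where i = ?M, simplified map_cf_top] cong: imp_cong)
      (auto simp: map_cf_top ops_Suc)
  then have 5: "md1 ?M (Suc n) ?M (md2 ?M ?N ?N \<theta>) = \<beta> \<longleftrightarrow>
      (\<forall>a b u. u \<in> ops a (Suc m) \<longrightarrow> (\<forall>v. v \<in> ops b (Suc n) \<longrightarrow> \<theta> a b (u, v) = \<beta> a b (u, v)))"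
    by (simp only: eq_bhom_iff[OF \<beta>] ball_bD prod.case)
  have top: "u \<in> ops a (Suc k) \<longleftrightarrow> u \<in> ops a (Suc (Suc k)) \<and> Suc (Suc k) \<notin> set u" for u a k
    using map_cd_top[of u a "Suc k"] by (auto simp: ops_def subset_iff)
  have 5: "md1 ?M (Suc n) ?M (md2 ?M ?N ?N \<theta>) = \<beta> \<longleftrightarrow>
      (\<forall>a b u v. u \<in> ops a ?M \<longrightarrow> v \<in> ops b ?N \<longrightarrow> ?M \<notin> set u \<and> ?N \<notin> set v \<longrightarrow> \<theta> a b (u, v) = \<beta> a b (u, v))"
    unfolding 5 using top[of _ _ m] top[of _ _ n] by blast
  have 6: "(\<forall>i<m. md1 ?M ?N i \<theta> = bconst (bD (Suc m) ?N) Y pt) \<longleftrightarrow>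
      (\<forall>a b u v. u \<in> ops a ?M \<longrightarrow> v \<in> ops b ?N \<longrightarrow> \<not> {..<m} \<subseteq> set u \<longrightarrow> \<theta> a b (u, v) = degen Y a b pt)"
  proof -
    have "(\<forall>i<m. md1 ?M ?N i \<theta> = bconst (bD (Suc m) ?N) Y pt) \<longleftrightarrow>
      (\<forall>i<m. \<forall>a b u. u \<in> ops a ?M \<longrightarrow> i \<notin> set u \<longrightarrow> (\<forall>v. v \<in> ops b ?N \<longrightarrow> \<theta> a b (u, v) = degen Y a b pt))"
      using 1 by (meson le_SucI less_imp_le)
    then show ?thesis unfolding subset_iff lessThan_iff by blast
  qed
  have 7: "(\<forall>j<n. md2 ?M ?N j \<theta> = bconst (bD ?M (Suc n)) Y pt) \<longleftrightarrow>
      (\<forall>a b u v. u \<in> ops a ?M \<longrightarrow> v \<in> ops b ?N \<longrightarrow> \<not> {..<n} \<subseteq> set v \<longrightarrow> \<theta> a b (u, v) = degen Y a b pt)"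
  proof -
    have "(\<forall>j<n. md2 ?M ?N j \<theta> = bconst (bD ?M (Suc n)) Y pt) \<longleftrightarrow>
      (\<forall>j<n. \<forall>a b u. u \<in> ops a ?M \<longrightarrow> (\<forall>v. v \<in> ops b ?N \<longrightarrow> j \<notin> set v \<longrightarrow> \<theta> a b (u, v) = degen Y a b pt))"
      using 2 by (meson le_SucI less_imp_le)
    then show ?thesis unfolding subset_iff lessThan_iff by blast
  qed
  \<comment> \<open>With \<open>p = Suc m\<close> and \<open>q = Suc n\<close> the subtractions
    \<open>p - 1\<close> and \<open>q - 1\<close> do not truncate.\<close>
  have ar: "Suc m + 1 = ?M" "Suc n + 1 = ?N" "Suc m - 1 = m" "Suc n - 1 = n" by simp_all
  show ?thesis
    unfolding aeppli_filler_def ar 3 4 5 6 7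
    by (rule conj_cong[OF refl all_conj_split[where U = "\<lambda>a u. u \<in> ops a ?M" and V = "\<lambda>b v. v \<in> ops b ?N"
          and P = "\<lambda>u. \<not> {..<m} \<subseteq> set u" and Q = "\<lambda>v. \<not> {..<n} \<subseteq> set v"
          and P' = "\<lambda>u. m \<notin> set u" and Q' = "\<lambda>v. n \<notin> set v"
          and A = "\<lambda>a b u v. \<theta> a b (u, v) = degen Y a b pt"
          and B = "\<lambda>a b u v. \<theta> a b (u, v) = \<alpha> a b (map (cd m) u, map (cd n) v)"
          and C = "\<lambda>u v. ?M \<notin> set u \<and> ?N \<notin> set v" and D = "\<lambda>a b u v. \<theta> a b (u, v) = \<beta> a b (u, v)"]])
qed

lemma aeppli_result:
  "md1 (Suc (Suc m)) (Suc n) (Suc m) (md2 (Suc (Suc m)) (Suc (Suc n)) (Suc n) \<theta>) =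
    (\<lambda>a b. \<lambda>(u, v)\<in>cells (bD (Suc m) (Suc n)) a b. \<theta> a b (map (cf (Suc m)) u, map (cf (Suc n)) v))"
  unfolding md1_def md2_def pull_def opdim_simps fun2_restrict_eq ball_bD prod.case
  by (simp add: coface_eq opcomp_id_left opcomp_id_left[OF map_cf_ops] cells_bD map_cf_ops cong: imp_cong)

text \<open>The description by \<open>THE\<close> is legitimate because every filler, for all
  representatives, yields a composite in the sense of \<open>T\<close>, and composites are unique up
  to \<open>E\<close>.\<close>

lemma (in composition) aeppli_class:
  assumes R: "htpy (bD p q) (bdeltaA p q) Y pt = {(a, b). a \<in> A \<and> b \<in> A \<and> E (r a) (r b)}" (is "?R = _")
    and rS: "\<And>a. a \<in> A \<Longrightarrow> r a \<in> S"
    and ex: "\<And>\<alpha> \<beta>. \<lbrakk>\<alpha> \<in> A; \<beta> \<in> A\<rbrakk> \<Longrightarrow> \<exists>\<theta>. aeppli_filler p q Y pt \<alpha> \<beta> \<theta>"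
    and res: "\<And>\<alpha> \<beta> \<theta>. \<lbrakk>\<alpha> \<in> A; \<beta> \<in> A; aeppli_filler p q Y pt \<alpha> \<beta> \<theta>\<rbrakk> \<Longrightarrow>
      md1 (p + 1) q p (md2 (p + 1) (q + 1) q \<theta>) \<in> A \<and>
      T (r \<alpha>) (r \<beta>) (r (md1 (p + 1) q p (md2 (p + 1) (q + 1) q \<theta>)))"
    and \<alpha>\<beta>: "\<alpha> \<in> A" "\<beta> \<in> A"
  shows "\<exists>\<gamma>\<in>A. T (r \<alpha>) (r \<beta>) (r \<gamma>) \<and> aeppli p q Y pt (?R `` {\<alpha>}) (?R `` {\<beta>}) = ?R `` {\<gamma>}"
proof -
  let ?G = "\<lambda>\<theta>. md1 (p + 1) q p (md2 (p + 1) (q + 1) q \<theta>)"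
  have Riff: "(a, b) \<in> ?R \<longleftrightarrow> a \<in> A \<and> b \<in> A \<and> E (r a) (r b)" for a b unfolding R by simp
  obtain \<theta> where \<theta>: "aeppli_filler p q Y pt \<alpha> \<beta> \<theta>" using ex[OF \<alpha>\<beta>] by blast
  note G = res[OF \<alpha>\<beta> \<theta>]
  have refl: "a \<in> ?R `` {a}" if "a \<in> A" for a
    using that left_unit[OF rS[OF that]] Riff by blast
  have "aeppli p q Y pt (?R `` {\<alpha>}) (?R `` {\<beta>}) = ?R `` {?G \<theta>}"
    unfolding aeppli_def
  proof (rule the_equality)
    show "\<exists>\<alpha>'\<in>?R `` {\<alpha>}. \<exists>\<beta>'\<in>?R `` {\<beta>}. \<exists>\<theta>'. aeppli_filler p q Y pt \<alpha>' \<beta>' \<theta>' \<and> ?R `` {?G \<theta>} = ?R `` {?G \<theta>'}"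
      using refl[OF \<alpha>\<beta>(1)] refl[OF \<alpha>\<beta>(2)] \<theta> by blast
  next
    fix c assume "\<exists>\<alpha>'\<in>?R `` {\<alpha>}. \<exists>\<beta>'\<in>?R `` {\<beta>}. \<exists>\<theta>'. aeppli_filler p q Y pt \<alpha>' \<beta>' \<theta>' \<and> c = ?R `` {?G \<theta>'}"
    then obtain \<alpha>' \<beta>' \<theta>' where *: "\<alpha>' \<in> ?R `` {\<alpha>}" "\<beta>' \<in> ?R `` {\<beta>}" "aeppli_filler p q Y pt \<alpha>' \<beta>' \<theta>'"
      and c: "c = ?R `` {?G \<theta>'}" by blast
    have A': "\<alpha>' \<in> A" "\<beta>' \<in> A" "E (r \<alpha>) (r \<alpha>')" "E (r \<beta>) (r \<beta>')" using *(1,2) Riff by blast+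
    note G' = res[OF A'(1,2) *(3)]
    have "T (r \<alpha>') (r \<beta>') (r (?G \<theta>))" using T_cong2[OF T_cong1[OF _ A'(3)] A'(4)] G by blast
    then have E: "E (r (?G \<theta>')) (r (?G \<theta>))" using T_unique G' by blast
    have "(?G \<theta>', x) \<in> ?R \<longleftrightarrow> (?G \<theta>, x) \<in> ?R" for x
      unfolding Riff using G G' E_trans[OF E] E_trans[OF E_sym[OF E]] by blast
    then show "c = ?R `` {?G \<theta>}" unfolding c by blast
  qed
  then show ?thesis using G by blast
qed

section \<open>The Aeppli group presented by loops\<close>

context loops
begin

abbreviation "A1 \<equiv> relmaps (bD (Suc m) (Suc n)) (bdeltaA (Suc m) (Suc n)) X pt"

text \<open>The bidegree is recovered from the lengths of the lists.\<close>

definition ev_list :: "(lpair, 'a) bmap \<Rightarrow> nat list \<Rightarrow> nat list \<Rightarrow> 'a" where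
  "ev_list \<alpha> s t = \<alpha> (dm s) (dm t) (s, t)"

lemma rin_ops: "rin s t \<Longrightarrow> s \<in> ops (dm s) (Suc m) \<and> t \<in> ops (dm t) (Suc n)"
  using crdD(1)[OF crd_bD, of "Suc m" "Suc n" s t] by (simp add: cells_bD)

lemma ops_rin: "u \<in> ops a (Suc m) \<Longrightarrow> v \<in> ops b (Suc n) \<Longrightarrow> rin u v \<and> dm u = a \<and> dm v = b"
  by (auto simp: inb_def ops_def)

lemma A1_rel:
  assumes \<alpha>: "\<alpha> \<in> A1" shows "rel (ev_list \<alpha>)"
  unfolding rel_def
proof (intro conjI allI impI)
  have b: "\<alpha> \<in> bhom (bD (Suc m) (Suc n)) X" using \<alpha> by (simp add: relmaps_iff)
  show "Bx X {..Suc m} {..Suc n} (ev_list \<alpha>)"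
    unfolding ev_list_def by (rule crd_nt[OF crd_bD bhom_nt[OF b]])
  fix s t assume r: "rin s t" and c: "\<not> {..m} \<subseteq> set s \<or> \<not> {..n} \<subseteq> set t \<or> Suc m \<notin> set s \<and> Suc n \<notin> set t"
  have "(s, t) \<in> cells (bdeltaA (Suc m) (Suc n)) (dm s) (dm t)" unfolding cells_bdeltaA using rin_ops[OF r] c by blast
  then show "ev_list \<alpha> s t = star s t" using \<alpha> by (simp add: relmaps_iff ev_list_def star_def)
qed

lemma nt_A1:
  assumes \<Psi>: "nt (bD (Suc m) (Suc n)) X \<Psi>"
    and star: "\<And>a b y. y \<in> cells (bdeltaA (Suc m) (Suc n)) a b \<Longrightarrow> \<Psi> a b y = degen X a b pt"
  shows "(\<lambda>a b. \<lambda>y\<in>cells (bD (Suc m) (Suc n)) a b. \<Psi> a b y) \<in> A1"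
  using nt_bhom[OF bisset_bD \<Psi>] star bdeltaA_props(1) unfolding relmaps_iff
  by (auto simp: subset_iff)

lemma A1_surj:
  assumes \<phi>: "rel \<phi>"
  obtains \<alpha> where "\<alpha> \<in> A1" "\<And>s t. rin s t \<Longrightarrow> ev_list \<alpha> s t = \<phi> s t"
proof -
  obtain \<Psi> where \<Psi>: "nt (bD (Suc m) (Suc n)) X \<Psi>" "\<And>s t. rin s t \<Longrightarrow> \<Psi> (dm s) (dm t) (s, t) = \<phi> s t"
    using crd_ex[OF crd_bD relD(1)[OF \<phi>]] by blast
  let ?\<alpha> = "\<lambda>a b. \<lambda>y\<in>cells (bD (Suc m) (Suc n)) a b. \<Psi> a b y"
  have "?\<alpha> \<in> A1"
  proof (rule nt_A1[OF \<Psi>(1)])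
    fix a b y assume "y \<in> cells (bdeltaA (Suc m) (Suc n)) a b"
    then obtain u v where y: "y = (u, v)" "u \<in> ops a (Suc m)" "v \<in> ops b (Suc n)"
        "\<not> {..m} \<subseteq> set u \<or> \<not> {..n} \<subseteq> set v \<or> Suc m \<notin> set u \<and> Suc n \<notin> set v"
      by (cases y) (simp only: cells_bdeltaA)
    note r = ops_rin[OF y(2,3)]
    have "\<Psi> a b y = \<phi> u v" using \<Psi>(2)[of u v] r y(1) by simp
    also have "\<dots> = star u v" using relD(2)[OF \<phi>] r y(4) by blast
    finally show "\<Psi> a b y = degen X a b pt" using r by (simp add: star_def)
  qed
  moreover have "ev_list ?\<alpha> s t = \<phi> s t" if "rin s t" for s t
    using \<Psi>(2)[OF that] rin_ops[OF that] by (simp add: ev_list_def cells_bD)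
  ultimately show thesis by (rule that)
qed

text \<open>In coordinates \<open>e12\<close> a relative homotopy is a \<open>rel_htpy\<close>, and
  \<open>rel_htpy_iff\<close> passes to loops.\<close>

lemma A1_htpy_iff:
  assumes \<alpha>: "\<alpha> \<in> A1" "\<beta> \<in> A1"
  shows "(\<alpha>, \<beta>) \<in> htpy (bD (Suc m) (Suc n)) (bdeltaA (Suc m) (Suc n)) X pt \<longleftrightarrow> E (rr (ev_list \<alpha>)) (rr (ev_list \<beta>))"
proof -
  let ?M = "bD (Suc m) (Suc n)" and ?N = "bdeltaA (Suc m) (Suc n)"
  have crd: "crd (bprod ?M (bD 1 1)) ({..Suc m} \<times> {..1}) ({..Suc n} \<times> {..1}) e12" by (rule crd_e12)
  have "(\<exists>H. ho_cond ?M ?N X pt \<alpha> \<beta> H) \<longleftrightarrow> (\<exists>h. rel_htpy (ev_list \<alpha>) (ev_list \<beta>) h)"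
  proof
    assume "\<exists>H. ho_cond ?M ?N X pt \<alpha> \<beta> H"
    then obtain H where "ho_cond ?M ?N X pt \<alpha> \<beta> H" by blast
    note H = ho_condD[OF this]
    have "rel_htpy (ev_list \<alpha>) (ev_list \<beta>) (\<lambda>s t. H (dm s) (dm t) (e12 s t))"
      unfolding rel_htpy_def
    proof (intro conjI allI impI)
      show "lbx (\<lambda>s t. H (dm s) (dm t) (e12 s t))" by (rule crd_nt[OF crd H(1)])
      fix s t assume lin: "lin s t"
      have c: "(map fst s, map fst t) \<in> cells ?M (dm s) (dm t)" "map snd s \<in> ops (dm s) 1" "map snd t \<in> ops (dm t) 1"
        using crdD(1)[OF crd lin] by (simp_all add: cells_bD)
      show "H (dm s) (dm t) (e12 s t) = star s t" if "nc s t \<or> Suc m \<notin> fst ` set s \<and> Suc n \<notin> fst ` set t"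
      proof -
        have "(map fst s, map fst t) \<in> cells ?N (dm s) (dm t)"
          using c(1) that unfolding cells_bdeltaA cells_bD nc_def by (simp only: set_map) blast
        from H(4)[OF c(1) this c(2,3)] show ?thesis by (simp add: star_def)
      qed
      show "H (dm s) (dm t) (e12 s t) = ev_list \<alpha> (map fst s) (map fst t)" if "0 \<notin> snd ` set s \<or> 0 \<notin> snd ` set t"
        using H(2)[OF c] that by (simp add: ev_list_def)
      show "H (dm s) (dm t) (e12 s t) = ev_list \<beta> (map fst s) (map fst t)" if "1 \<notin> snd ` set s \<and> 1 \<notin> snd ` set t"
        using H(3)[OF c] that by (simp add: ev_list_def)
    qed
    then show "\<exists>h. rel_htpy (ev_list \<alpha>) (ev_list \<beta>) h"
      by (rule exI[of "\<lambda>h. rel_htpy (ev_list \<alpha>) (ev_list \<beta>) h" "\<lambda>s t. H (dm s) (dm t) (e12 s t)"])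
  next
    assume "\<exists>h. rel_htpy (ev_list \<alpha>) (ev_list \<beta>) h"
    then obtain h where "rel_htpy (ev_list \<alpha>) (ev_list \<beta>) h" by blast
    note h = rel_htpyD[OF this]
    obtain H where H: "nt (bprod ?M (bD 1 1)) X H" "\<And>s t. lin s t \<Longrightarrow> H (dm s) (dm t) (e12 s t) = h s t"
      using crd_ex[OF crd h(1)] by blast
    have "ho_cond ?M ?N X pt \<alpha> \<beta> H"
      unfolding ho_cond_def
    proof (intro conjI[OF H(1)] allI impI)
      fix a b y u v assume *: "y \<in> cells ?M a b" "u \<in> ops a 1" "v \<in> ops b 1"
      obtain s t where st: "lin s t" "length s = Suc a" "length t = Suc b" "e12 s t = (y, u, v)"
        using crdD(3)[OF crd, of "(y, u, v)" a b] * by (auto simp: cells_bD)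
      have eqs: "(map fst s, map fst t) = y" "map snd s = u" "map snd t = v" "dm s = a" "dm t = b" using st by simp_all
      have Hh: "H a b (y, u, v) = h s t" using H(2)[OF st(1)] unfolding eqs .
      have ev: "ev_list \<gamma> (map fst s) (map fst t) = \<gamma> a b y" for \<gamma> using eqs by (simp add: ev_list_def)
      have su: "set u = snd ` set s" "set v = snd ` set t" unfolding eqs(2,3)[symmetric] by simp_all
      have 1: "0 \<notin> set u \<or> 0 \<notin> set v \<longrightarrow> H a b (y, u, v) = \<alpha> a b y" using h(3)[OF st(1)] unfolding Hh su ev by blast
      have 2: "1 \<notin> set u \<and> 1 \<notin> set v \<longrightarrow> H a b (y, u, v) = \<beta> a b y" using h(4)[OF st(1)] unfolding Hh su ev by blast
      have 3: "y \<in> cells ?N a b \<longrightarrow> H a b (y, u, v) = degen X a b pt"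
      proof
        assume "y \<in> cells ?N a b"
        then have "nc s t \<or> Suc m \<notin> fst ` set s \<and> Suc n \<notin> fst ` set t"
          unfolding eqs(1)[symmetric] cells_bdeltaA nc_def set_map by blast
        then show "H a b (y, u, v) = degen X a b pt" using h(2)[OF st(1)] eqs unfolding Hh star_def by simp
      qed
      show "(0 \<notin> set u \<or> 0 \<notin> set v \<longrightarrow> H a b (y, u, v) = \<alpha> a b y) \<and>
          (1 \<notin> set u \<and> 1 \<notin> set v \<longrightarrow> H a b (y, u, v) = \<beta> a b y) \<and>
          (y \<in> cells ?N a b \<longrightarrow> H a b (y, u, v) = degen X a b pt)"
        by (intro conjI 1 2 3)
    qed
    then show "\<exists>H. ho_cond ?M ?N X pt \<alpha> \<beta> H" by (rule exI[of "\<lambda>H. ho_cond ?M ?N X pt \<alpha> \<beta> H" H])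
  qed
  then show ?thesis
    unfolding htpy_ho_cond[OF bisset_bD bdeltaA_props(1)]
      rel_htpy_iff[OF A1_rel[OF \<alpha>(1)] A1_rel[OF \<alpha>(2)], symmetric]
    using \<alpha> by (simp only: simp_thms)
qed

text \<open>Transfers \<open>afill_ex\<close> and \<open>afill_T\<close> from functions of lists to
  maps. That the resulting corner lies in \<open>A1\<close> is seen by building a map in
  \<open>A1\<close> from \<open>aprod\<close> and showing that it is this corner.\<close>

lemma A1_filler:
  assumes \<alpha>: "\<alpha> \<in> A1" "\<beta> \<in> A1"
  shows "\<exists>\<theta>. aeppli_filler (Suc m) (Suc n) X pt \<alpha> \<beta> \<theta>"
    and "aeppli_filler (Suc m) (Suc n) X pt \<alpha> \<beta> \<theta> \<Longrightarrow>
      md1 (Suc m + 1) (Suc n) (Suc m) (md2 (Suc m + 1) (Suc n + 1) (Suc n) \<theta>) \<in> A1 \<and>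
      T (rr (ev_list \<alpha>)) (rr (ev_list \<beta>))
        (rr (ev_list (md1 (Suc m + 1) (Suc n) (Suc m) (md2 (Suc m + 1) (Suc n + 1) (Suc n) \<theta>))))"
proof -
  let ?D = "bD (Suc (Suc m)) (Suc (Suc n))"
  have b: "\<beta> \<in> bhom (bD (Suc m) (Suc n)) X" using \<alpha> by (simp add: relmaps_iff)
  note F = aeppli_filler_iff[OF b, of pt \<alpha>]
  note rel = A1_rel[OF \<alpha>(1)] A1_rel[OF \<alpha>(2)]
  have aops: "u \<in> ops a (Suc (Suc m)) \<and> v \<in> ops c (Suc (Suc n)) \<longleftrightarrow> ain u v \<and> length u = Suc a \<and> length v = Suc c" for u v a c
    by (auto simp: inb_def ops_def)
  show "\<exists>\<theta>. aeppli_filler (Suc m) (Suc n) X pt \<alpha> \<beta> \<theta>"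
  proof -
    obtain \<phi> where "afill (ev_list \<alpha>) (ev_list \<beta>) \<phi>" using afill_ex[OF rel] by blast
    note \<phi> = afillD[OF this]
    obtain \<Psi> where \<Psi>: "nt ?D X \<Psi>" "\<And>s t. ain s t \<Longrightarrow> \<Psi> (dm s) (dm t) (s, t) = \<phi> s t"
      using crd_ex[OF crd_bD \<phi>(1)] by blast
    let ?\<theta> = "\<lambda>a b. \<lambda>y\<in>cells ?D a b. \<Psi> a b y"
    have "aeppli_filler (Suc m) (Suc n) X pt \<alpha> \<beta> ?\<theta>"
      unfolding F
    proof (intro conjI[OF nt_bhom[OF bisset_bD \<Psi>(1)]] allI impI)
      fix a c u v assume *: "u \<in> ops a (Suc (Suc m))" "v \<in> ops c (Suc (Suc n))"
      then have i: "ain u v" "length u = Suc a" "length v = Suc c" using aops by blast+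
      have "?\<theta> a c (u, v) = \<phi> u v" using \<Psi>(2)[OF i(1)] i * by (simp add: cells_bD)
      then show "(\<not> {..<m} \<subseteq> set u \<or> \<not> {..<n} \<subseteq> set v \<longrightarrow> ?\<theta> a c (u, v) = degen X a c pt) \<and>
        (m \<notin> set u \<or> n \<notin> set v \<longrightarrow> ?\<theta> a c (u, v) = \<alpha> a c (map (cd m) u, map (cd n) v)) \<and>
        (Suc (Suc m) \<notin> set u \<and> Suc (Suc n) \<notin> set v \<longrightarrow> ?\<theta> a c (u, v) = \<beta> a c (u, v))"
        using \<phi>(2-4)[OF i(1)] i(2,3) by (simp only: star_def ev_list_def length_map diff_Suc_1 simp_thms) blast
    qed
    then show ?thesis by blast
  qed
  assume "aeppli_filler (Suc m) (Suc n) X pt \<alpha> \<beta> \<theta>"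
  then have \<theta>b: "\<theta> \<in> bhom ?D X" and \<theta>: "\<And>a c u v. \<lbrakk>u \<in> ops a (Suc (Suc m)); v \<in> ops c (Suc (Suc n))\<rbrakk> \<Longrightarrow>
      (\<not> {..<m} \<subseteq> set u \<or> \<not> {..<n} \<subseteq> set v \<longrightarrow> \<theta> a c (u, v) = degen X a c pt) \<and>
      (m \<notin> set u \<or> n \<notin> set v \<longrightarrow> \<theta> a c (u, v) = \<alpha> a c (map (cd m) u, map (cd n) v)) \<and>
      (Suc (Suc m) \<notin> set u \<and> Suc (Suc n) \<notin> set v \<longrightarrow> \<theta> a c (u, v) = \<beta> a c (u, v))"
    unfolding F by blast+
  have af: "afill (ev_list \<alpha>) (ev_list \<beta>) (ev_list \<theta>)"
    unfolding afill_def
  proof (intro conjI allI)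
    show "Bx X {..Suc (Suc m)} {..Suc (Suc n)} (ev_list \<theta>)"
      unfolding ev_list_def by (rule crd_nt[OF crd_bD bhom_nt[OF \<theta>b]])
    fix s t
    show "ain s t \<longrightarrow> (\<not> {..<m} \<subseteq> set s \<or> \<not> {..<n} \<subseteq> set t \<longrightarrow> ev_list \<theta> s t = star s t) \<and>
      (m \<notin> set s \<or> n \<notin> set t \<longrightarrow> ev_list \<theta> s t = ev_list \<alpha> (map (cd m) s) (map (cd n) t)) \<and>
      (Suc (Suc m) \<notin> set s \<and> Suc (Suc n) \<notin> set t \<longrightarrow> ev_list \<theta> s t = ev_list \<beta> s t)"
    proof
      assume i: "ain s t"
      then have "s \<in> ops (dm s) (Suc (Suc m))" "t \<in> ops (dm t) (Suc (Suc n))"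
        using aops[of s "dm s" t "dm t"] inb_len[OF i] by blast+
      from \<theta>[OF this] show "(\<not> {..<m} \<subseteq> set s \<or> \<not> {..<n} \<subseteq> set t \<longrightarrow> ev_list \<theta> s t = star s t) \<and>
        (m \<notin> set s \<or> n \<notin> set t \<longrightarrow> ev_list \<theta> s t = ev_list \<alpha> (map (cd m) s) (map (cd n) t)) \<and>
        (Suc (Suc m) \<notin> set s \<and> Suc (Suc n) \<notin> set t \<longrightarrow> ev_list \<theta> s t = ev_list \<beta> s t)"
        by (simp only: star_def ev_list_def length_map)
    qed
  qed
  let ?G = "md1 (Suc m + 1) (Suc n) (Suc m) (md2 (Suc m + 1) (Suc n + 1) (Suc n) \<theta>)"
  have G: "?G = (\<lambda>a b. \<lambda>(u, v)\<in>cells (bD (Suc m) (Suc n)) a b. \<theta> a b (map (cf (Suc m)) u, map (cf (Suc n)) v))"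
    using aeppli_result[of m n \<theta>] by simp
  obtain \<gamma> where \<gamma>: "\<gamma> \<in> A1" "\<And>s t. rin s t \<Longrightarrow> ev_list \<gamma> s t = aprod (ev_list \<theta>) s t"
    using A1_surj[OF aprod_rel[OF rel af]] by blast
  have "?G = \<gamma>"
    unfolding G eq_bhom_iff[OF relmaps_iff[THEN iffD1, OF \<gamma>(1), THEN conjunct1]] ball_bD prod.case
  proof (intro allI impI)
    fix a b u v assume "u \<in> ops a (Suc m)" "v \<in> ops b (Suc n)"
    note r = ops_rin[OF this]
    show "\<theta> a b (map (cf (Suc m)) u, map (cf (Suc n)) v) = \<gamma> a b (u, v)"
      using \<gamma>(2)[of u v] r by (simp add: ev_list_def aprod_def)
  qed
  moreover have "E (rr (aprod (ev_list \<theta>))) (rr (ev_list \<gamma>))"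
  proof (rule E_eqI[OF rr_loop[OF aprod_rel[OF rel af]] rr_loop[OF A1_rel[OF \<gamma>(1)]]])
    fix s t assume g: "gin 1 s t"
    have "rin (map (contr m) s) (map (contr n) t)" by (rule inb_map[OF g]) (simp_all add: contr_le)
    from \<gamma>(2)[OF this] show "rr (aprod (ev_list \<theta>)) s t = rr (ev_list \<gamma>) s t" by (simp only: rr_def)
  qed
  then have "T (rr (ev_list \<alpha>)) (rr (ev_list \<beta>)) (rr (ev_list \<gamma>))"
    using T_cong3[OF afill_T[OF rel af]] E_sym by blast
  ultimately show "?G \<in> A1 \<and> T (rr (ev_list \<alpha>)) (rr (ev_list \<beta>)) (rr (ev_list ?G))"
    using \<gamma>(1) by (simp only: simp_thms)
qed

lemma A1_presents:
  "presents A1 (htpy (bD (Suc m) (Suc n)) (bdeltaA (Suc m) (Suc n)) X pt) (\<lambda>\<alpha>. rr (ev_list \<alpha>))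
    (piA_group (Suc m) (Suc n) X pt)"
proof -
  let ?R = "htpy (bD (Suc m) (Suc n)) (bdeltaA (Suc m) (Suc n)) X pt"
  have "(a, b) \<in> ?R \<longleftrightarrow> a \<in> A1 \<and> b \<in> A1 \<and> E (rr (ev_list a)) (rr (ev_list b))" for a b
  proof (cases "a \<in> A1 \<and> b \<in> A1")
    case True then show ?thesis using A1_htpy_iff[of a b] by (simp only: simp_thms)
  next
    case False then show ?thesis unfolding htpy_iff by blast
  qed
  then have R: "?R = {(a, b). a \<in> A1 \<and> b \<in> A1 \<and> E (rr (ev_list a)) (rr (ev_list b))}"
    by (simp only: Set.set_eq_iff split_paired_all mem_Collect_eq prod.case) blast
  have lp: "rr (ev_list a) \<in> {x. loop x}" if "a \<in> A1" for a using rr_loop[OF A1_rel[OF that]] by simp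
  have sur: "\<exists>a\<in>A1. E (rr (ev_list a)) s" if s: "loop s" for s
  proof -
    obtain \<phi> where \<phi>: "rel \<phi>" "E (rr \<phi>) s" using rel_surj[OF s] by blast
    obtain \<alpha> where \<alpha>: "\<alpha> \<in> A1" "\<And>s t. rin s t \<Longrightarrow> ev_list \<alpha> s t = \<phi> s t" using A1_surj[OF \<phi>(1)] by blast
    have "E (rr (ev_list \<alpha>)) (rr \<phi>)"
    proof (rule E_eqI[OF rr_loop[OF A1_rel[OF \<alpha>(1)]] rr_loop[OF \<phi>(1)]])
      fix s t assume g: "gin 1 s t"
      have "rin (map (contr m) s) (map (contr n) t)" by (rule inb_map[OF g]) (simp_all add: contr_le)
      from \<alpha>(2)[OF this] show "rr (ev_list \<alpha>) s t = rr \<phi> s t" by (simp only: rr_def)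
    qed
    then show ?thesis using \<alpha>(1) E_trans[OF _ \<phi>(2)] by blast
  qed
  have one: "bconst (bD (Suc m) (Suc n)) X pt \<in> A1 \<and> E (rr (ev_list (bconst (bD (Suc m) (Suc n)) X pt))) star"
  proof
    have "nt (bD (Suc m) (Suc n)) X (\<lambda>a b _. degen X a b pt)"
      by (simp add: nt_def degen_cells[OF bisset pt] act_degen[OF bisset pt])
    from nt_A1[OF this] show A: "bconst (bD (Suc m) (Suc n)) X pt \<in> A1" by (simp add: bconst_def)
    show "E (rr (ev_list (bconst (bD (Suc m) (Suc n)) X pt))) star"
    proof (rule E_eqI[OF rr_loop[OF A1_rel[OF A]] loop_star_const])
      fix s t assume g: "gin 1 s t"
      have r: "rin (map (contr m) s) (map (contr n) t)" by (rule inb_map[OF g]) (simp_all add: contr_le)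
      show "rr (ev_list (bconst (bD (Suc m) (Suc n)) X pt)) s t = star s t"
        using rin_ops[OF r] by (simp add: rr_def ev_list_def bconst_def star_def cells_bD)
    qed
  qed
  have mult: "\<exists>c\<in>A1. T (rr (ev_list a)) (rr (ev_list b)) (rr (ev_list c)) \<and>
      aeppli (Suc m) (Suc n) X pt (?R `` {a}) (?R `` {b}) = ?R `` {c}" if "a \<in> A1" "b \<in> A1" for a b
    by (rule aeppli_class[OF R lp A1_filler that])
  show ?thesis
    unfolding presents_def
  proof (intro conjI ballI)
    show "?R = {(a, b). a \<in> A1 \<and> b \<in> A1 \<and> E (rr (ev_list a)) (rr (ev_list b))}" by (rule R)
    show "(\<lambda>\<alpha>. rr (ev_list \<alpha>)) ` A1 \<subseteq> {x. loop x}" using lp by blast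
    show "\<exists>a\<in>A1. E (rr (ev_list a)) s" if "s \<in> {x. loop x}" for s using sur that by blast
    show "carrier (piA_group (Suc m) (Suc n) X pt) = A1 // ?R" by (simp add: piA_group_def piA_def)
    show "\<exists>a\<in>A1. E (rr (ev_list a)) star \<and> \<one>\<^bsub>piA_group (Suc m) (Suc n) X pt\<^esub> = ?R `` {a}"
      using one by (simp add: piA_group_def) blast
    show "\<exists>c\<in>A1. T (rr (ev_list a)) (rr (ev_list b)) (rr (ev_list c)) \<and>
        ?R `` {a} \<otimes>\<^bsub>piA_group (Suc m) (Suc n) X pt\<^esub> ?R `` {b} = ?R `` {c}" if "a \<in> A1" "b \<in> A1" for a b
      using mult[OF that] by (simp add: piA_group_def)
  qed
qed

end

section \<open>Composition of loops\<close>

lemma unc_eq: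
  assumes Y: "bisset Y" and \<Phi>: "\<Phi> \<in> bhom Y (relHom K L X pt)" and \<Phi>': "\<Phi>' \<in> bhom Y (relHom K L' X pt')"
    and eq: "\<And>a b y k. \<lbrakk>y \<in> cells Y a b; k \<in> cells K a b\<rbrakk> \<Longrightarrow> unc \<Phi> a b (y, k) = unc \<Phi>' a b (y, k)"
  shows "\<Phi> = \<Phi>'"
proof (rule bhom_eqI[OF \<Phi> \<Phi>'])
  fix a b y assume y: "y \<in> cells Y a b"
  show "\<Phi> a b y = \<Phi>' a b y"
  proof (rule unc_inj[OF \<Phi> \<Phi>' y y])
    fix i j k f g assume "k \<in> cells K i j" "f \<in> ops i a" "g \<in> ops j b"
    then show "unc \<Phi> i j (act Y a b f g y, k) = unc \<Phi>' i j (act Y a b f g y, k)"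
      using eq bissetD(1)[OF Y _ _ y] by blast
  qed
qed

lemma nt_swap:
  assumes "nt (bprod Y K) X \<Psi>"
  shows "nt (bprod K Y) X (\<lambda>a b (k, y). \<Psi> a b (y, k))"
  unfolding nt_def
proof (intro allI ballI conjI)
  fix a b z assume "z \<in> cells (bprod K Y) a b"
  then obtain k y where z: "z = (k, y)" "(y, k) \<in> cells (bprod Y K) a b" by (cases z) auto
  show "(case z of (k, y) \<Rightarrow> \<Psi> a b (y, k)) \<in> cells X a b" using ntD(1)[OF assms z(2)] z(1) by simp
  show "(case act (bprod K Y) a b f g z of (k, y) \<Rightarrow> \<Psi> a' b' (y, k)) =
      act X a b f g (case z of (k, y) \<Rightarrow> \<Psi> a b (y, k))" if "f \<in> ops a' a" "g \<in> ops b' b" for a' b' f g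
    using ntD(2)[OF assms z(2) that] z(1) by simp
qed

section \<open>The group of loop classes and its transport along \<open>adj\<close>\<close>

context loops
begin

interpretation BC: loop_model X pt m n "bD m n" "bdelta m n" "bD 1 1" "bdeltaA 1 1" e12
  by (rule BC_model)

interpretation Z: loop_model X pt m n "bD 1 1" "bdeltaA 1 1" "bD m n" "bdelta m n" e21
  by (rule Z_model)

text \<open>Rather than checking naturality of the formula for \<open>adj\<close>,
  \<open>Z.unc_ex\<close> provides a map whose adjoint is that of \<open>\<omega>\<close> with the
  factors exchanged, and this map is shown to be \<open>adj m n \<omega>\<close>.\<close>

lemma adj_eq:
  assumes \<omega>: "\<omega> \<in> BC.A"
  shows "adj m n \<omega> \<in> Z.A"
    "u \<in> cells (bD 1 1) a b \<Longrightarrow> v \<in> cells (bD m n) a b \<Longrightarrow> unc (adj m n \<omega>) a b (u, v) = unc \<omega> a b (v, u)"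
proof -
  have nt: "nt (bprod (bD 1 1) (bD m n)) X (\<lambda>a b (u, v). unc \<omega> a b (v, u))"
    by (rule nt_swap[OF nt_unc(1)[OF bisset_bD BC.A_bhom[OF \<omega>]]])
  have st: "(case (u, v) of (u, v) \<Rightarrow> unc \<omega> a b (v, u)) = degen X a b pt"
    if "u \<in> cells (bD 1 1) a b" "v \<in> cells (bD m n) a b" "u \<in> cells (bdeltaA 1 1) a b \<or> v \<in> cells (bdelta m n) a b" for a b u v
    using BC.A_star[OF \<omega> that(2,1)] that(3) by (simp only: prod.case) blast
  obtain \<zeta> where \<zeta>: "\<zeta> \<in> Z.A" "\<And>a b u v. \<lbrakk>u \<in> cells (bD 1 1) a b; v \<in> cells (bD m n) a b\<rbrakk> \<Longrightarrow>
      unc \<zeta> a b (u, v) = (case (u, v) of (u, v) \<Rightarrow> unc \<omega> a b (v, u))"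
    using Z.unc_ex[OF nt st] by blast
  have "adj m n \<omega> = \<zeta>"
  proof (rule ext, rule ext, rule ext)
    fix a b u
    show "adj m n \<omega> a b u = \<zeta> a b u"
    proof (cases "u \<in> cells (bD 1 1) a b")
      case False
      then show ?thesis using bhomD(2)[OF Z.A_bhom[OF \<zeta>(1)]] by (simp add: adj_def)
    next
      case u: True
      have h: "\<zeta> a b u \<in> bhom (bprod (bD m n) (bD a b)) X"
        using bhomD(1)[OF Z.A_bhom[OF \<zeta>(1)] u] by (simp add: cells_relHom)
      show ?thesis
      proof (rule ext, rule ext, rule ext)
        fix i j z
        show "adj m n \<omega> a b u i j z = \<zeta> a b u i j z"
        proof (cases "z \<in> cells (bprod (bD m n) (bD a b)) i j")
          case False
          then show ?thesis using bhomD(2)[OF h] u by (simp add: adj_def)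
        next
          case True
          then obtain v f g where z: "z = (v, f, g)" "v \<in> cells (bD m n) i j" "f \<in> ops i a" "g \<in> ops j b"
            by (cases z) (auto simp: cells_bD)
          have au: "act (bD 1 1) a b f g u \<in> cells (bD 1 1) i j" by (rule bissetD(1)[OF bisset_bD z(3,4) u])
          have "adj m n \<omega> a b u i j z = unc \<omega> i j (v, act (bD 1 1) a b f g u)"
            using u True unfolding z(1) by (simp add: adj_def unc_def)
          also have "\<dots> = unc \<zeta> i j (act (bD 1 1) a b f g u, v)" using \<zeta>(2)[OF au z(2)] by simp
          also have "\<dots> = \<zeta> a b u i j z"
            unfolding z(1) by (rule unc_eval[OF Z.A_bhom[OF \<zeta>(1)] u z(2-4), symmetric])
          finally show ?thesis .
        qed
      qed
    qed
  qed
  then show "adj m n \<omega> \<in> Z.A"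
    "u \<in> cells (bD 1 1) a b \<Longrightarrow> v \<in> cells (bD m n) a b \<Longrightarrow> unc (adj m n \<omega>) a b (u, v) = unc \<omega> a b (v, u)"
    using \<zeta> by simp_all
qed

lemma adj_inj: "inj_on (adj m n) BC.A"
proof (rule inj_onI)
  fix \<omega> \<omega>' assume *: "\<omega> \<in> BC.A" "\<omega>' \<in> BC.A" "adj m n \<omega> = adj m n \<omega>'"
  show "\<omega> = \<omega>'"
    by (rule unc_eq[OF bisset_bD BC.A_bhom[OF *(1)] BC.A_bhom[OF *(2)]])
      (use adj_eq(2)[OF *(1)] adj_eq(2)[OF *(2)] *(3) in metis)
qed

lemma adj_surj:
  assumes \<zeta>: "\<zeta> \<in> Z.A"
  obtains \<omega> where "\<omega> \<in> BC.A" "adj m n \<omega> = \<zeta>"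
proof -
  have nt: "nt (bprod (bD m n) (bD 1 1)) X (\<lambda>a b (v, u). unc \<zeta> a b (u, v))"
    by (rule nt_swap[OF nt_unc(1)[OF bisset_bD Z.A_bhom[OF \<zeta>]]])
  have st: "(case (v, u) of (v, u) \<Rightarrow> unc \<zeta> a b (u, v)) = degen X a b pt"
    if "v \<in> cells (bD m n) a b" "u \<in> cells (bD 1 1) a b" "v \<in> cells (bdelta m n) a b \<or> u \<in> cells (bdeltaA 1 1) a b" for a b u v
    using Z.A_star[OF \<zeta> that(2,1)] that(3) by (simp only: prod.case) blast
  obtain \<omega> where \<omega>: "\<omega> \<in> BC.A" "\<And>a b v u. \<lbrakk>v \<in> cells (bD m n) a b; u \<in> cells (bD 1 1) a b\<rbrakk> \<Longrightarrow>
      unc \<omega> a b (v, u) = (case (v, u) of (v, u) \<Rightarrow> unc \<zeta> a b (u, v))"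
    using BC.unc_ex[OF nt st] by blast
  have "adj m n \<omega> = \<zeta>"
    by (rule unc_eq[OF bisset_bD Z.A_bhom[OF adj_eq(1)[OF \<omega>(1)]] Z.A_bhom[OF \<zeta>]])
      (simp only: adj_eq(2)[OF \<omega>(1)] \<omega>(2) prod.case)
  then show thesis using that \<omega>(1) by blast
qed

lemma adj_E:
  assumes \<omega>: "\<omega> \<in> BC.A"
  shows "E (BC.r \<omega>) (Z.r (adj m n \<omega>))"
proof (rule E_eqI[OF BC.r_loop[OF \<omega>] Z.r_loop[OF adj_eq(1)[OF \<omega>]]])
  fix s t assume g: "gin 1 s t"
  show "BC.r \<omega> s t = Z.r (adj m n \<omega>) s t"
    using adj_eq(2)[OF \<omega>] BC.e_cell[OF g] by (simp add: BC.r_def Z.r_def)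
qed

text \<open>\<open>adj\<close> does not change the loop up to \<open>E\<close>, so it preserves and
  reflects homotopy; as it is also onto, it carries classes onto whole classes.\<close>

lemma adj_class:
  assumes \<omega>: "\<omega> \<in> BC.A"
  shows "adj m n ` (BC.R `` {\<omega>}) = Z.R `` {adj m n \<omega>}"
proof -
  have iff: "(\<omega>, \<omega>') \<in> BC.R \<longleftrightarrow> (adj m n \<omega>, adj m n \<omega>') \<in> Z.R" if "\<omega>' \<in> BC.A" for \<omega>'
    unfolding BC.htpy_r_iff[OF \<omega> that] Z.htpy_r_iff[OF adj_eq(1)[OF \<omega>] adj_eq(1)[OF that]]
    using adj_E[OF \<omega>] adj_E[OF that] E_trans E_sym by blast
  show ?thesis
  proof (rule subset_antisym)
    show "adj m n ` (BC.R `` {\<omega>}) \<subseteq> Z.R `` {adj m n \<omega>}"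
    proof
      fix z assume "z \<in> adj m n ` (BC.R `` {\<omega>})"
      then obtain \<omega>' where w: "(\<omega>, \<omega>') \<in> BC.R" "z = adj m n \<omega>'" by blast
      then have "\<omega>' \<in> BC.A" unfolding BC.R_eq by blast
      then show "z \<in> Z.R `` {adj m n \<omega>}" using iff w by blast
    qed
    show "Z.R `` {adj m n \<omega>} \<subseteq> adj m n ` (BC.R `` {\<omega>})"
    proof
      fix z assume z: "z \<in> Z.R `` {adj m n \<omega>}"
      then have "z \<in> Z.A" unfolding Z.R_eq by blast
      then obtain \<omega>' where w: "\<omega>' \<in> BC.A" "adj m n \<omega>' = z" by (rule adj_surj)
      then show "z \<in> adj m n ` (BC.R `` {\<omega>})" using iff[OF w(1)] z by blast
    qed
  qed
qed

lemma Z_coord: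
  assumes "u \<in> ops i q" "v \<in> ops j q" "k \<in> cells (bD m n) i j"
  obtains s t where "gin q s t" "dm s = i" "dm t = j" "map snd s = u" "map snd t = v" "(map fst s, map fst t) = k"
proof -
  have "((u, v), k) \<in> cells (bprod (bD q q) (bD m n)) i j" using assms by (simp add: cells_bD)
  then obtain s t where "gin q s t" "length s = Suc i" "length t = Suc j" "e21 s t = ((u, v), k)"
    using crdD(3)[OF crd_e21] by blast
  then show thesis using that by simp
qed

lemma opcomp_map: "u \<in> ops a p \<Longrightarrow> f \<in> ops i a \<Longrightarrow> opcomp (map c u) f = map c (opcomp u f)"
  unfolding opcomp_def by (rule map_sel[symmetric]) (auto dest: opsD(1))

text \<open>Nothing is filled here: a composite of the two loops exists by \<open>T_ex\<close>, and
  its witness on \<open>\<Delta>^{m,n} \<times> \<Delta>^{2,2}\<close>, curried in the other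
  direction, is the filler.\<close>

lemma Z_filler_ex:
  assumes \<alpha>: "\<alpha> \<in> Z.A" and \<beta>: "\<beta> \<in> Z.A"
  shows "\<exists>\<theta>. aeppli_filler 1 1 Z.W Z.ctr \<alpha> \<beta> \<theta>"
proof -
  have b: "\<beta> \<in> bhom (bD (Suc 0) (Suc 0)) Z.W" using Z.A_bhom[OF \<beta>] by simp
  have "Z.r \<alpha> \<in> {x. loop x}" "Z.r \<beta> \<in> {x. loop x}" using Z.r_loop \<alpha> \<beta> by simp_all
  then obtain z where "T (Z.r \<alpha>) (Z.r \<beta>) z" by (rule T_ex)
  then obtain \<phi> where "comp_by \<phi> (Z.r \<alpha>) (Z.r \<beta>) z" unfolding T_def by blast
  note C = comp_byD[OF this]
  obtain \<Psi> where \<Psi>: "nt (bprod (bD 2 2) (bD m n)) X \<Psi>" "\<And>s t. gin 2 s t \<Longrightarrow> \<Psi> (dm s) (dm t) (e21 s t) = \<phi> s t"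
    using crd_ex[OF crd_e21 C(1)] by blast
  have st: "\<Psi> a c (y, k) = degen X a c pt" if y: "y \<in> cells (bD 2 2) a c" and k: "k \<in> cells (bdelta m n) a c" for a c y k
  proof -
    obtain u v where uv: "y = (u, v)" "u \<in> ops a 2" "v \<in> ops c 2" using y by (cases y) (simp add: cells_bD)
    obtain s t where s: "gin 2 s t" "dm s = a" "dm t = c" "map snd s = u" "map snd t = v" "(map fst s, map fst t) = k"
      by (rule Z_coord[OF uv(2,3) subsetD[OF bdelta_props(1) k]])
    have "nc s t" using k unfolding s(6)[symmetric] cells_bdelta nc_def by simp
    from C(2)[OF s(1) this] show ?thesis using \<Psi>(2)[OF s(1)] s(2-6) uv(1) by (simp add: star_def)
  qed
  have "\<exists>\<theta>\<in>bhom (bD 2 2) Z.W. \<forall>a c y k. y \<in> cells (bD 2 2) a c \<longrightarrow> k \<in> cells (bD m n) a c \<longrightarrow> unc \<theta> a c (y, k) = \<Psi> a c (y, k)"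
    by (rule curry_ex[OF bisset_bD bisset_bD \<Psi>(1) bdelta_props(1) st])
  then obtain \<theta> where \<theta>: "\<theta> \<in> bhom (bD 2 2) Z.W"
    and v: "\<And>a c y k. \<lbrakk>y \<in> cells (bD 2 2) a c; k \<in> cells (bD m n) a c\<rbrakk> \<Longrightarrow> unc \<theta> a c (y, k) = \<Psi> a c (y, k)" by blast
  have 2: "Suc (Suc 0) = 2" by simp
  have "aeppli_filler (Suc 0) (Suc 0) Z.W Z.ctr \<alpha> \<beta> \<theta>"
    unfolding aeppli_filler_iff[OF b] 2
  proof (intro conjI[OF \<theta>] allI impI conjI)
    fix a c u w assume uw: "u \<in> ops a 2" "w \<in> ops c 2"
    have y: "(u, w) \<in> cells (bD 2 2) a c" using uw by (simp add: cells_bD)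
    \<comment> \<open>Vacuous: for \<open>p = q = 1\<close> there are no faces below
      \<open>p - 1 = 0\<close>.\<close>
    show "\<theta> a c (u, w) = degen Z.W a c Z.ctr" if "\<not> {..<0} \<subseteq> set u \<or> \<not> {..<0} \<subseteq> set w" using that by simp
    show "\<theta> a c (u, w) = \<alpha> a c (map (cd 0) u, map (cd 0) w)" if z: "0 \<notin> set u \<or> 0 \<notin> set w"
    proof -
      have o: "map (cd 0) u \<in> ops a (Suc 0)" "map (cd 0) w \<in> ops c (Suc 0)"
        using map_cd_ops[of u a "Suc 0" 0] map_cd_ops[of w c "Suc 0" 0] uw by (simp_all add: numeral_2_eq_2)
      then have y': "(map (cd 0) u, map (cd 0) w) \<in> cells (bD 1 1) a c" by (simp add: cells_bD)
      show ?thesis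
      proof (rule unc_inj[OF \<theta> Z.A_bhom[OF \<alpha>] y y'])
        fix i j k f g assume k: "k \<in> cells (bD m n) i j" "f \<in> ops i a" "g \<in> ops j c"
        have o2: "opcomp u f \<in> ops i 2" "opcomp w g \<in> ops j 2" by (rule ops_comp[OF uw(1) k(2)] ops_comp[OF uw(2) k(3)])+
        obtain s t where s: "gin 2 s t" "dm s = i" "dm t = j" "map snd s = opcomp u f" "map snd t = opcomp w g" "(map fst s, map fst t) = k"
          by (rule Z_coord[OF o2 k(1)])
        have z0: "0 \<notin> snd ` set s \<or> 0 \<notin> snd ` set t"
          using z set_opcomp'[OF uw(1) k(2)] set_opcomp'[OF uw(2) k(3)] unfolding set_map[symmetric] s(4,5) by blast
        have cd: "cd 0 = (\<lambda>j. j - Suc 0)" by (auto simp: cd_def)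
        have "unc \<theta> i j (act (bD 2 2) a c f g (u, w), k) = \<phi> s t"
          using v[of "(opcomp u f, opcomp w g)" i j k] \<Psi>(2)[OF s(1)] s(2-6) o2 k(1) by (simp add: cells_bD)
        also have "\<dots> = Z.r \<alpha> (map dec s) (map dec t)" by (rule C(3)[OF s(1) z0])
        also have "\<dots> = unc \<alpha> i j ((map (cd 0) (map snd s), map (cd 0) (map snd t)), map fst s, map fst t)"
          using s(2,3) by (simp add: Z.r_def dec_def comp_def cd)
        also have "\<dots> = unc \<alpha> i j (act (bD 1 1) a c f g (map (cd 0) u, map (cd 0) w), k)"
          unfolding s(4-6) act_bD opcomp_map[OF uw(1) k(2)] opcomp_map[OF uw(2) k(3)] ..
        finally show "unc \<theta> i j (act (bD 2 2) a c f g (u, w), k) =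
          unc \<alpha> i j (act (bD 1 1) a c f g (map (cd 0) u, map (cd 0) w), k)" .
      qed
    qed
    show "\<theta> a c (u, w) = \<beta> a c (u, w)" if z: "2 \<notin> set u \<and> 2 \<notin> set w"
    proof -
      have y': "(u, w) \<in> cells (bD 1 1) a c"
        using map_cd_top[of u a "Suc 0"] map_cd_top[of w c "Suc 0"] uw z by (simp add: cells_bD numeral_2_eq_2)
      show ?thesis
      proof (rule unc_inj[OF \<theta> Z.A_bhom[OF \<beta>] y y'])
        fix i j k f g assume k: "k \<in> cells (bD m n) i j" "f \<in> ops i a" "g \<in> ops j c"
        have o2: "opcomp u f \<in> ops i 2" "opcomp w g \<in> ops j 2" by (rule ops_comp[OF uw(1) k(2)] ops_comp[OF uw(2) k(3)])+
        obtain s t where s: "gin 2 s t" "dm s = i" "dm t = j" "map snd s = opcomp u f" "map snd t = opcomp w g" "(map fst s, map fst t) = k"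
          by (rule Z_coord[OF o2 k(1)])
        have z0: "2 \<notin> snd ` set s" "2 \<notin> snd ` set t"
          using z set_opcomp'[OF uw(1) k(2)] set_opcomp'[OF uw(2) k(3)] unfolding set_map[symmetric] s(4,5) by blast+
        have "unc \<theta> i j (act (bD 2 2) a c f g (u, w), k) = \<phi> s t"
          using v[of "(opcomp u f, opcomp w g)" i j k] \<Psi>(2)[OF s(1)] s(2-6) o2 k(1) by (simp add: cells_bD)
        also have "\<dots> = Z.r \<beta> s t" by (rule C(4)[OF s(1) z0])
        also have "\<dots> = unc \<beta> i j (act (bD 1 1) a c f g (u, w), k)"
          using s(2-6) by (simp add: Z.r_def)
        finally show "unc \<theta> i j (act (bD 2 2) a c f g (u, w), k) = unc \<beta> i j (act (bD 1 1) a c f g (u, w), k)" .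
      qed
    qed
  qed
  then show ?thesis by auto
qed

text \<open>Conversely, uncurrying an arbitrary filler gives a witness of a composite, and the
  corner taken as product is the composed loop.\<close>

lemma Z_filler_T:
  assumes \<alpha>: "\<alpha> \<in> Z.A" and \<beta>: "\<beta> \<in> Z.A" and fil: "aeppli_filler 1 1 Z.W Z.ctr \<alpha> \<beta> \<theta>"
  shows "md1 (1 + 1) 1 1 (md2 (1 + 1) (1 + 1) 1 \<theta>) \<in> Z.A \<and>
    T (Z.r \<alpha>) (Z.r \<beta>) (Z.r (md1 (1 + 1) 1 1 (md2 (1 + 1) (1 + 1) 1 \<theta>)))"
proof -
  have b: "\<beta> \<in> bhom (bD (Suc 0) (Suc 0)) Z.W" using Z.A_bhom[OF \<beta>] by simp
  have 2: "Suc (Suc 0) = 2" by simp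
  have f: "aeppli_filler (Suc 0) (Suc 0) Z.W Z.ctr \<alpha> \<beta> \<theta>" using fil by simp
  then have \<theta>: "\<theta> \<in> bhom (bD 2 2) Z.W"
    and v0: "\<And>a c u w. \<lbrakk>u \<in> ops a 2; w \<in> ops c 2; 0 \<notin> set u \<or> 0 \<notin> set w\<rbrakk> \<Longrightarrow> \<theta> a c (u, w) = \<alpha> a c (map (cd 0) u, map (cd 0) w)"
    and v2: "\<And>a c u w. \<lbrakk>u \<in> ops a 2; w \<in> ops c 2; 2 \<notin> set u \<and> 2 \<notin> set w\<rbrakk> \<Longrightarrow> \<theta> a c (u, w) = \<beta> a c (u, w)"
    unfolding aeppli_filler_iff[OF b] 2 by blast+
  define q where "q s t = unc \<theta> (dm s) (dm t) (e21 s t)" for s t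
  have q: "gbx 2 q" unfolding q_def by (rule crd_nt[OF crd_e21 nt_unc(1)[OF bisset_bD \<theta>]])
  have c2: "map snd s \<in> ops (dm s) 2" "map snd t \<in> ops (dm t) 2" "(map fst s, map fst t) \<in> cells (bD m n) (dm s) (dm t)"
    if "gin 2 s t" for s t
    using crdD(1)[OF crd_e21 that] by (simp_all add: cells_bD)
  have qn: "q s t = star s t" if g: "gin 2 s t" and n: "nc s t" for s t
  proof -
    have "(map fst s, map fst t) \<in> cells (bdelta m n) (dm s) (dm t)"
      using c2(3)[OF g] n by (simp add: cells_bD cells_bdelta nc_def)
    from nt_unc(2)[OF bisset_bD \<theta> _ this, of "(map snd s, map snd t)"] c2(1,2)[OF g]
    show ?thesis by (simp add: q_def star_def cells_bD)
  qed
  have cd: "cd 0 = (\<lambda>j. j - Suc 0)" by (auto simp: cd_def)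
  have q0: "q s t = Z.r \<alpha> (map dec s) (map dec t)" if g: "gin 2 s t" and n: "0 \<notin> snd ` set s \<or> 0 \<notin> snd ` set t" for s t
    using v0[OF c2(1,2)[OF g]] n by (simp add: q_def Z.r_def unc_def dec_def comp_def cd)
  have q2: "q s t = Z.r \<beta> s t" if g: "gin 2 s t" and n: "2 \<notin> snd ` set s \<and> 2 \<notin> snd ` set t" for s t
    using v2[OF c2(1,2)[OF g]] n by (simp add: q_def Z.r_def unc_def)
  \<comment> \<open>The coface omitting level 1, which selects the corner that defines the
    product.\<close>
  let ?up = "\<lambda>p :: nat \<times> nat. (fst p, cf 1 (snd p))"
  have mu: "mono ?up" using monoD[OF mono_cf[of 1]] by (auto simp: mono_def less_eq_prod_def)
  have sub: "?up ` ({..k} \<times> {..1}) \<subseteq> {..k} \<times> {..2}" for k by (auto simp: cf_def)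
  define z where "z s t = q (map ?up s) (map ?up t)" for s t
  have g2: "gin 2 (map ?up s) (map ?up t)" if "gin 1 s t" for s t by (rule inb_map[OF that mu mu sub sub])
  have dup: "map dec (map ?up s) = s" if "set s \<subseteq> S \<times> {..1}" for s S
    using that by (force simp: dec_def cf_def intro!: map_idI)
  have z: "loop z"
    unfolding loop_def
  proof (intro conjI allI impI)
    show "gbx 1 z" unfolding z_def by (rule Bx_pull[OF q mu mu sub sub])
    fix s t assume g: "gin 1 s t"
      and c: "nc s t \<or> 0 \<notin> snd ` set s \<or> 0 \<notin> snd ` set t \<or> 1 \<notin> snd ` set s \<and> 1 \<notin> snd ` set t"
    then consider "nc s t" | "0 \<notin> snd ` set s \<or> 0 \<notin> snd ` set t" | "1 \<notin> snd ` set s \<and> 1 \<notin> snd ` set t" by blast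
    then show "z s t = star s t"
    proof cases
      case 1
      then have "nc (map ?up s) (map ?up t)" by (simp add: nc_def image_image)
      from qn[OF g2[OF g] this] show ?thesis by (simp add: z_def)
    next
      case 2
      have "0 \<notin> snd ` set (map ?up r)" if "0 \<notin> snd ` set r" for r using that by (force simp: cf_def image_iff)
      then have "z s t = Z.r \<alpha> (map dec (map ?up s)) (map dec (map ?up t))"
        unfolding z_def using 2 by (intro q0[OF g2[OF g]]) blast
      also have "\<dots> = Z.r \<alpha> s t" using g dup[of s "{..m}"] dup[of t "{..n}"] unfolding inb_def by simp
      also have "\<dots> = star s t" by (rule loop_star[OF Z.r_loop[OF \<alpha>] g c])
      finally show ?thesis .
    next
      case 3
      have d: "map ?up r = r" if "set r \<subseteq> S \<times> {..1}" "1 \<notin> snd ` set r" for r S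
        using that by (force simp: cf_def le_Suc_eq intro!: map_idI)
      have e: "map ?up s = s" "map ?up t = t" using g 3 unfolding inb_def by (blast intro: d)+
      have "2 \<notin> snd ` set s \<and> 2 \<notin> snd ` set t" using g by (force simp: inb_def)
      then have "z s t = Z.r \<beta> s t" unfolding z_def e by (intro q2 gin_mono[OF g]) simp_all
      also have "\<dots> = star s t" by (rule loop_star[OF Z.r_loop[OF \<beta>] g c])
      finally show ?thesis .
    qed
  qed
  have "comp_by q (Z.r \<alpha>) (Z.r \<beta>) z"
    unfolding comp_by_def
  proof (intro conjI[OF q] allI impI conjI)
    fix s t assume g: "gin 2 s t"
    show "q s t = star s t" if "nc s t" by (rule qn[OF g that])
    show "q s t = Z.r \<alpha> (map dec s) (map dec t)" if "0 \<notin> snd ` set s \<or> 0 \<notin> snd ` set t" by (rule q0[OF g that])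
    show "q s t = Z.r \<beta> s t" if "2 \<notin> snd ` set s \<and> 2 \<notin> snd ` set t" by (rule q2[OF g that])
    show "q s t = z (map dec s) (map dec t)" if c: "1 \<notin> snd ` set s \<and> 1 \<notin> snd ` set t"
    proof -
      have d: "map ?up (map dec r) = r" if "set r \<subseteq> S \<times> {..2}" "1 \<notin> snd ` set r" for r S
      proof -
        have "?up (dec p) = p" if p: "p \<in> set r" for p
        proof -
          have "snd p = 0 \<or> snd p = 2"
          proof -
            have "snd p \<noteq> 1" using \<open>1 \<notin> snd ` set r\<close> p by (metis image_eqI)
            moreover have "snd p \<le> 2" using \<open>set r \<subseteq> S \<times> {..2}\<close> p by auto
            ultimately show ?thesis by linarith
          qed
          then show ?thesis by (auto simp: dec_def cf_def prod_eq_iff)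
        qed
        then show ?thesis by (simp add: map_idI)
      qed
      have "map ?up (map dec s) = s" "map ?up (map dec t) = t" using g c unfolding inb_def by (blast intro: d)+
      then show ?thesis by (simp only: z_def)
    qed
  qed
  then have T: "T (Z.r \<alpha>) (Z.r \<beta>) z" unfolding T_def using z Z.r_loop \<alpha> \<beta> by blast
  obtain \<omega> where \<omega>: "\<omega> \<in> Z.A" "\<And>s t. gin 1 s t \<Longrightarrow> Z.r \<omega> s t = z s t" using Z.r_surj[OF z] by blast
  have G: "md1 (1 + 1) 1 1 (md2 (1 + 1) (1 + 1) 1 \<theta>) =
      (\<lambda>a b. \<lambda>(u, v)\<in>cells (bD 1 1) a b. \<theta> a b (map (cf 1) u, map (cf 1) v))"
    using aeppli_result[of 0 0 \<theta>] by simp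
  have "md1 (1 + 1) 1 1 (md2 (1 + 1) (1 + 1) 1 \<theta>) = \<omega>"
    unfolding G eq_bhom_iff[OF Z.A_bhom[OF \<omega>(1)]] ball_bD prod.case
  proof (intro allI impI)
    fix a c u w assume uw: "u \<in> ops a 1" "w \<in> ops c 1"
    have y: "(map (cf 1) u, map (cf 1) w) \<in> cells (bD 2 2) a c" and y': "(u, w) \<in> cells (bD 1 1) a c"
      using map_cf_ops[OF uw(1), of 1] map_cf_ops[OF uw(2), of 1] uw by (simp_all add: cells_bD numeral_2_eq_2)
    show "\<theta> a c (map (cf 1) u, map (cf 1) w) = \<omega> a c (u, w)"
    proof (rule unc_inj[OF \<theta> Z.A_bhom[OF \<omega>(1)] y y'])
      fix i j k f g assume k: "k \<in> cells (bD m n) i j" "f \<in> ops i a" "g \<in> ops j c"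
      obtain s t where s: "gin 1 s t" "dm s = i" "dm t = j" "map snd s = opcomp u f" "map snd t = opcomp w g" "(map fst s, map fst t) = k"
        by (rule Z_coord[OF ops_comp[OF uw(1) k(2)] ops_comp[OF uw(2) k(3)] k(1)])
      have "unc \<omega> i j (act (bD 1 1) a c f g (u, w), k) = Z.r \<omega> s t" using s(2-6) by (simp add: Z.r_def)
      also have "\<dots> = q (map ?up s) (map ?up t)" unfolding \<omega>(2)[OF s(1)] z_def ..
      also have "\<dots> = unc \<theta> i j ((map (cf 1) (map snd s), map (cf 1) (map snd t)), map fst s, map fst t)"
        using s(2,3) by (simp add: q_def comp_def)
      also have "\<dots> = unc \<theta> i j (act (bD 2 2) a c f g (map (cf 1) u, map (cf 1) w), k)"
        unfolding s(4-6) act_bD opcomp_map[OF uw(1) k(2)] opcomp_map[OF uw(2) k(3)] ..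
      finally show "unc \<theta> i j (act (bD 2 2) a c f g (map (cf 1) u, map (cf 1) w), k) = unc \<omega> i j (act (bD 1 1) a c f g (u, w), k)" ..
    qed
  qed
  moreover have "T (Z.r \<alpha>) (Z.r \<beta>) (Z.r \<omega>)"
    by (rule T_cong3[OF T E_eqI[OF Z.r_loop[OF \<omega>(1)] z \<omega>(2)]])
  ultimately show ?thesis using \<omega>(1) by (simp only: simp_thms)
qed

text \<open>\<open>loopcomp\<close> is the Aeppli product on \<open>Z\<close> transported back by
  \<open>the_inv_into\<close>. This is meaningful because taking images under the injective
  \<open>adj\<close> is injective on classes.\<close>

lemma BC_presents: "presents BC.A BC.R BC.r (piBC_loop_group m n X pt)"
proof -
  note defs = piBC_loop_group_def piBC_def loopsp_def
  have inj: "inj_on (image (adj m n)) (BC.A // BC.R)"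
  proof (rule inj_onI)
    fix x y assume *: "x \<in> BC.A // BC.R" "y \<in> BC.A // BC.R" "adj m n ` x = adj m n ` y"
    have "x \<subseteq> BC.A" "y \<subseteq> BC.A" using *(1,2) unfolding BC.R_eq quotient_def by blast+
    then show "x = y" using inj_on_image_eq_iff[OF adj_inj] *(3) by blast
  qed
  have mult: "\<exists>c\<in>BC.A. T (BC.r a) (BC.r b) (BC.r c) \<and> loopcomp m n X pt (BC.R `` {a}) (BC.R `` {b}) = BC.R `` {c}"
    if ab: "a \<in> BC.A" "b \<in> BC.A" for a b
  proof -
    have "\<exists>\<gamma>\<in>Z.A. T (Z.r (adj m n a)) (Z.r (adj m n b)) (Z.r \<gamma>) \<and>
        aeppli 1 1 Z.W Z.ctr (Z.R `` {adj m n a}) (Z.R `` {adj m n b}) = Z.R `` {\<gamma>}"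
    proof (rule aeppli_class[where r = Z.r, OF Z.R_eq])
      show "Z.r a \<in> {x. loop x}" if "a \<in> Z.A" for a using Z.r_loop[OF that] by simp
    qed (rule Z_filler_ex Z_filler_T adj_eq(1) ab | assumption)+
    then obtain \<gamma> where \<gamma>: "\<gamma> \<in> Z.A" "T (Z.r (adj m n a)) (Z.r (adj m n b)) (Z.r \<gamma>)"
      "aeppli 1 1 Z.W Z.ctr (Z.R `` {adj m n a}) (Z.R `` {adj m n b}) = Z.R `` {\<gamma>}" by blast
    obtain c where c: "c \<in> BC.A" "adj m n c = \<gamma>" by (rule adj_surj[OF \<gamma>(1)])
    have "loopcomp m n X pt (BC.R `` {a}) (BC.R `` {b}) =
        the_inv_into (BC.A // BC.R) (image (adj m n)) (adj m n ` (BC.R `` {c}))"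
      unfolding loopcomp_def piBC_def loopsp_def loopZ_def adj_class[OF ab(1)] adj_class[OF ab(2)] \<gamma>(3) adj_class[OF c(1)] c(2) ..
    also have "\<dots> = BC.R `` {c}" by (rule the_inv_into_f_f[OF inj quotientI[OF c(1)]])
    finally have "loopcomp m n X pt (BC.R `` {a}) (BC.R `` {b}) = BC.R `` {c}" .
    moreover have "T (BC.r a) (BC.r b) (BC.r c)"
      by (rule T_cong3[OF T_cong2[OF T_cong1[OF \<gamma>(2) E_sym[OF adj_E[OF ab(1)]]] E_sym[OF adj_E[OF ab(2)]]]])
        (use adj_E[OF c(1)] c(2) in simp)
    ultimately show ?thesis using c(1) by blast
  qed
  show ?thesis
    unfolding presents_def
  proof (intro conjI ballI)
    show "BC.R = {(a, b). a \<in> BC.A \<and> b \<in> BC.A \<and> E (BC.r a) (BC.r b)}" by (rule BC.R_eq)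
    show "BC.r ` BC.A \<subseteq> {x. loop x}" using BC.r_loop by blast
    show "\<exists>a\<in>BC.A. E (BC.r a) s" if "s \<in> {x. loop x}" for s
    proof -
      have s: "loop s" using that by simp
      obtain \<omega> where \<omega>: "\<omega> \<in> BC.A" "\<And>s' t. gin 1 s' t \<Longrightarrow> BC.r \<omega> s' t = s s' t" using BC.r_surj[OF s] by blast
      show ?thesis using \<omega>(1) E_eqI[OF BC.r_loop[OF \<omega>(1)] s \<omega>(2)] by blast
    qed
    show "carrier (piBC_loop_group m n X pt) = BC.A // BC.R" by (simp add: defs)
    show "\<exists>a\<in>BC.A. E (BC.r a) star \<and> \<one>\<^bsub>piBC_loop_group m n X pt\<^esub> = BC.R `` {a}"
      by (rule bexI[OF _ BC.r_const(1)]) (simp only: defs monoid.select_convs BC.r_const(2) simp_thms)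
    show "\<exists>c\<in>BC.A. T (BC.r a) (BC.r b) (BC.r c) \<and> BC.R `` {a} \<otimes>\<^bsub>piBC_loop_group m n X pt\<^esub> BC.R `` {b} = BC.R `` {c}"
      if "a \<in> BC.A" "b \<in> BC.A" for a b
      using mult[OF that] by (simp add: defs)
  qed
qed

section \<open>The map rho\<close>

lemma top_faces:
  "md1 (Suc m) n (Suc m) (md2 (Suc m) (Suc n) (Suc n) \<theta>) = (\<lambda>a b. \<lambda>(u, v)\<in>cells (bD m n) a b. \<theta> a b (u, v))"
  unfolding md1_def md2_def pull_def opdim_simps fun2_restrict_eq ball_bD prod.case
  by (auto simp: coface_eq opcomp_id_left opcomp_id_left[OF ops_Suc] map_cf_top cells_bD ops_Suc)

text \<open>Any lift in the sense of \<open>rho_lift\<close> is a \<open>lift\<close> after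
  uncurrying, so \<open>lift_E\<close> identifies its loop with \<open>rr\<close>, independently of
  the choice.\<close>

lemma rho_lift_E:
  assumes \<alpha>: "\<alpha> \<in> A1" and l: "rho_lift m n X pt \<alpha> \<alpha>'"
  shows "md1 (m + 1) n (m + 1) (md2 (m + 1) (n + 1) (n + 1) \<alpha>') \<in> BC.A"
    "E (rr (ev_list \<alpha>)) (BC.r (md1 (m + 1) n (m + 1) (md2 (m + 1) (n + 1) (n + 1) \<alpha>')))"
proof -
  let ?D = "bD (Suc m) (Suc n)" and ?P = "relHom (bD 1 1) (bLam 1 1) X pt"
  have a': "\<alpha>' \<in> bhom ?D ?P" and ev: "bcomp ?D (ev X pt) \<alpha>' = \<alpha>"
    and bl: "\<And>a b y. y \<in> cells (bLam (Suc m) (Suc n)) a b \<Longrightarrow> \<alpha>' a b y = degen ?P a b (lpt X pt)"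
    using l unfolding rho_lift_def brestr_bconst pathsp_def by simp_all
  define w where "w s t = unc \<alpha>' (dm s) (dm t) (e12 s t)" for s t
  have w: "lift w (ev_list \<alpha>)"
    unfolding lift_def
  proof (intro conjI allI impI)
    show "lbx w" unfolding w_def by (rule crd_nt[OF crd_e12 nt_unc(1)[OF bisset_bD a']])
    fix s t assume lin: "lin s t"
    have c: "(map fst s, map fst t) \<in> cells ?D (dm s) (dm t)" "(map snd s, map snd t) \<in> cells (bD 1 1) (dm s) (dm t)"
      using crdD(1)[OF crd_e12 lin] by (simp_all add: cells_bD)
    show "w s t = star s t" if z: "nc s t \<or> 0 \<notin> snd ` set s \<or> 0 \<notin> snd ` set t"
    proof (cases "nc s t")
      case True
      have "(map fst s, map fst t) \<in> cells (bLam (Suc m) (Suc n)) (dm s) (dm t)"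
        using c(1) True unfolding cells_bLam cells_bD nc_def set_map by blast
      from bl[OF this] relHom_degen_iff[OF a' bisset pt c(1)]
      have "unc \<alpha>' (dm s) (dm t) (act ?D (dm s) (dm t) (idop (dm s)) (idop (dm t)) (map fst s, map fst t), (map snd s, map snd t)) = degen X (dm s) (dm t) pt"
        using c(2) idop_ops by blast
      then show ?thesis unfolding bissetD(2)[OF bisset_bD c(1)] w_def star_def .
    next
      case False
      have "(map snd s, map snd t) \<in> cells (bLam (Suc 0) (Suc 0)) (dm s) (dm t)"
        using c(2) z False unfolding cells_bLam by (auto simp: cells_bD)
      from nt_unc(2)[OF bisset_bD a' c(1)] this show ?thesis by (simp add: w_def star_def)
    qed
    show "w s t = ev_list \<alpha> (map fst s) (map fst t)" if z: "1 \<notin> snd ` set s \<and> 1 \<notin> snd ` set t"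
    proof -
      \<comment> \<open>Without vertex 1 the loop coordinates are constantly 0, the vertex at which
        \<open>ev\<close> evaluates.\<close>
      have r: "map snd s = replicate (Suc (dm s)) 0" "map snd t = replicate (Suc (dm t)) 0"
        using c(2) z const_iff(2)[of "map snd s" "dm s"] const_iff(2)[of "map snd t" "dm t"] by (simp_all add: cells_bD del: replicate_Suc)
      have "\<alpha> (dm s) (dm t) (map fst s, map fst t) = \<alpha>' (dm s) (dm t) (map fst s, map fst t) (dm s) (dm t)
          ((replicate (Suc (dm s)) 0, replicate (Suc (dm t)) 0), idop (dm s), idop (dm t))"
        using c(1) bhomD(1)[OF a' c(1)] unfolding ev[symmetric] bcomp_def compose_def ev_def degen_def pathsp_def coface_1 act_bD opcomp_const
        by simp
      then show ?thesis by (simp add: w_def ev_list_def unc_def r del: replicate_Suc)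
    qed
  qed
  have lw: "loop w" by (rule lift_loop[OF A1_rel[OF \<alpha>] w])
  obtain \<omega> where \<omega>: "\<omega> \<in> BC.A" "\<And>s t. gin 1 s t \<Longrightarrow> BC.r \<omega> s t = w s t" using BC.r_surj[OF lw] by blast
  have "md1 (m + 1) n (m + 1) (md2 (m + 1) (n + 1) (n + 1) \<alpha>') = (\<lambda>a b. \<lambda>(u, v)\<in>cells (bD m n) a b. \<alpha>' a b (u, v))"
    using top_faces by simp
  also have "\<dots> = \<omega>"
    unfolding eq_bhom_iff[OF BC.A_bhom[OF \<omega>(1)]] ball_bD prod.case
  proof (intro allI impI)
    fix a b u v assume uv: "u \<in> ops a m" "v \<in> ops b n"
    have y: "(u, v) \<in> cells ?D a b" "(u, v) \<in> cells (bD m n) a b" using uv by (simp_all add: cells_bD ops_Suc)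
    show "\<alpha>' a b (u, v) = \<omega> a b (u, v)"
    proof (rule unc_inj[OF a' BC.A_bhom[OF \<omega>(1)] y])
      fix i j k f g assume k: "k \<in> cells (bD 1 1) i j" "f \<in> ops i a" "g \<in> ops j b"
      have "((opcomp u f, opcomp v g), k) \<in> cells (bprod (bD m n) (bD 1 1)) i j"
        using k ops_comp[OF uv(1) k(2)] ops_comp[OF uv(2) k(3)] by (simp add: cells_bD)
      then obtain s t where s: "gin 1 s t" "length s = Suc i" "length t = Suc j" "e12 s t = ((opcomp u f, opcomp v g), k)"
        using crdD(3)[OF crd_e12] by blast
      show "unc \<alpha>' i j (act ?D a b f g (u, v), k) = unc \<omega> i j (act (bD m n) a b f g (u, v), k)"
        using \<omega>(2)[OF s(1)] s(2,3) unfolding BC.r_def w_def s(4) act_bD by simp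
    qed
  qed
  finally have eq: "md1 (m + 1) n (m + 1) (md2 (m + 1) (n + 1) (n + 1) \<alpha>') = \<omega>" .
  show "md1 (m + 1) n (m + 1) (md2 (m + 1) (n + 1) (n + 1) \<alpha>') \<in> BC.A" unfolding eq by (rule \<omega>(1))
  show "E (rr (ev_list \<alpha>)) (BC.r (md1 (m + 1) n (m + 1) (md2 (m + 1) (n + 1) (n + 1) \<alpha>')))"
    unfolding eq by (rule E_trans[OF lift_E[OF A1_rel[OF \<alpha>] w] E_sym[OF E_eqI[OF BC.r_loop[OF \<omega>(1)] lw \<omega>(2)]]])
qed

text \<open>The lift is \<open>rr\<close> of \<open>\<alpha>\<close> on the whole base, curried.
  Evaluation returns \<open>\<alpha>\<close> because \<open>contr\<close> is the projection at level
  0.\<close>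

lemma rho_lift_ex:
  assumes \<alpha>: "\<alpha> \<in> A1"
  shows "\<exists>\<alpha>'. rho_lift m n X pt \<alpha> \<alpha>'"
proof -
  let ?D = "bD (Suc m) (Suc n)" and ?P = "relHom (bD 1 1) (bLam 1 1) X pt"
  note W = liftD[OF lift_rr[OF A1_rel[OF \<alpha>]]]
  let ?w = "rr (ev_list \<alpha>)"
  obtain \<Psi> where \<Psi>: "nt (bprod ?D (bD 1 1)) X \<Psi>" "\<And>s t. lin s t \<Longrightarrow> \<Psi> (dm s) (dm t) (e12 s t) = ?w s t"
    using crd_ex[OF crd_e12 W(1)] by blast
  have co: "\<exists>s t. lin s t \<and> length s = Suc a \<and> length t = Suc b \<and> e12 s t = (y, k)"
    if "y \<in> cells ?D a b" "k \<in> cells (bD 1 1) a b" for y k a b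
    using crdD(3)[OF crd_e12, of "(y, k)"] that by simp
  have st: "\<Psi> a b (y, k) = degen X a b pt"
    if y: "y \<in> cells ?D a b" and k: "k \<in> cells (bD 1 1) a b" and c: "y \<in> cells (bLam (Suc m) (Suc n)) a b \<or> k \<in> cells (bLam (Suc 0) (Suc 0)) a b" for a b y k
  proof -
    obtain s t where s: "lin s t" "length s = Suc a" "length t = Suc b" "e12 s t = (y, k)" using co[OF y k] by blast
    have e: "(map fst s, map fst t) = y" "(map snd s, map snd t) = k" "dm s = a" "dm t = b" using s by simp_all
    have "nc s t \<or> 0 \<notin> snd ` set s \<or> 0 \<notin> snd ` set t"
      using c unfolding e(1,2)[symmetric] cells_bLam nc_def set_map by auto
    from W(2)[OF s(1) this] show ?thesis using \<Psi>(2)[OF s(1)] e unfolding star_def by simp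
  qed
  have LK: "cells (bLam 1 1) a b \<subseteq> cells (bD 1 1) a b" for a b
    using cells_bLam[of _ _ 0 0 a b] by (auto simp: cells_bD)
  have st1: "\<Psi> a b (y, k) = degen X a b pt" if "y \<in> cells ?D a b" "k \<in> cells (bLam 1 1) a b" for a b y k
    using st[OF that(1) subsetD[OF LK that(2)]] that(2) by simp
  have "\<exists>\<Phi>\<in>bhom ?D ?P. \<forall>a b y k. y \<in> cells ?D a b \<longrightarrow> k \<in> cells (bD 1 1) a b \<longrightarrow> unc \<Phi> a b (y, k) = \<Psi> a b (y, k)"
    by (rule curry_ex[OF bisset_bD bisset_bD \<Psi>(1) LK st1])
  then obtain \<alpha>' where a': "\<alpha>' \<in> bhom ?D ?P"
    and v: "\<And>a b y k. \<lbrakk>y \<in> cells ?D a b; k \<in> cells (bD 1 1) a b\<rbrakk> \<Longrightarrow> unc \<alpha>' a b (y, k) = \<Psi> a b (y, k)" by blast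
  have "bcomp ?D (ev X pt) \<alpha>' = \<alpha>"
    unfolding bcomp_def compose_def eq_bhom_iff[OF relmaps_iff[THEN iffD1, OF \<alpha>, THEN conjunct1]]
  proof (intro allI ballI)
    fix a b y assume y: "y \<in> cells ?D a b"
    let ?k = "(replicate (Suc a) 0, replicate (Suc b) 0)"
    have k: "?k \<in> cells (bD 1 1) a b" using replicate_ops[of 0 1] by (simp add: cells_bD del: replicate_Suc)
    obtain s t where s: "lin s t" "length s = Suc a" "length t = Suc b" "e12 s t = (y, ?k)" using co[OF y k] by blast
    have e: "(map fst s, map fst t) = y" "map snd s = replicate (Suc a) 0" "map snd t = replicate (Suc b) 0" "dm s = a" "dm t = b" using s by simp_all
    have "1 \<notin> snd ` set s \<and> 1 \<notin> snd ` set t" unfolding set_map[symmetric] e(2,3) by (simp del: replicate_Suc)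
    from W(3)[OF s(1) this] have w: "?w s t = \<alpha> a b y" using e by (simp add: ev_list_def)
    have "ev X pt a b (\<alpha>' a b y) = unc \<alpha>' a b (y, ?k)"
      using bhomD(1)[OF a' y] unfolding ev_def degen_def pathsp_def coface_1 act_bD opcomp_const unc_def by simp
    also have "\<dots> = ?w s t" using v[OF y k] \<Psi>(2)[OF s(1)] unfolding s(4) e(4,5) by simp
    finally show "ev X pt a b (\<alpha>' a b y) = \<alpha> a b y" using w by simp
  qed
  moreover have "\<alpha>' a b y = degen ?P a b (lpt X pt)" if y: "y \<in> cells (bLam (Suc m) (Suc n)) a b" for a b y
  proof -
    obtain u w where uw: "y = (u, w)" "u \<in> ops a (Suc m)" "w \<in> ops b (Suc n)" "\<not> {..m} \<subseteq> set u \<or> \<not> {..n} \<subseteq> set w"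
      using y by (cases y) (simp only: cells_bLam)
    have yD: "y \<in> cells ?D a b" using uw by (simp add: cells_bD)
    have "unc \<alpha>' i j (act ?D a b f g y, k) = degen X i j pt"
      if k: "k \<in> cells (bD 1 1) i j" "f \<in> ops i a" "g \<in> ops j b" for i j k f g
    proof -
      have c: "act ?D a b f g y \<in> cells ?D i j" by (rule bissetD(1)[OF bisset_bD k(2,3) yD])
      have "act ?D a b f g y \<in> cells (bLam (Suc m) (Suc n)) i j"
        unfolding uw(1) act_bD cells_bLam
        using ops_comp[OF uw(2) k(2)] ops_comp[OF uw(3) k(3)] set_opcomp[OF uw(2) k(2)] set_opcomp[OF uw(3) k(3)] uw(4) by blast
      then show ?thesis using v[OF c k(1)] st[OF c k(1)] by simp
    qed
    then show ?thesis using relHom_degen_iff[OF a' bisset pt yD] by blast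
  qed
  ultimately have "rho_lift m n X pt \<alpha> \<alpha>'"
    unfolding rho_lift_def brestr_bconst pathsp_def using a' by simp
  then show ?thesis by blast
qed

text \<open>Homotopic simplices give loops related by \<open>E\<close>, and by
  \<open>rho_lift_E\<close> every lift gives that same loop; so the \<open>THE\<close> in
  \<open>rho\<close> is determined, and on loops \<open>rho\<close> is the identity up to
  \<open>E\<close>.\<close>

lemma rho_class:
  assumes \<alpha>: "\<alpha> \<in> A1"
  shows "\<exists>\<omega>\<in>BC.A. E (rr (ev_list \<alpha>)) (BC.r \<omega>) \<and>
    rho m n X pt (htpy (bD (Suc m) (Suc n)) (bdeltaA (Suc m) (Suc n)) X pt `` {\<alpha>}) = BC.R `` {\<omega>}"
proof -
  let ?R = "htpy (bD (Suc m) (Suc n)) (bdeltaA (Suc m) (Suc n)) X pt"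
  let ?f = "\<lambda>\<alpha>'. md1 (m + 1) n (m + 1) (md2 (m + 1) (n + 1) (n + 1) \<alpha>')"
  have Riff: "(a, b) \<in> ?R \<longleftrightarrow> a \<in> A1 \<and> b \<in> A1 \<and> E (rr (ev_list a)) (rr (ev_list b))" for a b
    by (subst presentsD(1)[OF A1_presents]) simp
  obtain \<alpha>' where l: "rho_lift m n X pt \<alpha> \<alpha>'" using rho_lift_ex[OF \<alpha>] by blast
  note F = rho_lift_E[OF \<alpha> l]
  have refl: "\<alpha> \<in> ?R `` {\<alpha>}" using Riff \<alpha> left_unit rr_loop[OF A1_rel[OF \<alpha>]] by simp
  have "rho m n X pt (?R `` {\<alpha>}) = BC.R `` {?f \<alpha>'}"
    unfolding rho_def loopsp_def
  proof (rule the_equality)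
    show "\<exists>\<alpha>2\<in>?R `` {\<alpha>}. \<exists>\<beta>. rho_lift m n X pt \<alpha>2 \<beta> \<and> BC.R `` {?f \<alpha>'} = BC.R `` {?f \<beta>}"
      using refl l by blast
    fix c assume "\<exists>\<alpha>2\<in>?R `` {\<alpha>}. \<exists>\<beta>. rho_lift m n X pt \<alpha>2 \<beta> \<and> c = BC.R `` {?f \<beta>}"
    then obtain \<alpha>2 \<beta> where a2: "(\<alpha>, \<alpha>2) \<in> ?R" "rho_lift m n X pt \<alpha>2 \<beta>" "c = BC.R `` {?f \<beta>}" by blast
    have A2: "\<alpha>2 \<in> A1" "E (rr (ev_list \<alpha>)) (rr (ev_list \<alpha>2))" using a2(1) Riff by blast+
    note F2 = rho_lift_E[OF A2(1) a2(2)]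
    have "E (BC.r (?f \<beta>)) (BC.r (?f \<alpha>'))"
      by (rule E_trans[OF E_sym[OF F2(2)] E_trans[OF E_sym[OF A2(2)] F(2)]])
    then show "c = BC.R `` {?f \<alpha>'}" unfolding a2(3) using presents_eq_iff[OF BC_presents F2(1) F(1)] by blast
  qed
  then show ?thesis using F by blast
qed

lemma rho_iso:
  "group (piA_group (m + 1) (n + 1) X pt) \<and> group (piBC_loop_group m n X pt) \<and>
    rho m n X pt \<in> iso (piA_group (m + 1) (n + 1) X pt) (piBC_loop_group m n X pt)"
  using presents_group[OF A1_presents] presents_group[OF BC_presents]
    presents_iso[OF A1_presents BC_presents rho_class] by simp

end

theorem theorem3p27:
  fixes X :: "'a bisset" and pt :: 'a and m n :: nat
  assumes "fibrant TYPE('u::infinite) X"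
    and "pt \<in> cells X 0 0"
  shows "group (piA_group (m + 1) (n + 1) X pt) \<and>
         group (piBC_loop_group m n X pt) \<and>
         rho m n X pt \<in> iso (piA_group (m + 1) (n + 1) X pt) (piBC_loop_group m n X pt)"
proof -
  interpret loops X pt m n
  proof
    show "bisset X" using assms(1) by (simp add: fibrant_def fibration_def)
    show "pt \<in> cells X 0 0" by (rule assms(2))
    show "\<exists>H\<in>bhom (bD p q) X. \<forall>a b. \<forall>x\<in>cells (bhorn p q k l) a b. H a b x = h a b x"
      if "1 \<le> p" "1 \<le> q" "k \<le> p" "l \<le> q" "h \<in> bhom (bhorn p q k l) X" for p q k l h
      using fibrant_horn_filler[OF assms(1) that] by metis
  qed
  show ?thesis by (rule rho_iso)
qed

end
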